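(* Let $k$ be a field of characteristic $0$, $x_1,\ldots,x_m$ indeterminates over $k$, and let $R$ be either $k[x_1,\ldots,x_m]_{\mathfrak q}/I$ (with $\mathfrak q\in\operatorname{Spec}k[x_1,\ldots,x_m]$) or $k[[x_1,\ldots,x_m]]/I$, where $I$ is a proper radical ideal. Suppose $\dim R=1$ and $\Omega_{R/k}$ is torsionfree. If $\operatorname{pd}_R\operatorname{Der}_k(R)^{\dagger}<\infty$, then $R$ is regular. (That is, Berger's conjecture holds true for $R$ if $\operatorname{pd}_R\operatorname{Der}_k(R)^{\dagger}<\infty$.)
   Context: $\operatorname{Der}_k(R)$ is the $R$-module of $k$-derivations $R\to R$. $\Omega_{R/k}$ is the universally finite $k$-differential module of $R$, a finitely generated $R$-module universal for $k$-derivations of $R$ into finitely generated $R$-modules; in the first case it is the module of Kähler differentials, and in both cases it is the quotient of $\bigoplus_{i=1}^m R\,dx_i$ by the submodule generated by $\sum_i\frac{\partial f}{\partial x_i}dx_i$, $f\in I$. $X^{\dagger}=\operatorname{Hom}_R(X,\omega_R)$, where $\omega_R$ is the canonical module of $R$ (which exists here, since $R$ is reduced of dimension one, hence Cohen--Macaulay, and is a quotient of a regular local ring). $\operatorname{pd}$ is projective dimension. Berger's conjecture asserts that, if $k$ is a field of characteristic $0$, $x_1,\ldots,x_m$ are indeterminates over $k$, and $R$ is either $k[x_1,\ldots,x_m]_{\mathfrak q}/I$ (with $\mathfrak q\in\operatorname{Spec}k[x_1,\ldots,x_m]$) or $k[[x_1,\ldots,x_m]]/I$ with $I$ a proper radical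 ideal, then $R$ must be regular if $\dim R=1$ and $\Omega_{R/k}$ is torsionfree. *)

theory Defs
  imports "HOL-Algebra.Algebra" "HOL-Algebra.Indexed_Polynomials" "HOL-Library.Extended_Nat"
begin

section \<open>Polynomials, power series and localization\<close>

text \<open>
  As in \<^theory>\<open>HOL-Algebra.Indexed_Polynomials\<close>, a monomial is a multiset of variables and a
  series is its coefficient function, with value \<open>\<zero>\<close> at monomials involving other variables.
  The variables are the natural numbers below \<open>m\<close>.
\<close>

definition power_series_ring :: "('k, 'x) ring_scheme \<Rightarrow> nat \<Rightarrow> (nat multiset \<Rightarrow> 'k) ring" where
  "power_series_ring K m =
    \<lparr>carrier = {f. (\<forall>\<mu>. f \<mu> \<in> carrier K) \<and> (\<forall>\<mu>. \<not> set_mset \<mu> \<subseteq> {..<m} \<longrightarrow> f \<mu> = \<zero>\<^bsub>K\<^esub>)},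
     monoid.mult = (\<lambda>f g \<mu>. \<Oplus>\<^bsub>K\<^esub>\<nu>\<in>{\<nu>. \<nu> \<subseteq># \<mu>}. f \<nu> \<otimes>\<^bsub>K\<^esub> g (\<mu> - \<nu>)),
     one = ring.indexed_const K \<one>\<^bsub>K\<^esub>,
     ring.zero = ring.indexed_const K \<zero>\<^bsub>K\<^esub>,
     add = ring.indexed_padd K\<rparr>"

definition polynomial_ring :: "('k, 'x) ring_scheme \<Rightarrow> nat \<Rightarrow> (nat multiset \<Rightarrow> 'k) ring" where
  "polynomial_ring K m =
    (power_series_ring K m)\<lparr>carrier := ring.indexed_pset K {..<m} (carrier K)\<rparr>"

text \<open>The fraction \<open>a / s\<close> with respect to the multiplicative set \<open>A - Q\<close>, as an equivalence class.\<close>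

definition fraction :: "('a, 'x) ring_scheme \<Rightarrow> 'a set \<Rightarrow> 'a \<Rightarrow> 'a \<Rightarrow> ('a \<times> 'a) set" where
  "fraction A Q a s =
    {(b, t). b \<in> carrier A \<and> t \<in> carrier A - Q \<and>
      (\<exists>u \<in> carrier A - Q. u \<otimes>\<^bsub>A\<^esub> (a \<otimes>\<^bsub>A\<^esub> t \<ominus>\<^bsub>A\<^esub> b \<otimes>\<^bsub>A\<^esub> s) = \<zero>\<^bsub>A\<^esub>)}"

definition localization :: "('a, 'x) ring_scheme \<Rightarrow> 'a set \<Rightarrow> ('a \<times> 'a) set ring" where
  "localization A Q =
    \<lparr>carrier = {fraction A Q a s | a s. a \<in> carrier A \<and> s \<in> carrier A - Q},
     monoid.mult = (\<lambda>U V. \<Union>(a, s)\<in>U. \<Union>(b, t)\<in>V. fraction A Q (a \<otimes>\<^bsub>A\<^esub> b) (s \<otimes>\<^bsub>A\<^esub> t)),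
     one = fraction A Q \<one>\<^bsub>A\<^esub> \<one>\<^bsub>A\<^esub>,
     ring.zero = fraction A Q \<zero>\<^bsub>A\<^esub> \<one>\<^bsub>A\<^esub>,
     add = (\<lambda>U V. \<Union>(a, s)\<in>U. \<Union>(b, t)\<in>V.
       fraction A Q (a \<otimes>\<^bsub>A\<^esub> t \<oplus>\<^bsub>A\<^esub> b \<otimes>\<^bsub>A\<^esub> s) (s \<otimes>\<^bsub>A\<^esub> t))\<rparr>"

text \<open>The case \<open>n = 0\<close> is vacuous, since a proper ideal does not contain \<open>\<one>\<close>.\<close>

definition proper_radical_ideal :: "'a set \<Rightarrow> ('a, 'x) ring_scheme \<Rightarrow> bool" where
  "proper_radical_ideal I S \<longleftrightarrow> ideal I S \<and> I \<noteq> carrier S \<and>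
    (\<forall>a \<in> carrier S. \<forall>n::nat. a [^]\<^bsub>S\<^esub> n \<in> I \<longrightarrow> a \<in> I)"

text \<open>
  \<open>R\<close> is isomorphic as a \<open>K\<close>-algebra to \<open>S / I\<close>, where the \<open>K\<close>-algebra structure of \<open>S\<close> is given
  by the map \<open>\<iota>\<close> from \<open>K\<close> to \<open>S\<close>.
\<close>

definition iso_quotient_algebra ::
  "('k, 'x) ring_scheme \<Rightarrow> ('k, 'r) module \<Rightarrow> ('s, 'y) ring_scheme \<Rightarrow> ('k \<Rightarrow> 's) \<Rightarrow> 's set \<Rightarrow> bool" where
  "iso_quotient_algebra K R S \<iota> I \<longleftrightarrow>
    (\<exists>\<psi> \<in> ring_iso (S Quot I) R. \<forall>c \<in> carrier K. \<psi> (I +>\<^bsub>S\<^esub> \<iota> c) = c \<odot>\<^bsub>R\<^esub> \<one>\<^bsub>R\<^esub>)"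


section \<open>Local rings\<close>

definition local_ring :: "('r, 'x) ring_scheme \<Rightarrow> bool" where
  "local_ring R \<longleftrightarrow> cring R \<and> (\<exists>!M. maximalideal M R)"

definition max_ideal :: "('r, 'x) ring_scheme \<Rightarrow> 'r set" where
  "max_ideal R = (THE M. maximalideal M R)"

definition krull_dim :: "('r, 'x) ring_scheme \<Rightarrow> enat" where
  "krull_dim R = Sup {enat n | n. \<exists>p :: nat \<Rightarrow> 'r set.
    (\<forall>i\<le>n. primeideal (p i) R) \<and> (\<forall>i<n. p i \<subset> p (Suc i))}"

definition embedding_dim :: "('r, 'x) ring_scheme \<Rightarrow> enat" where
  "embedding_dim R = Inf {enat (card A) | A. finite A \<and> A \<subseteq> carrier R \<and> genideal R A = max_ideal R}"

definition regular_local_ring :: "('r, 'x) ring_scheme \<Rightarrow> bool" where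
  "regular_local_ring R \<longleftrightarrow>
    noetherian_ring R \<and> local_ring R \<and> embedding_dim R = krull_dim R"


section \<open>Modules\<close>

definition self_module :: "('r, 'x) ring_scheme \<Rightarrow> ('r, 'r) module" where
  "self_module R = \<lparr>carrier = carrier R, monoid.mult = monoid.mult R, one = one R,
    ring.zero = ring.zero R, add = add R, smult = monoid.mult R\<rparr>"

definition quotient_module :: "('r, 'm) module \<Rightarrow> 'm set \<Rightarrow> ('r, 'm set) module" where
  "quotient_module M N = \<lparr>carrier = a_rcosets\<^bsub>M\<^esub> N, monoid.mult = undefined, one = undefined,
    ring.zero = N, add = set_add M, smult = (\<lambda>a U. \<Union>x\<in>U. N +>\<^bsub>M\<^esub> (a \<odot>\<^bsub>M\<^esub> x))\<rparr>"

definition residue_module :: "('r, 'x) ring_scheme \<Rightarrow> ('r, 'r set) module" where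
  "residue_module R = quotient_module (self_module R) (max_ideal R)"

definition module_span :: "('r, 'x) ring_scheme \<Rightarrow> ('r, 'm) module \<Rightarrow> 'm set \<Rightarrow> 'm set" where
  "module_span R M A = \<Inter>{N. submodule N R M \<and> A \<subseteq> N}"

definition fin_gen_module :: "('r, 'x) ring_scheme \<Rightarrow> ('r, 'm) module \<Rightarrow> bool" where
  "fin_gen_module R M \<longleftrightarrow> module R M \<and>
    (\<exists>A. finite A \<and> A \<subseteq> carrier M \<and> module_span R M A = carrier M)"

text \<open>Maps are extensional, so that equality of homomorphisms is equality in the logic.\<close>

definition module_homs :: "('r, 'x) ring_scheme \<Rightarrow> ('r, 'm) module \<Rightarrow> ('r, 'n) module \<Rightarrow> ('m \<Rightarrow> 'n) set" where
  "module_homs R M N = {h \<in> carrier M \<rightarrow>\<^sub>E carrier N.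
    (\<forall>x \<in> carrier M. \<forall>y \<in> carrier M. h (x \<oplus>\<^bsub>M\<^esub> y) = h x \<oplus>\<^bsub>N\<^esub> h y) \<and>
    (\<forall>a \<in> carrier R. \<forall>x \<in> carrier M. h (a \<odot>\<^bsub>M\<^esub> x) = a \<odot>\<^bsub>N\<^esub> h x)}"

definition isomorphic_modules :: "('r, 'x) ring_scheme \<Rightarrow> ('r, 'm) module \<Rightarrow> ('r, 'n) module \<Rightarrow> bool" where
  "isomorphic_modules R M N \<longleftrightarrow> (\<exists>h \<in> module_homs R M N. bij_betw h (carrier M) (carrier N))"

definition pointwise_module :: "'a set \<Rightarrow> ('r, 'n) module \<Rightarrow> ('a \<Rightarrow> 'n) set \<Rightarrow> ('r, 'a \<Rightarrow> 'n) module" where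
  "pointwise_module A N H = \<lparr>carrier = H, monoid.mult = undefined, one = undefined,
    ring.zero = (\<lambda>x\<in>A. \<zero>\<^bsub>N\<^esub>), add = (\<lambda>f g. \<lambda>x\<in>A. f x \<oplus>\<^bsub>N\<^esub> g x), smult = (\<lambda>a f. \<lambda>x\<in>A. a \<odot>\<^bsub>N\<^esub> f x)\<rparr>"

definition Hom_module :: "('r, 'x) ring_scheme \<Rightarrow> ('r, 'm) module \<Rightarrow> ('r, 'n) module \<Rightarrow> ('r, 'm \<Rightarrow> 'n) module" where
  "Hom_module R M N = pointwise_module (carrier M) N (module_homs R M N)"

definition torsionfree_module :: "('r, 'x) ring_scheme \<Rightarrow> ('r, 'm) module \<Rightarrow> bool" where
  "torsionfree_module R M \<longleftrightarrow>
    (\<forall>r \<in> carrier R. \<forall>x \<in> carrier M.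
      (\<forall>a \<in> carrier R. r \<otimes>\<^bsub>R\<^esub> a = \<zero>\<^bsub>R\<^esub> \<longrightarrow> a = \<zero>\<^bsub>R\<^esub>) \<and> r \<odot>\<^bsub>M\<^esub> x = \<zero>\<^bsub>M\<^esub> \<longrightarrow> x = \<zero>\<^bsub>M\<^esub>)"


section \<open>Projective and injective modules, resolutions, Ext\<close>

text \<open>
  Quantification over all \<open>R\<close>-modules has to be rendered by quantification over the modules on
  subsets of one type. We take the type \<open>nat \<Rightarrow> 'r\<close>, where \<open>'r\<close> is the type of elements of \<open>R\<close>.
  For \<open>R\<close> nonzero, every finitely or countably generated \<open>R\<close>-module is isomorphic to a module on
  this type, as its cardinality is at most that of the sequences in \<open>R\<close>. The same bound holds for
  a free module that maps onto a given module of this kind, and for the terms of the minimal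
  injective resolution of a finitely generated module over a Noetherian ring. Hence the lifting
  properties below have their usual meaning for modules on this type (Baer's criterion needs
  only the ideals of \<open>R\<close>), and for finitely generated modules over a Noetherian ring the homological
  dimensions are the usual ones.
\<close>

definition projective_module :: "('r, 'x) ring_scheme \<Rightarrow> ('r, 'p) module \<Rightarrow> bool" where
  "projective_module R P \<longleftrightarrow> module R P \<and>
    (\<forall>(M :: ('r, nat \<Rightarrow> 'r) module) (N :: ('r, nat \<Rightarrow> 'r) module).
      module R M \<longrightarrow> module R N \<longrightarrow>
      (\<forall>g \<in> module_homs R M N. \<forall>f \<in> module_homs R P N. g ` carrier M = carrier N \<longrightarrow>
        (\<exists>h \<in> module_homs R P M. \<forall>x \<in> carrier P. g (h x) = f x)))"

definition injective_module :: "('r, 'x) ring_scheme \<Rightarrow> ('r, 'e) module \<Rightarrow> bool" where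
  "injective_module R E \<longleftrightarrow> module R E \<and>
    (\<forall>(M :: ('r, nat \<Rightarrow> 'r) module) (N :: ('r, nat \<Rightarrow> 'r) module).
      module R M \<longrightarrow> module R N \<longrightarrow>
      (\<forall>g \<in> module_homs R M N. \<forall>f \<in> module_homs R M E. inj_on g (carrier M) \<longrightarrow>
        (\<exists>h \<in> module_homs R N E. \<forall>x \<in> carrier M. h (g x) = f x)))"

text \<open>
  A projective resolution \<open>\<dots> \<rightarrow> P 1 \<rightarrow> P 0 \<rightarrow> M \<rightarrow> 0\<close> with differentials \<open>d i\<close> from \<open>P (i + 1)\<close>
  to \<open>P i\<close> and augmentation \<open>e\<close>, and dually an injective resolution.
\<close>

definition projective_resolution ::
  "('r, 'x) ring_scheme \<Rightarrow> ('r, 'm) module \<Rightarrow> (nat \<Rightarrow> ('r, nat \<Rightarrow> 'r) module) \<Rightarrow>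
   (nat \<Rightarrow> (nat \<Rightarrow> 'r) \<Rightarrow> (nat \<Rightarrow> 'r)) \<Rightarrow> ((nat \<Rightarrow> 'r) \<Rightarrow> 'm) \<Rightarrow> bool" where
  "projective_resolution R M P d e \<longleftrightarrow>
    (\<forall>i. projective_module R (P i)) \<and>
    (\<forall>i. d i \<in> module_homs R (P (Suc i)) (P i)) \<and> e \<in> module_homs R (P 0) M \<and>
    e ` carrier (P 0) = carrier M \<and>
    d 0 ` carrier (P 1) = a_kernel (P 0) M e \<and>
    (\<forall>i. d (Suc i) ` carrier (P (Suc (Suc i))) = a_kernel (P (Suc i)) (P i) (d i))"

definition injective_resolution ::
  "('r, 'x) ring_scheme \<Rightarrow> ('r, 'm) module \<Rightarrow> (nat \<Rightarrow> ('r, nat \<Rightarrow> 'r) module) \<Rightarrow>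
   (nat \<Rightarrow> (nat \<Rightarrow> 'r) \<Rightarrow> (nat \<Rightarrow> 'r)) \<Rightarrow> ('m \<Rightarrow> (nat \<Rightarrow> 'r)) \<Rightarrow> bool" where
  "injective_resolution R M E d e \<longleftrightarrow>
    (\<forall>i. injective_module R (E i)) \<and>
    (\<forall>i. d i \<in> module_homs R (E i) (E (Suc i))) \<and> e \<in> module_homs R M (E 0) \<and>
    inj_on e (carrier M) \<and>
    e ` carrier M = a_kernel (E 0) (E 1) (d 0) \<and>
    (\<forall>i. d i ` carrier (E i) = a_kernel (E (Suc i)) (E (Suc (Suc i))) (d (Suc i)))"

definition proj_dim :: "('r, 'x) ring_scheme \<Rightarrow> ('r, 'm) module \<Rightarrow> enat" where
  "proj_dim R M = Inf {enat n | n. \<exists>P d e.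
    projective_resolution R M P d e \<and> (\<forall>i>n. carrier (P i) = {\<zero>\<^bsub>P i\<^esub>})}"

definition inj_dim :: "('r, 'x) ring_scheme \<Rightarrow> ('r, 'm) module \<Rightarrow> enat" where
  "inj_dim R M = Inf {enat n | n. \<exists>E d e.
    injective_resolution R M E d e \<and> (\<forall>i>n. carrier (E i) = {\<zero>\<^bsub>E i\<^esub>})}"

definition cocycles ::
  "('r, 'x) ring_scheme \<Rightarrow> (nat \<Rightarrow> ('r, 'p) module) \<Rightarrow> (nat \<Rightarrow> 'p \<Rightarrow> 'p) \<Rightarrow> ('r, 'm) module \<Rightarrow>
   nat \<Rightarrow> ('p \<Rightarrow> 'm) set" where
  "cocycles R P d M i =
    {f \<in> module_homs R (P i) M. \<forall>x \<in> carrier (P (Suc i)). f (d i x) = \<zero>\<^bsub>M\<^esub>}"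

fun coboundaries ::
  "('r, 'x) ring_scheme \<Rightarrow> (nat \<Rightarrow> ('r, 'p) module) \<Rightarrow> (nat \<Rightarrow> 'p \<Rightarrow> 'p) \<Rightarrow> ('r, 'm) module \<Rightarrow>
   nat \<Rightarrow> ('p \<Rightarrow> 'm) set" where
  "coboundaries R P d M 0 = {\<lambda>x\<in>carrier (P 0). \<zero>\<^bsub>M\<^esub>}"
| "coboundaries R P d M (Suc i) =
    (\<lambda>f. compose (carrier (P (Suc i))) f (d i)) ` module_homs R (P i) M"

text \<open>\<open>Ext\<^sup>i(N, M)\<close>, computed from an arbitrarily chosen projective resolution of \<open>N\<close>.\<close>

definition Ext_module ::
  "('r, 'x) ring_scheme \<Rightarrow> nat \<Rightarrow> ('r, 'n) module \<Rightarrow> ('r, 'm) module \<Rightarrow>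
   ('r, ((nat \<Rightarrow> 'r) \<Rightarrow> 'm) set) module" where
  "Ext_module R i N M =
    (case (SOME T. case T of (P, d, e) \<Rightarrow> projective_resolution R N P d e) of
      (P, d, e) \<Rightarrow> quotient_module
        ((Hom_module R (P i) M)\<lparr>carrier := cocycles R P d M i\<rparr>) (coboundaries R P d M i))"


section \<open>Depth and the canonical module\<close>

definition set_smult :: "('r, 'x) ring_scheme \<Rightarrow> 'r set \<Rightarrow> ('r, 'm) module \<Rightarrow> 'm set" where
  "set_smult R A M = module_span R M {a \<odot>\<^bsub>M\<^esub> x | a x. a \<in> A \<and> x \<in> carrier M}"

definition regular_sequence :: "('r, 'x) ring_scheme \<Rightarrow> ('r, 'm) module \<Rightarrow> 'r list \<Rightarrow> bool" where
  "regular_sequence R M as \<longleftrightarrow> set as \<subseteq> carrier R \<and>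
    (\<forall>i < length as. \<forall>x \<in> carrier M.
      as ! i \<odot>\<^bsub>M\<^esub> x \<in> set_smult R (set (take i as)) M \<longrightarrow> x \<in> set_smult R (set (take i as)) M) \<and>
    set_smult R (set as) M \<noteq> carrier M"

definition depth :: "('r, 'x) ring_scheme \<Rightarrow> ('r, 'm) module \<Rightarrow> enat" where
  "depth R M = Sup {enat (length as) | as. set as \<subseteq> max_ideal R \<and> regular_sequence R M as}"

definition maximal_cohen_macaulay :: "('r, 'x) ring_scheme \<Rightarrow> ('r, 'm) module \<Rightarrow> bool" where
  "maximal_cohen_macaulay R M \<longleftrightarrow>
    fin_gen_module R M \<and> carrier M \<noteq> {\<zero>\<^bsub>M\<^esub>} \<and> depth R M = krull_dim R"

text \<open>
  A canonical module is a maximal Cohen-Macaulay module of finite injective dimension and of type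
  one; the type is the dimension of \<open>Ext\<^sup>t(k, C)\<close> over the residue field \<open>k\<close>, where \<open>t\<close> is the depth.
\<close>

definition canonical_module :: "('r, 'x) ring_scheme \<Rightarrow> ('r, 'm) module \<Rightarrow> bool" where
  "canonical_module R C \<longleftrightarrow>
    maximal_cohen_macaulay R C \<and> inj_dim R C < \<infinity> \<and>
    isomorphic_modules R (Ext_module R (the_enat (depth R C)) (residue_module R) C) (residue_module R)"


section \<open>Derivations and differentials\<close>

definition derivations ::
  "('k, 'x) ring_scheme \<Rightarrow> ('k, 'r) module \<Rightarrow> ('r, 'm) module \<Rightarrow> ('r \<Rightarrow> 'm) set" where
  "derivations K R M = {D \<in> carrier R \<rightarrow>\<^sub>E carrier M.
    (\<forall>a \<in> carrier R. \<forall>b \<in> carrier R. D (a \<oplus>\<^bsub>R\<^esub> b) = D a \<oplus>\<^bsub>M\<^esub> D b) \<and>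
    (\<forall>c \<in> carrier K. \<forall>a \<in> carrier R. D (c \<odot>\<^bsub>R\<^esub> a) = (c \<odot>\<^bsub>R\<^esub> \<one>\<^bsub>R\<^esub>) \<odot>\<^bsub>M\<^esub> D a) \<and>
    (\<forall>a \<in> carrier R. \<forall>b \<in> carrier R. D (a \<otimes>\<^bsub>R\<^esub> b) = a \<odot>\<^bsub>M\<^esub> D b \<oplus>\<^bsub>M\<^esub> b \<odot>\<^bsub>M\<^esub> D a)}"

definition Der_module :: "('k, 'x) ring_scheme \<Rightarrow> ('k, 'r) module \<Rightarrow> ('r, 'r \<Rightarrow> 'r) module" where
  "Der_module K R = pointwise_module (carrier R) (self_module R) (derivations K R (self_module R))"

text \<open>The test modules range over all finitely generated \<open>R\<close>-modules up to isomorphism, see above.\<close>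

definition universally_finite_differentials ::
  "('k, 'x) ring_scheme \<Rightarrow> ('k, 'r) module \<Rightarrow> ('r, 'w) module \<Rightarrow> ('r \<Rightarrow> 'w) \<Rightarrow> bool" where
  "universally_finite_differentials K R \<Omega> d \<longleftrightarrow>
    fin_gen_module R \<Omega> \<and> d \<in> derivations K R \<Omega> \<and>
    (\<forall>M :: ('r, nat \<Rightarrow> 'r) module. fin_gen_module R M \<longrightarrow>
      (\<forall>D \<in> derivations K R M. \<exists>!h. h \<in> module_homs R \<Omega> M \<and> (\<forall>a \<in> carrier R. h (d a) = D a)))"

end

theory Submission
  imports "HOL-Library.Multiset_Order" Defs
begin

text \<open>
  Let \<open>\<mm>\<close> be the maximal ideal of \<open>R\<close> and \<open>\<omega>\<close> the canonical module. For \<open>x \<in> \<mm>\<close> regular, the condition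
  on \<open>Ext\<close> makes the socle of \<open>\<omega> / x \<omega>\<close> one-dimensional, and finite injective dimension allows to lift
  it along the ideals containing \<open>x\<close>; hence \<open>\<omega>\<close> is faithful and its endomorphisms are homotheties.

  The module \<open>H = Hom(Der R, \<omega>)\<close> is torsionfree of finite projective dimension, thus free. The submodule
  \<open>N\<close> spanned by the maps \<open>D \<mapsto> D(y) w\<close> with \<open>y \<in> \<Omega>\<close>, \<open>w \<in> \<omega>\<close> contains \<open>c H\<close> for some regular \<open>c\<close>. If \<open>N \<noteq> H\<close>,
  a linear form on \<open>H\<close> that maps \<open>N\<close> into \<open>\<mm>\<close> but takes the value \<open>1\<close>, multiplied by a socle element of
  \<open>\<omega> / x \<omega>\<close>, induces endomorphisms of \<open>\<omega>\<close>, hence a derivation \<open>D\<close>, and evaluation at \<open>D\<close> gives a contradiction.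
  So some \<open>D \<mapsto> D(y) w\<close> is part of a basis of \<open>H\<close>, which forces \<open>\<omega> \<cong> R\<close> and \<open>\<Omega> \<cong> H\<close>; thus \<open>\<Omega>\<close> is free.

  In characteristic \<open>0\<close> a maximal subring that meets \<open>\<mm>\<close> in \<open>\<mm>\<^sup>2\<close> yields a derivation from \<open>R\<close> to \<open>\<mm> / \<mm>\<^sup>2\<close> that
  extends the projection of \<open>\<mm>\<close>. Hence, with \<open>\<Omega>\<close> free, there are \<open>x \<in> \<mm>\<close> and a derivation of \<open>R\<close> with
  value \<open>1\<close> at \<open>x\<close>, so \<open>x\<close> is regular as \<open>R\<close> is reduced. If \<open>\<mm> \<noteq> x R\<close>, there are \<open>y \<in> \<mm>\<close> and a derivation \<open>D\<close>
  with \<open>D x = 0\<close> and \<open>D y = 1\<close>; applying \<open>D\<close> to the least power of \<open>y\<close> in \<open>x R\<close> gives a smaller one.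
\<close>

text \<open>The hypothesis speaks of Hom(Der R, \<omega>), so the obstacle is the way back from a
  dual to \<Omega> itself. It is overcome with three elementary properties of \<omega>: it is
  finitely generated, nonzerodivisors act injectively, and each endomorphism is multiplication by a
  unique scalar. If a linear form \<sigma> on \<omega> takes a unit value at w, then v ->
  \<sigma>(v) w is such a multiplication, by the unit \<sigma>(w); hence \<omega> = R w. This is why
  a single basis vector of the form D -> D(y) w forces \<omega> \<cong> R. Then y -> (D -> D(y) w)
  maps \<Omega> onto N = H, and it is injective as \<Omega> is torsionfree. The regular c comes from
  the minimal primes: R is reduced, so its localization at such a prime is a field, over which the
  identity of \<Omega> is a sum of rank-one maps; c clears the denominators. Characteristic 0 enters
  twice. A separable equation over the maximal subring is solved modulo the square of \<mm> by one
  Newton step, and n + 1 is a unit when a derivation is applied to y^(n+1).\<close>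

text \<open>Below, a ring or module stands for its carrier, and a subscript names the structure of an operation.\<close>

abbreviation smult_at (\<open>_ *\<^sub>_ _\<close> [70, 1000, 71] 70) where "a *\<^sub>M x \<equiv> smult M a x"
abbreviation add_at (\<open>_ +\<^sub>_ _\<close> [65, 1000, 66] 65) where "x +\<^sub>M y \<equiv> add M x y"
abbreviation minus_at (\<open>_ -\<^sub>_ _\<close> [65, 1000, 66] 65) where "x -\<^sub>M y \<equiv> a_minus M x y"
abbreviation neg_at (\<open>-\<^sub>_ _\<close> [1000, 81] 80) where "-\<^sub>M x \<equiv> a_inv M x"
abbreviation zero_at (\<open>0\<^sub>_\<close> [1000] 1000) where "0\<^sub>M \<equiv> ring.zero M"
abbreviation mult_at (\<open>_ \<otimes>\<^sub>_ _\<close> [70, 1000, 71] 70) where "x \<otimes>\<^sub>M y \<equiv> monoid.mult M x y"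
abbreviation one_at (\<open>\<one>\<^sub>_\<close> [1000] 1000) where "\<one>\<^sub>M \<equiv> one M"

declare [[coercion carrier]]

section \<open>Ideals, linear maps and submodules\<close>

lemma (in cring) cring_idealI:
  assumes "I \<subseteq> R" "\<zero> \<in> I" "\<And>a b. a \<in> I ==> b \<in> I ==> a \<oplus> b \<in> I"
    and mult: "\<And>r a. r \<in> R ==> a \<in> I ==> r \<otimes> a \<in> I"
  shows "ideal I R"
proof (rule idealI[OF ring_axioms])
  show "subgroup I (add_monoid R)"
  proof (rule add.subgroupI)
    show "\<ominus> a \<in> I" if "a \<in> I" for a
    proof -
      have "(\<ominus> \<one>) \<otimes> a \<in> I" using mult that by auto
      moreover have "(\<ominus> \<one>) \<otimes> a = \<ominus> a" using that assms(1) by (auto simp: l_minus)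
      ultimately show ?thesis by simp
    qed
  qed (use assms in auto)
  show "a \<otimes> x \<in> I" if "a \<in> I" "x \<in> R" for a x using mult[OF that(2,1)] that assms(1) m_comm by auto
qed (use mult in auto)

locale rmod = module R M for R :: "('r, 'x) ring_scheme" (structure) and M :: "('r, 'm) module" (structure)

lemmas rmodI = rmod.intro

text \<open>Linearity on the carrier alone. Unlike the members of \<open>module_homs\<close>, such
  maps need not be extensional, so composites and pointwise combinations can be written as plain
  functions.\<close>

definition lin :: "('r, 'x) ring_scheme \<Rightarrow> ('r, 'm) module \<Rightarrow> ('r, 'n) module \<Rightarrow> ('m \<Rightarrow> 'n) \<Rightarrow> bool" where
  "lin R M N h \<longleftrightarrow> (\<forall>x \<in> carrier M. h x \<in> N) \<and>
    (\<forall>x \<in> carrier M. \<forall>y \<in> carrier M. h (x +\<^sub>M y) = h x +\<^sub>N h y) \<and>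
    (\<forall>a \<in> carrier R. \<forall>x \<in> carrier M. h (a *\<^sub>M x) = a *\<^sub>N h x)"

lemma linD:
  assumes "lin R M N h"
  shows "x \<in> M ==> h x \<in> N"
    and "x \<in> M ==> y \<in> M ==> h (x +\<^sub>M y) = h x +\<^sub>N h y"
    and "a \<in> R ==> x \<in> M ==> h (a *\<^sub>M x) = a *\<^sub>N h x" using assms unfolding lin_def by auto

lemma linI:
  assumes "\<And>x. x \<in> carrier M ==> h x \<in> carrier N"
    and "\<And>x y. x \<in> carrier M ==> y \<in> carrier M ==> h (x +\<^sub>M y) = h x +\<^sub>N h y"
    and "\<And>a x. a \<in> carrier R ==> x \<in> carrier M ==> h (a *\<^sub>M x) = a *\<^sub>N h x"
  shows "lin R M N h" using assms unfolding lin_def by auto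

lemma lin_comp:
  assumes "lin R M N f" "lin R N L g"
  shows "lin R M L (\<lambda>x. g (f x))" using assms by (auto simp: lin_def)

lemma module_homs_imp_lin: "h \<in> module_homs R M N ==> lin R M N h"
  by (auto simp: module_homs_def lin_def PiE_def Pi_def)

lemma lin_cong:
  assumes "module R M" "\<And>x. x \<in> M ==> f x = g x"
  shows "lin R M N f \<longleftrightarrow> lin R M N g"
proof -
  interpret module R M by fact
  show ?thesis using assms(2) by (auto simp: lin_def)
qed

lemma lin_restrict:
  assumes "module R M" "lin R M N h"
  shows "restrict h M \<in> module_homs R M N"
proof -
  interpret module R M by fact
  show ?thesis using assms(2) by (auto simp: lin_def module_homs_def)
qed

lemma lin_zero:
  assumes "module R M" "module R N" "lin R M N h"
  shows "h 0\<^sub>M = 0\<^sub>N"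
proof -
  interpret M: rmod R M by (rule rmodI) fact
  interpret N: rmod R N by (rule rmodI) fact
  have "h 0\<^sub>M = h (0\<^sub>R *\<^sub>M 0\<^sub>M)" by simp
  also have "\<dots> = 0\<^sub>R *\<^sub>N h 0\<^sub>M" by (rule linD(3)[OF assms(3)]) auto
  also have "\<dots> = 0\<^sub>N" using linD(1)[OF assms(3)] by simp
  finally show ?thesis .
qed

lemma lin_neg:
  assumes "module R M" "module R N" "lin R M N h" "x \<in> M"
  shows "h (-\<^sub>M x) = -\<^sub>N h x"
proof -
  interpret M: rmod R M by (rule rmodI) fact
  interpret N: rmod R N by (rule rmodI) fact
  have "h (-\<^sub>M x) +\<^sub>N h x = h (-\<^sub>M x +\<^sub>M x)" using linD(2)[OF assms(3), of "-\<^sub>M x" x] assms(4) by simp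
  also have "\<dots> = 0\<^sub>N" using assms(4) lin_zero[OF assms(1-3)] by (simp add: M.M.l_neg)
  finally show ?thesis using N.M.minus_equality linD(1)[OF assms(3)] assms(4) M.M.a_inv_closed by metis
qed

lemma lin_minus:
  assumes "module R M" "module R N" "lin R M N h" "x \<in> M" "y \<in> M"
  shows "h (x -\<^sub>M y) = h x -\<^sub>N h y"
proof -
  interpret M: rmod R M by (rule rmodI) fact
  interpret N: rmod R N by (rule rmodI) fact
  show ?thesis using assms by (simp add: a_minus_def linD(2) lin_neg)
qed

context rmod
begin

lemma is_mod: "module R M" by (rule module_axioms)

lemma submoduleD:
  assumes "submodule N R M"
  shows "x \<in> N ==> x \<in> M" "0\<^sub>M \<in> N"
    "x \<in> N ==> y \<in> N ==> x +\<^sub>M y \<in> N" "x \<in> N ==> -\<^sub>M x \<in> N"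
    "x \<in> N ==> y \<in> N ==> x -\<^sub>M y \<in> N"
    "a \<in> R ==> x \<in> N ==> a *\<^sub>M x \<in> N"
proof -
  note E = submoduleE[OF assms]
  show 1: "x \<in> N ==> x \<in> M" using E by auto
  show "a \<in> R ==> x \<in> N ==> a *\<^sub>M x \<in> N" using E by auto
  show "x \<in> N ==> y \<in> N ==> x +\<^sub>M y \<in> N" using E by auto
  show "x \<in> N ==> -\<^sub>M x \<in> N" using E by auto
  show "x \<in> N ==> y \<in> N ==> x -\<^sub>M y \<in> N" using E by (auto simp: a_minus_def)
  obtain z where "z \<in> N" using E(2) by blast
  thus "0\<^sub>M \<in> N" using E(4)[of \<zero> z] 1 E(1) by auto
qed

lemma submoduleI':
  assumes "N \<subseteq> M" "0\<^sub>M \<in> N"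
    "\<And>x y. x \<in> N ==> y \<in> N ==> x +\<^sub>M y \<in> N"
    "\<And>a x. a \<in> R ==> x \<in> N ==> a *\<^sub>M x \<in> N"
  shows "submodule N R M"
proof (rule submoduleI)
  fix x assume "x \<in> N"
  hence "(\<ominus> \<one>) *\<^sub>M x \<in> N" using assms(4) by auto
  moreover have "(\<ominus> \<one>) *\<^sub>M x = -\<^sub>M x" using \<open>x \<in> N\<close> assms(1) by (subst smult_l_minus) auto
  ultimately show "-\<^sub>M x \<in> N" by simp
qed (use assms in auto)

lemma submodule_zero: "submodule {0\<^sub>M} R M" by (rule submoduleI') auto

lemma submodule_module:
  assumes "submodule N R M" shows "module R (M\<lparr>carrier := N\<rparr>)"
  using submodule.submodule_is_module[OF assms is_mod] .

lemma span_submodule: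
  assumes "A \<subseteq> M" shows "submodule (module_span R M A) R M" unfolding module_span_def
  by (rule submoduleI') (use carrier_is_submodule assms in \<open>auto intro: submoduleD\<close>)

lemma span_incl: "A \<subseteq> module_span R M A" unfolding module_span_def by auto

lemma span_least: "submodule N R M ==> A \<subseteq> N ==> module_span R M A \<subseteq> N" unfolding module_span_def by auto

lemma span_closed: "A \<subseteq> M ==> x \<in> module_span R M A ==> x \<in> M" using span_submodule submoduleD(1) by blast

lemma span_mono: "A \<subseteq> B ==> module_span R M A \<subseteq> module_span R M B" unfolding module_span_def by auto

lemma span_empty: "module_span R M {} = {0\<^sub>M}"
  using span_least[OF submodule_zero, of "{}"] submoduleD(2)[OF span_submodule[of "{}"]] by auto

lemma adjoin_submodule:
  assumes N: "submodule N R M" and v: "v \<in> M"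
  shows "submodule {a *\<^sub>M v +\<^sub>M w |a w. a \<in> R \<and> w \<in> N} R M" (is "submodule ?S R M")
proof (rule submoduleI')
  note D = submoduleD[OF N]
  show "?S \<subseteq> M" using D(1) v by auto
  show "0\<^sub>M \<in> ?S" using D(2) v by (intro CollectI exI[of _ \<zero>] exI[of _ "0\<^sub>M"]) auto
  { fix x y assume "x \<in> ?S" "y \<in> ?S"
    then obtain a w b u where *: "x = a *\<^sub>M v +\<^sub>M w" "a \<in> R" "w \<in> N"
      "y = b *\<^sub>M v +\<^sub>M u" "b \<in> R" "u \<in> N" by auto
    have "x +\<^sub>M y = (a \<oplus> b) *\<^sub>M v +\<^sub>M (w +\<^sub>M u)" using * v D(1) by (simp add: smult_l_distr M.a_ac)
    thus "x +\<^sub>M y \<in> ?S" using * D(3) by blast }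
  { fix r x assume "r \<in> R" "x \<in> ?S"
    then obtain a w where *: "x = a *\<^sub>M v +\<^sub>M w" "a \<in> R" "w \<in> N" by auto
    have "r *\<^sub>M x = (r \<otimes> a) *\<^sub>M v +\<^sub>M (r *\<^sub>M w)"
      using * v D(1) \<open>r \<in> R\<close> by (simp add: smult_r_distr smult_assoc1)
    thus "r *\<^sub>M x \<in> ?S" using * D(6) \<open>r \<in> R\<close> by blast }
qed

lemma span_insert:
  assumes A: "A \<subseteq> M" and v: "v \<in> M"
  shows "module_span R M (insert v A) =
    {a *\<^sub>M v +\<^sub>M w |a w. a \<in> R \<and> w \<in> module_span R M A}" (is "_ = ?S")
proof
  note S = span_submodule[OF A]
  show "module_span R M (insert v A) \<subseteq> ?S"
  proof (rule span_least[OF adjoin_submodule[OF S v]], rule insert_subsetI)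
    have "v = \<one> *\<^sub>M v +\<^sub>M 0\<^sub>M" using v by simp
    thus "v \<in> ?S" using submoduleD(2)[OF S] by blast
    show "A \<subseteq> ?S"
    proof
      fix w assume w: "w \<in> A"
      have "w = \<zero> *\<^sub>M v +\<^sub>M w" using v w A by auto
      thus "w \<in> ?S" using w span_incl by blast
    qed
  qed
  have I: "submodule (module_span R M (insert v A)) R M" using span_submodule A v by auto
  have "v \<in> module_span R M (insert v A)" using span_incl by blast
  moreover have "module_span R M A \<subseteq> module_span R M (insert v A)" by (rule span_mono) auto
  ultimately show "?S \<subseteq> module_span R M (insert v A)" using submoduleD(3,6)[OF I] by blast
qed

lemma kernel_submodule:
  assumes "module R N" "lin R M N h"
  shows "submodule {x \<in> M. h x = 0\<^sub>N} R M"
proof -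
  interpret N: rmod R N by (rule rmodI) fact
  show ?thesis by (rule submoduleI') (use assms in \<open>auto simp: linD lin_zero[OF is_mod] \<close>)
qed

lemma vimage_submodule:
  assumes "module R N" "lin R M N h" "submodule S R N"
  shows "submodule {x \<in> M. h x \<in> S} R M"
proof -
  interpret N: rmod R N by (rule rmodI) fact
  note N.submoduleD[OF assms(3)]
  thus ?thesis by (intro submoduleI') (use assms in \<open>auto simp: linD lin_zero[OF is_mod] \<close>)
qed

lemma image_submodule:
  assumes "module R N" "lin R M N h" "submodule S R M"
  shows "submodule (h ` S) R N"
proof -
  interpret N: rmod R N by (rule rmodI) fact
  note D = submoduleD[OF assms(3)]
  show ?thesis
  proof (rule N.submoduleI')
    show "h ` S \<subseteq> N" using D(1) linD(1)[OF assms(2)] by auto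
    show "0\<^sub>N \<in> h ` S" using D(2) lin_zero[OF is_mod assms(1,2)] by (metis imageI)
    show "x +\<^sub>N y \<in> h ` S" if "x \<in> h ` S" "y \<in> h ` S" for x y
    proof -
      from that obtain u w where "u \<in> S" "w \<in> S" "x = h u" "y = h w" by auto
      thus ?thesis using linD(2)[OF assms(2), of u w] D(1,3) by (metis imageI)
    qed
    show "a *\<^sub>N x \<in> h ` S" if "a \<in> R" "x \<in> h ` S" for a x
    proof -
      from that obtain u where "u \<in> S" "x = h u" by auto
      thus ?thesis using linD(3)[OF assms(2), of a u] D(1,6) that(1) by (metis imageI)
    qed
  qed
qed

lemma submodule_inter:
  assumes "submodule A R M" "submodule B R M"
  shows "submodule (A \<inter> B) R M"
  by (rule submoduleI') (use submoduleD[OF assms(1)] submoduleD[OF assms(2)] in auto)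

lemma span_image:
  assumes "module R N" "lin R M N h" "A \<subseteq> M"
  shows "module_span R N (h ` A) = h ` module_span R M A"
proof
  interpret N: rmod R N by (rule rmodI) fact
  have hA: "h ` A \<subseteq> N" using linD(1)[OF assms(2)] assms(3) by auto
  show "module_span R N (h ` A) \<subseteq> h ` module_span R M A"
    by (rule N.span_least[OF image_submodule[OF assms(1,2) span_submodule[OF assms(3)]]])
      (use span_incl in blast)
  have "module_span R M A \<subseteq> {x \<in> M. h x \<in> module_span R N (h ` A)}"
    by (rule span_least[OF vimage_submodule[OF assms(1,2) N.span_submodule[OF hA]]])
      (use N.span_incl assms(3) in blast)
  thus "h ` module_span R M A \<subseteq> module_span R N (h ` A)" by blast
qed

lemma minus_eq_iff: "x \<in> M ==> y \<in> M ==> x -\<^sub>M y = 0\<^sub>M \<longleftrightarrow> x = y"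
proof -
  assume *: "x \<in> M" "y \<in> M"
  have "x = x -\<^sub>M y +\<^sub>M y" using * by (simp add: M.minus_eq M.a_assoc M.l_neg)
  thus ?thesis using * by (metis M.l_zero M.minus_eq M.r_neg)
qed

lemma smult_minus_r: "a \<in> R ==> x \<in> M ==> y \<in> M ==>
  a *\<^sub>M (x -\<^sub>M y) = a *\<^sub>M x -\<^sub>M a *\<^sub>M y" by (simp add: a_minus_def smult_r_distr smult_r_minus)

lemma smult_minus_l: "a \<in> R ==> b \<in> R ==> x \<in> M ==>
  (a \<ominus> b) *\<^sub>M x = a *\<^sub>M x -\<^sub>M b *\<^sub>M x" by (simp add: a_minus_def smult_l_distr smult_l_minus)

text \<open>A submodule is Noetherian by the coefficient-ideal argument of Hilbert's basis theorem.\<close>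

lemma coefficient_ideal:
  assumes T: "submodule T R M" and W: "submodule W R M" and v: "v \<in> M"
  shows "ideal {r \<in> R. \<exists>w\<in>W. r *\<^sub>M v +\<^sub>M w \<in> T} R" (is "ideal ?I R")
proof (rule R.cring_idealI)
  note TD = submoduleD[OF T] and WD = submoduleD[OF W]
  show "?I \<subseteq> R" by auto
  show "\<zero> \<in> ?I" using v TD(2) WD(2) by (auto intro!: bexI[of _ "0\<^sub>M"])
  show "x \<otimes> a \<in> ?I" if "x \<in> R" "a \<in> ?I" for a x
  proof -
    from that obtain w where w: "a \<in> R" "w \<in> W" "a *\<^sub>M v +\<^sub>M w \<in> T" by auto
    have eq: "(x \<otimes> a) *\<^sub>M v +\<^sub>M x *\<^sub>M w = x *\<^sub>M (a *\<^sub>M v +\<^sub>M w)"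
      using w that v WD(1) by (simp add: smult_assoc1 smult_r_distr)
    have "(x \<otimes> a) *\<^sub>M v +\<^sub>M x *\<^sub>M w \<in> T" "x *\<^sub>M w \<in> W" unfolding eq using w that TD(6) WD(6) by auto
    moreover have "x \<otimes> a \<in> R" using w(1) that(1) by auto
    ultimately show ?thesis by blast
  qed
  show "a \<oplus> b \<in> ?I" if "a \<in> ?I" "b \<in> ?I" for a b
  proof -
    from that obtain w u where w: "a \<in> R" "w \<in> W" "a *\<^sub>M v +\<^sub>M w \<in> T"
      "b \<in> R" "u \<in> W" "b *\<^sub>M v +\<^sub>M u \<in> T" by auto
    have eq: "(a \<oplus> b) *\<^sub>M v +\<^sub>M (w +\<^sub>M u) =
        (a *\<^sub>M v +\<^sub>M w) +\<^sub>M (b *\<^sub>M v +\<^sub>M u)" using w v WD(1) by (simp add: smult_l_distr M.a_ac)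
    have "(a \<oplus> b) *\<^sub>M v +\<^sub>M (w +\<^sub>M u) \<in> T" "w +\<^sub>M u \<in> W" unfolding eq using w TD(3) WD(3) by auto
    moreover have "a \<oplus> b \<in> R" using w by auto
    ultimately show ?thesis by blast
  qed
qed

lemma fg_submodule_of_span:
  assumes noeth: "noetherian_ring R" and "finite A" "A \<subseteq> M"
    and "submodule N R M" "N \<subseteq> module_span R M A"
  shows "\<exists>B. finite B \<and> B \<subseteq> N \<and> module_span R M B = N" using assms(2-)
proof (induction A arbitrary: N rule: finite_induct)
  case empty
  thus ?case using span_empty submoduleD(2)[OF empty(2)] by (intro exI[of _ "{}"]) auto
next
  case (insert v A)
  note N = insert.prems(2) and ND = submoduleD[OF insert.prems(2)]
  have v: "v \<in> M" and A: "A \<subseteq> M" using insert.prems by auto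
  define W where "W = module_span R M A"
  have W: "submodule W R M" and WD: "\<And>w. w \<in> W ==> w \<in> M"
    using span_submodule[OF A] submoduleD(1)[OF span_submodule[OF A]] by (auto simp: W_def)
  have in_W: "x \<in> module_span R M (insert v A) ==> \<exists>a\<in>R. \<exists>w\<in>W. x = a *\<^sub>M v +\<^sub>M w" for x
    using span_insert[OF A v] by (auto simp: W_def)
  obtain B1 where B1: "finite B1" "B1 \<subseteq> N \<inter> W" "module_span R M B1 = N \<inter> W"
    using insert.IH[OF A submodule_inter[OF N W]] by (auto simp: W_def)
  define I where "I = {r \<in> R. \<exists>w\<in>W. r *\<^sub>M v +\<^sub>M w \<in> N}"
  have "ideal I R" unfolding I_def by (rule coefficient_ideal[OF N W v])
  then obtain G where G: "G \<subseteq> R" "finite G" "I = genideal R G"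
    using noetherian_ring.finetely_gen[OF noeth] by blast
  have "\<forall>r\<in>G. \<exists>w\<in>W. r *\<^sub>M v +\<^sub>M w \<in> N" using R.genideal_self[OF G(1)] G(3) by (auto simp: I_def)
  then obtain w where w: "\<And>r. r \<in> G ==> w r \<in> W" "\<And>r. r \<in> G ==> r *\<^sub>M v +\<^sub>M w r \<in> N" by metis
  define B where "B = (\<lambda>r. r *\<^sub>M v +\<^sub>M w r) ` G \<union> B1"
  have BN: "B \<subseteq> N" using w B1 by (auto simp: B_def)
  hence BM: "B \<subseteq> M" using ND(1) by auto
  define T where "T = module_span R M B"
  have T: "submodule T R M" unfolding T_def by (rule span_submodule[OF BM])
  note TD = submoduleD[OF T]
  have TN: "T \<subseteq> N" unfolding T_def by (rule span_least[OF N BN])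
  have BT: "B \<subseteq> T" unfolding T_def by (rule span_incl)
  have "N \<inter> W \<subseteq> T" using B1(3) span_mono[of B1 B] by (auto simp: T_def B_def)
  have "I \<subseteq> {r \<in> R. \<exists>w\<in>W. r *\<^sub>M v +\<^sub>M w \<in> T}" unfolding G(3)
  proof (rule R.genideal_minimal[OF coefficient_ideal[OF T W v]], rule subsetI)
    fix r assume "r \<in> G"
    moreover from this have "r *\<^sub>M v +\<^sub>M w r \<in> T" using BT by (auto simp: B_def)
    ultimately show "r \<in> {r \<in> R. \<exists>w\<in>W. r *\<^sub>M v +\<^sub>M w \<in> T}" using w(1) G(1) by blast
  qed
  have "N \<subseteq> T"
  proof
    fix x assume x: "x \<in> N"
    then obtain a u where u: "a \<in> R" "u \<in> W" "x = a *\<^sub>M v +\<^sub>M u" using in_W insert.prems(3) by blast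
    hence "a \<in> I" using x unfolding I_def by blast
    then obtain u' where u': "u' \<in> W" "a *\<^sub>M v +\<^sub>M u' \<in> T" using \<open>I \<subseteq> _\<close> by blast
    \<comment> \<open>Two elements with the same coefficient at v, one in N and one in T, differ by
      an element of N \<inter> W, which already lies in T.\<close>
    have eq: "x -\<^sub>M (a *\<^sub>M v +\<^sub>M u') = u -\<^sub>M u'"
      using u u' v WD by (simp add: a_minus_def M.minus_add M.a_ac M.r_neg1 M.r_neg2 M.r_neg)
    have "u -\<^sub>M u' \<in> W" using submoduleD(5)[OF W] u u' by auto
    moreover have "u -\<^sub>M u' \<in> N" unfolding eq[symmetric] using ND(5) x u'(2) TN by auto
    ultimately have "x -\<^sub>M (a *\<^sub>M v +\<^sub>M u') \<in> T" using eq \<open>N \<inter> W \<subseteq> T\<close> by auto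
    from TD(3)[OF this u'(2)] show "x \<in> T" using x u' ND(1) TD(1) by (simp add: a_minus_def M.a_assoc M.l_neg)
  qed
  with TN have "T = N" by auto
  thus ?case using BN B1(1) G(2) by (intro exI[of _ B]) (auto simp: T_def B_def)
qed

end

section \<open>Ideals and local Noetherian rings\<close>

lemma idealD:
  fixes R (structure)
  assumes "ideal J R"
  shows "x \<in> J ==> x \<in> R" "\<zero> \<in> J" "x \<in> J ==> y \<in> J ==> x \<oplus> y \<in> J"
    "x \<in> J ==> \<ominus> x \<in> J" "x \<in> J ==> y \<in> J ==> x \<ominus> y \<in> J"
    "a \<in> R ==> x \<in> J ==> a \<otimes> x \<in> J" "a \<in> R ==> x \<in> J ==> x \<otimes> a \<in> J"
proof -
  interpret ideal J R by fact
  show "x \<in> J ==> x \<in> R" "\<zero> \<in> J" "x \<in> J ==> y \<in> J ==> x \<oplus> y \<in> J"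
    "x \<in> J ==> \<ominus> x \<in> J" 
    "a \<in> R ==> x \<in> J ==> a \<otimes> x \<in> J" "a \<in> R ==> x \<in> J ==> x \<otimes> a \<in> J" by (auto simp: Icarr I_l_closed I_r_closed)
  thus "x \<in> J ==> y \<in> J ==> x \<ominus> y \<in> J" by (simp add: a_minus_def)
qed

text \<open>In a Noetherian ring the union of a chain of ideals is one of its members, so Zorn's
  lemma applies to every nonempty family of ideals, whether or not it is closed under
  unions.\<close>

lemma (in noetherian_ring) exists_maximal_ideal_in:
  assumes "SS \<noteq> {}" "\<forall>J\<in>SS. ideal J R"
  shows "\<exists>J\<in>SS. \<forall>J'\<in>SS. J \<subseteq> J' \<longrightarrow> J' = J"
  proof (rule subset_Zorn_nonempty[OF assms(1)])
    fix C assume C: "C \<noteq> {}" "subset.chain SS C"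
    hence "subset.chain {I. ideal I R} C" using assms(2) by (auto simp: pred_on.chain_def)
    from ideal_chain_is_trivial[OF C(1) this] show "\<Union>C \<in> SS" using C(2) by (auto simp: pred_on.chain_def)
  qed

text \<open>Noetherian induction downwards from R. In the applications the larger ideal is J + R u,
  where the class of u spans a copy of the residue field in R / J.\<close>

lemma (in noetherian_ring) ideal_induct:
  assumes J: "ideal J R"
    and step: "\<And>J. ideal J R ==> (\<And>J'. ideal J' R ==> J \<subset> J' ==> P J') ==> P J"
  shows "P J"
proof (rule ccontr)
  assume "\<not> P J"
  define SS where "SS = {J. ideal J R \<and> \<not> P J}"
  have ne: "SS \<noteq> {}" and ids: "\<forall>J\<in>SS. ideal J R" using \<open>\<not> P J\<close> J by (auto simp: SS_def)
  from exists_maximal_ideal_in[OF ne ids]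
  obtain J0 where "J0 \<in> SS" and max: "\<forall>J'\<in>SS. J0 \<subseteq> J' \<longrightarrow> J' = J0" by (elim bexE)
  hence J0: "ideal J0 R" "\<not> P J0" by (auto simp: SS_def)
  have "P J0"
  proof (rule step[OF J0(1)])
    fix J' assume *: "ideal J' R" "J0 \<subset> J'"
    show "P J'"
    proof (rule ccontr)
      assume "\<not> P J'"
      hence "J' \<in> SS" using *(1) by (simp add: SS_def)
      from bspec[OF max this] *(2) show False by auto
    qed
  qed
  with J0(2) show False by simp
qed

lemma (in cring) adjoin_ideal:
  assumes J: "ideal J R" and v: "v \<in> R"
  shows "ideal {r \<otimes> v \<oplus> w |r w. r \<in> R \<and> w \<in> J} R" (is "ideal ?S R")
proof (rule cring_idealI)
  note D = idealD[OF J]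
  show "?S \<subseteq> R" using D(1) v by auto
  show "\<zero> \<in> ?S" using D(2) v by (intro CollectI exI[of _ \<zero>]) auto
  show "x \<oplus> y \<in> ?S" if "x \<in> ?S" "y \<in> ?S" for x y
  proof -
    from that obtain a w b u where *: "x = a \<otimes> v \<oplus> w" "a \<in> R" "w \<in> J"
      "y = b \<otimes> v \<oplus> u" "b \<in> R" "u \<in> J" by auto
    have "x \<oplus> y = (a \<oplus> b) \<otimes> v \<oplus> (w \<oplus> u)" using * v D(1) by (simp add: l_distr a_ac)
    thus ?thesis using * D(3) by blast
  qed
  show "s \<otimes> x \<in> ?S" if "s \<in> R" "x \<in> ?S" for s x
  proof -
    from that obtain a w where *: "x = a \<otimes> v \<oplus> w" "a \<in> R" "w \<in> J" by auto
    have "s \<otimes> x = (s \<otimes> a) \<otimes> v \<oplus> (s \<otimes> w)" using * v D(1) that by (simp add: r_distr m_assoc)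
    thus ?thesis using * D(6) that by blast
  qed
qed

lemma (in cring) adjoin_ideal_incl:
  assumes J: "ideal J R" and v: "v \<in> R"
  shows "J \<subseteq> {r \<otimes> v \<oplus> w |r w. r \<in> R \<and> w \<in> J}"
    and "v \<in> {r \<otimes> v \<oplus> w |r w. r \<in> R \<and> w \<in> J}"
proof -
  note D = idealD[OF J]
  show "v \<in> {r \<otimes> v \<oplus> w |r w. r \<in> R \<and> w \<in> J}" using v D(2) by (intro CollectI exI[of _ \<one>] exI[of _ \<zero>]) auto
  show "J \<subseteq> {r \<otimes> v \<oplus> w |r w. r \<in> R \<and> w \<in> J}"
  proof
    fix w assume "w \<in> J"
    thus "w \<in> {r \<otimes> v \<oplus> w |r w. r \<in> R \<and> w \<in> J}" using v D(1) by (intro CollectI exI[of _ \<zero>] exI[of _ w]) auto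
  qed
qed

text \<open>Locality in terms of units. This is what the two constructions of R provide directly;
  \<open>maximalideal_iff\<close> identifies \<mm> with the maximal ideal of the
  definitions.\<close>

locale local_noetherian = cring R + noetherian_ring R for R :: "('r, 'x) ring_scheme" (structure) +
  fixes \<mm> :: "'r set"
  assumes m_ideal: "ideal \<mm> R"
    and one_notin_m: "\<one> \<notin> \<mm>"
    and unit_if: "\<lbrakk>a \<in> R; a \<notin> \<mm>\<rbrakk> \<Longrightarrow> a \<in> Units R"
begin

lemma m_closed': "a \<in> \<mm> ==> a \<in> R" using idealD(1)[OF m_ideal] .

lemma unit_notin_m: "a \<in> Units R ==> a \<notin> \<mm>" using idealD(6)[OF m_ideal, of "inv a" a] one_notin_m by auto

lemma one_minus_unit: "a \<in> \<mm> ==> \<one> \<ominus> a \<in> Units R"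
proof (rule unit_if)
  assume a: "a \<in> \<mm>"
  show "\<one> \<ominus> a \<in> R" using a m_closed' by auto
  show "\<one> \<ominus> a \<notin> \<mm>"
  proof
    assume "\<one> \<ominus> a \<in> \<mm>"
    hence "(\<one> \<ominus> a) \<oplus> a \<in> \<mm>" using a idealD(3)[OF m_ideal] by blast
    moreover have "(\<one> \<ominus> a) \<oplus> a = \<one>" using a m_closed' by (simp add: a_minus_def a_assoc l_neg)
    ultimately show False using one_notin_m by simp
  qed
qed

lemma m_prime: "primeideal \<mm> R"
proof (rule primeidealI[OF m_ideal])
  show "cring R" by (rule is_cring)
  show "carrier R \<noteq> \<mm>" using one_notin_m by auto
  show "a \<in> \<mm> \<or> b \<in> \<mm>" if "a \<in> R" "b \<in> R" "a \<otimes> b \<in> \<mm>" for a b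
    using that unit_if Units_m_closed unit_notin_m by blast
qed

lemma ideal_notin_one: "ideal J R ==> J \<noteq> carrier R ==> \<one> \<notin> J" by (auto dest: ideal.one_imp_carrier)

lemma proper_ideal_le_m: "ideal J R ==> \<one> \<notin> J ==> J \<subseteq> \<mm>"
proof
  fix a assume J: "ideal J R" "\<one> \<notin> J" and a: "a \<in> J"
  show "a \<in> \<mm>"
  proof (rule ccontr)
    assume "a \<notin> \<mm>"
    hence u: "a \<in> Units R" using unit_if idealD(1)[OF J(1) a] by auto
    show False using idealD(6)[OF J(1) Units_inv_closed[OF u] a] J(2) Units_l_inv[OF u] by simp
  qed
qed

lemma primeidealD:
  assumes "primeideal P R"
  shows "ideal P R" "\<one> \<notin> P" "a \<in> R ==> b \<in> R ==> a \<otimes> b \<in> P ==> a \<in> P \<or> b \<in> P" "P \<subseteq> \<mm>"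
proof -
  interpret P: primeideal P R by fact
  show i: "ideal P R" by (rule P.is_ideal)
  show "\<one> \<notin> P" using P.I_notcarr P.one_imp_carrier by auto
  thus "P \<subseteq> \<mm>" using i proper_ideal_le_m by auto
  show "a \<in> R ==> b \<in> R ==> a \<otimes> b \<in> P ==> a \<in> P \<or> b \<in> P" using P.I_prime by auto
qed

text \<open>An ideal P maximal among those that contain J and avoid S is prime: for a and b outside
  P, both P + R a and P + R b meet S, and the product of two common elements lies in S, but also in
  P if a b does.\<close>

lemma prime_avoiding:
  assumes J: "ideal J R" and S: "S \<subseteq> R" "\<one> \<in> S" "\<And>a b. a \<in> S ==> b \<in> S ==> a \<otimes> b \<in> S"
    and disj: "J \<inter> S = {}"
  obtains P where "primeideal P R" "J \<subseteq> P" "P \<inter> S = {}"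
proof -
  define SS where "SS = {Q. ideal Q R \<and> J \<subseteq> Q \<and> Q \<inter> S = {}}"
  have ne: "SS \<noteq> {}" and ids: "\<forall>J\<in>SS. ideal J R" using J disj by (auto simp: SS_def)
  from exists_maximal_ideal_in[OF ne ids]
  obtain P where "P \<in> SS" and max0: "\<forall>Q\<in>SS. P \<subseteq> Q \<longrightarrow> Q = P" by (elim bexE)
  hence P: "ideal P R" "J \<subseteq> P" "P \<inter> S = {}" by (auto simp: SS_def)
  have max: "\<And>Q. ideal Q R ==> J \<subseteq> Q ==> Q \<inter> S = {} ==> P \<subseteq> Q ==> Q = P" using max0 unfolding SS_def by simp
  note D = idealD[OF P(1)]
  have meets: "\<exists>r\<in>R. \<exists>w\<in>P. r \<otimes> a \<oplus> w \<in> S" if a: "a \<in> R" "a \<notin> P" for a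
  proof -
    define Q where "Q = {r \<otimes> a \<oplus> w |r w. r \<in> R \<and> w \<in> P}"
    have "ideal Q R" "P \<subseteq> Q" "a \<in> Q"
      unfolding Q_def using adjoin_ideal[OF P(1) a(1)] adjoin_ideal_incl[OF P(1) a(1)] by auto
    hence "Q \<inter> S \<noteq> {}" using max[of Q] P(2) a(2) by blast
    thus ?thesis by (auto simp: Q_def)
  qed
  have "primeideal P R"
  proof (rule primeidealI[OF P(1) is_cring])
    show "carrier R \<noteq> P" using P(3) S by auto
    show "a \<in> P \<or> b \<in> P" if ab: "a \<in> R" "b \<in> R" "a \<otimes> b \<in> P" for a b
    proof (rule ccontr)
      assume "\<not> (a \<in> P \<or> b \<in> P)"
      then obtain r w s v where *: "r \<in> R" "w \<in> P" "r \<otimes> a \<oplus> w \<in> S"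
        "s \<in> R" "v \<in> P" "s \<otimes> b \<oplus> v \<in> S" using meets ab by meson
      have "(r \<otimes> a \<oplus> w) \<otimes> (s \<otimes> b \<oplus> v) = (r \<otimes> s) \<otimes> (a \<otimes> b) \<oplus> (s \<otimes> b \<oplus> v) \<otimes> w \<oplus> (r \<otimes> a) \<otimes> v"
        using * ab D(1) by (simp add: l_distr r_distr m_ac a_ac)
      moreover have "\<dots> \<in> P" using * ab D by auto
      moreover have "(r \<otimes> a \<oplus> w) \<otimes> (s \<otimes> b \<oplus> v) \<in> S" using S(3) * by auto
      ultimately show False using P(3) by auto
    qed
  qed
  thus ?thesis using that P by auto
qed

text \<open>If \<open>span (Y \<union> H)\<close> is maximal proper among such spans, then \<open>span (Y \<union> H) + \<mm> v\<close> works for the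
  generator \<open>v\<close> that is still missing.\<close>

lemma nakayama:
  assumes U: "module R U" and Y: "submodule Y R U" "Y \<noteq> carrier U"
    and A: "finite A" "A \<subseteq> U" "module_span R U A = carrier U"
  obtains Z where "submodule Z R U" "Y \<subseteq> Z" "Z \<noteq> carrier U"
    "\<And>z v. z \<in> \<mm> ==> v \<in> U ==> z *\<^sub>U v \<in> Z"
proof -
  interpret U: rmod R U by (rule rmodI) fact
  note YD = U.submoduleD[OF Y(1)]
  define HH where "HH = {H. H \<subseteq> A \<and> module_span R U (Y \<union> H) \<noteq> carrier U}"
  have "module_span R U (Y \<union> {}) = Y" using U.span_least[OF Y(1), of Y] U.span_incl[of Y] by auto
  hence ne: "{} \<in> HH" using Y(2) by (auto simp: HH_def)
  have fin: "finite HH" using A(1) by (auto simp: HH_def)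
  obtain H where H: "H \<in> HH" "\<And>H'. H' \<in> HH ==> H \<subseteq> H' ==> H = H'" using finite_has_maximal[OF fin] ne by blast
  define W where "W = module_span R U (Y \<union> H)"
  have sub: "Y \<union> H \<subseteq> U" using YD(1) H(1) A(2) by (auto simp: HH_def)
  have W: "submodule W R U" unfolding W_def by (rule U.span_submodule[OF sub])
  note WD = U.submoduleD[OF W]
  have WX: "W \<noteq> carrier U" using H(1) by (auto simp: W_def HH_def)
  have "\<not> A \<subseteq> W" using U.span_least[OF W, of A] A(3) WX WD(1) by blast
  then obtain v where v: "v \<in> A" "v \<notin> W" by blast
  have vX: "v \<in> U" using v A by auto
  have "v \<notin> H" using v(2) U.span_incl[of "Y \<union> H"] by (auto simp: W_def)
  hence "insert v H \<notin> HH" using H(2)[of "insert v H"] by blast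
  hence "module_span R U (insert v (Y \<union> H)) = carrier U" using v(1) H(1) by (auto simp: HH_def)
  hence full: "\<exists>a\<in>R. \<exists>w\<in>W. x = a *\<^sub>U v +\<^sub>U w" if "x \<in> U" for x
    using U.span_insert[OF sub vX] that unfolding W_def by blast
  define Z where "Z = {x \<in> U. \<exists>a\<in>\<mm>. \<exists>w\<in>W. x = a *\<^sub>U v +\<^sub>U w}"
  have Z: "submodule Z R U"
  proof (rule U.submoduleI')
    show "Z \<subseteq> U" by (auto simp: Z_def)
    show "0\<^sub>U \<in> Z" using idealD(2)[OF m_ideal] WD(2) vX
      by (auto simp: Z_def intro!: bexI[of _ \<zero>] bexI[of _ "0\<^sub>U"])
    show "x +\<^sub>U y \<in> Z" if "x \<in> Z" "y \<in> Z" for x y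
    proof -
      from that obtain a w b u where *: "a \<in> \<mm>" "w \<in> W" "x = a *\<^sub>U v +\<^sub>U w"
        "b \<in> \<mm>" "u \<in> W" "y = b *\<^sub>U v +\<^sub>U u" "x \<in> U" "y \<in> U" by (auto simp: Z_def)
      have "x +\<^sub>U y = (a \<oplus> b) *\<^sub>U v +\<^sub>U (w +\<^sub>U u)"
        using * vX WD(1) m_closed' by (simp add: U.smult_l_distr U.M.a_ac)
      thus ?thesis using * idealD(3)[OF m_ideal] WD(3) unfolding Z_def by blast
    qed
    show "r *\<^sub>U x \<in> Z" if "r \<in> R" "x \<in> Z" for r x
    proof -
      from that obtain a w where *: "a \<in> \<mm>" "w \<in> W" "x = a *\<^sub>U v +\<^sub>U w" "x \<in> U" by (auto simp: Z_def)
      have "r *\<^sub>U x = (r \<otimes> a) *\<^sub>U v +\<^sub>U (r *\<^sub>U w)"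
        using * vX WD(1) m_closed' that by (simp add: U.smult_r_distr U.smult_assoc1)
      moreover have "r *\<^sub>U x \<in> U" using that *(4) by auto
      ultimately show ?thesis using * idealD(6)[OF m_ideal] WD(6) that(1) unfolding Z_def by blast
    qed
  qed
  have WZ: "W \<subseteq> Z"
  proof
    fix w assume "w \<in> W"
    thus "w \<in> Z" using idealD(2)[OF m_ideal] WD(1) vX by (auto simp: Z_def intro!: bexI[of _ \<zero>] bexI[of _ w])
  qed
  have "v \<notin> Z"
  proof
    assume "v \<in> Z"
    then obtain a w where *: "a \<in> \<mm>" "w \<in> W" "v = a *\<^sub>U v +\<^sub>U w" by (auto simp: Z_def)
    have aR: "a \<in> R" using *(1) m_closed' by auto
    have "(\<one> \<ominus> a) *\<^sub>U v = v -\<^sub>U a *\<^sub>U v" using aR vX by (simp add: U.smult_minus_l)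
    also have "\<dots> = (a *\<^sub>U v +\<^sub>U w) -\<^sub>U a *\<^sub>U v" using *(3) by simp
    also have "\<dots> = w" using aR vX WD(1)[OF *(2)] by (simp add: a_minus_def U.M.a_ac U.M.r_neg1 U.M.r_neg)
    finally have "(\<one> \<ominus> a) *\<^sub>U v \<in> W" using *(2) by simp
    hence "inv (\<one> \<ominus> a) *\<^sub>U ((\<one> \<ominus> a) *\<^sub>U v) \<in> W" using one_minus_unit[OF *(1)] WD(6) by auto
    moreover have "inv (\<one> \<ominus> a) *\<^sub>U ((\<one> \<ominus> a) *\<^sub>U v) = v"
      using one_minus_unit[OF *(1)] vX by (subst U.smult_assoc1[symmetric]) auto
    ultimately show False using v(2) by simp
  qed
  show ?thesis
  proof (rule that[OF Z])
    show "Y \<subseteq> Z" using U.span_incl[of "Y \<union> H"] WZ by (auto simp: W_def)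
    show "Z \<noteq> carrier U" using \<open>v \<notin> Z\<close> vX by auto
    show "z *\<^sub>U x \<in> Z" if zx: "z \<in> \<mm>" "x \<in> U" for z x
    proof -
      obtain a w where *: "a \<in> R" "w \<in> W" "x = a *\<^sub>U v +\<^sub>U w" using full zx(2) by blast
      have "z *\<^sub>U x = (z \<otimes> a) *\<^sub>U v +\<^sub>U (z *\<^sub>U w)"
        using * vX WD(1) m_closed' zx by (simp add: U.smult_r_distr U.smult_assoc1)
      moreover have "z *\<^sub>U x \<in> U" using zx m_closed' by auto
      moreover have "z \<otimes> a \<in> \<mm>" using * zx idealD(7)[OF m_ideal] by auto
      moreover have "z *\<^sub>U w \<in> W" using * zx m_closed' WD(6) by auto
      ultimately show ?thesis unfolding Z_def by blast
    qed
  qed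
qed

end

section \<open>Reduced local rings of dimension one\<close>

definition nonzerodivisor :: "('r, 'x) ring_scheme \<Rightarrow> 'r \<Rightarrow> bool" where
  "nonzerodivisor R x \<longleftrightarrow> x \<in> R \<and> (\<forall>a\<in>R. x \<otimes>\<^sub>R a = 0\<^sub>R \<longrightarrow> a = 0\<^sub>R)"

lemma (in cring) nonzerodivisor_cancel:
  assumes "nonzerodivisor R x" "a \<in> R" "b \<in> R" "x \<otimes> a = x \<otimes> b"
  shows "a = b"
proof -
  have x: "x \<in> R" using assms(1) by (auto simp: nonzerodivisor_def)
  have "x \<otimes> (a \<ominus> b) = \<zero>" using assms x by (simp add: a_minus_def r_distr r_minus r_neg)
  hence "a \<ominus> b = \<zero>" using assms by (auto simp: nonzerodivisor_def)
  thus ?thesis using assms by simp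
qed

lemma (in cring) nonzerodivisor_pow:
  assumes "nonzerodivisor R x"
  shows "nonzerodivisor R (x [^] (n::nat))"
proof (induction n)
  case 0
  show ?case by (auto simp: nonzerodivisor_def)
next
  case (Suc n)
  have x: "x \<in> R" using assms by (simp add: nonzerodivisor_def)
  have "a = \<zero>" if a: "a \<in> R" "x [^] Suc n \<otimes> a = \<zero>" for a
  proof -
    have "x [^] n \<otimes> (x \<otimes> a) = \<zero>" using a x by (simp add: m_assoc)
    hence "x \<otimes> a = \<zero>" using Suc a x by (simp add: nonzerodivisor_def)
    thus ?thesis using assms a by (simp add: nonzerodivisor_def)
  qed
  thus ?case using x by (simp add: nonzerodivisor_def)
qed

text \<open>\<open>no_chain\<close> makes every prime other than \<mm> minimal. In a reduced local
  ring \<mm> is itself a minimal prime only if it is zero, so \<open>m_nonzero\<close> excludes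
  dimension zero.\<close>

locale dim_one_ring = local_noetherian R \<mm>
  for R :: "('r, 'x) ring_scheme" (structure) and \<mm> :: "'r set" +
  assumes reduced: "\<lbrakk>a \<in> R; a \<otimes> a = \<zero>\<rbrakk> \<Longrightarrow> a = \<zero>"
    and no_chain: "\<lbrakk>primeideal p R; primeideal q R; p \<subset> q; q \<subset> \<mm>\<rbrakk> \<Longrightarrow> False"
    and m_nonzero: "\<mm> \<noteq> {\<zero>}"
begin

lemma reduced_pow: "a \<in> R ==> a [^] (n::nat) = \<zero> ==> a = \<zero>"
proof (induction n arbitrary: a rule: less_induct)
  case (less n)
  consider "n = 0" | "n = 1" | "n \<ge> 2" by linarith
  thus ?case
  proof cases
    case 1
    thus ?thesis using less by (metis nat_pow_0 r_null r_one)
  next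
    case 2
    thus ?thesis using less by simp
  next
    case 3
    \<comment> \<open>Half of n, rounded up: smaller than n because n \<ge> 2, and large enough that
      the square of a^k is a multiple of a^n.\<close>
    define k where "k = (n + 1) div 2"
    have "k < n" "2 * k \<ge> n" using 3 by (auto simp: k_def)
    have "(a [^] k) \<otimes> (a [^] k) = a [^] (k + k)" using less(2) by (simp add: nat_pow_mult)
    also have "\<dots> = a [^] n \<otimes> a [^] (k + k - n)" using less(2) \<open>2 * k \<ge> n\<close> by (simp add: nat_pow_mult)
    also have "\<dots> = \<zero>" using less by simp
    finally have "a [^] k = \<zero>" using reduced[of "a [^] k"] less(2) by simp
    thus ?thesis using less(1)[OF \<open>k < n\<close> less(2)] by simp
  qed
qed

text \<open>The hypothesis \<open>reg\<close> says that b is not zero in the localization at P. As R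
  is reduced, b is not nilpotent there either, so the products b^n t with t outside P form a
  multiplicative set without 0. A prime that avoids this set lies in P and omits b.\<close>

lemma no_zero_in_product_set:
  assumes P: "primeideal P R" and b: "b \<in> R"
    and reg: "\<And>t. t \<in> R ==> t \<notin> P ==> b \<otimes> t \<noteq> \<zero>"
  obtains p where "primeideal p R" "p \<subseteq> P" "b \<notin> p"
proof -
  note PD = primeidealD[OF P]
  define S where "S = {b [^] (n::nat) \<otimes> t |n t. t \<in> R \<and> t \<notin> P}"
  have one: "\<one> \<in> S" using PD(2) by (auto simp: S_def intro!: exI[of _ "0::nat"] exI[of _ \<one>])
  have "{\<zero>} \<inter> S = {}"
  proof -
    have "b [^] (n::nat) \<otimes> t \<noteq> \<zero>" if "t \<in> R" "t \<notin> P" for n t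
    proof
      assume *: "b [^] n \<otimes> t = \<zero>"
      have "(b \<otimes> t) [^] Suc n = (b [^] n \<otimes> t) \<otimes> (b \<otimes> t [^] n)" using b that by (simp add: nat_pow_distrib m_ac)
      hence "(b \<otimes> t) [^] Suc n = \<zero>" using * b that by simp
      hence "b \<otimes> t = \<zero>" using reduced_pow[of "b \<otimes> t" "Suc n"] b that by simp
      thus False using reg that by auto
    qed
    hence "\<zero> \<notin> S" unfolding S_def by fastforce
    thus ?thesis by simp
  qed
  moreover have "x \<otimes> y \<in> S" if "x \<in> S" "y \<in> S" for x y
  proof -
    from that obtain n t k u where *: "x = b [^] (n::nat) \<otimes> t" "t \<in> R" "t \<notin> P"
      "y = b [^] (k::nat) \<otimes> u" "u \<in> R" "u \<notin> P" by (auto simp: S_def)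
    have "x \<otimes> y = b [^] (n + k) \<otimes> (t \<otimes> u)" using * b by (simp add: nat_pow_mult[symmetric] m_ac)
    moreover have "t \<otimes> u \<in> R" "t \<otimes> u \<notin> P" using * PD(3) by auto
    ultimately show ?thesis unfolding S_def by blast
  qed
  moreover have "S \<subseteq> R" using b by (auto simp: S_def)
  ultimately obtain p where p: "primeideal p R" "p \<inter> S = {}"
    using prime_avoiding[OF zeroideal, of S] one by metis
  note pD = primeidealD[OF p(1)]
  have "p \<subseteq> P"
  proof
    fix a assume "a \<in> p"
    show "a \<in> P"
    proof (rule ccontr)
      assume "a \<notin> P"
      hence "a \<in> S" using idealD(1)[OF pD(1) \<open>a \<in> p\<close>]
        by (auto simp: S_def intro!: exI[of _ "0::nat"] exI[of _ a])
      thus False using p(2) \<open>a \<in> p\<close> by auto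
    qed
  qed
  moreover have "b \<in> S" using PD(2) b by (auto simp: S_def intro!: exI[of _ "1::nat"] exI[of _ \<one>])
  hence "b \<notin> p" using p(2) by auto
  ultimately show ?thesis using that p(1) by auto
qed

text \<open>A nonzerodivisor stays nonzero in every localization, so
  \<open>no_zero_in_product_set\<close> finds a prime inside P that omits x. If P were not \<mm>,
  this would give a chain of three primes.\<close>

lemma prime_containing_nonzerodivisor:
  assumes P: "primeideal P R" and x: "nonzerodivisor R x" "x \<in> P"
  shows "P = \<mm>"
proof (rule ccontr)
  assume "P \<noteq> \<mm>"
  note PD = primeidealD[OF P]
  have xR: "x \<in> R" using x(1) by (auto simp: nonzerodivisor_def)
  obtain p where "primeideal p R" "p \<subseteq> P" "x \<notin> p"
    using no_zero_in_product_set[OF P xR] x(1) idealD(2)[OF PD(1)] by (metis nonzerodivisor_def)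
  thus False using no_chain[of p P] P PD(4) x(2) \<open>P \<noteq> \<mm>\<close> by blast
qed

text \<open>The localization at a prime P \<noteq> \<mm> is reduced with a single prime, hence a
  field: an element of P becomes zero there, that is, something outside P kills it.\<close>

lemma minimal_prime_annihilator:
  assumes P: "primeideal P R" "P \<noteq> \<mm>" and b: "b \<in> P"
  obtains a where "a \<in> R" "a \<notin> P" "a \<otimes> b = \<zero>"
proof (rule ccontr)
  assume no: "\<not> thesis"
  note outer = that
  note PD = primeidealD[OF P(1)]
  have bR: "b \<in> R" using idealD(1)[OF PD(1) b] .
  have "b \<otimes> t \<noteq> \<zero>" if t: "t \<in> R" "t \<notin> P" for t
  proof
    assume "b \<otimes> t = \<zero>"
    hence "t \<otimes> b = \<zero>" using t bR by (simp add: m_comm)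
    with no outer[OF t] show False by blast
  qed
  then obtain p where "primeideal p R" "p \<subseteq> P" "b \<notin> p" using no_zero_in_product_set[OF P(1) bR] by blast
  thus False using no_chain[of p P] P PD(4) b by blast
qed

text \<open>If no power of y lay in J, some prime above J would avoid all of them.\<close>

lemma pow_in_if_prime:
  assumes J: "ideal J R" and y: "y \<in> R"
    and P: "\<And>P. primeideal P R ==> J \<subseteq> P ==> y \<in> P"
  shows "\<exists>n::nat. y [^] n \<in> J"
proof (rule ccontr)
  assume no: "\<nexists>n::nat. y [^] n \<in> J"
  define S where "S = range (\<lambda>n::nat. y [^] n)"
  have "S \<subseteq> R" "J \<inter> S = {}" using y no by (auto simp: S_def)
  moreover have "\<one> \<in> S" using rangeI[of "\<lambda>n::nat. y [^] n" 0] by (simp add: S_def)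
  moreover have "a \<otimes> b \<in> S" if "a \<in> S" "b \<in> S" for a b using that y by (auto simp: S_def nat_pow_mult)
  ultimately obtain P where "primeideal P R" "J \<subseteq> P" "P \<inter> S = {}" using prime_avoiding[OF J, of S] by metis
  moreover have "y \<in> S" using y rangeI[of "\<lambda>n::nat. y [^] n" 1] by (simp add: S_def)
  ultimately show False using P by blast
qed

lemma pow_in_if_nonzerodivisor:
  assumes "ideal J R" "nonzerodivisor R x" "x \<in> J" "y \<in> \<mm>"
  shows "\<exists>n::nat. y [^] n \<in> J"
  using assms prime_containing_nonzerodivisor by (intro pow_in_if_prime) (auto dest: m_closed')

text \<open>Let x in \<mm> have a maximal double annihilator \<open>bi x\<close>. If x b = 0 for
  some nonzero b in \<mm>, then reducedness shows that whatever kills x + b kills both x and b.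
  Hence \<open>bi (x \<oplus> b)\<close> contains \<open>bi x\<close> and also b, and by maximality
  b lies in \<open>bi x\<close>. But b kills x, so b kills itself, contrary to reducedness.\<close>

lemma exists_nonzerodivisor: "\<exists>x\<in>\<mm>. nonzerodivisor R x"
proof -
  define ann where "ann x = {a \<in> R. x \<otimes> a = \<zero>}" for x
  define bi where "bi x = {b \<in> R. \<forall>a\<in>ann x. b \<otimes> a = \<zero>}" for x
  have bi: "ideal (bi x) R" if "x \<in> R" for x by (rule cring_idealI) (auto simp: bi_def ann_def l_distr m_assoc)
  obtain x where x: "x \<in> \<mm>" "\<And>y. y \<in> \<mm> ==> bi x \<subseteq> bi y ==> bi y = bi x"
  proof -
    have "bi ` \<mm> \<noteq> {}" using idealD(2)[OF m_ideal] by auto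
    moreover have "\<forall>J\<in>bi ` \<mm>. ideal J R" using bi m_closed' by auto
    ultimately have "\<exists>J\<in>bi ` \<mm>. \<forall>J'\<in>bi ` \<mm>. J \<subseteq> J' \<longrightarrow> J' = J" by (rule exists_maximal_ideal_in)
    then obtain x where "x \<in> \<mm>" "\<forall>J'\<in>bi ` \<mm>. bi x \<subseteq> J' \<longrightarrow> J' = bi x" by (elim bexE imageE) simp
    thus ?thesis by (intro that[of x]) simp_all
  qed
  note xR = m_closed'[OF x(1)]
  have False if a: "a \<in> R" "x \<otimes> a = \<zero>" "a \<noteq> \<zero>" for a
  proof -
    \<comment> \<open>A killer of x is a nonunit unless x = 0; in that case any nonzero element of
      \<mm> will do.\<close>
    obtain b where b: "b \<in> \<mm>" "b \<noteq> \<zero>" "x \<otimes> b = \<zero>"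
    proof (cases "x = \<zero>")
      case True
      obtain b where "b \<in> \<mm>" "b \<noteq> \<zero>" using m_nonzero idealD(2)[OF m_ideal] by blast
      thus ?thesis using that True m_closed' by auto
    next
      case False
      have "a \<in> \<mm>"
      proof (rule ccontr)
        assume "a \<notin> \<mm>"
        hence u: "a \<in> Units R" using unit_if a by auto
        have "x = x \<otimes> a \<otimes> inv a" using u xR a(1) by (simp add: m_assoc Units_r_inv)
        also have "\<dots> = \<zero>" using a(2) u by simp
        finally show False using False by simp
      qed
      thus ?thesis using that a by auto
    qed
    note bR = m_closed'[OF b(1)]
    have ann_sum: "x \<otimes> c = \<zero> \<and> b \<otimes> c = \<zero>" if c: "c \<in> ann (x \<oplus> b)" for c
    proof -
      have cR: "c \<in> R" and e: "x \<otimes> c \<oplus> b \<otimes> c = \<zero>" using c xR bR by (auto simp: ann_def l_distr)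
      have "(x \<otimes> c) \<otimes> (x \<otimes> c) = x \<otimes> c \<otimes> (x \<otimes> c \<oplus> b \<otimes> c) \<ominus> (x \<otimes> b) \<otimes> (c \<otimes> c)"
        using cR xR bR by (simp add: r_distr a_minus_def m_ac a_assoc r_neg)
      also have "\<dots> = \<zero>" using e b(3) cR xR by (simp add: a_minus_def)
      finally have "x \<otimes> c = \<zero>" using reduced[of "x \<otimes> c"] cR xR by simp
      thus ?thesis using e cR bR by auto
    qed
    have "x \<oplus> b \<in> \<mm>" using x(1) b(1) idealD(3)[OF m_ideal] by auto
    moreover have "bi x \<subseteq> bi (x \<oplus> b)" using ann_sum by (auto simp: bi_def ann_def)
    ultimately have "bi (x \<oplus> b) = bi x" using x(2) by auto
    moreover have "b \<in> bi (x \<oplus> b)" using ann_sum bR by (auto simp: bi_def)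
    ultimately have "b \<in> bi x" by simp
    hence "b \<otimes> b = \<zero>" using b(3) bR by (auto simp: bi_def ann_def)
    thus False using reduced[of b] bR b(2) by simp
  qed
  thus ?thesis using x(1) xR by (auto simp: nonzerodivisor_def)
qed

text \<open>An ideal maximal among the colon ideals (Y : v) with v outside Y is prime. It contains
  x, so it equals \<mm>, and u represents a nonzero socle element of U / Y.\<close>

lemma socle:
  fixes U :: "('r, 'm) module"
  assumes U: "module R U" and Y: "submodule Y R U" "Y \<noteq> carrier U"
    and x: "nonzerodivisor R x" "\<And>v. v \<in> U ==> x *\<^sub>U v \<in> Y"
  obtains u where "u \<in> U" "u \<notin> Y" "\<And>z. z \<in> \<mm> ==> z *\<^sub>U u \<in> Y"
proof -
  interpret U: rmod R U by (rule rmodI) fact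
  note YD = U.submoduleD[OF Y(1)]
  have xR: "x \<in> R" using x(1) by (auto simp: nonzerodivisor_def)
  define col where "col v = {a \<in> R. a *\<^sub>U v \<in> Y}" for v
  have col: "ideal (col v) R" if "v \<in> U" for v
    by (rule cring_idealI) (use that YD in \<open>auto simp: col_def U.smult_l_distr U.smult_assoc1\<close>)
  define SS where "SS = col ` (carrier U - Y)"
  have "SS \<noteq> {}" using Y(2) YD(1) by (auto simp: SS_def)
  moreover have "\<forall>J\<in>SS. ideal J R" using col by (auto simp: SS_def)
  ultimately have "\<exists>J\<in>SS. \<forall>J'\<in>SS. J \<subseteq> J' \<longrightarrow> J' = J" by (rule exists_maximal_ideal_in)
  then obtain J where J: "J \<in> SS" "\<forall>J'\<in>SS. J \<subseteq> J' \<longrightarrow> J' = J" by (elim bexE)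
  then obtain u where u: "u \<in> U" "u \<notin> Y" "J = col u" by (auto simp: SS_def)
  have "primeideal (col u) R"
  proof (rule primeidealI[OF col[OF u(1)] is_cring])
    have "\<one> \<notin> col u" using u by (auto simp: col_def)
    thus "carrier R \<noteq> col u" by auto
    show "a \<in> col u \<or> b \<in> col u" if ab: "a \<in> R" "b \<in> R" "a \<otimes> b \<in> col u" for a b
    proof (rule disjCI)
      assume "b \<notin> col u"
      hence "col (b *\<^sub>U u) \<in> SS" using ab u by (auto simp: SS_def col_def)
      moreover have "col u \<subseteq> col (b *\<^sub>U u)"
      proof
        fix r assume r: "r \<in> col u"
        hence "r *\<^sub>U (b *\<^sub>U u) = b *\<^sub>U (r *\<^sub>U u)"
          using ab u by (auto simp: col_def U.smult_assoc1[symmetric] m_comm)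
        thus "r \<in> col (b *\<^sub>U u)" using r ab YD(6) by (auto simp: col_def)
      qed
      ultimately have "col (b *\<^sub>U u) = col u" using J(2) u(3) by auto
      moreover have "a \<in> col (b *\<^sub>U u)" using ab u by (auto simp: col_def U.smult_assoc1)
      ultimately show "a \<in> col u" by simp
    qed
  qed
  moreover have "x \<in> col u" using xR x(2) u(1) by (auto simp: col_def)
  ultimately have "col u = \<mm>" using prime_containing_nonzerodivisor x(1) by blast
  thus ?thesis using that u by (auto simp: col_def)
qed

end

section \<open>The ring as a module over itself; finite generation\<close>

lemma self_module_simps [simp]:
  "carrier (self_module R) = carrier R" "\<zero>\<^bsub>self_module R\<^esub> = 0\<^sub>R" "add (self_module R) = add R"
  "smult (self_module R) = monoid.mult R" by (simp_all add: self_module_def)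

lemma (in cring) self_module_module: "module R (self_module R)"
proof (rule moduleI)
  show "abelian_group (self_module R)"
    by (rule abelian_groupI) (auto simp: a_assoc intro: a_comm l_neg bexI[of _ "\<ominus> _"])
qed (auto simp: l_distr r_distr m_assoc is_cring)

lemma (in cring) self_module_neg: "x \<in> R ==> \<ominus>\<^bsub>self_module R\<^esub> x = \<ominus> x"
proof -
  interpret S: rmod R "self_module R" by (rule rmodI, rule self_module_module)
  assume x: "x \<in> R"
  show ?thesis using S.M.minus_equality[of "\<ominus> x" x] x by (simp add: l_neg)
qed

lemma (in cring) self_submodule_iff: "submodule J R (self_module R) \<longleftrightarrow> ideal J R"
proof -
  interpret S: rmod R "self_module R" by (rule rmodI, rule self_module_module)
  show ?thesis
  proof
    assume "submodule J R (self_module R)"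
    note D = S.submoduleD[OF this]
    show "ideal J R" by (rule cring_idealI) (use D in auto)
  next
    assume "ideal J R"
    note D = idealD[OF this]
    show "submodule J R (self_module R)" by (rule S.submoduleI') (use D in auto)
  qed
qed

context dim_one_ring
begin

lemma ideal_socle:
  assumes J: "ideal J R" "J \<noteq> carrier R" and x: "nonzerodivisor R x" "x \<in> J"
  obtains u where "u \<in> R" "u \<notin> J" "\<And>z. z \<in> \<mm> ==> z \<otimes> u \<in> J"
  using socle[OF self_module_module, of J x] J x self_submodule_iff idealD(7)[OF J(1)] by auto

end

lemma fin_gen_moduleD:
  assumes "fin_gen_module R M"
  obtains A where "module R M" "finite A" "A \<subseteq> M" "module_span R M A = carrier M"
  using assms by (auto simp: fin_gen_module_def)

lemma moduleD_fin_gen: "fin_gen_module R M ==> module R M" by (simp add: fin_gen_module_def)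

context rmod
begin

lemma sub_carrier_neg:
  assumes "submodule N R M" "x \<in> N"
  shows "\<ominus>\<^bsub>M\<lparr>carrier := N\<rparr>\<^esub> x = -\<^sub>M x"
proof -
  interpret N: rmod R "M\<lparr>carrier := N\<rparr>" by (rule rmodI, rule submodule_module, fact)
  show ?thesis using N.M.minus_equality[of "-\<^sub>M x" x] assms submoduleD[OF assms(1)] by (simp add: M.l_neg)
qed

lemma submodule_of_submodule_iff:
  assumes "submodule N R M"
  shows "submodule L R (M\<lparr>carrier := N\<rparr>) \<longleftrightarrow> submodule L R M \<and> L \<subseteq> N"
proof -
  interpret N: rmod R "M\<lparr>carrier := N\<rparr>" by (rule rmodI, rule submodule_module, fact)
  note D = submoduleD[OF assms]
  show ?thesis
  proof
    assume L: "submodule L R (M\<lparr>carrier := N\<rparr>)"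
    note LD = N.submoduleD[OF L]
    show "submodule L R M \<and> L \<subseteq> N"
    proof
      show "L \<subseteq> N" using LD(1) by auto
      show "submodule L R M" by (rule submoduleI') (use LD D in auto)
    qed
  next
    assume L: "submodule L R M \<and> L \<subseteq> N"
    note LD = submoduleD[OF conjunct1[OF L]]
    show "submodule L R (M\<lparr>carrier := N\<rparr>)" by (rule N.submoduleI') (use L LD in auto)
  qed
qed

lemma span_in_submodule:
  assumes N: "submodule N R M" and "B \<subseteq> N"
  shows "module_span R (M\<lparr>carrier := N\<rparr>) B = module_span R M B"
proof
  interpret N: rmod R "M\<lparr>carrier := N\<rparr>" by (rule rmodI, rule submodule_module, fact)
  have "submodule (module_span R M B) R (M\<lparr>carrier := N\<rparr>)"
    using span_submodule[of B] span_least[OF N] assms submoduleD(1)[OF N]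
    by (auto simp: submodule_of_submodule_iff[OF N])
  thus "module_span R (M\<lparr>carrier := N\<rparr>) B \<subseteq> module_span R M B" using N.span_least span_incl by metis
  have "submodule (module_span R (M\<lparr>carrier := N\<rparr>) B) R M"
    using N.span_submodule[of B] assms by (auto simp: submodule_of_submodule_iff[OF N])
  thus "module_span R M B \<subseteq> module_span R (M\<lparr>carrier := N\<rparr>) B" using span_least N.span_incl by metis
qed

lemma fg_submodule:
  assumes "noetherian_ring R" "fin_gen_module R M" "submodule N R M"
  shows "\<exists>B. finite B \<and> B \<subseteq> N \<and> module_span R M B = N"
proof -
  obtain A where A: "finite A" "A \<subseteq> M" "module_span R M A = carrier M" using assms(2) by (rule fin_gen_moduleD)
  show ?thesis
    by (rule fg_submodule_of_span[OF assms(1) A(1,2) assms(3)]) (use A(3) submoduleD(1)[OF assms(3)] in auto)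
qed

lemma fin_gen_submodule:
  assumes "noetherian_ring R" "fin_gen_module R M" "submodule N R M"
  shows "fin_gen_module R (M\<lparr>carrier := N\<rparr>)"
proof -
  obtain B where B: "finite B" "B \<subseteq> N" "module_span R M B = N" using fg_submodule[OF assms] by blast
  show ?thesis unfolding fin_gen_module_def
    using submodule_module[OF assms(3)] B span_in_submodule[OF assms(3) B(2)] by auto
qed

text \<open>The maps q i embed H jointly into a finite power of N. Induction on their number stands
  in for that power: the kernel of the last map on H is covered by the induction hypothesis, its
  image by Noetherianity of N. Modules of homomorphisms are treated in this way, by evaluation at
  generators.\<close>

lemma fg_of_embedding_family:
  assumes noeth: "noetherian_ring R" and N: "fin_gen_module R N"
    and q: "\<And>i::nat. i < k ==> lin R M N (q i)"
    and H: "submodule H R M" "\<And>v. v \<in> H ==> (\<And>i. i < k ==> q i v = 0\<^sub>N) ==> v = 0\<^sub>M"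
  shows "\<exists>B. finite B \<and> B \<subseteq> H \<and> module_span R M B = H" using q H
proof (induction k arbitrary: H)
  case 0
  have "v = 0\<^sub>M" if "v \<in> H" for v by (rule 0(3)[OF that]) simp
  hence "H = {0\<^sub>M}" using submoduleD(2)[OF 0(2)] by blast
  thus ?case using span_empty by (intro exI[of _ "{}"]) auto
next
  case (Suc k)
  have Nm: "module R N" by (rule moduleD_fin_gen[OF N])
  interpret N: rmod R N by (rule rmodI, rule Nm)
  note H = Suc.prems(2) and HD = submoduleD[OF Suc.prems(2)]
  have qk: "lin R M N (q k)" using Suc.prems(1) by auto
  define H' where "H' = H \<inter> {x \<in> M. q k x = 0\<^sub>N}"
  have H': "submodule H' R M" unfolding H'_def by (rule submodule_inter[OF H kernel_submodule[OF Nm qk]])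
  have "\<exists>B. finite B \<and> B \<subseteq> H' \<and> module_span R M B = H'"
  proof (rule Suc.IH[OF _ H'])
    show "lin R M N (q i)" if "i < k" for i using Suc.prems(1) that by auto
    show "v = 0\<^sub>M" if "v \<in> H'" "\<And>i. i < k ==> q i v = 0\<^sub>N" for v
    proof (rule Suc.prems(3))
      show "v \<in> H" using that(1) by (simp add: H'_def)
      show "q i v = 0\<^sub>N" if "i < Suc k" for i
        using \<open>v \<in> H'\<close> \<open>\<And>i. i < k ==> q i v = 0\<^sub>N\<close>[of i] that by (cases "i = k") (simp_all add: H'_def)
    qed
  qed
  then obtain B' where B': "finite B'" "B' \<subseteq> H'" "module_span R M B' = H'" by auto
  obtain C where C: "finite C" "C \<subseteq> q k ` H" "module_span R N C = q k ` H"
    using N.fg_submodule[OF noeth N image_submodule[OF Nm qk H]] by auto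
  obtain B0 where B0: "finite B0" "B0 \<subseteq> H" "C = q k ` B0" using C(1,2) by (meson finite_subset_image)
  have B0M: "B0 \<subseteq> M" using B0(2) HD(1) by auto
  define B where "B = B0 \<union> B'"
  have BH: "B \<subseteq> H" using B0 B' by (auto simp: B_def H'_def)
  define T where "T = module_span R M B"
  have T: "submodule T R M" unfolding T_def by (rule span_submodule) (use BH HD(1) in auto)
  note TD = submoduleD[OF T]
  have TH: "T \<subseteq> H" unfolding T_def by (rule span_least[OF H BH])
  have "H' \<subseteq> T" unfolding T_def B'(3)[symmetric] B_def by (rule span_mono) auto
  have "module_span R M B0 \<subseteq> T" unfolding T_def B_def by (rule span_mono) auto
  have "H \<subseteq> T"
  proof
    fix v assume v: "v \<in> H"
    have "q k v \<in> module_span R N (q k ` B0)" using C(3) B0(3) v by auto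
    also have "\<dots> = q k ` module_span R M B0" by (rule span_image[OF Nm qk B0M])
    finally obtain w where w: "w \<in> module_span R M B0" "q k v = q k w" by auto
    have wT: "w \<in> T" using w(1) \<open>module_span R M B0 \<subseteq> T\<close> by auto
    have "q k (v -\<^sub>M w) = 0\<^sub>N"
      using lin_minus[OF is_mod Nm qk, of v w] w(2) HD(1)[OF v] TD(1)[OF wT] linD(1)[OF qk]
        N.minus_eq_iff by simp
    moreover have "v -\<^sub>M w \<in> H" using v wT TH HD(5) by auto
    ultimately have "v -\<^sub>M w \<in> T" using \<open>H' \<subseteq> T\<close> HD(1) by (auto simp: H'_def)
    hence "(v -\<^sub>M w) +\<^sub>M w \<in> T" using TD(3) wT by auto
    thus "v \<in> T" using HD(1)[OF v] TD(1)[OF wT] by (simp add: a_minus_def M.a_assoc M.l_neg)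
  qed
  hence "T = H" using TH by auto
  thus ?case using BH B0(1) B'(1) by (intro exI[of _ B]) (auto simp: T_def B_def)
qed

lemma fin_gen_if_embedding_family:
  assumes "noetherian_ring R" "fin_gen_module R N" "\<And>i. i < k ==> lin R M N (q i)"
    and "\<And>v. v \<in> M ==> (\<And>i. i < (k::nat) ==> q i v = 0\<^sub>N) ==> v = 0\<^sub>M"
  shows "fin_gen_module R M"
proof -
  have "\<exists>B. finite B \<and> B \<subseteq> M \<and> module_span R M B = carrier M"
    by (rule fg_of_embedding_family[OF assms(1,2), of k q]) (use assms carrier_is_submodule in auto)
  thus ?thesis unfolding fin_gen_module_def using is_mod by auto
qed

end

section \<open>Free modules\<close>

text \<open>Placed on the type nat => 'r of the test modules in the definitions. Entries from index
  b on are 0, so that equal vectors are equal functions.\<close>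

definition free_mod :: "('r, 'x) ring_scheme \<Rightarrow> nat \<Rightarrow> ('r, nat \<Rightarrow> 'r) module" where
  "free_mod R b = \<lparr>carrier = {f. (\<forall>i<b. f i \<in> R) \<and> (\<forall>i\<ge>b. f i = 0\<^sub>R)},
    monoid.mult = undefined, one = undefined, ring.zero = (\<lambda>_. 0\<^sub>R),
    add = (\<lambda>f g i. f i +\<^sub>R g i), smult = (\<lambda>a f i. a \<otimes>\<^sub>R f i)\<rparr>"

definition unit_vec :: "('r, 'x) ring_scheme \<Rightarrow> nat \<Rightarrow> nat \<Rightarrow> 'r" where
  "unit_vec R i = (\<lambda>j. if j = i then \<one>\<^sub>R else 0\<^sub>R)"

primrec comb :: "('r, 'm) module \<Rightarrow> (nat \<Rightarrow> 'm) \<Rightarrow> nat \<Rightarrow> (nat \<Rightarrow> 'r) \<Rightarrow> 'm" where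
  "comb M y 0 f = 0\<^sub>M"
| "comb M y (Suc n) f = comb M y n f +\<^sub>M f n *\<^sub>M y n"

lemma free_mod_simps [simp]:
  "\<zero>\<^bsub>free_mod R b\<^esub> = (\<lambda>_. 0\<^sub>R)" "f \<oplus>\<^bsub>free_mod R b\<^esub> g = (\<lambda>i. f i +\<^sub>R g i)"
  "a \<odot>\<^bsub>free_mod R b\<^esub> f = (\<lambda>i. a \<otimes>\<^sub>R f i)" by (simp_all add: free_mod_def)

lemma free_mod_carrier:
  "f \<in> free_mod R b \<longleftrightarrow> (\<forall>i<b. f i \<in> R) \<and> (\<forall>i\<ge>b. f i = 0\<^sub>R)" by (simp add: free_mod_def)

context cring
begin

lemma free_mod_closed: "f \<in> free_mod R b ==> f i \<in> R" by (cases "i < b") (auto simp: free_mod_carrier)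

lemma free_mod_module: "module R (free_mod R b)"
proof (rule moduleI[OF is_cring])
  show "abelian_group (free_mod R b)"
  proof (rule abelian_groupI)
    fix f assume f: "f \<in> free_mod R b"
    show "\<exists>g\<in>(free_mod R b). g \<oplus>\<^bsub>free_mod R b\<^esub> f = \<zero>\<^bsub>free_mod R b\<^esub>" using free_mod_closed[OF f] f
      by (intro bexI[of _ "\<lambda>i. \<ominus> f i"]) (auto simp: free_mod_carrier l_neg)
  qed (auto simp: free_mod_carrier fun_eq_iff free_mod_closed a_ac)
qed (auto simp: fun_eq_iff free_mod_closed l_distr r_distr m_assoc, auto simp: free_mod_carrier)

lemma unit_vec_closed: "i < b ==> unit_vec R i \<in> free_mod R b" by (auto simp: free_mod_carrier unit_vec_def)

lemma free_mod_span: "module_span R (free_mod R b) (unit_vec R ` {..<b}) = carrier (free_mod R b)"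
proof
  interpret F: rmod R "free_mod R b" by (rule rmodI, rule free_mod_module)
  have U: "unit_vec R ` {..<b} \<subseteq> free_mod R b" using unit_vec_closed by auto
  define S where "S = module_span R (free_mod R b) (unit_vec R ` {..<b})"
  have S: "submodule S R (free_mod R b)" unfolding S_def by (rule F.span_submodule[OF U])
  note SD = F.submoduleD[OF S]
  show "module_span R (free_mod R b) (unit_vec R ` {..<b}) \<subseteq> free_mod R b" using SD(1) by (auto simp: S_def)
  have *: "f \<in> S" if "n \<le> b" "f \<in> free_mod R b" "\<And>i. i \<ge> n ==> f i = \<zero>" for f n using that
  proof (induction n arbitrary: f)
    case 0
    hence "f = \<zero>\<^bsub>free_mod R b\<^esub>" by auto
    thus ?case using SD(2) by metis
  next
    case (Suc n)
    note c = free_mod_closed[OF Suc.prems(2)]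
    have "f(n := \<zero>) \<in> S" by (rule Suc.IH) (use Suc.prems in \<open>auto simp: free_mod_carrier\<close>)
    moreover have "unit_vec R n \<in> S"
      using F.span_incl[of "unit_vec R ` {..<b}"] Suc.prems(1) by (auto simp: S_def)
    hence "f n \<odot>\<^bsub>free_mod R b\<^esub> unit_vec R n \<in> S" using SD(6) c by blast
    ultimately have "f(n := \<zero>) \<oplus>\<^bsub>free_mod R b\<^esub> f n \<odot>\<^bsub>free_mod R b\<^esub> unit_vec R n \<in> S" using SD(3) by blast
    moreover have "f(n := \<zero>) \<oplus>\<^bsub>free_mod R b\<^esub> f n \<odot>\<^bsub>free_mod R b\<^esub> unit_vec R n = f"
      using c by (auto simp: fun_eq_iff unit_vec_def)
    ultimately show ?case by simp
  qed
  show "carrier (free_mod R b) \<subseteq> module_span R (free_mod R b) (unit_vec R ` {..<b})"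
    using *[of b] by (auto simp: free_mod_carrier S_def)
qed

lemma free_mod_fin_gen: "fin_gen_module R (free_mod R b)" unfolding fin_gen_module_def
  using free_mod_module free_mod_span unit_vec_closed by (intro conjI exI[of _ "unit_vec R ` {..<b}"]) auto

end

context rmod
begin

lemma comb_closed:
  assumes "\<And>i. i < b ==> y i \<in> M" "\<And>i. i < b ==> f i \<in> R"
  shows "comb M y b f \<in> M" using assms by (induction b) auto

lemma comb_lin:
  assumes "\<And>i. i < b ==> y i \<in> M"
  shows "lin R (free_mod R b) M (comb M y b)"
proof (rule linI)
  show "comb M y b f \<in> M" if "f \<in> free_mod R b" for f
    using comb_closed[of b y f] R.free_mod_closed[OF that] assms by auto
  show "comb M y b (f \<oplus>\<^bsub>free_mod R b\<^esub> g) = comb M y b f +\<^sub>M comb M y b g"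
    if "f \<in> free_mod R b" "g \<in> free_mod R b" for f g
  proof -
    note c = R.free_mod_closed[OF that(1)] R.free_mod_closed[OF that(2)]
    have "comb M y n (\<lambda>i. f i \<oplus> g i) = comb M y n f +\<^sub>M comb M y n g" if "n \<le> b" for n using that
    proof (induction n)
      case (Suc n)
      have "comb M y n f \<in> M" "comb M y n g \<in> M" "y n \<in> M" using comb_closed assms c Suc.prems by auto
      thus ?case using Suc c by (simp add: smult_l_distr M.a_ac)
    qed auto
    thus ?thesis by simp
  qed
  show "comb M y b (a \<odot>\<^bsub>free_mod R b\<^esub> f) = a *\<^sub>M comb M y b f"
    if "a \<in> R" "f \<in> free_mod R b" for a f
  proof -
    note c = R.free_mod_closed[OF that(2)]
    have "comb M y n (\<lambda>i. a \<otimes> f i) = a *\<^sub>M comb M y n f" if "n \<le> b" for n using that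
    proof (induction n)
      case 0
      show ?case using \<open>a \<in> R\<close> by simp
    next
      case (Suc n)
      have "comb M y n f \<in> M" "y n \<in> M" using comb_closed assms c Suc.prems by auto
      thus ?case using Suc c \<open>a \<in> R\<close> by (simp add: smult_r_distr smult_assoc1)
    qed
    thus ?thesis by simp
  qed
qed

lemma comb_unit_vec:
  assumes "\<And>i. i < b ==> y i \<in> M" "j < b"
  shows "comb M y b (unit_vec R j) = y j"
proof -
  have "comb M y n (unit_vec R j) = (if j < n then y j else 0\<^sub>M)" if "n \<le> b" for n
    using that assms by (induction n) (auto simp: unit_vec_def less_Suc_eq)
  from this[of b] show ?thesis using assms by simp
qed

lemma comb_image:
  assumes "\<And>i. i < b ==> y i \<in> M"
  shows "comb M y b ` carrier (free_mod R b) = module_span R M (y ` {..<b})"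
proof -
  interpret F: rmod R "free_mod R b" by (rule rmodI, rule R.free_mod_module)
  have "module_span R M (comb M y b ` unit_vec R ` {..<b}) = comb M y b ` carrier (free_mod R b)"
  proof -
    have "unit_vec R ` {..<b} \<subseteq> free_mod R b" using R.unit_vec_closed by auto
    from F.span_image[OF is_mod comb_lin[of b y] this] show ?thesis
      unfolding R.free_mod_span using assms by blast
  qed
  moreover have "comb M y b ` unit_vec R ` {..<b} = y ` {..<b}"
    using comb_unit_vec[of b y] assms by (force simp: image_iff)
  ultimately show ?thesis by simp
qed

lemma lin_eq_on_span:
  assumes "module R N" "lin R M N f" "lin R M N g" "A \<subseteq> M" "\<And>a. a \<in> A ==> f a = g a"
    and "x \<in> module_span R M A"
  shows "f x = g x"
proof -
  interpret N: rmod R N by (rule rmodI) fact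
  have "submodule {x \<in> M. f x = g x} R M"
    by (rule submoduleI') (use assms(1-3) in \<open>auto simp: linD lin_zero[OF is_mod]\<close>)
  from span_least[OF this, of A] show ?thesis using assms by auto
qed

lemma lin_free_eq:
  assumes "lin R (free_mod R b) M f" "lin R (free_mod R b) M g"
    "\<And>i. i < b ==> f (unit_vec R i) = g (unit_vec R i)" "x \<in> free_mod R b"
  shows "f x = g x"
proof -
  interpret F: rmod R "free_mod R b" by (rule rmodI, rule R.free_mod_module)
  show ?thesis by (rule F.lin_eq_on_span[OF is_mod assms(1,2), of "unit_vec R ` {..<b}"])
      (use assms R.free_mod_span R.unit_vec_closed in auto)
qed

lemma free_lift:
  assumes N: "module R N" and g: "lin R M N g" "g ` carrier M = carrier N"
    and f: "lin R (free_mod R b) N f"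
  shows "\<exists>h. lin R (free_mod R b) M h \<and> (\<forall>x\<in>(free_mod R b). g (h x) = f x)"
proof -
  interpret N: rmod R N by (rule rmodI) fact
  have "\<forall>i. \<exists>y. i < b \<longrightarrow> y \<in> M \<and> g y = f (unit_vec R i)"
    using g(2) linD(1)[OF f R.unit_vec_closed] by (metis image_iff)
  then obtain y where y: "\<And>i. i < b ==> y i \<in> M" "\<And>i. i < b ==> g (y i) = f (unit_vec R i)" by metis
  have l: "lin R (free_mod R b) M (comb M y b)" by (rule comb_lin[OF y(1)])
  have "g (comb M y b x) = f x" if "x \<in> free_mod R b" for x
    by (rule N.lin_free_eq[OF lin_comp[OF l g(1)] f _ that]) (use y comb_unit_vec[of b y] in auto)
  thus ?thesis using l by auto
qed

lemma fin_gen_cover: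
  assumes "fin_gen_module R M"
  obtains b g where "lin R (free_mod R b) M g" "g ` carrier (free_mod R b) = carrier M"
proof -
  obtain A where A: "finite A" "A \<subseteq> M" "module_span R M A = carrier M" using assms by (rule fin_gen_moduleD)
  obtain y and b :: nat where y: "A = y ` {i. i < b}" using A(1) by (auto simp: finite_conv_nat_seg_image)
  have yc: "\<And>i. i < b ==> y i \<in> M" using A(2) y by auto
  show ?thesis by (rule that[OF comb_lin[OF yc]])
      (use comb_image[of b y] yc A(3) y in \<open>auto simp: lessThan_def\<close>)
qed

lemma comb_split:
  assumes "\<And>i. i < b ==> y i \<in> M" "\<And>i. i < b ==> f i \<in> R" "j < b"
  shows "\<exists>w\<in>module_span R M (y ` ({..<b} - {j})). comb M y b f = f j *\<^sub>M y j +\<^sub>M w"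
proof -
  define W where "W = module_span R M (y ` ({..<b} - {j}))"
  have W: "submodule W R M" unfolding W_def by (rule span_submodule) (use assms in auto)
  note WD = submoduleD[OF W]
  have yW: "y i \<in> W" if "i < b" "i \<noteq> j" for i
    using that span_incl[of "y ` ({..<b} - {j})"] by (auto simp: W_def)
  have "\<exists>w\<in>W. comb M y n f = (if j < n then f j *\<^sub>M y j +\<^sub>M w else w)" if "n \<le> b" for n using that
  proof (induction n)
    case 0
    thus ?case using WD(2) by auto
  next
    case (Suc n)
    then obtain w where w: "w \<in> W" "comb M y n f = (if j < n then f j *\<^sub>M y j +\<^sub>M w else w)" by auto
    have c: "y n \<in> M" "f n \<in> R" "y j \<in> M" "f j \<in> R" "w \<in> M" using Suc.prems assms w(1) WD(1) by auto
    show ?case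
    proof (cases "n = j")
      case True
      thus ?thesis using w c by (intro bexI[of _ w]) (auto simp: M.a_ac)
    next
      case False
      hence "w +\<^sub>M f n *\<^sub>M y n \<in> W" using w(1) yW[of n] Suc.prems c WD(3,6) by auto
      thus ?thesis using w c False by (intro bexI[of _ "w +\<^sub>M f n *\<^sub>M y n"]) (auto simp: M.a_assoc)
    qed
  qed
  from this[of b] show ?thesis using assms(3) by (auto simp: W_def)
qed

end

text \<open>The generators form a generating set of least cardinality: a relation with a unit
  coefficient would allow one of them to be dropped.\<close>

lemma (in local_noetherian) minimal_cover:
  fixes M :: "('r, 'm) module"
  assumes fg: "fin_gen_module R M"
  obtains b g where "lin R (free_mod R b) M g" "g ` carrier (free_mod R b) = carrier M"
    "\<And>f i. f \<in> free_mod R b ==> g f = 0\<^sub>M ==> f i \<in> \<mm>"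
proof -
  interpret M: rmod R M by (rule rmodI, rule moduleD_fin_gen[OF fg])
  define P where "P A \<longleftrightarrow> finite A \<and> A \<subseteq> M \<and> module_span R M A = carrier M" for A
  have "\<exists>A. P A" using fg unfolding P_def fin_gen_module_def by blast
  then obtain A where A: "P A" "\<And>B. P B ==> card A \<le> card B" using ex_has_least_nat[of P _ card] by blast
  have Af: "finite A" "A \<subseteq> M" "module_span R M A = carrier M" using A(1) by (auto simp: P_def)
  obtain y where y: "bij_betw y {..<card A} A"
    using ex_bij_betw_nat_finite[OF Af(1)] by (auto simp: atLeast0LessThan)
  have yc: "\<And>i. i < card A ==> y i \<in> M" using y Af(2) by (auto simp: bij_betw_def)
  show ?thesis
  proof (rule that[OF M.comb_lin[OF yc]])
    show "comb M y (card A) ` carrier (free_mod R (card A)) = carrier M"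
      using M.comb_image[of "card A" y] yc y Af(3) by (auto simp: bij_betw_def)
    fix f j assume f: "f \<in> carrier (free_mod R (card A))" "comb M y (card A) f = 0\<^sub>M"
    note fc = free_mod_closed[OF f(1)]
    show "f j \<in> \<mm>"
    proof (rule ccontr)
      assume nj: "f j \<notin> \<mm>"
      hence u: "f j \<in> Units R" using unit_if fc by auto
      have j: "j < card A" using nj f(1) idealD(2)[OF m_ideal] by (metis free_mod_carrier not_less)
      define B where "B = A - {y j}"
      have B: "B = y ` ({..<card A} - {j})" using y j by (auto simp: B_def bij_betw_def inj_on_def)
      have BM: "B \<subseteq> M" using Af(2) by (auto simp: B_def)
      obtain w where w: "w \<in> module_span R M B" "comb M y (card A) f = f j *\<^sub>M y j +\<^sub>M w"
        using M.comb_split[of "card A" y f j] yc fc j by (auto simp: B)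
      note S = M.span_submodule[OF BM]
      note SD = M.submoduleD[OF S]
      have e: "f j *\<^sub>M y j +\<^sub>M w = 0\<^sub>M" using w(2) f(2) by simp
      have "f j *\<^sub>M y j = -\<^sub>M w" using M.M.minus_equality[OF e] fc yc[OF j] SD(1)[OF w(1)] by simp
      hence "f j *\<^sub>M y j \<in> module_span R M B" using SD(4)[OF w(1)] by simp
      hence "inv (f j) *\<^sub>M (f j *\<^sub>M y j) \<in> module_span R M B" using SD(6) u by auto
      moreover have "inv (f j) *\<^sub>M (f j *\<^sub>M y j) = y j"
        using u fc yc[OF j] by (simp add: M.smult_assoc1[symmetric])
      ultimately have "y j \<in> module_span R M B" by simp
      hence "A \<subseteq> module_span R M B" using M.span_incl[of B] by (auto simp: B_def)
      from M.span_least[OF S this] have "module_span R M B = carrier M" using Af(3) SD(1) by auto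
      hence "P B" using Af(1) BM by (auto simp: P_def B_def)
      moreover have "card B < card A"
        using Af(1) j y by (auto simp: B_def bij_betw_def intro!: psubset_card_mono)
      ultimately show False using A(2) by fastforce
    qed
  qed
qed

text \<open>The lifting properties and universal properties of the definitions test only modules on the type
  \<open>nat \<Rightarrow> 'r\<close>. They are applied to a module of another type through an injection of its carrier.\<close>

definition transport :: "('m \<Rightarrow> 'n) \<Rightarrow> ('r, 'm) module \<Rightarrow> ('r, 'n) module" where
  "transport j M = \<lparr>carrier = j ` carrier M, monoid.mult = undefined, one = undefined,
    ring.zero = j 0\<^sub>M,
    add = (\<lambda>u v. j (inv_into M j u +\<^sub>M inv_into M j v)),
    smult = (\<lambda>a u. j (a *\<^sub>M inv_into M j u))\<rparr>"

context rmod
begin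

lemma transport_module:
  assumes j: "inj_on j M"
  shows "module R (transport j M)"
proof (rule moduleI[OF R.is_cring])
  note s = transport_def inv_into_f_f[OF j]
  show "abelian_group (transport j M)"
  proof (rule abelian_groupI)
    fix u assume "u \<in> carrier (transport j M)"
    then obtain x where x: "x \<in> M" "u = j x" by (auto simp: s)
    show "\<exists>v\<in>carrier (transport j M). v \<oplus>\<^bsub>transport j M\<^esub> u = \<zero>\<^bsub>transport j M\<^esub>"
      using x by (intro bexI[of _ "j (-\<^sub>M x)"]) (auto simp: s M.l_neg)
  qed (auto simp: s M.a_ac)
qed (auto simp: transport_def inv_into_f_f[OF j] smult_l_distr smult_r_distr smult_assoc1)

lemma transport_lin:
  assumes j: "inj_on j M"
  shows "lin R M (transport j M) j" "lin R (transport j M) M (inv_into (carrier M) j)"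
    "inv_into (carrier M) j ` carrier (transport j M) = carrier M"
    "j ` carrier M = carrier (transport j M)" using j by (auto simp: lin_def transport_def image_image)

lemma fin_gen_transport:
  assumes j: "inj_on j M" and fg: "fin_gen_module R M"
  shows "fin_gen_module R (transport j M)"
proof -
  obtain A where A: "finite A" "A \<subseteq> M" "module_span R M A = carrier M" using fg by (rule fin_gen_moduleD)
  note l = transport_lin[OF j]
  have "module_span R (transport j M) (j ` A) = carrier (transport j M)"
    using span_image[OF transport_module[OF j] l(1) A(2)] A(3) l(4) by simp
  thus ?thesis unfolding fin_gen_module_def using transport_module[OF j] A l(4)[symmetric]
    by (intro conjI exI[of _ "j ` A"]) auto
qed

text \<open>A set-theoretic section of a cover by a free module. It brings finitely generated
  modules of any type within reach of \<open>transport\<close>.\<close>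

lemma fin_gen_injection:
  assumes "fin_gen_module R M"
  obtains j :: "'m \<Rightarrow> nat \<Rightarrow> 'r" where "inj_on j M"
proof -
  obtain b g where g: "lin R (free_mod R b) M g" "g ` carrier (free_mod R b) = carrier M"
    using fin_gen_cover[OF assms] .
  have "inj_on (inv_into (free_mod R b) g) (carrier M)" by (rule inj_on_inv_into) (simp add: g(2))
  thus ?thesis by (rule that)
qed

end

lemma (in cring) self_module_fin_gen: "fin_gen_module R (self_module R)"
proof -
  interpret S: rmod R "self_module R" by (rule rmodI, rule self_module_module)
  have "module_span R (self_module R) {\<one>} = carrier (self_module R)"
  proof
    show "module_span R (self_module R) {\<one>} \<subseteq> self_module R" using S.span_closed[of "{\<one>}"] by auto
    show "carrier (self_module R) \<subseteq> module_span R (self_module R) {\<one>}"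
    proof
      fix a assume "a \<in> self_module R"
      moreover have "\<one> \<in> module_span R (self_module R) {\<one>}" using S.span_incl by blast
      ultimately show "a \<in> module_span R (self_module R) {\<one>}"
        using S.submoduleD(6)[OF S.span_submodule[of "{\<one>}"], of a \<one>] by simp
    qed
  qed
  thus ?thesis unfolding fin_gen_module_def using self_module_module by (intro conjI exI[of _ "{\<one>}"]) auto
qed

section \<open>Factoring, dividing and lifting linear maps\<close>

lemma lin_factor_inj:
  assumes P: "module R P" and B: "module R B" and i: "lin R B C i" "inj_on i B"
    and k: "lin R P C k" "\<And>u. u \<in> P ==> \<exists>v\<in>B. k u = i v"
  obtains f where "lin R P B f" "\<And>u. u \<in> P ==> k u = i (f u)"
proof -
  interpret P: rmod R P by (rule rmodI, fact)
  interpret B: rmod R B by (rule rmodI, fact)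
  obtain f where f: "\<And>u. u \<in> P ==> f u \<in> B" "\<And>u. u \<in> P ==> k u = i (f u)" using k(2) by metis
  note fD = inj_onD[OF i(2)]
  have "lin R P B f"
  proof (rule linI)
    fix u assume u: "u \<in> P"
    show "f u \<in> B" by (rule f(1)[OF u])
    show "f (u +\<^sub>P v) = f u +\<^sub>B f v" if v: "v \<in> P" for v
      using linD(2)[OF k(1) u v] f(2)[OF u] f(2)[OF v] f(2)[OF P.M.a_closed[OF u v]] linD(2)[OF i(1) f(1)[OF u] f(1)[OF v]]
      by (intro fD f(1) P.M.a_closed B.M.a_closed u v) simp
    show "f (a *\<^sub>P u) = a *\<^sub>B f u" if a: "a \<in> R" for a
      using linD(3)[OF k(1) a u] f(2)[OF u] f(2)[OF P.smult_closed[OF a u]] linD(3)[OF i(1) a f(1)[OF u]]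
      by (intro fD f(1) P.smult_closed B.smult_closed a u) simp
  qed
  thus ?thesis using f(2) by (rule that)
qed

text \<open>The homomorphism theorem along a surjection \<pi>. It serves to define maps on quotients
  and on images of differentials, where only values on representatives are known.\<close>

lemma lin_factor_surj:
  assumes A: "module R A" and B: "module R B" and C: "module R C"
    and \<pi>: "lin R A B \<pi>" "\<pi> ` carrier A = carrier B"
    and k: "lin R A C k" "\<And>a. a \<in> A ==> \<pi> a = 0\<^sub>B ==> k a = 0\<^sub>C"
  obtains h where "lin R B C h" "\<And>a. a \<in> A ==> h (\<pi> a) = k a"
proof -
  interpret A: rmod R A by (rule rmodI, fact)
  interpret B: rmod R B by (rule rmodI, fact)
  interpret C: rmod R C by (rule rmodI, fact)
  have eq: "k a = k b" if ab: "a \<in> A" "b \<in> A" "\<pi> a = \<pi> b" for a b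
  proof -
    have "\<pi> (a -\<^sub>A b) = 0\<^sub>B"
      unfolding lin_minus[OF A B \<pi>(1) ab(1,2)] using ab B.minus_eq_iff linD(1)[OF \<pi>(1)] by simp
    hence "k a -\<^sub>C k b = 0\<^sub>C" using k(2)[OF A.M.minus_closed[OF ab(1,2)]] lin_minus[OF A C k(1) ab(1,2)] by simp
    thus ?thesis using C.minus_eq_iff linD(1)[OF k(1)] ab by simp
  qed
  define h where "h u = k (inv_into A \<pi> u)" for u
  have h: "h (\<pi> a) = k a" if "a \<in> A" for a
    unfolding h_def using that by (intro eq) (auto intro: inv_into_into f_inv_into_f)
  have "lin R B C h"
  proof (rule linI)
    fix u assume "u \<in> B"
    then obtain a where a: "a \<in> A" "u = \<pi> a" using \<pi>(2) by auto
    show "h u \<in> C" using a h linD(1)[OF k(1) a(1)] by simp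
    show "h (u +\<^sub>B v) = h u +\<^sub>C h v" if "v \<in> B" for v
    proof -
      obtain b where b: "b \<in> A" "v = \<pi> b" using \<open>v \<in> B\<close> \<pi>(2) by auto
      show ?thesis unfolding a(2) b(2) linD(2)[OF \<pi>(1) a(1) b(1), symmetric] h[OF a(1)] h[OF b(1)]
          h[OF A.M.a_closed[OF a(1) b(1)]] by (rule linD(2)[OF k(1) a(1) b(1)])
    qed
    show "h (r *\<^sub>B u) = r *\<^sub>C h u" if r: "r \<in> R" for r
      unfolding a(2) linD(3)[OF \<pi>(1) r a(1), symmetric] h[OF a(1)] h[OF A.smult_closed[OF r a(1)]]
      by (rule linD(3)[OF k(1) r a(1)])
  qed
  thus ?thesis using h by (rule that)
qed

context rmod
begin

lemma smult_swap: "a \<in> R ==> b \<in> R ==> v \<in> M ==> a *\<^sub>M (b *\<^sub>M v) = b *\<^sub>M (a *\<^sub>M v)"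
  by (simp add: smult_assoc1[symmetric] R.m_comm)

lemma lin_homothety: "a \<in> R ==> lin R M M (\<lambda>v. a *\<^sub>M v)" by (rule linI) (auto simp: smult_r_distr smult_swap)

lemma multiples_submodule: "a \<in> R ==> submodule ((\<lambda>v. a *\<^sub>M v) ` carrier M) R M"
  by (rule image_submodule[OF is_mod lin_homothety carrier_is_submodule])

lemma smult_cancel:
  assumes "x \<in> R" "\<And>v. v \<in> M ==> x *\<^sub>M v = 0\<^sub>M ==> v = 0\<^sub>M"
    and "x *\<^sub>M v = x *\<^sub>M w" "v \<in> M" "w \<in> M"
  shows "v = w" using assms(2)[of "v -\<^sub>M w"] assms(1,3-) by (simp add: smult_minus_r minus_eq_iff)

text \<open>Division by x is well defined and linear where x acts injectively. It plays the part of
  a connecting homomorphism: congruences modulo x W are turned into maps and cocycles with values in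
  W.\<close>

lemma lin_divide:
  assumes x: "x \<in> R" "\<And>v. v \<in> M ==> x *\<^sub>M v = 0\<^sub>M ==> v = 0\<^sub>M"
    and P: "module R P" and k: "lin R P M k" "\<And>u. u \<in> P ==> \<exists>v\<in>M. k u = x *\<^sub>M v"
  obtains f where "lin R P M f" "\<And>u. u \<in> P ==> k u = x *\<^sub>M f u"
proof (rule lin_factor_inj[OF P is_mod lin_homothety[OF x(1)] _ k])
  show "inj_on (\<lambda>v. x *\<^sub>M v) M" by (rule inj_onI) (rule smult_cancel[OF x])
qed (assumption, rule that)

end

lemma quotient_injection:
  assumes "inj_on j A" "g ` A = B"
  shows "inj_on (\<lambda>y. j (inv_into A g y)) B"
proof (rule inj_onI)
  fix x y assume xy: "x \<in> B" "y \<in> B" "j (inv_into A g x) = j (inv_into A g y)"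
  have "inv_into A g x = inv_into A g y"
    by (rule inj_onD[OF assms(1) xy(3)]) (use xy assms(2) in \<open>auto intro!: inv_into_into\<close>)
  thus "x = y" using xy assms(2) by (metis f_inv_into_f)
qed

text \<open>Removes the restriction of the lifting property to one type. An injection is required
  for M alone, since a section of g provides one for N.\<close>

lemma projective_lift:
  fixes R :: "('r, 'x) ring_scheme" and j :: "'m \<Rightarrow> nat \<Rightarrow> 'r"
  assumes P: "projective_module R P" and M: "module R M" and N: "module R N"
    and j: "inj_on j M"
    and g: "lin R M N g" "g ` carrier M = carrier N" and f: "lin R P N f"
  obtains h where "lin R P M h" "\<And>x. x \<in> P ==> g (h x) = f x"
proof -
  interpret M: rmod R M by (rule rmodI, fact)
  interpret N: rmod R N by (rule rmodI, fact)
  have Pm: "module R P" using P by (simp add: projective_module_def)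
  interpret P: rmod R P by (rule rmodI, fact)
  define i where "i = (\<lambda>y. j (inv_into M g y))"
  have i: "inj_on i N" unfolding i_def by (rule quotient_injection[OF j g(2)])
  define M' where "M' = transport j M"
  define N' where "N' = transport i N"
  note jl = M.transport_lin[OF j, folded M'_def] and il = N.transport_lin[OF i, folded N'_def]
  have mods: "module R M'" "module R N'"
    unfolding M'_def N'_def by (rule M.transport_module[OF j], rule N.transport_module[OF i])
  define g' where "g' = restrict (\<lambda>u. i (g (inv_into M j u))) (carrier M')"
  define f' where "f' = restrict (\<lambda>x. i (f x)) (carrier P)"
  have g': "g' \<in> module_homs R M' N'"
    unfolding g'_def by (rule lin_restrict[OF mods(1) lin_comp[OF lin_comp[OF jl(2) g(1)] il(1)]])
  have f': "f' \<in> module_homs R P N'" unfolding f'_def by (rule lin_restrict[OF Pm lin_comp[OF f il(1)]])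
  have "g' ` carrier M' = i ` g ` inv_into M j ` carrier M'" by (force simp: g'_def)
  hence surj: "g' ` carrier M' = carrier N'" using jl(3) g(2) il(4) by simp
  obtain h' where h': "h' \<in> module_homs R P M'" "\<forall>x\<in>P. g' (h' x) = f' x"
    using P mods g' f' surj unfolding projective_module_def by meson
  note h'l = module_homs_imp_lin[OF h'(1)]
  define h where "h x = inv_into M j (h' x)" for x
  have h: "lin R P M h" unfolding h_def by (rule lin_comp[OF h'l jl(2)])
  have "g (h x) = f x" if x: "x \<in> P" for x
  proof -
    have "i (g (h x)) = i (f x)" using bspec[OF h'(2) x] x linD(1)[OF h'l x] by (simp add: g'_def f'_def h_def)
    thus ?thesis using i linD(1)[OF g(1) linD(1)[OF h x]] linD(1)[OF f x] by (auto dest: inj_onD)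
  qed
  thus ?thesis using that h by blast
qed

text \<open>The easy half of Baer's criterion. J and R reach the test type as constant functions,
  and e is the value at 1 of the extension to R.\<close>

lemma (in cring) injective_baer:
  assumes E: "injective_module R E" and J: "ideal J R"
    and h: "lin R ((self_module R)\<lparr>carrier := J\<rparr>) E h"
  obtains e where "e \<in> E" "\<And>a. a \<in> J ==> h a = a *\<^sub>E e"
proof -
  interpret S: rmod R "self_module R" by (rule rmodI, rule self_module_module)
  have J': "submodule J R (self_module R)" using J self_submodule_iff by simp
  note JD = idealD[OF J]
  define JM where "JM = (self_module R)\<lparr>carrier := J\<rparr>"
  interpret JM: rmod R JM unfolding JM_def by (rule rmodI, rule S.submodule_module[OF J'])
  have Em: "module R E" using E by (simp add: injective_module_def)
  interpret E: rmod R E by (rule rmodI, fact)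
  define c :: "'a \<Rightarrow> nat \<Rightarrow> 'a" where "c = (\<lambda>a _. a)"
  have c: "inj_on c A" for A by (auto simp: c_def inj_on_def fun_eq_iff)
  define M' where "M' = transport c JM"
  define N' where "N' = transport c (self_module R)"
  note jl = JM.transport_lin[OF c, folded M'_def] and il = S.transport_lin[OF c, folded N'_def]
  have mods: "module R M'" "module R N'"
    unfolding M'_def N'_def by (rule JM.transport_module[OF c], rule S.transport_module[OF c])
  have JMR: "lin R JM (self_module R) (\<lambda>a. a)" using JD by (auto simp: lin_def JM_def)
  define g' where "g' = restrict (\<lambda>u. c (inv_into (carrier JM) c u)) (carrier M')"
  define f' where "f' = restrict (\<lambda>u. h (inv_into (carrier JM) c u)) (carrier M')"
  have g': "g' \<in> module_homs R M' N'"
    unfolding g'_def by (rule lin_restrict[OF mods(1) lin_comp[OF lin_comp[OF jl(2) JMR] il(1)]])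
  have f': "f' \<in> module_homs R M' E"
    unfolding f'_def by (rule lin_restrict[OF mods(1) lin_comp[OF jl(2) h[folded JM_def]]])
  have cinv: "inv_into (carrier JM) c (c a) = a" if "a \<in> J" for a
    using that by (intro inv_into_f_f[OF c]) (simp add: JM_def)
  have inj: "inj_on g' M'" using cinv by (auto simp: g'_def inj_on_def M'_def transport_def JM_def)
  obtain k where k: "k \<in> module_homs R N' E" "\<forall>u\<in>M'. k (g' u) = f' u"
    using E mods g' f' inj unfolding injective_module_def by meson
  note kl = module_homs_imp_lin[OF k(1)]
  have kc: "lin R (self_module R) E (\<lambda>a. k (c a))" by (rule lin_comp[OF il(1) kl])
  show ?thesis
  proof (rule that)
    show "k (c \<one>) \<in> E" using linD(1)[OF kc, of \<one>] by simp
    show "h a = a *\<^sub>E k (c \<one>)" if a: "a \<in> J" for a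
    proof -
      have "c a \<in> M'" using a by (auto simp: M'_def transport_def JM_def)
      from bspec[OF k(2) this] this have "k (c a) = h a" using cinv[OF a] by (simp add: g'_def f'_def)
      thus ?thesis using linD(3)[OF kc, of a \<one>] JD(1)[OF a] by simp
    qed
  qed
qed

lemma (in cring) free_mod_projective: "projective_module R (free_mod R b)" unfolding projective_module_def
proof (intro conjI allI impI ballI)
  show "module R (free_mod R b)" by (rule free_mod_module)
  fix M N :: "('a, nat \<Rightarrow> 'a) module" and g f
  assume M: "module R M" and N: "module R N" and g: "g \<in> module_homs R M N"
    and f: "f \<in> module_homs R (free_mod R b) N" and s: "g ` carrier M = carrier N"
  interpret M: rmod R M by (rule rmodI, fact)
  obtain h where "lin R (free_mod R b) M h" "\<forall>x\<in>(free_mod R b). g (h x) = f x"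
    using M.free_lift[OF N module_homs_imp_lin[OF g] s module_homs_imp_lin[OF f]] by blast
  thus "\<exists>h\<in>module_homs R (free_mod R b) M. \<forall>x\<in>(free_mod R b). g (h x) = f x"
    using lin_restrict[OF free_mod_module, of b M h] by (intro bexI) auto
qed

section \<open>Homomorphism and quotient modules\<close>

lemma pointwise_module_simps [simp]:
  "carrier (pointwise_module A N H) = H" "\<zero>\<^bsub>pointwise_module A N H\<^esub> = (\<lambda>x\<in>A. 0\<^sub>N)"
  "f \<oplus>\<^bsub>pointwise_module A N H\<^esub> g = (\<lambda>x\<in>A. f x +\<^sub>N g x)"
  "a \<odot>\<^bsub>pointwise_module A N H\<^esub> f = (\<lambda>x\<in>A. a *\<^sub>N f x)" by (simp_all add: pointwise_module_def)

text \<open>Common source of the module structures on \<open>Hom_module\<close> and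
  \<open>Der_module\<close>.\<close>

lemma (in rmod) pointwise_module_module:
  assumes H: "H \<subseteq> A \<rightarrow>\<^sub>E carrier M" and zero: "(\<lambda>x\<in>A. 0\<^sub>M) \<in> H"
    and add: "\<And>f g. f \<in> H ==> g \<in> H ==> (\<lambda>x\<in>A. f x +\<^sub>M g x) \<in> H"
    and smult: "\<And>a f. a \<in> R ==> f \<in> H ==> (\<lambda>x\<in>A. a *\<^sub>M f x) \<in> H"
  shows "module R (pointwise_module A M H)"
proof -
  have c: "f x \<in> M" if "f \<in> H" "x \<in> A" for f x using that H by (auto simp: PiE_def Pi_def)
  have e: "(\<lambda>x\<in>A. f x) = f" if "f \<in> H" for f using that H by (auto simp: PiE_def extensional_restrict)
  show ?thesis
  proof (rule moduleI[OF R.is_cring])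
    show "abelian_group (pointwise_module A M H)"
    proof (rule abelian_groupI)
      fix f assume "f \<in> carrier (pointwise_module A M H)"
      hence f: "f \<in> H" by simp
      have "(\<lambda>x\<in>A. (\<ominus> \<one>) *\<^sub>M f x) \<in> H" by (rule smult) (use f in auto)
      moreover have "(\<lambda>x\<in>A. (\<lambda>x\<in>A. (\<ominus> \<one>) *\<^sub>M f x) x +\<^sub>M f x) = (\<lambda>x\<in>A. 0\<^sub>M)"
        using c[OF f] by (auto simp: restrict_def smult_l_minus M.l_neg)
      ultimately show "\<exists>g\<in>carrier (pointwise_module A M H).
          g \<oplus>\<^bsub>pointwise_module A M H\<^esub> f = \<zero>\<^bsub>pointwise_module A M H\<^esub>"
        unfolding pointwise_module_simps by (intro bexI)
    next
      fix f assume "f \<in> carrier (pointwise_module A M H)"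
      hence f: "f \<in> H" by simp
      have "(\<lambda>x\<in>A. (\<lambda>x\<in>A. 0\<^sub>M) x +\<^sub>M f x) = (\<lambda>x\<in>A. f x)" using c[OF f] by (auto simp: restrict_def)
      thus "\<zero>\<^bsub>pointwise_module A M H\<^esub> \<oplus>\<^bsub>pointwise_module A M H\<^esub> f = f" using e[OF f] by simp
    qed (use add zero c in \<open>auto simp: M.a_ac intro!: restrict_ext\<close>)
  next
    fix f assume "f \<in> carrier (pointwise_module A M H)"
    hence f: "f \<in> H" by simp
    have "(\<lambda>x\<in>A. \<one> *\<^sub>M f x) = (\<lambda>x\<in>A. f x)" using c[OF f] by (auto simp: restrict_def)
    thus "\<one> \<odot>\<^bsub>pointwise_module A M H\<^esub> f = f" using e[OF f] by simp
  qed (use smult c in \<open>auto simp: smult_l_distr smult_r_distr smult_assoc1 intro!: restrict_ext\<close>)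
qed

lemma Hom_module_simps [simp]:
  "carrier (Hom_module R M N) = module_homs R M N" "\<zero>\<^bsub>Hom_module R M N\<^esub> = (\<lambda>x\<in>M. 0\<^sub>N)"
  "f \<oplus>\<^bsub>Hom_module R M N\<^esub> g = (\<lambda>x\<in>M. f x +\<^sub>N g x)"
  "a \<odot>\<^bsub>Hom_module R M N\<^esub> f = (\<lambda>x\<in>M. a *\<^sub>N f x)" by (simp_all add: Hom_module_def)

lemma module_homsD:
  assumes "h \<in> module_homs R M N"
  shows "x \<in> M ==> h x \<in> N"
    and "x \<in> M ==> y \<in> M ==> h (x +\<^sub>M y) = h x +\<^sub>N h y"
    and "a \<in> R ==> x \<in> M ==> h (a *\<^sub>M x) = a *\<^sub>N h x"
    and "(\<lambda>x\<in>M. h x) = h"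
proof -
  show "(\<lambda>x\<in>M. h x) = h" using assms by (auto simp: module_homs_def PiE_def extensional_restrict)
qed (use linD[OF module_homs_imp_lin[OF assms]] in auto)

lemma lin_add:
  assumes "module R N" "module R M" "lin R M N f" "lin R M N g"
  shows "lin R M N (\<lambda>x. f x +\<^sub>N g x)"
proof -
  interpret N: rmod R N by (rule rmodI, fact)
  show ?thesis by (rule linI) (use assms(3,4) in \<open>auto simp: linD N.M.a_ac N.smult_r_distr\<close>)
qed

lemma lin_smult:
  assumes "module R N" "module R M" "lin R M N f" "a \<in> R"
  shows "lin R M N (\<lambda>x. a *\<^sub>N f x)"
proof -
  interpret N: rmod R N by (rule rmodI, fact)
  have "a *\<^sub>N (b *\<^sub>N f x) = b *\<^sub>N (a *\<^sub>N f x)" if "b \<in> R" "x \<in> M" for b x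
    using that assms(4) linD(1)[OF assms(3)] by (simp add: N.smult_assoc1[symmetric] N.R.m_comm)
  thus ?thesis by (intro linI) (use assms(3,4) in \<open>auto simp: linD N.smult_r_distr\<close>)
qed

lemma lin_const_zero:
  assumes "module R N" shows "lin R M N (\<lambda>x. 0\<^sub>N)"
proof -
  interpret N: rmod R N by (rule rmodI, fact)
  show ?thesis by (rule linI) auto
qed

lemma Hom_module_module:
  assumes M: "module R M" and N: "module R N"
  shows "module R (Hom_module R M N)" unfolding Hom_module_def
proof (rule rmod.pointwise_module_module[OF rmodI[OF N]])
  show "module_homs R M N \<subseteq> M \<rightarrow>\<^sub>E carrier N" by (auto simp: module_homs_def)
  show "(\<lambda>x\<in>M. 0\<^sub>N) \<in> module_homs R M N" by (rule lin_restrict[OF M lin_const_zero[OF N]])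
  show "(\<lambda>x\<in>M. f x +\<^sub>N g x) \<in> module_homs R M N"
    if "f \<in> module_homs R M N" "g \<in> module_homs R M N" for f g
    by (rule lin_restrict[OF M lin_add[OF N M]]) (use that module_homs_imp_lin in auto)
  show "(\<lambda>x\<in>M. a *\<^sub>N f x) \<in> module_homs R M N"
    if "a \<in> R" "f \<in> module_homs R M N" for a f
    by (rule lin_restrict[OF M lin_smult[OF N M]]) (use that module_homs_imp_lin in auto)
qed

lemma Hom_eval_lin:
  assumes "x \<in> carrier M" shows "lin R (Hom_module R M N) N (\<lambda>h. h x)"
  using assms by (auto simp: lin_def module_homs_def PiE_def Pi_def)

context rmod
begin

lemma coset_carrier: "submodule N R M ==> x \<in> M ==> N +>\<^bsub>M\<^esub> x = {n +\<^sub>M x |n. n \<in> N}"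
  by (auto simp: a_r_coset_def r_coset_def)

lemma coset_eq_iff:
  assumes N: "submodule N R M" and "x \<in> M" "y \<in> M"
  shows "N +>\<^bsub>M\<^esub> x = N +>\<^bsub>M\<^esub> y \<longleftrightarrow> x -\<^sub>M y \<in> N"
proof
  note D = submoduleD[OF N]
  assume "N +>\<^bsub>M\<^esub> x = N +>\<^bsub>M\<^esub> y"
  moreover have "x \<in> N +>\<^bsub>M\<^esub> x" using coset_carrier[OF N assms(2)] D(2) assms by (force intro!: exI[of _ "0\<^sub>M"])
  ultimately obtain n where "n \<in> N" "x = n +\<^sub>M y" using coset_carrier[OF N assms(3)] by auto
  thus "x -\<^sub>M y \<in> N" using assms D by (simp add: a_minus_def M.a_assoc M.r_neg)
next
  note D = submoduleD[OF N]
  have *: "N +>\<^bsub>M\<^esub> x \<subseteq> N +>\<^bsub>M\<^esub> y" if xy: "x \<in> M" "y \<in> M" "x -\<^sub>M y \<in> N" for x y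
  proof
    fix z assume "z \<in> N +>\<^bsub>M\<^esub> x"
    then obtain n where n: "n \<in> N" "z = n +\<^sub>M x" using coset_carrier[OF N xy(1)] by auto
    have "z = (n +\<^sub>M (x -\<^sub>M y)) +\<^sub>M y" using n xy D(1) by (simp add: a_minus_def M.a_assoc M.l_neg)
    moreover have "n +\<^sub>M (x -\<^sub>M y) \<in> N" using n xy D by auto
    ultimately show "z \<in> N +>\<^bsub>M\<^esub> y" using coset_carrier[OF N xy(2)] by blast
  qed
  assume xy: "x -\<^sub>M y \<in> N"
  have "y -\<^sub>M x = -\<^sub>M (x -\<^sub>M y)" using assms by (simp add: a_minus_def M.minus_add M.a_comm)
  hence "y -\<^sub>M x \<in> N" using D(4)[OF xy] by simp
  thus "N +>\<^bsub>M\<^esub> x = N +>\<^bsub>M\<^esub> y" using *[of x y] *[of y x] assms xy by blast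
qed

lemma quotient_carrier: "carrier (quotient_module M N) = (\<lambda>x. N +>\<^bsub>M\<^esub> x) ` carrier M"
  by (auto simp: quotient_module_def A_RCOSETS_def RCOSETS_def a_r_coset_def)

lemma quotient_zero:
  assumes N: "submodule N R M"
  shows "\<zero>\<^bsub>quotient_module M N\<^esub> = N +>\<^bsub>M\<^esub> 0\<^sub>M"
proof -
  have "{n +\<^sub>M 0\<^sub>M |n. n \<in> N} = (\<lambda>n. n) ` N" unfolding image_def using submoduleD(1)[OF N] by (metis M.r_zero)
  thus ?thesis using coset_carrier[OF N, of "0\<^sub>M"] by (simp add: quotient_module_def)
qed

lemma mem_coset:
  assumes N: "submodule N R M" and "x \<in> M"
  shows "y \<in> N +>\<^bsub>M\<^esub> x \<longleftrightarrow> y \<in> M \<and> y -\<^sub>M x \<in> N"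
proof
  note D = submoduleD[OF N]
  show "y \<in> M \<and> y -\<^sub>M x \<in> N" if "y \<in> N +>\<^bsub>M\<^esub> x"
    using that coset_carrier[OF N assms(2)] D assms(2) by (auto simp: a_minus_def M.a_assoc M.r_neg)
  show "y \<in> N +>\<^bsub>M\<^esub> x" if y: "y \<in> M \<and> y -\<^sub>M x \<in> N"
  proof -
    have "y = (y -\<^sub>M x) +\<^sub>M x" using y assms(2) by (simp add: a_minus_def M.a_assoc M.l_neg)
    thus ?thesis using coset_carrier[OF N assms(2)] y by blast
  qed
qed

lemma quotient_add:
  assumes N: "submodule N R M" and x: "x \<in> M" and y: "y \<in> M"
  shows "(N +>\<^bsub>M\<^esub> x) \<oplus>\<^bsub>quotient_module M N\<^esub> (N +>\<^bsub>M\<^esub> y) = N +>\<^bsub>M\<^esub> (x +\<^sub>M y)"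
proof -
  note D = submoduleD[OF N]
  have "(N +>\<^bsub>M\<^esub> x) \<oplus>\<^bsub>quotient_module M N\<^esub> (N +>\<^bsub>M\<^esub> y) = {u +\<^sub>M v |u v. u \<in> N +>\<^bsub>M\<^esub> x \<and> v \<in> N +>\<^bsub>M\<^esub> y}"
    by (auto simp: quotient_module_def set_add_def set_mult_def)
  also have "\<dots> = N +>\<^bsub>M\<^esub> (x +\<^sub>M y)"
  proof
    show "{u +\<^sub>M v |u v. u \<in> N +>\<^bsub>M\<^esub> x \<and> v \<in> N +>\<^bsub>M\<^esub> y} \<subseteq> N +>\<^bsub>M\<^esub> (x +\<^sub>M y)"
    proof
      fix z assume "z \<in> {u +\<^sub>M v |u v. u \<in> N +>\<^bsub>M\<^esub> x \<and> v \<in> N +>\<^bsub>M\<^esub> y}"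
      then obtain n k where nk: "n \<in> N" "k \<in> N" "z = (n +\<^sub>M x) +\<^sub>M (k +\<^sub>M y)"
        using coset_carrier[OF N x] coset_carrier[OF N y] by auto
      hence "z = (n +\<^sub>M k) +\<^sub>M (x +\<^sub>M y)" using D(1) x y by (simp add: M.a_ac)
      thus "z \<in> N +>\<^bsub>M\<^esub> (x +\<^sub>M y)" using coset_carrier[OF N, of "x +\<^sub>M y"] nk D(3) x y by blast
    qed
    show "N +>\<^bsub>M\<^esub> (x +\<^sub>M y) \<subseteq> {u +\<^sub>M v |u v. u \<in> N +>\<^bsub>M\<^esub> x \<and> v \<in> N +>\<^bsub>M\<^esub> y}"
    proof
      fix z assume "z \<in> N +>\<^bsub>M\<^esub> (x +\<^sub>M y)"
      then obtain n where n: "n \<in> N" "z = n +\<^sub>M (x +\<^sub>M y)" using coset_carrier[OF N, of "x +\<^sub>M y"] x y by auto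
      hence "z = (n +\<^sub>M x) +\<^sub>M (0\<^sub>M +\<^sub>M y)" using D(1) x y by (simp add: M.a_ac)
      thus "z \<in> {u +\<^sub>M v |u v. u \<in> N +>\<^bsub>M\<^esub> x \<and> v \<in> N +>\<^bsub>M\<^esub> y}"
        using coset_carrier[OF N x] coset_carrier[OF N y] n(1) D(2) by blast
    qed
  qed
  finally show ?thesis .
qed

lemma quotient_smult:
  assumes N: "submodule N R M" and x: "x \<in> M" and a: "a \<in> R"
  shows "a \<odot>\<^bsub>quotient_module M N\<^esub> (N +>\<^bsub>M\<^esub> x) = N +>\<^bsub>M\<^esub> (a *\<^sub>M x)"
proof -
  note D = submoduleD[OF N]
  have "N +>\<^bsub>M\<^esub> (a *\<^sub>M y) = N +>\<^bsub>M\<^esub> (a *\<^sub>M x)" if "y \<in> N +>\<^bsub>M\<^esub> x" for y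
  proof -
    have y: "y \<in> M" "y -\<^sub>M x \<in> N" using that mem_coset[OF N x] by auto
    have "a *\<^sub>M y -\<^sub>M a *\<^sub>M x = a *\<^sub>M (y -\<^sub>M x)" using y a x by (simp add: smult_minus_r)
    thus ?thesis using coset_eq_iff[OF N, of "a *\<^sub>M y" "a *\<^sub>M x"] y a x D(6) by auto
  qed
  moreover have "x \<in> N +>\<^bsub>M\<^esub> x" using mem_coset[OF N x] x D(2) by (simp add: a_minus_def M.r_neg)
  moreover have "a \<odot>\<^bsub>quotient_module M N\<^esub> (N +>\<^bsub>M\<^esub> x) = (\<Union>y\<in>N +>\<^bsub>M\<^esub> x. N +>\<^bsub>M\<^esub> (a *\<^sub>M y))"
    by (simp add: quotient_module_def)
  ultimately show ?thesis by blast
qed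

lemma quotient_module_module:
  assumes N: "submodule N R M"
  shows "module R (quotient_module M N)"
proof (rule moduleI[OF R.is_cring])
  note s = quotient_add[OF N] quotient_smult[OF N] quotient_zero[OF N] quotient_carrier
  show "abelian_group (quotient_module M N)"
  proof (rule abelian_groupI)
    fix u assume "u \<in> quotient_module M N"
    then obtain x where x: "x \<in> M" "u = N +>\<^bsub>M\<^esub> x" by (auto simp: s)
    show "\<exists>v\<in>(quotient_module M N). v \<oplus>\<^bsub>quotient_module M N\<^esub> u = \<zero>\<^bsub>quotient_module M N\<^esub>"
      using x by (intro bexI[of _ "N +>\<^bsub>M\<^esub> (-\<^sub>M x)"]) (auto simp: s M.l_neg)
  qed (auto simp: s M.a_ac)
qed (auto simp: quotient_add[OF N] quotient_smult[OF N] quotient_carrier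
  smult_l_distr smult_r_distr smult_assoc1)

lemma quotient_lin:
  assumes N: "submodule N R M"
  shows "lin R M (quotient_module M N) (\<lambda>x. N +>\<^bsub>M\<^esub> x)"
    and "(\<lambda>x. N +>\<^bsub>M\<^esub> x) ` carrier M = carrier (quotient_module M N)"
  by (auto simp: lin_def quotient_add[OF N] quotient_smult[OF N] quotient_carrier)

lemma coset_eq_zero_iff:
  assumes N: "submodule N R M" and x: "x \<in> M"
  shows "N +>\<^bsub>M\<^esub> x = \<zero>\<^bsub>quotient_module M N\<^esub> \<longleftrightarrow> x \<in> N" using coset_eq_iff[OF N x, of "0\<^sub>M"] quotient_zero[OF N] x
    M.minus_equality[of "0\<^sub>M" "0\<^sub>M"] by (simp add: a_minus_def)

lemma fin_gen_image:
  assumes "module R N" "lin R M N g" "g ` carrier M = carrier N" "fin_gen_module R M"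
  shows "fin_gen_module R N"
proof -
  obtain A where A: "finite A" "A \<subseteq> M" "module_span R M A = carrier M" using assms(4) by (rule fin_gen_moduleD)
  have "module_span R N (g ` A) = carrier N" using span_image[OF assms(1,2) A(2)] A(3) assms(3) by simp
  thus ?thesis unfolding fin_gen_module_def using assms A by (intro conjI exI[of _ "g ` A"]) auto
qed

end

section \<open>Endomorphisms of the canonical module\<close>

text \<open>For a submodule Z of E this is the vanishing of Ext^1(R / J, Z): each homomorphism from
  J to Z comes from an element of Z. Z is given as a subset of E since it will be a cosyzygy, the
  image of a differential.\<close>

definition baer :: "('r, 'x) ring_scheme \<Rightarrow> 'r set \<Rightarrow> ('r, 'm) module \<Rightarrow> 'm set \<Rightarrow> bool" where
  "baer R J E Z \<longleftrightarrow> (\<forall>h. lin R ((self_module R)\<lparr>carrier := J\<rparr>) E h \<longrightarrow> (\<forall>a\<in>J. h a \<in> Z) \<longrightarrow>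
    (\<exists>c\<in>Z. \<forall>a\<in>J. h a = a *\<^sub>E c))"

lemma lin_ideal_iff:
  "lin R ((self_module R)\<lparr>carrier := J\<rparr>) E h \<longleftrightarrow> (\<forall>a\<in>J. h a \<in> E) \<and>
    (\<forall>a\<in>J. \<forall>b\<in>J. h (a +\<^sub>R b) = h a +\<^sub>E h b) \<and>
    (\<forall>r\<in>R. \<forall>a\<in>J. h (r \<otimes>\<^sub>R a) = r *\<^sub>E h a)" by (simp add: lin_def)

lemma lin_idealD:
  assumes "lin R ((self_module R)\<lparr>carrier := J\<rparr>) E h"
  shows "a \<in> J ==> h a \<in> E"
    and "a \<in> J ==> b \<in> J ==> h (a +\<^sub>R b) = h a +\<^sub>E h b"
    and "r \<in> R ==> a \<in> J ==> h (r \<otimes>\<^sub>R a) = r *\<^sub>E h a" using assms by (simp_all add: lin_ideal_iff)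

context rmod
begin

lemma add_minus_cancel:
  "x \<in> M ==> y \<in> M ==> x +\<^sub>M (y +\<^sub>M -\<^sub>M x) = y" by (metis M.a_assoc M.a_comm M.a_inv_closed M.r_neg M.r_zero)

lemma minus_zero_right: "x \<in> M ==> x -\<^sub>M 0\<^sub>M = x"
  using M.minus_equality[of "0\<^sub>M" "0\<^sub>M"] by (simp add: a_minus_def)

text \<open>Extension from J to J + R u with prescribed value c at u. The hypothesis
  \<open>comp\<close> on the r with r u in J is what makes r c + h w independent of the
  representation r u + w.\<close>

lemma extend_hom:
  assumes J: "ideal J R" and u: "u \<in> R" and c: "c \<in> M"
    and h: "lin R ((self_module R)\<lparr>carrier := J\<rparr>) M h"
    and comp: "\<And>r. r \<in> R ==> r \<otimes> u \<in> J ==> h (r \<otimes> u) = r *\<^sub>M c"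
  obtains g where "lin R ((self_module R)\<lparr>carrier := {r \<otimes> u \<oplus> w |r w. r \<in> R \<and> w \<in> J}\<rparr>) M g"
    "\<And>r w. r \<in> R ==> w \<in> J ==> g (r \<otimes> u \<oplus> w) = r *\<^sub>M c +\<^sub>M h w"
proof -
  note JD = idealD[OF J]
  note hD = lin_idealD[OF h]
  define J1 where "J1 = {r \<otimes> u \<oplus> w |r w. r \<in> R \<and> w \<in> J}"
  have uniq: "r *\<^sub>M c +\<^sub>M h w = r' *\<^sub>M c +\<^sub>M h w'"
    if *: "r \<in> R" "w \<in> J" "r' \<in> R" "w' \<in> J" "r \<otimes> u \<oplus> w = r' \<otimes> u \<oplus> w'" for r w r' w'
  proof -
    note wc = JD(1)[OF *(2)] JD(1)[OF *(4)]
    have "(r \<ominus> r') \<otimes> u \<oplus> w = (r \<otimes> u \<oplus> w) \<ominus> r' \<otimes> u"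
      using *(1,3) wc u by (simp add: R.l_distr a_minus_def R.l_minus R.a_ac)
    also have "\<dots> = w'" unfolding *(5) using *(1,3) wc u by (simp add: a_minus_def R.a_ac R.r_neg1 R.r_neg)
    finally have e: "(r \<ominus> r') \<otimes> u \<oplus> w = w'" .
    hence "(r \<ominus> r') \<otimes> u = w' \<ominus> w"
      using * wc u by (metis R.minus_closed R.m_closed R.add.inv_solve_right a_minus_def a_inv_def)
    hence in_J: "(r \<ominus> r') \<otimes> u \<in> J" using JD(5)[OF *(4,2)] by simp
    have "h w' = h ((r \<ominus> r') \<otimes> u) +\<^sub>M h w" using hD(2)[OF in_J *(2)] e by simp
    also have "h ((r \<ominus> r') \<otimes> u) = (r \<ominus> r') *\<^sub>M c" using comp in_J * by auto
    finally have "h w' = (r *\<^sub>M c -\<^sub>M r' *\<^sub>M c) +\<^sub>M h w" using * c by (simp add: smult_minus_l)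
    thus ?thesis using * c hD by (simp add: a_minus_def M.a_ac add_minus_cancel)
  qed
  define g where "g a = (SOME m. \<exists>r w. r \<in> R \<and> w \<in> J \<and> a = r \<otimes> u \<oplus> w \<and> m = r *\<^sub>M c +\<^sub>M h w)" for a
  have g: "g (r \<otimes> u \<oplus> w) = r *\<^sub>M c +\<^sub>M h w" if "r \<in> R" "w \<in> J" for r w unfolding g_def
  proof (rule someI2)
    show "\<exists>r' w'. r' \<in> R \<and> w' \<in> J \<and> r \<otimes> u \<oplus> w = r' \<otimes> u \<oplus> w' \<and>
      r *\<^sub>M c +\<^sub>M h w = r' *\<^sub>M c +\<^sub>M h w'" using that by blast
  qed (use uniq that in metis)
  have "lin R ((self_module R)\<lparr>carrier := J1\<rparr>) M g" unfolding lin_ideal_iff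
  proof (intro conjI ballI)
    fix a assume "a \<in> J1"
    then obtain r w where a: "r \<in> R" "w \<in> J" "a = r \<otimes> u \<oplus> w" by (auto simp: J1_def)
    show "g a \<in> M" using g[OF a(1,2)] a c hD by auto
    { fix b assume "b \<in> J1"
      then obtain r' w' where b: "r' \<in> R" "w' \<in> J" "b = r' \<otimes> u \<oplus> w'" by (auto simp: J1_def)
      have "a \<oplus> b = (r \<oplus> r') \<otimes> u \<oplus> (w \<oplus> w')" using a b u JD(1) by (simp add: R.l_distr R.a_ac)
      hence "g (a \<oplus> b) = (r \<oplus> r') *\<^sub>M c +\<^sub>M h (w \<oplus> w')" using g a b JD(3) by auto
      also have "h (w \<oplus> w') = h w +\<^sub>M h w'" using hD a b by auto
      finally show "g (a \<oplus> b) = g a +\<^sub>M g b"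
        using g[OF a(1,2)] g[OF b(1,2)] a b c hD by (simp add: smult_l_distr M.a_ac) }
    { fix s assume s: "s \<in> R"
      have "s \<otimes> a = (s \<otimes> r) \<otimes> u \<oplus> (s \<otimes> w)" using a s u JD(1) by (simp add: R.r_distr R.m_assoc)
      hence "g (s \<otimes> a) = (s \<otimes> r) *\<^sub>M c +\<^sub>M h (s \<otimes> w)" using g a s JD(6) by auto
      also have "h (s \<otimes> w) = s *\<^sub>M h w" using hD a s by auto
      finally show "g (s \<otimes> a) = s *\<^sub>M g a"
        using g[OF a(1,2)] a s c hD by (simp add: smult_r_distr smult_assoc1) }
  qed
  thus ?thesis using that g unfolding J1_def by blast
qed

lemma extend_zero_hom:
  assumes J: "ideal J R" and u: "u \<in> R" and c: "c \<in> M"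
    and comp: "\<And>r. r \<in> R ==> r \<otimes> u \<in> J ==> r *\<^sub>M c = 0\<^sub>M"
  obtains g where "lin R ((self_module R)\<lparr>carrier := {r \<otimes> u \<oplus> w |r w. r \<in> R \<and> w \<in> J}\<rparr>) M g"
    "\<And>r w. r \<in> R ==> w \<in> J ==> g (r \<otimes> u \<oplus> w) = r *\<^sub>M c"
proof -
  have "lin R ((self_module R)\<lparr>carrier := J\<rparr>) M (\<lambda>_. 0\<^sub>M)" by (rule lin_const_zero[OF is_mod])
  from extend_hom[OF J u c this] obtain g
    where "lin R ((self_module R)\<lparr>carrier := {r \<otimes> u \<oplus> w |r w. r \<in> R \<and> w \<in> J}\<rparr>) M g"
    "\<And>r w. r \<in> R ==> w \<in> J ==> g (r \<otimes> u \<oplus> w) = r *\<^sub>M c +\<^sub>M 0\<^sub>M" using comp by auto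
  thus ?thesis using that c by simp
qed

text \<open>Since x is regular, r x -> r u is a homomorphism on R x; the element e that represents
  it satisfies x e = u.\<close>

lemma injective_divisible:
  assumes inj: "injective_module R M" and x: "nonzerodivisor R x" and u: "u \<in> M"
  shows "\<exists>e\<in>M. u = x *\<^sub>M e"
proof -
  have xR: "x \<in> R" using x by (simp add: nonzerodivisor_def)
  define J where "J = PIdl x"
  have J: "ideal J R" unfolding J_def by (rule R.cgenideal_ideal[OF xR])
  have Jx: "a \<in> J \<longleftrightarrow> (\<exists>r\<in>R. a = r \<otimes> x)" for a by (auto simp: J_def cgenideal_def)
  define q where "q a = (THE r. r \<in> R \<and> a = r \<otimes> x)" for a
  have q: "q (r \<otimes> x) = r" if "r \<in> R" for r unfolding q_def
  proof (rule the_equality)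
    fix r' assume r': "r' \<in> R \<and> r \<otimes> x = r' \<otimes> x"
    hence "x \<otimes> r' = x \<otimes> r" using that xR by (simp add: R.m_comm)
    thus "r' = r" using R.nonzerodivisor_cancel[OF x] r' that by blast
  qed (use that in simp)
  have "lin R ((self_module R)\<lparr>carrier := J\<rparr>) M (\<lambda>a. q a *\<^sub>M u)" unfolding lin_ideal_iff
  proof (intro conjI ballI)
    fix a assume "a \<in> J"
    then obtain r where a: "r \<in> R" "a = r \<otimes> x" using Jx by auto
    show "q a *\<^sub>M u \<in> M" using a q u by simp
    show "q (a \<oplus> b) *\<^sub>M u = q a *\<^sub>M u +\<^sub>M q b *\<^sub>M u" if bJ: "b \<in> J" for b
    proof -
      obtain r' where b: "r' \<in> R" "b = r' \<otimes> x" using bJ Jx by auto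
      have "a \<oplus> b = (r \<oplus> r') \<otimes> x" using a b xR by (simp add: R.l_distr)
      thus ?thesis using a b q u by (simp add: smult_l_distr)
    qed
    show "q (s \<otimes> a) *\<^sub>M u = s *\<^sub>M (q a *\<^sub>M u)" if "s \<in> R" for s
    proof -
      have "s \<otimes> a = (s \<otimes> r) \<otimes> x" using a that xR by (simp add: R.m_assoc)
      thus ?thesis using a that q u by (simp add: smult_assoc1)
    qed
  qed
  then obtain e where e: "e \<in> M" "\<And>a. a \<in> J ==> q a *\<^sub>M u = a *\<^sub>M e" using R.injective_baer[OF inj J] by blast
  have "\<one> \<otimes> x \<in> J" using Jx by blast
  from e(2)[OF this] show ?thesis using e(1) q[of \<one>] u xR by auto
qed

end

context dim_one_ring
begin

lemma colon_socle:
  assumes J: "ideal J R" and u: "u \<in> R" "u \<notin> J" and r: "r \<in> R" "r \<otimes> u \<in> J"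
  shows "r \<in> \<mm>"
proof (rule ccontr)
  assume "r \<notin> \<mm>"
  hence U: "r \<in> Units R" using unit_if r by auto
  have "inv r \<otimes> (r \<otimes> u) \<in> J" using idealD(6)[OF J _ r(2)] U by auto
  moreover have "inv r \<otimes> (r \<otimes> u) = u" using U u r by (simp add: m_assoc[symmetric])
  ultimately show False using u by simp
qed

text \<open>For u outside J with \<mm> u inside J, the quotient (J + R u) / J is a copy of R /
  \<mm>. So the vanishing spreads from R / \<mm> to all R / J with x in J, by induction from the
  larger ideal J + R u. The value of the extension at u is the c that represents z -> h (z u) on
  \<mm>.\<close>

lemma baer_if_baer_maximal:
  assumes x: "nonzerodivisor R x" and E: "module R E" and Z: "submodule Z R E"
    and max: "baer R \<mm> E Z" and J: "ideal J R" "x \<in> J"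
  shows "baer R J E Z"
proof -
  interpret E: rmod R E by (rule rmodI, fact)
  note ZD = E.submoduleD[OF Z]
  have "x \<in> J \<longrightarrow> baer R J E Z" using J(1)
  proof (induction J rule: ideal_induct[consumes 1])
    case (1 J)
    note JD = idealD[OF 1(1)]
    show ?case unfolding baer_def
    proof (intro impI allI)
      fix h assume xJ: "x \<in> J" and h: "lin R ((self_module R)\<lparr>carrier := J\<rparr>) E h" and hZ: "\<forall>a\<in>J. h a \<in> Z"
      note hD = lin_idealD[OF h]
      show "\<exists>c\<in>Z. \<forall>a\<in>J. h a = a *\<^sub>E c"
      proof (cases "J = carrier R")
        case True
        have lin1: "h a = a *\<^sub>E h \<one>" if "a \<in> J" for a
        proof -
          have "h (a \<otimes> \<one>) = a *\<^sub>E h \<one>" using hD(3)[of a \<one>] that True by simp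
          thus ?thesis using that True by simp
        qed
        have "h \<one> \<in> Z" using hZ True by simp
        thus ?thesis using lin1 by (intro bexI ballI)
      next
        case False
        obtain u where u: "u \<in> R" "u \<notin> J" "\<And>z. z \<in> \<mm> ==> z \<otimes> u \<in> J"
          using ideal_socle[OF 1(1) False x xJ] by blast
        have "lin R ((self_module R)\<lparr>carrier := \<mm>\<rparr>) E (\<lambda>z. h (z \<otimes> u))"
          unfolding lin_ideal_iff using u(1,3) hD m_closed' by (simp add: l_distr m_assoc)
        moreover have "\<forall>z\<in>\<mm>. h (z \<otimes> u) \<in> Z" using hZ u by auto
        ultimately obtain c where c: "c \<in> Z" "\<And>z. z \<in> \<mm> ==> h (z \<otimes> u) = z *\<^sub>E c"
          using max unfolding baer_def by blast
        note cE = ZD(1)[OF c(1)]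
        define J1 where "J1 = {r \<otimes> u \<oplus> w |r w. r \<in> R \<and> w \<in> J}"
        obtain g where g: "lin R ((self_module R)\<lparr>carrier := J1\<rparr>) E g"
          "\<And>r w. r \<in> R ==> w \<in> J ==> g (r \<otimes> u \<oplus> w) = r *\<^sub>E c +\<^sub>E h w"
          unfolding J1_def using E.extend_hom[OF 1(1) u(1) cE h] c(2) colon_socle[OF 1(1) u(1,2)] by blast
        have J1: "ideal J1 R" "J \<subseteq> J1" "u \<in> J1"
          using adjoin_ideal[OF 1(1) u(1)] adjoin_ideal_incl[OF 1(1) u(1)] by (auto simp: J1_def)
        hence "baer R J1 E Z" using 1(2)[of J1] u(2) xJ by auto
        moreover have "\<forall>a\<in>J1. g a \<in> Z" using g(2) c(1) hZ ZD by (auto simp: J1_def)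
        ultimately obtain c1 where c1: "c1 \<in> Z" "\<forall>a\<in>J1. g a = a *\<^sub>E c1" using g(1) unfolding baer_def by blast
        have "h a = a *\<^sub>E c1" if a: "a \<in> J" for a
        proof -
          have "g a = h a" using g(2)[OF zero_closed a] JD(1)[OF a] u(1) cE hD a by simp
          thus ?thesis using c1(2) J1(2) a by auto
        qed
        thus ?thesis using c1(1) by auto
      qed
    qed
  qed
  thus ?thesis using J(2) by blast
qed

text \<open>Dimension shifting: the obstruction to extending a map from \<open>\<mm>\<close> into \<open>im d\<close> lies in the next
  cosyzygy, since \<open>R / \<mm>\<close> embeds into \<open>R / x R\<close>, which has projective dimension one.\<close>

lemma baer_step:
  assumes x: "nonzerodivisor R x" "x \<in> \<mm>"
    and E: "injective_module R E" "module R E'" and d: "lin R E E' d"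
    and div: "\<And>v. v \<in> E ==> d v = 0\<^sub>E' ==>
      \<exists>w\<in>E. d w = 0\<^sub>E' \<and> v = x *\<^sub>E w"
    and next_baer: "\<And>J. ideal J R ==> x \<in> J ==> baer R J E' (d ` carrier E)"
  shows "baer R \<mm> E {v \<in> E. d v = 0\<^sub>E'}" unfolding baer_def
proof (intro impI allI)
  have Em: "module R E" using E(1) by (simp add: injective_module_def)
  interpret E: rmod R E by (rule rmodI, fact)
  interpret E': rmod R E' by (rule rmodI, fact)
  have xR: "x \<in> R" using x(1) by (simp add: nonzerodivisor_def)
  fix g assume g: "lin R ((self_module R)\<lparr>carrier := \<mm>\<rparr>) E g" and gZ: "\<forall>a\<in>\<mm>. g a \<in> {v \<in> carrier E. d v = 0\<^sub>E'}"
  obtain e where e: "e \<in> E" "\<And>z. z \<in> \<mm> ==> g z = z *\<^sub>E e" using injective_baer[OF E(1) m_ideal g] by blast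
  define P where "P = PIdl x"
  have P: "ideal P R" unfolding P_def by (rule cgenideal_ideal[OF xR])
  have xP: "x \<in> P" unfolding P_def by (rule cgenideal_self[OF xR])
  have "P \<subseteq> \<mm>" unfolding P_def by (rule cgenideal_minimal[OF m_ideal x(2)])
  hence "P \<noteq> carrier R" using one_notin_m by auto
  then obtain s where s: "s \<in> R" "s \<notin> P" "\<And>z. z \<in> \<mm> ==> z \<otimes> s \<in> P" using ideal_socle[OF P _ x(1) xP] by blast
  have de: "d e \<in> E'" using linD(1)[OF d e(1)] .
  have kill: "r *\<^sub>E' d e = 0\<^sub>E'" if "r \<in> R" "r \<otimes> s \<in> P" for r
  proof -
    have "r \<in> \<mm>" using colon_socle[OF P s(1,2) that] .
    hence "d (r *\<^sub>E e) = 0\<^sub>E'" using e(2) gZ by force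
    thus ?thesis using linD(3)[OF d that(1) e(1)] by simp
  qed
  define J1 where "J1 = {r \<otimes> s \<oplus> w |r w. r \<in> R \<and> w \<in> P}"
  have J1: "ideal J1 R" "P \<subseteq> J1" "s \<in> J1"
    using adjoin_ideal[OF P s(1)] adjoin_ideal_incl[OF P s(1)] by (auto simp: J1_def)
  \<comment> \<open>The obstruction to correcting e, read on R s + R x: it vanishes on R x and takes
    s to d e.\<close>
  obtain h where h: "lin R ((self_module R)\<lparr>carrier := J1\<rparr>) E' h"
    "\<And>r w. r \<in> R ==> w \<in> P ==> h (r \<otimes> s \<oplus> w) = r *\<^sub>E' d e"
    unfolding J1_def using E'.extend_zero_hom[OF P s(1) de] kill by blast
  have "\<forall>a\<in>J1. h a \<in> d ` carrier E"
  proof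
    fix a assume "a \<in> J1"
    then obtain r w where a: "r \<in> R" "w \<in> P" "a = r \<otimes> s \<oplus> w" by (auto simp: J1_def)
    hence "h a = d (r *\<^sub>E e)" using h(2) linD(3)[OF d _ e(1)] by auto
    thus "h a \<in> d ` carrier E" using a e by auto
  qed
  then obtain c' where c': "c' \<in> d ` carrier E" "\<forall>a\<in>J1. h a = a *\<^sub>E' c'"
    using next_baer[OF J1(1)] J1(2) xP h(1) unfolding baer_def by blast
  then obtain e' where e': "e' \<in> E" "c' = d e'" by auto
  have "h x = 0\<^sub>E'" using h(2)[OF zero_closed xP] xR s(1) de by simp
  hence "d (x *\<^sub>E e') = 0\<^sub>E'" using c'(2) J1(2) xP e' linD(3)[OF d xR e'(1)] by auto
  then obtain c1 where c1: "c1 \<in> E" "d c1 = 0\<^sub>E'" "x *\<^sub>E e' = x *\<^sub>E c1"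
    using div[of "x *\<^sub>E e'"] e'(1) xR by auto
  \<comment> \<open>x e' lies in ker d, and ker d is divisible by x. Subtracting c1 achieves x e2 =
    0 without changing the image under d. Then d (s e2) = d e, and z s e2 = 0 for z in \<mm> because
    z s is a multiple of x; so e - s e2 lies in ker d and still represents g.\<close>
  define e2 where "e2 = e' -\<^sub>E c1"
  have e2: "e2 \<in> E" "x *\<^sub>E e2 = 0\<^sub>E" "d e2 = d e'"
  proof -
    show "e2 \<in> E" using e' c1 by (simp add: e2_def)
    show "x *\<^sub>E e2 = 0\<^sub>E"
      unfolding e2_def E.smult_minus_r[OF xR e'(1) c1(1)] using e' c1 xR by (simp add: E.minus_eq_iff)
    show "d e2 = d e'" using lin_minus[OF Em E(2) d e'(1) c1(1)] linD(1)[OF d e'(1)] c1(2) E'.minus_zero_right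
      by (simp add: e2_def)
  qed
  have "h s = d e" using h(2)[OF one_closed idealD(2)[OF P]] s(1) de by simp
  hence "d (s *\<^sub>E e2) = d e" using c'(2) J1(3) e' e2 linD(3)[OF d s(1) e2(1)] by auto
  hence dc: "d (e -\<^sub>E s *\<^sub>E e2) = 0\<^sub>E'"
    using lin_minus[OF Em E(2) d e(1), of "s *\<^sub>E e2"] e2(1) s(1) de E'.minus_eq_iff by auto
  have "g z = z *\<^sub>E (e -\<^sub>E s *\<^sub>E e2)" if z: "z \<in> \<mm>" for z
  proof -
    obtain r where r: "r \<in> R" "z \<otimes> s = r \<otimes> x" using s(3)[OF z] by (auto simp: P_def cgenideal_def)
    have "z *\<^sub>E (s *\<^sub>E e2) = r *\<^sub>E (x *\<^sub>E e2)"
      using r z m_closed' s(1) xR e2(1) by (simp add: E.smult_assoc1[symmetric])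
    also have "\<dots> = 0\<^sub>E" using e2 r by simp
    finally show ?thesis
      using e z m_closed' s(1) e2(1) E.smult_minus_r[of z e "s *\<^sub>E e2"] E.minus_zero_right by simp
  qed
  thus "\<exists>c\<in>{v \<in> E. d v = 0\<^sub>E'}. \<forall>a\<in>\<mm>. g a = a *\<^sub>E c" using dc e(1) e2(1) s(1) by blast
qed

text \<open>Downward induction from the end of the finite injective resolution, beyond which the
  cosyzygies vanish. The image of E j under d j is divisible by x because the injective module E j
  is; this is what \<open>baer_step\<close> asks for.\<close>

lemma baer_cosyzygies:
  assumes x: "nonzerodivisor R x" "x \<in> \<mm>" and res: "injective_resolution R W E d e"
    and fin: "\<forall>i>n. carrier (E i) = {\<zero>\<^bsub>E i\<^esub>}"
  shows "ideal J R ==> x \<in> J ==> baer R J (E (Suc j)) (d j ` carrier (E j))"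
proof (induction "Suc n - j" arbitrary: j J)
  have inj: "\<And>i. injective_module R (E i)" and d: "\<And>i. d i \<in> module_homs R (E i) (E (Suc i))"
    and ex: "\<And>i. d i ` carrier (E i) = a_kernel (E (Suc i)) (E (Suc (Suc i))) (d (Suc i))"
    using res by (auto simp: injective_resolution_def)
  have Em: "\<And>i. module R (E i)" using inj by (simp add: injective_module_def)
  have dl: "\<And>i. lin R (E i) (E (Suc i)) (d i)" by (rule module_homs_imp_lin[OF d])
  {
    case 0
    hence c: "carrier (E (Suc j)) = {\<zero>\<^bsub>E (Suc j)\<^esub>}" using fin by auto
    interpret E: rmod R "E j" by (rule rmodI, rule Em)
    interpret F: rmod R "E (Suc j)" by (rule rmodI, rule Em)
    have "d j ` carrier (E j) = {\<zero>\<^bsub>E (Suc j)\<^esub>}"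
      using linD(1)[OF dl, of _ j] c lin_zero[OF Em Em dl, of j] E.M.zero_closed by force
    thus ?case using idealD(1)[OF 0(2)] by (auto simp: baer_def)
  next
    case (Suc k)
    interpret E: rmod R "E j" by (rule rmodI, rule Em)
    interpret F: rmod R "E (Suc j)" by (rule rmodI, rule Em)
    have xR: "x \<in> R" using x(1) by (simp add: nonzerodivisor_def)
    have Z: "d j ` carrier (E j) = {v \<in> carrier (E (Suc j)). d (Suc j) v = \<zero>\<^bsub>E (Suc (Suc j))\<^esub>}"
      using ex[of j] by (auto simp: a_kernel_def' )
    have "baer R \<mm> (E (Suc j)) {v \<in> carrier (E (Suc j)). d (Suc j) v = \<zero>\<^bsub>E (Suc (Suc j))\<^esub>}"
    proof (rule baer_step[OF x inj Em dl])
      show "baer R J (E (Suc (Suc j))) (d (Suc j) ` carrier (E (Suc j)))" if "ideal J R" "x \<in> J" for J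
        by (rule Suc.hyps(1)) (use Suc.hyps(2) that in auto)
      fix v assume "v \<in> carrier (E (Suc j))" "d (Suc j) v = \<zero>\<^bsub>E (Suc (Suc j))\<^esub>"
      hence "v \<in> d j ` carrier (E j)" using Z by auto
      then obtain u where u: "u \<in> E j" "v = d j u" by auto
      obtain w where w: "w \<in> E j" "u = x \<odot>\<^bsub>E j\<^esub> w" using E.injective_divisible[OF inj x(1) u(1)] by auto
      have "d j w \<in> d j ` carrier (E j)" using w by auto
      thus "\<exists>w\<in>carrier (E (Suc j)). d (Suc j) w = \<zero>\<^bsub>E (Suc (Suc j))\<^esub> \<and> v = x \<odot>\<^bsub>E (Suc j)\<^esub> w"
        using Z u w linD(3)[OF dl xR w(1)] by auto
    qed
    moreover have "submodule {v \<in> carrier (E (Suc j)). d (Suc j) v = \<zero>\<^bsub>E (Suc (Suc j))\<^esub>} R (E (Suc j))"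
      by (rule F.kernel_submodule[OF Em dl])
    ultimately show ?case using baer_if_baer_maximal[OF x(1) Em _ _ Suc.prems] Z by metis
  }
qed

end

section \<open>Homotheties of W / x W and of W\<close>

context dim_one_ring
begin

text \<open>This is the injectivity of W / x W over R / x R, in the case of the map u -> s on (J + R
  u) / J. Regard W as a submodule of E 0. The map z -> z s / x from \<mm> to W is multiplication by
  some t in E 0, and the vanishing for the first cosyzygy gives e' in E 0 with u e' - t in W and J
  e' inside W. The wanted w is x e', since x t = s.\<close>

lemma socle_lifting:
  assumes x: "nonzerodivisor R x" "x \<in> \<mm>" and W: "module R W"
    and xreg: "\<And>v. v \<in> W ==> x *\<^sub>W v = 0\<^sub>W ==> v = 0\<^sub>W"
    and res: "injective_resolution R W E d e" and fin: "\<forall>i>n. carrier (E i) = {\<zero>\<^bsub>E i\<^esub>}"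
    and J: "ideal J R" "x \<in> J" and u: "u \<in> R" "u \<notin> J" "\<And>z. z \<in> \<mm> ==> z \<otimes> u \<in> J"
    and s: "s \<in> W" "\<And>z. z \<in> \<mm> ==> \<exists>v\<in>W. z *\<^sub>W s = x *\<^sub>W v"
  obtains w where "w \<in> W" "\<And>a. a \<in> J ==> \<exists>v\<in>W. a *\<^sub>W w = x *\<^sub>W v"
    "\<exists>v\<in>W. u *\<^sub>W w = s +\<^sub>W x *\<^sub>W v"
proof -
  interpret W: rmod R W by (rule rmodI, fact)
  have inj: "\<And>i. injective_module R (E i)" and dl: "\<And>i. lin R (E i) (E (Suc i)) (d i)"
    and el: "lin R W (E 0) e" and einj: "inj_on e W"
    and ker: "e ` carrier W = {v \<in> E 0. d 0 v = \<zero>\<^bsub>E 1\<^esub>}"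
    using res by (auto simp: injective_resolution_def module_homs_imp_lin a_kernel_def')
  have Em: "\<And>i. module R (E i)" using inj by (simp add: injective_module_def)
  interpret E: rmod R "E 0" by (rule rmodI, rule Em)
  interpret F: rmod R "E 1" by (rule rmodI, rule Em)
  have xR: "x \<in> R" using x(1) by (simp add: nonzerodivisor_def)
  note xcancel = W.smult_cancel[OF xR xreg]
  note mD = idealD[OF m_ideal]
  interpret m: rmod R "(self_module R)\<lparr>carrier := \<mm>\<rparr>"
    by (rule rmodI, rule rmod.submodule_module[OF rmodI[OF self_module_module]]) (simp add: self_submodule_iff m_ideal)
  have sl: "lin R ((self_module R)\<lparr>carrier := \<mm>\<rparr>) W (\<lambda>z. z *\<^sub>W s)"
    by (rule linI) (auto simp: s(1) mD(1) W.smult_l_distr W.smult_assoc1)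
  have sx: "\<exists>v\<in>carrier W. z *\<^sub>W s = x *\<^sub>W v" if "z \<in> carrier ((self_module R)\<lparr>carrier := \<mm>\<rparr>)" for z
    using s(2) that by simp
  obtain g where g': "lin R ((self_module R)\<lparr>carrier := \<mm>\<rparr>) W g" "\<And>z. z \<in> carrier ((self_module R)\<lparr>carrier := \<mm>\<rparr>) ==> z *\<^sub>W s = x *\<^sub>W g z"
    by (rule W.lin_divide[OF xR xreg m.is_mod sl sx]) (assumption+, rule that)
  hence g: "\<And>z. z \<in> \<mm> ==> g z \<in> W" "\<And>z. z \<in> \<mm> ==> z *\<^sub>W s = x *\<^sub>W g z" using linD(1)[OF g'(1)] g'(2) by auto
  have "lin R ((self_module R)\<lparr>carrier := \<mm>\<rparr>) (E 0) (\<lambda>z. e (g z))" by (rule lin_comp[OF g'(1) el])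
  then obtain t where t: "t \<in> E 0" "\<And>z. z \<in> \<mm> ==> e (g z) = z \<odot>\<^bsub>E 0\<^esub> t"
    using injective_baer[OF inj m_ideal] by blast
  have de: "d 0 (e w) = \<zero>\<^bsub>E 1\<^esub>" if "w \<in> W" for w using ker that by auto
  have dt: "d 0 t \<in> E 1" using linD(1)[OF dl t(1)] by simp
  have kill: "r \<odot>\<^bsub>E 1\<^esub> d 0 t = \<zero>\<^bsub>E 1\<^esub>" if r: "r \<in> R" "r \<otimes> u \<in> J" for r
  proof -
    have "r \<in> \<mm>" using colon_socle[OF J(1) u(1,2) r] .
    hence "d 0 (r \<odot>\<^bsub>E 0\<^esub> t) = \<zero>\<^bsub>E 1\<^esub>" using de[OF g(1)] t(2) by simp
    thus ?thesis using linD(3)[OF dl r(1) t(1)] by simp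
  qed
  define J1 where "J1 = {r \<otimes> u \<oplus> w |r w. r \<in> R \<and> w \<in> J}"
  have J1: "ideal J1 R" "J \<subseteq> J1" "u \<in> J1"
    using adjoin_ideal[OF J(1) u(1)] adjoin_ideal_incl[OF J(1) u(1)] by (auto simp: J1_def)
  obtain h where h: "lin R ((self_module R)\<lparr>carrier := J1\<rparr>) (E 1) h"
    "\<And>r w. r \<in> R ==> w \<in> J ==> h (r \<otimes> u \<oplus> w) = r \<odot>\<^bsub>E 1\<^esub> d 0 t"
    unfolding J1_def using F.extend_zero_hom[OF J(1) u(1) dt] kill by blast
  have "baer R J1 (E 1) (d 0 ` carrier (E 0))"
    using baer_cosyzygies[OF x res fin J1(1), of 0] J1(2) J(2) by auto
  moreover have "\<forall>a\<in>J1. h a \<in> d 0 ` carrier (E 0)"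
  proof
    fix a assume "a \<in> J1"
    then obtain r w where a: "r \<in> R" "w \<in> J" "a = r \<otimes> u \<oplus> w" by (auto simp: J1_def)
    hence "h a = d 0 (r \<odot>\<^bsub>E 0\<^esub> t)" using h(2) linD(3)[OF dl _ t(1)] by auto
    thus "h a \<in> d 0 ` carrier (E 0)" using a t by auto
  qed
  ultimately obtain e' where e': "e' \<in> E 0" "\<And>a. a \<in> J1 ==> h a = a \<odot>\<^bsub>E 1\<^esub> d 0 e'"
    using h(1) unfolding baer_def by blast
  note JD = idealD[OF J(1)]
  have "\<exists>w\<in>W. a \<odot>\<^bsub>E 0\<^esub> e' = e w" if a: "a \<in> J" for a
  proof -
    have "h a = \<zero> \<odot>\<^bsub>E 1\<^esub> d 0 t" using h(2)[OF zero_closed a] JD(1)[OF a] u(1) by simp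
    also have "\<dots> = \<zero>\<^bsub>E 1\<^esub>" by (rule F.smult_l_null[OF dt])
    finally have "d 0 (a \<odot>\<^bsub>E 0\<^esub> e') = \<zero>\<^bsub>E 1\<^esub>" using e'(2)[of a] J1(2) a linD(3)[OF dl JD(1)[OF a] e'(1)] by auto
    thus ?thesis using ker JD(1)[OF a] e'(1) by blast
  qed
  then obtain f where f: "\<And>a. a \<in> J ==> f a \<in> W" "\<And>a. a \<in> J ==> a \<odot>\<^bsub>E 0\<^esub> e' = e (f a)" by metis
  have "h u = d 0 t" using h(2)[OF one_closed JD(2)] u(1) F.smult_one[OF dt] by simp
  hence "d 0 (u \<odot>\<^bsub>E 0\<^esub> e') = d 0 t" using e'(2)[OF J1(3)] linD(3)[OF dl u(1) e'(1)] by simp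
  moreover have "d 0 (u \<odot>\<^bsub>E 0\<^esub> e' \<ominus>\<^bsub>E 0\<^esub> t) = d 0 (u \<odot>\<^bsub>E 0\<^esub> e') \<ominus>\<^bsub>E 1\<^esub> d 0 t"
    using lin_minus[OF Em Em dl, of "u \<odot>\<^bsub>E 0\<^esub> e'" 0 t] e'(1) u(1) t(1) by simp
  ultimately have "d 0 (u \<odot>\<^bsub>E 0\<^esub> e' \<ominus>\<^bsub>E 0\<^esub> t) = \<zero>\<^bsub>E 1\<^esub>" using F.minus_eq_iff[OF dt dt] by simp
  moreover have "u \<odot>\<^bsub>E 0\<^esub> e' \<ominus>\<^bsub>E 0\<^esub> t \<in> E 0" using e'(1) u(1) t(1) by simp
  ultimately have "u \<odot>\<^bsub>E 0\<^esub> e' \<ominus>\<^bsub>E 0\<^esub> t \<in> e ` carrier W" unfolding ker by blast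
  then obtain w0 where w0: "w0 \<in> W" "u \<odot>\<^bsub>E 0\<^esub> e' \<ominus>\<^bsub>E 0\<^esub> t = e w0" by blast
  note swap = E.smult_swap
  show ?thesis
  proof (rule that[of "f x"])
    show "f x \<in> W" using f(1) J(2) by auto
    show "\<exists>v\<in>W. a *\<^sub>W f x = x *\<^sub>W v" if a: "a \<in> J" for a
    proof (intro bexI)
      show "f a \<in> W" using f(1) a by auto
      have "e (a *\<^sub>W f x) = e (x *\<^sub>W f a)"
        using linD(3)[OF el JD(1)[OF a] f(1)[OF J(2)]] linD(3)[OF el xR f(1)[OF a]] f(2)[OF a] f(2)[OF J(2)]
          swap[OF JD(1)[OF a] xR e'(1)] by simp
      thus "a *\<^sub>W f x = x *\<^sub>W f a" using inj_onD[OF einj] JD(1)[OF a] xR f(1)[OF a] f(1)[OF J(2)] by auto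
    qed
    show "\<exists>v\<in>W. u *\<^sub>W f x = s +\<^sub>W x *\<^sub>W v"
    proof (intro bexI)
      show "w0 \<in> W" by fact
      have gx: "g x = s" using xcancel[of "g x" s] g(1)[OF x(2)] g(2)[OF x(2)] s(1) by simp
      have "u \<odot>\<^bsub>E 0\<^esub> e' = t \<oplus>\<^bsub>E 0\<^esub> e w0"
        unfolding w0(2)[symmetric] using e'(1) t(1) u(1) by (simp add: a_minus_def E.add_minus_cancel)
      hence "x \<odot>\<^bsub>E 0\<^esub> (u \<odot>\<^bsub>E 0\<^esub> e') = e s \<oplus>\<^bsub>E 0\<^esub> e (x *\<^sub>W w0)"
        using t(2)[OF x(2)] gx t(1) linD(1)[OF el w0(1)] linD(3)[OF el xR w0(1)] xR
        by (simp add: E.smult_r_distr)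
      hence "e (u *\<^sub>W f x) = e (s +\<^sub>W x *\<^sub>W w0)"
        using linD(3)[OF el u(1) f(1)[OF J(2)]] f(2)[OF J(2)] swap[OF u(1) xR e'(1)]
          linD(2)[OF el s(1), of "x *\<^sub>W w0"] w0(1) xR by simp
      thus "u *\<^sub>W f x = s +\<^sub>W x *\<^sub>W w0" using inj_onD[OF einj] u(1) f(1)[OF J(2)] s(1) w0(1) xR by auto
    qed
  qed
qed

text \<open>Matlis duality for \<open>R / x R\<close>, proved directly along ideals \<open>J \<supset> x R\<close>: each step
  from \<open>J + R u\<close> to \<open>J\<close> adds one copy of the residue field on both sides.\<close>

lemma homotheties_of_annihilated:
  fixes Q :: "('r, 'q) module"
  assumes x: "nonzerodivisor R x" and Q: "module R Q"
    and s: "s \<in> Q" "s \<noteq> 0\<^sub>Q" "\<And>z. z \<in> \<mm> ==> z *\<^sub>Q s = 0\<^sub>Q"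
    and soc: "\<And>w. w \<in> Q ==> (\<And>z. z \<in> \<mm> ==> z *\<^sub>Q w = 0\<^sub>Q) ==>
      \<exists>r\<in>R. w = r *\<^sub>Q s"
    and lift: "\<And>J u. ideal J R ==> x \<in> J ==> u \<in> R ==> u \<notin> J ==> (\<And>z. z \<in> \<mm> ==> z \<otimes> u \<in> J) ==>
      \<exists>e\<in>Q. (\<forall>a\<in>J. a *\<^sub>Q e = 0\<^sub>Q) \<and> u *\<^sub>Q e = s"
    and J: "ideal J R" "x \<in> J"
  shows "(\<forall>h. lin R (Q\<lparr>carrier := {e \<in> carrier Q. \<forall>a\<in>J. a *\<^sub>Q e = 0\<^sub>Q}\<rparr>) Q h \<longrightarrow>
      (\<exists>a\<in>R. \<forall>e\<in>Q. (\<forall>a\<in>J. a *\<^sub>Q e = 0\<^sub>Q) \<longrightarrow> h e = a *\<^sub>Q e)) \<and>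
    (\<forall>a\<in>R. (\<forall>e\<in>Q. (\<forall>a\<in>J. a *\<^sub>Q e = 0\<^sub>Q) \<longrightarrow> a *\<^sub>Q e = 0\<^sub>Q) \<longrightarrow> a \<in> J)"
proof -
  interpret Q: rmod R Q by (rule rmodI, fact)
  define A where "A J = {e \<in> Q. \<forall>a\<in>J. a *\<^sub>Q e = 0\<^sub>Q}" for J
  note swap = Q.smult_swap
  have Asub: "submodule (A J) R Q" if J: "ideal J R" for J
    by (rule Q.submoduleI') (use idealD(1)[OF J] swap in \<open>auto simp: A_def Q.smult_r_distr\<close>)
  have "x \<in> J \<longrightarrow> (\<forall>h. lin R (Q\<lparr>carrier := A J\<rparr>) Q h \<longrightarrow>
      (\<exists>a\<in>R. \<forall>e\<in>A J. h e = a *\<^sub>Q e)) \<and>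
    (\<forall>a\<in>R. (\<forall>e\<in>A J. a *\<^sub>Q e = 0\<^sub>Q) \<longrightarrow> a \<in> J)" using J(1)
  proof (induction J rule: ideal_induct[consumes 1])
    case (1 J)
    note J = 1(1) and JD = idealD[OF 1(1)]
    note AJ = Q.submoduleD[OF Asub[OF J]]
    show ?case
    proof (intro impI)
      assume xJ: "x \<in> J"
      show "(\<forall>h. lin R (Q\<lparr>carrier := A J\<rparr>) Q h \<longrightarrow> (\<exists>a\<in>carrier R. \<forall>e\<in>A J. h e = a *\<^sub>Q e)) \<and>
        (\<forall>a\<in>R. (\<forall>e\<in>A J. a *\<^sub>Q e = 0\<^sub>Q) \<longrightarrow> a \<in> J)"
      proof (cases "J = carrier R")
        case True
        have A0: "e = 0\<^sub>Q" if "e \<in> A J" for e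
        proof -
          have "\<one> *\<^sub>Q e = 0\<^sub>Q" using that True unfolding A_def by blast
          thus ?thesis using AJ(1)[OF that] by simp
        qed
        have "\<exists>a\<in>carrier R. \<forall>e\<in>A J. h e = a *\<^sub>Q e" if h: "lin R (Q\<lparr>carrier := A J\<rparr>) Q h" for h
        proof -
          have "h 0\<^sub>Q = 0\<^sub>Q" using lin_zero[OF Q.submodule_module[OF Asub[OF J]] Q h] by simp
          hence "h e = \<zero> *\<^sub>Q e" if "e \<in> A J" for e using A0[OF that] by simp
          thus ?thesis using zero_closed by blast
        qed
        thus ?thesis using True by simp
      next
        case False
        obtain u where u: "u \<in> R" "u \<notin> J" "\<And>z. z \<in> \<mm> ==> z \<otimes> u \<in> J" using ideal_socle[OF J False x xJ] by blast
        define J1 where "J1 = {r \<otimes> u \<oplus> w |r w. r \<in> R \<and> w \<in> J}"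
        have J1: "ideal J1 R" "J \<subseteq> J1" "u \<in> J1"
          using adjoin_ideal[OF J u(1)] adjoin_ideal_incl[OF J u(1)] by (auto simp: J1_def)
        have "J \<subset> J1" "x \<in> J1" using J1(2,3) u(2) xJ by auto
        note IH = mp[OF 1(2)[OF J1(1) this(1)] this(2)]
        have A1: "e \<in> A J1" if e: "e \<in> A J" "u *\<^sub>Q e = 0\<^sub>Q" for e
        proof -
          have "(r \<otimes> u \<oplus> w) *\<^sub>Q e = 0\<^sub>Q" if "r \<in> R" "w \<in> J" for r w
            using that e u(1) JD(1) by (simp add: A_def Q.smult_l_distr Q.smult_assoc1)
          thus ?thesis using AJ(1)[OF e(1)] by (auto simp: A_def J1_def)
        qed
        have A1': "A J1 \<subseteq> A J" using J1(2) by (auto simp: A_def)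
        have us: "\<exists>r\<in>R. u *\<^sub>Q e = r *\<^sub>Q s" if e: "e \<in> A J" for e
        proof (rule soc)
          show "u *\<^sub>Q e \<in> Q" using AJ(1)[OF e] u(1) by simp
          show "z *\<^sub>Q (u *\<^sub>Q e) = 0\<^sub>Q" if "z \<in> \<mm>" for z
            using u(3)[OF that] e u(1) m_closed'[OF that] by (simp add: A_def Q.smult_assoc1[symmetric])
        qed
        obtain e0 where "e0 \<in> Q" "\<forall>a\<in>J. a *\<^sub>Q e0 = 0\<^sub>Q" and ue0: "u *\<^sub>Q e0 = s" using lift[OF J xJ u] by blast
        hence e0: "e0 \<in> A J" by (simp add: A_def)
        note e0Q = AJ(1)[OF e0]
        have "\<exists>a\<in>carrier R. \<forall>e\<in>A J. h e = a *\<^sub>Q e" if h: "lin R (Q\<lparr>carrier := A J\<rparr>) Q h" for h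
        proof -
          have hD: "\<And>e. e \<in> A J ==> h e \<in> Q"
            "\<And>e e'. e \<in> A J ==> e' \<in> A J ==> h (e +\<^sub>Q e') = h e +\<^sub>Q h e'"
            "\<And>r e. r \<in> R ==> e \<in> A J ==> h (r *\<^sub>Q e) = r *\<^sub>Q h e" using h by (simp_all add: lin_def)
          have "lin R (Q\<lparr>carrier := A J1\<rparr>) Q h" by (rule linI) (use hD subsetD[OF A1'] in simp_all)
          then obtain a where a: "a \<in> R" "\<And>e. e \<in> A J1 ==> h e = a *\<^sub>Q e" using IH by blast
          \<comment> \<open>h is multiplication by a on the elements killed by J + R u. Since \<mm>
            e0 lies among these, the defect k at e0 is in the socle, so k = b s = b u e0. Every e
            killed by J is c e0 plus an element killed by J + R u, so a + b u is the scalar for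
            h.\<close>
          define k where "k = h e0 -\<^sub>Q a *\<^sub>Q e0"
          have kQ: "k \<in> Q" using hD(1)[OF e0] a(1) e0Q by (simp add: k_def)
          have "\<exists>b\<in>R. k = b *\<^sub>Q s"
          proof (rule soc[OF kQ])
            fix z assume z: "z \<in> \<mm>"
            note zR = m_closed'[OF z]
            have ze: "z *\<^sub>Q e0 \<in> A J1"
              by (rule A1) (use AJ(6)[OF zR e0] swap[OF u(1) zR e0Q] ue0 s(3)[OF z] in auto)
            have "z *\<^sub>Q k = h (z *\<^sub>Q e0) -\<^sub>Q a *\<^sub>Q (z *\<^sub>Q e0)"
              unfolding k_def using zR hD(3)[OF _ e0] hD(1)[OF e0] a(1) e0Q swap[OF zR a(1) e0Q]
              by (simp add: Q.smult_minus_r)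
            thus "z *\<^sub>Q k = 0\<^sub>Q" using a(2)[OF ze] a(1) zR e0Q Q.minus_eq_iff by simp
          qed
          then obtain b where b: "b \<in> R" "k = b *\<^sub>Q s" by blast
          have "h e = (a \<oplus> b \<otimes> u) *\<^sub>Q e" if e: "e \<in> A J" for e
          proof -
            note eQ = AJ(1)[OF e]
            obtain c where c: "c \<in> R" "u *\<^sub>Q e = c *\<^sub>Q s" using us[OF e] by blast
            define e1 where "e1 = e -\<^sub>Q c *\<^sub>Q e0"
            have ce0: "c *\<^sub>Q e0 \<in> A J" using AJ(6)[OF c(1) e0] .
            have e1J: "e1 \<in> A J" unfolding e1_def by (rule AJ(5)[OF e ce0])
            have "u *\<^sub>Q e1 = u *\<^sub>Q e -\<^sub>Q c *\<^sub>Q s"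
              unfolding e1_def using u(1) eQ c(1) e0Q swap[OF u(1) c(1) e0Q] ue0 by (simp add: Q.smult_minus_r)
            also have "\<dots> = 0\<^sub>Q" using c s(1) Q.minus_eq_iff by simp
            finally have "e1 \<in> A J1" using A1[OF e1J] by simp
            hence he1: "h e1 = a *\<^sub>Q e1" by (rule a(2))
            have e_eq: "e = e1 +\<^sub>Q c *\<^sub>Q e0"
              unfolding e1_def using eQ c(1) e0Q by (simp add: a_minus_def Q.M.a_assoc Q.M.l_neg)
            note e1Q = AJ(1)[OF e1J]
            have he0: "h e0 = a *\<^sub>Q e0 +\<^sub>Q b *\<^sub>Q s" unfolding b(2)[symmetric] k_def using hD(1)[OF e0] a(1) e0Q
              by (simp add: a_minus_def Q.add_minus_cancel)
            have "h e = h e1 +\<^sub>Q c *\<^sub>Q h e0" using hD(2)[OF e1J ce0] hD(3)[OF c(1) e0] e_eq by simp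
            also have "\<dots> = a *\<^sub>Q e1 +\<^sub>Q (c *\<^sub>Q (a *\<^sub>Q e0) +\<^sub>Q c *\<^sub>Q (b *\<^sub>Q s))"
              using he0 he1 c(1) a(1) e0Q b(1) s(1) by (simp add: Q.smult_r_distr)
            also have "\<dots> = (a *\<^sub>Q e1 +\<^sub>Q a *\<^sub>Q (c *\<^sub>Q e0)) +\<^sub>Q b *\<^sub>Q (u *\<^sub>Q e)"
              using c a(1) e0Q b(1) s(1) e1Q swap[OF c(1) a(1) e0Q] swap[OF c(1) b(1) s(1)]
              by (simp add: Q.M.a_assoc)
            also have "a *\<^sub>Q e1 +\<^sub>Q a *\<^sub>Q (c *\<^sub>Q e0) = a *\<^sub>Q e"
              using a(1) e1Q c(1) e0Q Q.smult_r_distr[of a e1 "c *\<^sub>Q e0"] e_eq by simp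
            finally show ?thesis using a(1) b(1) u(1) eQ by (simp add: Q.smult_l_distr Q.smult_assoc1)
          qed
          thus ?thesis using a(1) b(1) u(1) by (intro bexI[of _ "a \<oplus> b \<otimes> u"]) auto
        qed
        \<comment> \<open>By induction a = r u + w with w in J. Now a e0 = r s vanishes, which puts
          r into \<mm> and r u into J.\<close>
        moreover have "a \<in> J" if a: "a \<in> R" "\<And>e. e \<in> A J ==> a *\<^sub>Q e = 0\<^sub>Q" for a
        proof -
          have "a \<in> J1" using IH a A1' by blast
          then obtain r w where rw: "r \<in> R" "w \<in> J" "a = r \<otimes> u \<oplus> w" by (auto simp: J1_def)
          have "a *\<^sub>Q e0 = r *\<^sub>Q s"
            using rw u(1) JD(1) e0Q e0 ue0 s(1) by (simp add: A_def Q.smult_l_distr Q.smult_assoc1)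
          hence rs: "r *\<^sub>Q s = 0\<^sub>Q" using a(2)[OF e0] by simp
          have "r \<in> \<mm>"
          proof (rule ccontr)
            assume "r \<notin> \<mm>"
            hence U: "r \<in> Units R" using unit_if rw(1) by auto
            have "s = inv r *\<^sub>Q (r *\<^sub>Q s)" using U rw(1) s(1) by (simp add: Q.smult_assoc1[symmetric])
            thus False using rs s(2) U by simp
          qed
          thus ?thesis using rw JD(3)[OF u(3)] by simp
        qed
        ultimately show ?thesis by blast
      qed
    qed
  qed
  with J(2) have "(\<forall>h. lin R (Q\<lparr>carrier := A J\<rparr>) Q h \<longrightarrow>
      (\<exists>a\<in>R. \<forall>e\<in>A J. h e = a *\<^sub>Q e)) \<and>
    (\<forall>a\<in>R. (\<forall>e\<in>A J. a *\<^sub>Q e = 0\<^sub>Q) \<longrightarrow> a \<in> J)" by blast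
  thus ?thesis unfolding A_def mem_Collect_eq Ball_def imp_conjL by blast
qed

lemma fin_gen_Hom:
  fixes M :: "('r, 'm) module" and N :: "('r, 'n) module"
  assumes M: "fin_gen_module R M" and N: "fin_gen_module R N"
  shows "fin_gen_module R (Hom_module R M N)"
proof -
  note Nm = moduleD_fin_gen[OF N] and Mm = moduleD_fin_gen[OF M]
  interpret M: rmod R M by (rule rmodI, fact)
  interpret H: rmod R "Hom_module R M N" by (rule rmodI, rule Hom_module_module[OF Mm Nm])
  obtain A where A: "finite A" "A \<subseteq> M" "module_span R M A = carrier M" using M by (rule fin_gen_moduleD)
  obtain y and b :: nat where y: "A = y ` {i. i < b}" using A(1) by (auto simp: finite_conv_nat_seg_image)
  show ?thesis
  proof (rule H.fin_gen_if_embedding_family[OF noetherian_ring_axioms N])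
    show "lin R (Hom_module R M N) N (\<lambda>h. h (y i))" if "i < b" for i
      by (rule Hom_eval_lin) (use A(2) y that in auto)
    fix h assume h: "h \<in> Hom_module R M N" "\<And>i. i < b ==> h (y i) = 0\<^sub>N"
    hence hh: "h \<in> module_homs R M N" by simp
    have "h v = 0\<^sub>N" if "v \<in> M" for v
      by (rule M.lin_eq_on_span[OF Nm module_homs_imp_lin[OF hh] lin_const_zero[OF Nm] A(2)])
        (use h(2) y A(3) that in auto)
    hence "(\<lambda>v\<in>carrier M. h v) = (\<lambda>v\<in>carrier M. 0\<^sub>N)" by (rule restrict_ext)
    thus "h = \<zero>\<^bsub>Hom_module R M N\<^esub>" using module_homsD(4)[OF hh] by simp
  qed
qed

text \<open>Nakayama's lemma, twice. In End W every h is a homothety plus x times an endomorphism,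
  so the homotheties are everything. For the annihilator I of W, each member is x r with r again in
  I, as x acts injectively; so I = x I and I = 0.\<close>

lemma endomorphisms_from_quotient:
  fixes W :: "('r, 'w) module"
  assumes W: "fin_gen_module R W" and x: "x \<in> \<mm>" "nonzerodivisor R x"
    and xreg: "\<And>v. v \<in> W ==> x *\<^sub>W v = 0\<^sub>W ==> v = 0\<^sub>W"
    and endo: "\<And>h. lin R W W h ==> \<exists>a\<in>R. \<forall>v\<in>W. \<exists>w\<in>W. h v = a *\<^sub>W v +\<^sub>W x *\<^sub>W w"
    and ann: "\<And>a. a \<in> R ==> (\<And>v. v \<in> W ==> \<exists>w\<in>W. a *\<^sub>W v = x *\<^sub>W w) ==>
      \<exists>r\<in>R. a = x \<otimes> r"
  shows "\<And>h. lin R W W h ==> \<exists>a\<in>R. \<forall>v\<in>W. h v = a *\<^sub>W v"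
    and "\<And>a. a \<in> R ==> (\<And>v. v \<in> W ==> a *\<^sub>W v = 0\<^sub>W) ==> a = \<zero>"
proof -
  have Wm: "module R W" by (rule moduleD_fin_gen[OF W])
  interpret W: rmod R W by (rule rmodI, fact)
  have xR: "x \<in> R" using x(1) m_closed' by auto
  define H where "H = Hom_module R W W"
  have Hm: "module R H" unfolding H_def by (rule Hom_module_module[OF Wm Wm])
  interpret H: rmod R H by (rule rmodI, fact)
  have Hfg: "fin_gen_module R H" unfolding H_def by (rule fin_gen_Hom[OF W W])
  define Y where "Y = {h \<in> H. \<exists>a\<in>R. \<forall>v\<in>W. h v = a *\<^sub>W v}"
  have Y: "submodule Y R H"
  proof (rule H.submoduleI')
    show "Y \<subseteq> H" by (auto simp: Y_def)
    show "0\<^sub>H \<in> Y" unfolding Y_def using H.M.zero_closed by (auto simp: H_def intro!: bexI[of _ \<zero>])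
    show "f +\<^sub>H g \<in> Y" if fg: "f \<in> Y" "g \<in> Y" for f g
    proof -
      obtain a b where ab: "a \<in> R" "b \<in> R" "\<forall>v\<in>W. f v = a *\<^sub>W v"
        "\<forall>v\<in>W. g v = b *\<^sub>W v" using fg by (auto simp: Y_def)
      have "f +\<^sub>H g \<in> H" using fg by (auto simp: Y_def)
      moreover have "\<forall>v\<in>W. (f +\<^sub>H g) v = (a \<oplus> b) *\<^sub>W v" using ab by (simp add: H_def W.smult_l_distr)
      ultimately show ?thesis using ab unfolding Y_def by blast
    qed
    show "r *\<^sub>H f \<in> Y" if rf: "r \<in> R" "f \<in> Y" for r f
    proof -
      obtain a where a: "a \<in> R" "\<forall>v\<in>W. f v = a *\<^sub>W v" using rf by (auto simp: Y_def)
      have "r *\<^sub>H f \<in> H" using rf by (auto simp: Y_def)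
      moreover have "\<forall>v\<in>W. (r *\<^sub>H f) v = (r \<otimes> a) *\<^sub>W v" using a rf by (simp add: H_def W.smult_assoc1)
      ultimately show ?thesis using a rf(1) unfolding Y_def by blast
    qed
  qed
  obtain B where B: "finite B" "B \<subseteq> H" "module_span R H B = carrier H" using Hfg by (rule fin_gen_moduleD)
  have "Y = carrier H"
  proof (rule ccontr)
    assume "Y \<noteq> carrier H"
    then obtain Z where Z: "submodule Z R H" "Y \<subseteq> Z" "Z \<noteq> carrier H"
      "\<And>z v. z \<in> \<mm> ==> v \<in> H ==> z *\<^sub>H v \<in> Z" using nakayama[OF Hm Y _ B] by blast
    have "h \<in> Z" if h: "h \<in> H" for h
    proof -
      have hh: "h \<in> module_homs R W W" using h by (simp add: H_def)
      note hD = module_homsD[OF hh]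
      obtain a where a: "a \<in> R" "\<forall>v\<in>W. \<exists>w\<in>W. h v = a *\<^sub>W v +\<^sub>W x *\<^sub>W w"
        using endo[OF module_homs_imp_lin[OF hh]] by blast
      have kl: "lin R W W (\<lambda>v. h v -\<^sub>W a *\<^sub>W v)"
        unfolding a_minus_def by (rule linI) (simp_all add: hD(1-3) a(1) W.smult_r_distr W.M.minus_add W.M.a_ac W.smult_r_minus W.smult_swap)
      have kx: "\<exists>w\<in>W. h v -\<^sub>W a *\<^sub>W v = x *\<^sub>W w" if v: "v \<in> W" for v
      proof -
        obtain w where "w \<in> W" "h v = a *\<^sub>W v +\<^sub>W x *\<^sub>W w" using a(2) v by blast
        thus ?thesis using a(1) v xR by (intro bexI[of _ w]) (simp_all add: a_minus_def W.M.a_ac W.add_minus_cancel)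
      qed
      obtain g where gl: "lin R W W g" and xg: "\<And>v. v \<in> W ==> h v -\<^sub>W a *\<^sub>W v = x *\<^sub>W g v"
        by (rule W.lin_divide[OF xR xreg Wm kl kx]) (assumption+, rule that)
      have g: "h v = a *\<^sub>W v +\<^sub>W x *\<^sub>W g v" if v: "v \<in> W" for v
        using hD(1)[OF v] a(1) v by (simp add: xg[OF v, symmetric] a_minus_def W.add_minus_cancel)
      define g' where "g' = restrict g W"
      define f where "f = (\<lambda>v\<in>W. a *\<^sub>W v)"
      have g'H: "g' \<in> H" unfolding g'_def H_def using lin_restrict[OF Wm gl] by simp
      have "f \<in> module_homs R W W" unfolding f_def by (intro lin_restrict[OF Wm] W.lin_homothety a(1))
      hence "f \<in> Y" using a(1) by (auto simp: Y_def H_def f_def)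
      have "f +\<^sub>H x *\<^sub>H g' = (\<lambda>v\<in>W. h v)" using g by (auto simp: H_def f_def g'_def)
      hence "h = f +\<^sub>H x *\<^sub>H g'" using hD(4) by simp
      thus ?thesis using H.submoduleD(3)[OF Z(1)] Z(2) Z(4)[OF x(1) g'H] \<open>f \<in> Y\<close> by auto
    qed
    thus False using Z(3) H.submoduleD(1)[OF Z(1)] by blast
  qed
  thus "\<exists>a\<in>R. \<forall>v\<in>W. h v = a *\<^sub>W v" if h: "lin R W W h" for h
  proof -
    have "restrict h W \<in> Y" using lin_restrict[OF Wm h] \<open>Y = carrier H\<close> by (simp add: H_def)
    thus ?thesis by (simp add: Y_def)
  qed
next
  have Wm: "module R W" by (rule moduleD_fin_gen[OF W])
  interpret W: rmod R W by (rule rmodI, fact)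
  interpret S: rmod R "self_module R" by (rule rmodI, rule self_module_module)
  have xR: "x \<in> R" using x(1) m_closed' by auto
  define I where "I = {a \<in> R. \<forall>v\<in>W. a *\<^sub>W v = 0\<^sub>W}"
  have I: "ideal I R" by (rule cring_idealI) (auto simp: I_def W.smult_l_distr W.smult_assoc1)
  hence IS: "submodule I R (self_module R)" using self_submodule_iff by simp
  define N where "N = (self_module R)\<lparr>carrier := I\<rparr>"
  have Nm: "module R N" unfolding N_def by (rule S.submodule_module[OF IS])
  interpret N: rmod R N by (rule rmodI, fact)
  have "fin_gen_module R N"
    unfolding N_def by (rule S.fin_gen_submodule[OF noetherian_ring_axioms self_module_fin_gen IS])
  then obtain B where B: "finite B" "B \<subseteq> N" "module_span R N B = carrier N" by (rule fin_gen_moduleD)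
  have "{0\<^sub>N} = carrier N"
  proof (rule ccontr)
    assume "{0\<^sub>N} \<noteq> carrier N"
    then obtain Z where Z: "submodule Z R N" "Z \<noteq> carrier N"
      "\<And>z v. z \<in> \<mm> ==> v \<in> N ==> z *\<^sub>N v \<in> Z" using nakayama[OF Nm N.submodule_zero _ B] by metis
    have "a \<in> Z" if a: "a \<in> N" for a
    proof -
      have aI: "a \<in> R" "\<forall>v\<in>W. a *\<^sub>W v = 0\<^sub>W" using a by (auto simp: N_def I_def)
      have "\<exists>r\<in>R. a = x \<otimes> r" by (rule ann[OF aI(1)]) (use aI xR in \<open>auto intro!: bexI[of _ "0\<^sub>W"]\<close>)
      then obtain r where r: "r \<in> R" "a = x \<otimes> r" by blast
      have "r *\<^sub>W v = 0\<^sub>W" if v: "v \<in> W" for v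
        using xreg[of "r *\<^sub>W v"] aI(2) v r xR by (simp add: W.smult_assoc1)
      hence "r \<in> N" using r(1) by (simp add: N_def I_def)
      from Z(3)[OF x(1) this] show ?thesis using r(2) by (simp add: N_def)
    qed
    thus False using Z(2) N.submoduleD(1)[OF Z(1)] by blast
  qed
  thus "a = \<zero>" if "a \<in> R" "\<And>v. v \<in> W ==> a *\<^sub>W v = 0\<^sub>W" for a using that by (auto simp: N_def I_def)
qed

end

section \<open>Projective resolutions and Ext^1 of the residue field\<close>

lemma (in rmod) submodule_cover:
  assumes "noetherian_ring R" "fin_gen_module R M" "submodule N R M"
  obtains b g where "lin R (free_mod R b) M g" "g ` carrier (free_mod R b) = N"
proof -
  obtain B where B: "finite B" "B \<subseteq> N" "module_span R M B = N" using fg_submodule[OF assms] by blast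
  obtain y and b :: nat where y: "B = y ` {i. i < b}" using B(1) by (auto simp: finite_conv_nat_seg_image)
  have yc: "\<And>i. i < b ==> y i \<in> M" using B(2) y submoduleD(1)[OF assms(3)] by auto
  show ?thesis
    by (rule that[OF comb_lin[of b y]]) (use yc comb_image[of b y] B(3) y in \<open>auto simp: lessThan_def\<close>)
qed

text \<open>\<open>Ext_module\<close> chooses a resolution, so one has to exist. The recursion
  carries a pair: the rank b of the current free module and the submodule K of it that the next free
  module has to cover.\<close>

lemma (in local_noetherian) exists_projective_resolution:
  fixes M :: "('r, 'm) module"
  assumes fg: "fin_gen_module R M"
  obtains P d e where "projective_resolution R M P d e"
proof -
  interpret M: rmod R M by (rule rmodI, rule moduleD_fin_gen[OF fg])
  obtain b0 g0 where g0: "lin R (free_mod R b0) M g0" "g0 ` carrier (free_mod R b0) = carrier M"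
    using M.fin_gen_cover[OF fg] .
  define K0 where "K0 = {f \<in> free_mod R b0. g0 f = 0\<^sub>M}"
  have ker_sub: "submodule {f \<in> free_mod R b. g f = 0\<^sub>N} R (free_mod R b)"
    if "module R N" "lin R (free_mod R b) N g" for b g and N :: "('r, 'n) module"
  proof -
    interpret F: rmod R "free_mod R b" by (rule rmodI, rule free_mod_module)
    show ?thesis by (rule F.kernel_submodule[OF that])
  qed
  have ex: "\<exists>bg. lin R (free_mod R (fst bg)) (free_mod R b) (snd bg) \<and>
      snd bg ` carrier (free_mod R (fst bg)) = K" if K: "submodule K R (free_mod R b)" for b K
  proof -
    interpret F: rmod R "free_mod R b" by (rule rmodI, rule free_mod_module)
    obtain b' g' where "lin R (free_mod R b') (free_mod R b) g'" "g' ` carrier (free_mod R b') = K"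
      using F.submodule_cover[OF noetherian_ring_axioms free_mod_fin_gen K] .
    thus ?thesis by (intro exI[of _ "(b', g')"]) simp
  qed
  define c where "c b K = (SOME bg. lin R (free_mod R (fst bg)) (free_mod R b) (snd bg) \<and>
      snd bg ` carrier (free_mod R (fst bg)) = K)" for b K
  have c: "lin R (free_mod R (fst (c b K))) (free_mod R b) (snd (c b K)) \<and>
      snd (c b K) ` carrier (free_mod R (fst (c b K))) = K" if "submodule K R (free_mod R b)" for b K
    unfolding c_def by (rule someI_ex[OF ex[OF that]])
  define step where "step = (\<lambda>(b, K). (fst (c b K),
    {f \<in> carrier (free_mod R (fst (c b K))). snd (c b K) f = \<zero>\<^bsub>free_mod R b\<^esub>}))"
  define st where "st = rec_nat (b0, K0) (\<lambda>_. step)"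
  have st0: "st 0 = (b0, K0)" and stS: "st (Suc i) = step (st i)" for i by (simp_all add: st_def)
  define \<beta> where "\<beta> i = fst (st i)" for i
  define \<kappa> where "\<kappa> i = snd (st i)" for i
  define \<gamma> where "\<gamma> i = snd (c (\<beta> i) (\<kappa> i))" for i
  have \<beta>S: "\<beta> (Suc i) = fst (c (\<beta> i) (\<kappa> i))" for i by (simp add: \<beta>_def \<kappa>_def stS step_def split_beta)
  have \<kappa>S: "\<kappa> (Suc i) = {f \<in> carrier (free_mod R (\<beta> (Suc i))). \<gamma> i f = \<zero>\<^bsub>free_mod R (\<beta> i)\<^esub>}" for i
    by (simp add: \<beta>_def \<kappa>_def \<gamma>_def stS step_def split_beta)
  have \<kappa>: "submodule (\<kappa> i) R (free_mod R (\<beta> i))" for i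
  proof (induction i)
    case 0
    show ?case using ker_sub[OF M.is_mod g0(1)] by (simp add: \<kappa>_def \<beta>_def st0 K0_def)
  next
    case (Suc i)
    show ?case unfolding \<kappa>S by (rule ker_sub[OF free_mod_module]) (use c[OF Suc] in \<open>simp add: \<beta>S \<gamma>_def\<close>)
  qed
  have \<gamma>: "lin R (free_mod R (\<beta> (Suc i))) (free_mod R (\<beta> i)) (\<gamma> i)"
    "\<gamma> i ` carrier (free_mod R (\<beta> (Suc i))) = \<kappa> i" for i using c[OF \<kappa>[of i]] by (simp_all add: \<beta>S \<gamma>_def)
  define P where "P i = free_mod R (\<beta> i)" for i
  define d where "d i = restrict (\<gamma> i) (carrier (P (Suc i)))" for i
  define e where "e = restrict g0 (carrier (P 0))"
  have P0: "P 0 = free_mod R b0" by (simp add: P_def \<beta>_def st0)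
  have "projective_resolution R M P d e" unfolding projective_resolution_def
  proof (intro conjI allI)
    show "projective_module R (P i)" for i unfolding P_def by (rule free_mod_projective)
    show "d i \<in> module_homs R (P (Suc i)) (P i)" for i
      unfolding d_def P_def by (rule lin_restrict[OF free_mod_module \<gamma>(1)])
    show "e \<in> module_homs R (P 0) M" unfolding e_def P0 by (rule lin_restrict[OF free_mod_module g0(1)])
    show "e ` carrier (P 0) = carrier M" using g0(2) by (simp add: e_def P0)
    have "d 0 ` carrier (P 1) = \<kappa> 0" using \<gamma>(2)[of 0] by (simp add: d_def P_def)
    also have "\<dots> = {f \<in> P 0. e f = 0\<^sub>M}" by (auto simp: \<kappa>_def st0 K0_def e_def P0)
    finally show "d 0 ` carrier (P 1) = a_kernel (P 0) M e" by (simp add: a_kernel_def')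
    show "d (Suc i) ` carrier (P (Suc (Suc i))) = a_kernel (P (Suc i)) (P i) (d i)" for i
    proof -
      have "d (Suc i) ` carrier (P (Suc (Suc i))) = \<kappa> (Suc i)" using \<gamma>(2)[of "Suc i"] by (simp add: d_def P_def)
      thus ?thesis by (auto simp: \<kappa>S a_kernel_def' d_def P_def)
    qed
  qed
  thus ?thesis by (rule that)
qed

lemma compose_lin:
  assumes "module R P" "module R P'" "module R W" and d: "lin R P' P d"
  shows "lin R (Hom_module R P W) (Hom_module R P' W) (\<lambda>f. compose P' f d)"
proof (rule linI)
  interpret P': rmod R P' by (rule rmodI, fact)
  show "compose P' f d \<in> Hom_module R P' W" if "f \<in> Hom_module R P W" for f
    using lin_restrict[OF assms(2) lin_comp[OF d module_homs_imp_lin, of f W]] that by (simp add: compose_def)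
qed (use linD(1)[OF d] in \<open>auto simp: compose_def restrict_def fun_eq_iff\<close>)

context dim_one_ring
begin

text \<open>The isomorphism of Ext^1(\<kappa>, W) with Hom(\<kappa>, W / x W), made explicit. Let p
  in P 0 lie over 1, and let \<open>y z\<close> in P 1 lie over z p. A cocycle f is sent to f (y x)
  modulo x W. This is a socle element since x f (y z) = z f (y x); the value lies in x W exactly for
  coboundaries; and every socle element occurs. The element s comes from a cocycle whose class
  generates Ext^1.\<close>

lemma Ext_socle:
  fixes W :: "('r, 'w) module" and P :: "nat \<Rightarrow> ('r, nat \<Rightarrow> 'r) module"
  defines "\<kappa> \<equiv> quotient_module (self_module R) \<mm>"
  assumes x: "nonzerodivisor R x" "x \<in> \<mm>" and W: "fin_gen_module R W"
    and xreg: "\<And>v. v \<in> W ==> x *\<^sub>W v = 0\<^sub>W ==> v = 0\<^sub>W"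
    and res: "projective_resolution R \<kappa> P d e"
    and iso: "isomorphic_modules R (quotient_module ((Hom_module R (P 1) W)\<lparr>carrier := cocycles R P d W 1\<rparr>)
      (coboundaries R P d W 1)) \<kappa>"
  obtains s where "s \<in> W" "\<not> (\<exists>v\<in>W. s = x *\<^sub>W v)"
    "\<And>z. z \<in> \<mm> ==> \<exists>v\<in>W. z *\<^sub>W s = x *\<^sub>W v"
    "\<And>w. w \<in> W ==> (\<And>z. z \<in> \<mm> ==> \<exists>v\<in>W. z *\<^sub>W w = x *\<^sub>W v) ==>
      \<exists>r\<in>R. \<exists>v\<in>W. w = r *\<^sub>W s +\<^sub>W x *\<^sub>W v"
proof -
  have Wm: "module R W" by (rule moduleD_fin_gen[OF W])
  interpret W: rmod R W by (rule rmodI, fact)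
  interpret S: rmod R "self_module R" by (rule rmodI, rule self_module_module)
  have mS: "submodule \<mm> R (self_module R)" using self_submodule_iff m_ideal by simp
  have \<kappa>m: "module R \<kappa>" unfolding \<kappa>_def by (rule S.quotient_module_module[OF mS])
  interpret \<kappa>: rmod R \<kappa> by (rule rmodI, fact)
  define q where "q = (\<lambda>r. \<mm> +>\<^bsub>self_module R\<^esub> r)"
  have ql: "lin R (self_module R) \<kappa> q" and qs: "q ` carrier R = carrier \<kappa>"
    using S.quotient_lin[OF mS] by (simp_all add: q_def \<kappa>_def)
  have q0: "q r = 0\<^sub>\<kappa> \<longleftrightarrow> r \<in> \<mm>" if "r \<in> R" for r
    using S.coset_eq_zero_iff[OF mS, of r] that by (simp add: q_def \<kappa>_def)
  have xR: "x \<in> R" using x(1) by (simp add: nonzerodivisor_def)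
  note xcancel = W.smult_cancel[OF xR xreg]
  have proj: "\<And>i. projective_module R (P i)" and dl: "\<And>i. lin R (P (Suc i)) (P i) (d i)"
    and el: "lin R (P 0) \<kappa> e" and es: "e ` carrier (P 0) = carrier \<kappa>"
    and ker0: "d 0 ` carrier (P 1) = {v \<in> P 0. e v = 0\<^sub>\<kappa>}"
    and ker1: "d 1 ` carrier (P 2) = {v \<in> P 1. d 0 v = \<zero>\<^bsub>P 0\<^esub>}"
  proof -
    show "\<And>i. projective_module R (P i)" "e ` carrier (P 0) = carrier \<kappa>"
      using res by (simp_all add: projective_resolution_def)
    show "\<And>i. lin R (P (Suc i)) (P i) (d i)" "lin R (P 0) \<kappa> e"
      using res by (simp_all add: projective_resolution_def module_homs_imp_lin)
    show "d 0 ` carrier (P 1) = {v \<in> P 0. e v = 0\<^sub>\<kappa>}"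
      using res by (simp add: projective_resolution_def a_kernel_def')
    have "d (Suc 0) ` carrier (P (Suc (Suc 0))) = a_kernel (P (Suc 0)) (P 0) (d 0)"
      using res unfolding projective_resolution_def by blast
    thus "d 1 ` carrier (P 2) = {v \<in> P 1. d 0 v = \<zero>\<^bsub>P 0\<^esub>}" by (simp add: a_kernel_def' numeral_2_eq_2)
  qed
  have Pm: "\<And>i. module R (P i)" using proj by (simp add: projective_module_def)
  interpret P0: rmod R "P 0" by (rule rmodI, rule Pm)
  interpret P1: rmod R "P 1" by (rule rmodI, rule Pm)
  have d0l: "lin R (P 1) (P 0) (d 0)" using dl[of 0] by simp
  have d1l: "lin R (P 2) (P 1) (d 1)" using dl[of 1] by (simp add: numeral_2_eq_2)
  define H where "H = Hom_module R (P 1) W"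
  have Hm: "module R H" unfolding H_def by (rule Hom_module_module[OF Pm Wm])
  interpret H: rmod R H by (rule rmodI, fact)
  define Zc where "Zc = cocycles R P d W 1"
  have Zc: "f \<in> Zc \<longleftrightarrow> f \<in> module_homs R (P 1) W \<and> (\<forall>y\<in>(P 2). f (d 1 y) = 0\<^sub>W)" for f
    by (simp add: Zc_def cocycles_def numeral_2_eq_2)
  define Bc where "Bc = coboundaries R P d W 1"
  have Bc: "Bc = (\<lambda>f. compose (P 1) f (d 0)) ` carrier (Hom_module R (P 0) W)" by (simp add: Bc_def)
  have Zsub: "submodule Zc R H"
  proof -
    define K where "K u = {f \<in> H. f (d 1 u) = 0\<^sub>W}" for u
    have K: "submodule (K u) R H" if "u \<in> P 2" for u unfolding K_def H_def
      by (rule rmod.kernel_submodule[OF rmodI[OF Hom_module_module[OF Pm Wm]] Wm Hom_eval_lin])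
        (rule linD(1)[OF d1l that])
    note KD = H.submoduleD[OF K]
    have Zc': "f \<in> Zc \<longleftrightarrow> f \<in> H \<and> (\<forall>u\<in>(P 2). f \<in> K u)" for f by (auto simp: Zc K_def H_def)
    show ?thesis
    proof (rule H.submoduleI')
      show "Zc \<subseteq> H" using Zc' by blast
      show "0\<^sub>H \<in> Zc" unfolding Zc' using KD(2) H.M.zero_closed by blast
      show "f +\<^sub>H g \<in> Zc" if "f \<in> Zc" "g \<in> Zc" for f g using that KD(3) H.M.a_closed unfolding Zc' by blast
      show "a *\<^sub>H f \<in> Zc" if "a \<in> R" "f \<in> Zc" for a f using that KD(6) H.smult_closed unfolding Zc' by blast
    qed
  qed
  have Bsub: "submodule Bc R H" unfolding Bc H_def
    by (rule rmod.image_submodule[OF rmodI[OF Hom_module_module[OF Pm Wm]] Hom_module_module[OF Pm Wm]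
          compose_lin[OF Pm Pm Wm d0l]])
      (rule module.carrier_is_submodule[OF Hom_module_module[OF Pm Wm]])
  have d01: "d 0 (d 1 y) = \<zero>\<^bsub>P 0\<^esub>" if "y \<in> P 2" for y using ker1 that by blast
  have BZ: "Bc \<subseteq> Zc"
  proof
    fix f assume f: "f \<in> Bc"
    then obtain g where g: "g \<in> module_homs R (P 0) W" "f = compose (P 1) g (d 0)" by (auto simp: Bc)
    have "f (d 1 y) = 0\<^sub>W" if "y \<in> P 2" for y
      using d01[OF that] lin_zero[OF Pm Wm module_homs_imp_lin[OF g(1)]] linD(1)[OF d1l that]
      by (simp add: g(2) compose_def)
    thus "f \<in> Zc" using f H.submoduleD(1)[OF Bsub f] by (simp add: Zc H_def)
  qed
  define HZ where "HZ = H\<lparr>carrier := Zc\<rparr>"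
  have HZm: "module R HZ" unfolding HZ_def by (rule H.submodule_module[OF Zsub])
  interpret HZ: rmod R HZ by (rule rmodI, fact)
  have BHZ: "submodule Bc R HZ" unfolding HZ_def using H.submodule_of_submodule_iff[OF Zsub] Bsub BZ by simp
  define Ex where "Ex = quotient_module HZ Bc"
  have Exm: "module R Ex" unfolding Ex_def by (rule HZ.quotient_module_module[OF BHZ])
  interpret Ex: rmod R Ex by (rule rmodI, fact)
  obtain \<theta> where \<theta>: "\<theta> \<in> module_homs R Ex \<kappa>" "bij_betw \<theta> (carrier Ex) (carrier \<kappa>)"
    using iso unfolding isomorphic_modules_def Ex_def HZ_def H_def Zc_def Bc_def by blast
  note \<theta>l = module_homs_imp_lin[OF \<theta>(1)]
  have q1: "q \<one> \<in> \<kappa>" using qs by auto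
  then obtain \<epsilon> where \<epsilon>: "\<epsilon> \<in> carrier Ex" "\<theta> \<epsilon> = q \<one>" using bij_betw_imp_surj_on[OF \<theta>(2)] by (metis imageE)
  have Excar: "carrier Ex = (\<lambda>f. Bc +>\<^bsub>HZ\<^esub> f) ` Zc"
    using HZ.quotient_carrier[of Bc] by (simp add: Ex_def HZ_def)
  obtain f0 where f0: "f0 \<in> Zc" "\<epsilon> = Bc +>\<^bsub>HZ\<^esub> f0" using \<epsilon>(1) Excar by auto
  have f0HZ: "f0 \<in> carrier HZ" using f0(1) by (simp add: HZ_def)
  have f0B: "f0 \<notin> Bc"
  proof
    assume "f0 \<in> Bc"
    hence "\<epsilon> = \<zero>\<^bsub>Ex\<^esub>" using HZ.coset_eq_zero_iff[OF BHZ f0HZ] f0(2) by (simp add: Ex_def)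
    hence "q \<one> = 0\<^sub>\<kappa>" using lin_zero[OF Exm \<kappa>m \<theta>l] \<epsilon>(2) by simp
    thus False using q0[of \<one>] one_notin_m by simp
  qed
  have gen: "\<exists>r\<in>R. f \<ominus>\<^bsub>HZ\<^esub> r \<odot>\<^bsub>HZ\<^esub> f0 \<in> Bc" if f: "f \<in> Zc" for f
  proof -
    have fHZ: "f \<in> carrier HZ" using f by (simp add: HZ_def)
    define u where "u = Bc +>\<^bsub>HZ\<^esub> f"
    have u: "u \<in> carrier Ex" using Excar f by (auto simp: u_def)
    obtain r where r: "r \<in> R" "\<theta> u = q r" using linD(1)[OF \<theta>l u] qs by auto
    have "q r = r *\<^sub>\<kappa> q \<one>" using linD(3)[OF ql r(1), of \<one>] r(1) by simp
    also have "\<dots> = \<theta> (r \<odot>\<^bsub>Ex\<^esub> \<epsilon>)" using linD(3)[OF \<theta>l r(1) \<epsilon>(1)] \<epsilon>(2) by simp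
    finally have "u = r \<odot>\<^bsub>Ex\<^esub> \<epsilon>"
      using \<theta>(2) u r \<epsilon>(1) Ex.smult_closed[OF r(1) \<epsilon>(1)] by (auto simp: bij_betw_def dest: inj_onD)
    also have "\<dots> = Bc +>\<^bsub>HZ\<^esub> (r \<odot>\<^bsub>HZ\<^esub> f0)" using HZ.quotient_smult[OF BHZ f0HZ r(1)] f0(2) by (simp add: Ex_def)
    finally show ?thesis
      using HZ.coset_eq_iff[OF BHZ fHZ HZ.smult_closed[OF r(1) f0HZ]] r(1) by (auto simp: u_def)
  qed
  obtain p where p: "p \<in> P 0" "e p = q \<one>" using es q1 by (metis imageE)
  have eq: "e (r \<odot>\<^bsub>P 0\<^esub> p) = q r" if "r \<in> R" for r
    using linD(3)[OF el that p(1)] linD(3)[OF ql that, of \<one>] p(2) that by simp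
  have "\<exists>y\<in>(P 1). d 0 y = z \<odot>\<^bsub>P 0\<^esub> p" if z: "z \<in> \<mm>" for z
  proof -
    have "z \<odot>\<^bsub>P 0\<^esub> p \<in> d 0 ` carrier (P 1)"
      unfolding ker0 using eq[OF m_closed'[OF z]] q0[OF m_closed'[OF z]] z m_closed'[OF z] p(1) by simp
    thus ?thesis by (metis imageE)
  qed
  then obtain y where y: "\<And>z. z \<in> \<mm> ==> y z \<in> P 1" "\<And>z. z \<in> \<mm> ==> d 0 (y z) = z \<odot>\<^bsub>P 0\<^esub> p" by metis
  have fD: "\<And>u v. u \<in> P 1 ==> v \<in> P 1 ==> d 0 u = d 0 v ==> f u = f v"
    and fl: "lin R (P 1) W f" if f: "f \<in> Zc" for f
  proof -
    show fl: "lin R (P 1) W f" using f by (auto simp: Zc intro: module_homs_imp_lin)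
    fix u v assume uv: "u \<in> P 1" "v \<in> P 1" "d 0 u = d 0 v"
    have "d 0 (u \<ominus>\<^bsub>P 1\<^esub> v) = \<zero>\<^bsub>P 0\<^esub>" unfolding lin_minus[OF Pm Pm d0l uv(1,2)]
      using P0.minus_eq_iff[OF linD(1)[OF d0l uv(1)] linD(1)[OF d0l uv(2)]] uv(3) by simp
    moreover have "u \<ominus>\<^bsub>P 1\<^esub> v \<in> P 1" by (rule P1.M.minus_closed[OF uv(1,2)])
    ultimately have "u \<ominus>\<^bsub>P 1\<^esub> v \<in> d 1 ` carrier (P 2)" unfolding ker1 by blast
    hence "f (u \<ominus>\<^bsub>P 1\<^esub> v) = 0\<^sub>W" using f Zc by auto
    thus "f u = f v"
      using lin_minus[OF Pm Wm fl uv(1,2)] W.minus_eq_iff[OF linD(1)[OF fl uv(1)] linD(1)[OF fl uv(2)]] by simp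
  qed
  have \<kappa>_ann: "x *\<^sub>\<kappa> u = 0\<^sub>\<kappa>" if "u \<in> \<kappa>" for u
  proof -
    obtain r where r: "r \<in> R" "u = q r" using qs \<open>u \<in> \<kappa>\<close> by auto
    thus ?thesis using linD(3)[OF ql xR, of r] q0[of "x \<otimes> r"] idealD(7)[OF m_ideal r(1) x(2)] xR by simp
  qed
  have fy: "x *\<^sub>W f (y z) = z *\<^sub>W f (y x)" if f: "f \<in> Zc" and z: "z \<in> \<mm>" for f z
  proof -
    note zR = m_closed'[OF z]
    have "d 0 (x \<odot>\<^bsub>P 1\<^esub> y z) = x \<odot>\<^bsub>P 0\<^esub> (z \<odot>\<^bsub>P 0\<^esub> p)" using linD(3)[OF d0l xR y(1)[OF z]] y(2)[OF z] by simp
    also have "\<dots> = z \<odot>\<^bsub>P 0\<^esub> (x \<odot>\<^bsub>P 0\<^esub> p)" using zR xR p(1) by (simp add: P0.smult_assoc1[symmetric] m_comm)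
    also have "\<dots> = d 0 (z \<odot>\<^bsub>P 1\<^esub> y x)" using linD(3)[OF d0l zR y(1)[OF x(2)]] y(2)[OF x(2)] by simp
    finally have "f (x \<odot>\<^bsub>P 1\<^esub> y z) = f (z \<odot>\<^bsub>P 1\<^esub> y x)"
      using fD[OF f P1.smult_closed[OF xR y(1)[OF z]] P1.smult_closed[OF zR y(1)[OF x(2)]]] by simp
    thus ?thesis using linD(3)[OF fl[OF f] xR y(1)[OF z]] linD(3)[OF fl[OF f] zR y(1)[OF x(2)]] by simp
  qed
  have decomp: "\<exists>r\<in>R. \<exists>u\<in>(P 1). v = d 0 u \<oplus>\<^bsub>P 0\<^esub> r \<odot>\<^bsub>P 0\<^esub> p" if v: "v \<in> P 0" for v
  proof -
    obtain r where r: "r \<in> R" "e v = q r" using linD(1)[OF el v] qs by auto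
    have rp: "r \<odot>\<^bsub>P 0\<^esub> p \<in> P 0" using r(1) p(1) by simp
    have "e (v \<ominus>\<^bsub>P 0\<^esub> r \<odot>\<^bsub>P 0\<^esub> p) = 0\<^sub>\<kappa>"
      unfolding lin_minus[OF Pm \<kappa>m el v rp] using eq[OF r(1)] r(2) \<kappa>.minus_eq_iff linD(1)[OF el v] by simp
    hence "v \<ominus>\<^bsub>P 0\<^esub> r \<odot>\<^bsub>P 0\<^esub> p \<in> d 0 ` carrier (P 1)" unfolding ker0 using v rp by simp
    then obtain u where u: "u \<in> P 1" "v \<ominus>\<^bsub>P 0\<^esub> r \<odot>\<^bsub>P 0\<^esub> p = d 0 u" by (metis imageE)
    have "v = d 0 u \<oplus>\<^bsub>P 0\<^esub> r \<odot>\<^bsub>P 0\<^esub> p"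
      unfolding u(2)[symmetric] using v rp by (simp add: a_minus_def P0.M.a_assoc P0.M.l_neg)
    thus ?thesis using r(1) u(1) by blast
  qed
  have boundary: "f \<in> Bc" if f: "f \<in> Zc" and v: "v \<in> W" "f (y x) = x *\<^sub>W v" for f v
  proof -
    note fl = fl[OF f]
    have im: "submodule (d 0 ` carrier (P 1)) R (P 0)"
      by (rule P1.image_submodule[OF Pm d0l P1.carrier_is_submodule])
    define I where "I = (P 0)\<lparr>carrier := d 0 ` carrier (P 1)\<rparr>"
    have Im: "module R I" unfolding I_def by (rule P0.submodule_module[OF im])
    have d0I: "lin R (P 1) I (d 0)" "d 0 ` carrier (P 1) = carrier I"
      unfolding I_def using d0l by (auto simp: lin_def)
    obtain k where k: "lin R I W k" "\<And>u. u \<in> P 1 ==> k (d 0 u) = f u"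
      by (rule lin_factor_surj[OF Pm Im Wm d0I fl])
        (use fD[OF f _ P1.M.zero_closed] lin_zero[OF Pm Pm d0l] lin_zero[OF Pm Wm fl] in \<open>auto simp: I_def\<close>)
    have xI: "x \<odot>\<^bsub>P 0\<^esub> a \<in> d 0 ` carrier (P 1)" if a: "a \<in> P 0" for a
      unfolding ker0 using xR a x(2) q0 linD(1)[OF el a] linD(3)[OF el xR a] \<kappa>_ann by simp
    \<comment> \<open>f induces k on the image of d 0, and x kills \<kappa>, so k (x a) makes sense
      for every a in P 0. Its values lie in x W; division by x yields g with g o d 0 = f.\<close>
    have Gl: "lin R (P 0) W (\<lambda>a. k (x \<odot>\<^bsub>P 0\<^esub> a))"
      by (rule lin_comp[OF _ k(1)]) (use xI P0.lin_homothety[OF xR] in \<open>auto simp: lin_def I_def\<close>)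
    have Gd: "k (x \<odot>\<^bsub>P 0\<^esub> d 0 u) = x *\<^sub>W f u" if u: "u \<in> P 1" for u
      using k(2)[OF P1.smult_closed[OF xR u]] linD(3)[OF d0l xR u] linD(3)[OF fl xR u] by simp
    have Gx: "\<exists>w\<in>W. k (x \<odot>\<^bsub>P 0\<^esub> a) = x *\<^sub>W w" if a: "a \<in> P 0" for a
    proof -
      obtain r u where ru: "r \<in> R" "u \<in> P 1" "a = d 0 u \<oplus>\<^bsub>P 0\<^esub> r \<odot>\<^bsub>P 0\<^esub> p" using decomp[OF a] by blast
      have "k (x \<odot>\<^bsub>P 0\<^esub> p) = x *\<^sub>W v" using k(2)[OF y(1)[OF x(2)]] y(2)[OF x(2)] v(2) by simp
      hence "k (x \<odot>\<^bsub>P 0\<^esub> a) = x *\<^sub>W f u +\<^sub>W r *\<^sub>W (x *\<^sub>W v)"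
        unfolding ru(3) using linD(2)[OF Gl linD(1)[OF d0l ru(2)] P0.smult_closed[OF ru(1) p(1)]]
          linD(3)[OF Gl ru(1) p(1)] Gd[OF ru(2)] by simp
      also have "\<dots> = x *\<^sub>W (f u +\<^sub>W r *\<^sub>W v)"
        using linD(1)[OF fl ru(2)] ru(1) v(1) xR by (simp add: W.smult_r_distr W.smult_swap)
      finally show ?thesis using linD(1)[OF fl ru(2)] ru(1) v(1) by blast
    qed
    obtain g where gl: "lin R (P 0) W g" and g: "\<And>a. a \<in> P 0 ==> k (x \<odot>\<^bsub>P 0\<^esub> a) = x *\<^sub>W g a"
      by (rule W.lin_divide[OF xR xreg Pm Gl Gx]) (assumption+, rule that)
    have gd: "g (d 0 u) = f u" if u: "u \<in> P 1" for u
      by (rule xcancel) (use Gd[OF u] g[OF linD(1)[OF d0l u]] linD(1)[OF d0l u] linD(1)[OF gl] linD(1)[OF fl u] in auto)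
    have "compose (P 1) (restrict g (P 0)) (d 0) = (\<lambda>u\<in>(P 1). f u)"
      using gd linD(1)[OF d0l] by (auto simp: compose_def)
    also have "\<dots> = f" using f by (intro module_homsD(4)[of f R "P 1" W]) (simp add: Zc)
    finally show "f \<in> Bc" unfolding Bc using lin_restrict[OF Pm gl] by (metis Hom_module_simps(1) imageI)
  qed
  define Y where "Y = (\<lambda>v. x *\<^sub>W v) ` carrier W"
  have Y: "submodule Y R W" unfolding Y_def by (rule W.multiples_submodule[OF xR])
  define Q where "Q = quotient_module W Y"
  have Qm: "module R Q" unfolding Q_def by (rule W.quotient_module_module[OF Y])
  have ql': "lin R W Q (\<lambda>v. Y +>\<^bsub>W\<^esub> v)" "(\<lambda>v. Y +>\<^bsub>W\<^esub> v) ` carrier W = carrier Q"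
    using W.quotient_lin[OF Y] by (simp_all add: Q_def)
  have surj: "\<exists>f\<in>Zc. f (y x) -\<^sub>W w \<in> Y" if w: "w \<in> W" "\<And>z. z \<in> \<mm> ==> z *\<^sub>W w \<in> Y" for w
  proof -
    have Yk: "lin R (self_module R) Q (\<lambda>r. Y +>\<^bsub>W\<^esub> (r *\<^sub>W w))"
      by (rule lin_comp[OF _ ql'(1)]) (rule linI, use w(1) in \<open>auto simp: W.smult_l_distr W.smult_assoc1\<close>)
    have Y0: "Y +>\<^bsub>W\<^esub> (r *\<^sub>W w) = 0\<^sub>Q" if "r \<in> \<mm>" for r
      using W.coset_eq_zero_iff[OF Y W.smult_closed[OF m_closed'[OF that] w(1)]] w(2)[OF that] by (simp add: Q_def)
    obtain \<psi> where \<psi>: "lin R \<kappa> Q \<psi>" "\<And>r. r \<in> self_module R ==> \<psi> (q r) = Y +>\<^bsub>W\<^esub> (r *\<^sub>W w)"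
      by (rule lin_factor_surj[OF self_module_module \<kappa>m Qm ql _ Yk]) (use qs q0 Y0 in auto)
    define \<phi> where "\<phi> v = \<psi> (e v)" for v
    have \<phi>l: "lin R (P 0) Q \<phi>" unfolding \<phi>_def by (rule lin_comp[OF el \<psi>(1)])
    have \<phi>: "\<phi> v = Y +>\<^bsub>W\<^esub> (r *\<^sub>W w)" if "v \<in> P 0" "r \<in> R" "e v = q r" for v r
      unfolding \<phi>_def that(3) by (rule \<psi>(2)) (use that in simp)
    obtain j :: "'w \<Rightarrow> nat \<Rightarrow> 'r" where j: "inj_on j W" using W.fin_gen_injection[OF W] .
    \<comment> \<open>A lift to W of the composite P 0 -> \<kappa> -> W / x W that takes p to the
      class of w. On the image of d 0 it has values in x W, and division by x yields the
      cocycle.\<close>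
    obtain g where g: "lin R (P 0) W g" "\<And>v. v \<in> P 0 ==> Y +>\<^bsub>W\<^esub> g v = \<phi> v"
      by (rule projective_lift[OF proj Wm Qm j ql' \<phi>l]) blast
    have "\<exists>v\<in>W. g (d 0 u) = x *\<^sub>W v" if u: "u \<in> P 1" for u
    proof -
      note du = linD(1)[OF d0l u]
      have "e (d 0 u) = q \<zero>" using ker0 u q0[of \<zero>] idealD(2)[OF m_ideal] by auto
      hence "Y +>\<^bsub>W\<^esub> g (d 0 u) = Y +>\<^bsub>W\<^esub> 0\<^sub>W" using \<phi>[OF du zero_closed] g(2)[OF du] w(1) by simp
      hence "g (d 0 u) \<in> Y"
        using W.coset_eq_iff[OF Y linD(1)[OF g(1) du], of "0\<^sub>W"] W.minus_zero_right linD(1)[OF g(1) du] by simp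
      thus ?thesis by (auto simp: Y_def)
    qed
    hence gx: "\<exists>v\<in>W. g (d 0 u) = x *\<^sub>W v" if "u \<in> P 1" for u using that by simp
    obtain f where fl: "lin R (P 1) W f" and f': "\<And>u. u \<in> P 1 ==> g (d 0 u) = x *\<^sub>W f u"
      by (rule W.lin_divide[OF xR xreg Pm lin_comp[OF d0l g(1)] gx]) (assumption+, rule that)
    note f = linD(1)[OF fl] f'
    define f' where "f' = restrict f (P 1)"
    have f'y: "f' u = f u" if "u \<in> P 1" for u using that by (simp add: f'_def)
    have "f' (d 1 u) = 0\<^sub>W" if u: "u \<in> P 2" for u
    proof -
      note du = linD(1)[OF d1l u]
      have "x *\<^sub>W f (d 1 u) = 0\<^sub>W" using f(2)[OF du] d01[OF u] lin_zero[OF Pm Wm g(1)] by simp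
      thus ?thesis using xreg[OF f(1)[OF du]] f'y[OF du] by simp
    qed
    hence f'Z: "f' \<in> Zc" using lin_restrict[OF Pm fl] by (simp add: Zc f'_def)
    have "x *\<^sub>W f (y x) = x *\<^sub>W g p" using f(2)[OF y(1)[OF x(2)]] y(2)[OF x(2)] linD(3)[OF g(1) xR p(1)] by simp
    hence "f (y x) = g p" by (intro xcancel[of "f (y x)" "g p"] f(1) y(1) x(2) linD(1)[OF g(1)] p(1))
    moreover have "Y +>\<^bsub>W\<^esub> g p = Y +>\<^bsub>W\<^esub> w" using g(2)[OF p(1)] \<phi>[OF p(1) one_closed p(2)] w(1) by simp
    hence "g p -\<^sub>W w \<in> Y" using W.coset_eq_iff[OF Y linD(1)[OF g(1) p(1)] w(1)] by simp
    ultimately show ?thesis using f'Z f'y[OF y(1)[OF x(2)]] by (intro bexI[of _ f']) simp_all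
  qed
  define s where "s = f0 (y x)"
  have yx: "y x \<in> P 1" by (rule y(1)[OF x(2)])
  have sW: "s \<in> W" unfolding s_def by (rule linD(1)[OF fl[OF f0(1)] yx])
  show ?thesis
  proof (rule that[OF sW])
    show "\<not> (\<exists>v\<in>W. s = x *\<^sub>W v)" using boundary[OF f0(1)] f0B by (auto simp: s_def)
    show "\<exists>v\<in>W. z *\<^sub>W s = x *\<^sub>W v" if z: "z \<in> \<mm>" for z
      using fy[OF f0(1) z, symmetric] linD(1)[OF fl[OF f0(1)] y(1)[OF z]] by (auto simp: s_def)
    fix w assume w: "w \<in> W" "\<And>z. z \<in> \<mm> ==> \<exists>v\<in>W. z *\<^sub>W w = x *\<^sub>W v"
    have "z *\<^sub>W w \<in> Y" if "z \<in> \<mm>" for z using w(2)[OF that] by (auto simp: Y_def)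
    then obtain f where f: "f \<in> Zc" "f (y x) -\<^sub>W w \<in> Y" using surj[OF w(1)] by blast
    obtain r where r: "r \<in> R" "f \<ominus>\<^bsub>HZ\<^esub> r \<odot>\<^bsub>HZ\<^esub> f0 \<in> Bc" using gen[OF f(1)] by blast
    have fHZ: "f \<in> carrier HZ" using f(1) by (simp add: HZ_def)
    define h where "h = f \<ominus>\<^bsub>HZ\<^esub> r \<odot>\<^bsub>HZ\<^esub> f0"
    have "f = h \<oplus>\<^bsub>HZ\<^esub> r \<odot>\<^bsub>HZ\<^esub> f0"
      unfolding h_def using fHZ HZ.smult_closed[OF r(1) f0HZ] by (simp add: a_minus_def HZ.M.a_assoc HZ.M.l_neg)
    hence "f (y x) = (h \<oplus>\<^bsub>HZ\<^esub> r \<odot>\<^bsub>HZ\<^esub> f0) (y x)" by simp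
    also have "\<dots> = h (y x) +\<^sub>W r *\<^sub>W s" using yx by (simp add: HZ_def H_def s_def)
    finally have fyx: "f (y x) = h (y x) +\<^sub>W r *\<^sub>W s" .
    obtain g where g: "g \<in> module_homs R (P 0) W" "h = compose (P 1) g (d 0)"
      using r(2) by (auto simp: Bc h_def[symmetric])
    have hy: "h (y x) = x *\<^sub>W g p"
      using g yx y(2)[OF x(2)] module_homsD(3)[OF g(1) xR p(1)] by (simp add: compose_def)
    obtain v where v: "v \<in> W" "f (y x) -\<^sub>W w = x *\<^sub>W v" using f(2) by (auto simp: Y_def)
    note gp = module_homsD(1)[OF g(1) p(1)]
    have fW: "f (y x) \<in> W" by (rule linD(1)[OF fl[OF f(1)] yx])
    have "w = f (y x) -\<^sub>W (f (y x) -\<^sub>W w)"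
      using w(1) fW by (simp add: a_minus_def W.M.minus_add W.M.a_assoc[symmetric] W.M.r_neg)
    also have "\<dots> = (x *\<^sub>W g p +\<^sub>W r *\<^sub>W s) -\<^sub>W x *\<^sub>W v" unfolding v(2) unfolding fyx hy ..
    finally have "w = (x *\<^sub>W g p +\<^sub>W r *\<^sub>W s) -\<^sub>W x *\<^sub>W v" .
    hence "w = r *\<^sub>W s +\<^sub>W x *\<^sub>W (g p -\<^sub>W v)"
      using gp v(1) xR r(1) sW by (simp add: W.smult_r_distr W.smult_r_minus a_minus_def W.M.a_ac)
    thus "\<exists>r\<in>R. \<exists>v\<in>W. w = r *\<^sub>W s +\<^sub>W x *\<^sub>W v"
      using r(1) gp v(1) by (intro bexI[of _ r] bexI[of _ "g p -\<^sub>W v"]) auto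
  qed
qed

end

section \<open>Properties of the canonical module\<close>

lemma enat_Inf_less_infinity:
  assumes "Inf {enat n |n. P n} < \<infinity>" shows "\<exists>n. P n"
proof (rule ccontr)
  assume "\<nexists>n. P n"
  hence "{enat n |n. P n} = {}" by auto
  thus False using assms by (simp add: Inf_enat_def)
qed

context dim_one_ring
begin

text \<open>In dimension one a power of x0 is a multiple of x, so x v = 0 implies that this power of
  x0 kills v.\<close>

lemma nonzerodivisor_regular_on:
  fixes W :: "('r, 'w) module"
  assumes W: "module R W" and x0: "x0 \<in> \<mm>" "\<And>v. v \<in> W ==> x0 *\<^sub>W v = 0\<^sub>W ==> v = 0\<^sub>W"
    and x: "nonzerodivisor R x" and v: "v \<in> W" "x *\<^sub>W v = 0\<^sub>W"
  shows "v = 0\<^sub>W"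
proof -
  interpret W: rmod R W by (rule rmodI, fact)
  have xR: "x \<in> R" using x by (simp add: nonzerodivisor_def)
  note x0R = m_closed'[OF x0(1)]
  obtain n :: nat where "x0 [^] n \<in> PIdl x"
    using pow_in_if_nonzerodivisor[OF cgenideal_ideal[OF xR] x cgenideal_self[OF xR] x0(1)] by blast
  then obtain r where r: "r \<in> R" "x0 [^] n = r \<otimes> x" by (auto simp: cgenideal_def)
  hence "x0 [^] n *\<^sub>W v = 0\<^sub>W" using v xR by (simp add: W.smult_assoc1)
  thus ?thesis
  proof (induction n)
    case 0
    thus ?case using v(1) by simp
  next
    case (Suc n)
    have "x0 *\<^sub>W (x0 [^] n *\<^sub>W v) = 0\<^sub>W"
      using Suc.prems x0R v(1) by (simp add: W.smult_assoc1[symmetric] m_comm)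
    thus ?case using Suc.IH x0(2)[of "x0 [^] n *\<^sub>W v"] x0R v(1) by simp
  qed
qed

text \<open>Depth one provides one element of \<mm> that is regular on W, the first member of a
  regular sequence; \<open>nonzerodivisor_regular_on\<close> passes from it to all nonzerodivisors
  of R.\<close>

lemma depth_one_regular:
  fixes W :: "('r, 'w) module"
  assumes max: "max_ideal R = \<mm>" and W: "module R W" and depth: "depth R W = 1"
    and x: "nonzerodivisor R x" and v: "v \<in> W" "x *\<^sub>W v = 0\<^sub>W"
  shows "v = 0\<^sub>W"
proof -
  interpret W: rmod R W by (rule rmodI, fact)
  define S where "S = {enat (length as) |as. set as \<subseteq> \<mm> \<and> regular_sequence R W as}"
  have "Sup S = 1" using depth max by (simp add: S_def depth_def)
  hence "\<not> (\<forall>s\<in>S. s \<le> 0)" using Sup_least[of S 0] by auto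
  then obtain as where as: "set as \<subseteq> \<mm>" "regular_sequence R W as" "as \<noteq> []" by (auto simp: S_def zero_enat_def)
  have zero: "set_smult R {} W = {0\<^sub>W}" using W.span_empty by (simp add: set_smult_def)
  have "\<And>v. v \<in> W ==> as ! 0 *\<^sub>W v = 0\<^sub>W ==> v = 0\<^sub>W"
    using as(2,3) zero unfolding regular_sequence_def by fastforce
  moreover have "as ! 0 \<in> \<mm>" using as(1,3) by auto
  ultimately show ?thesis using nonzerodivisor_regular_on[OF W _ _ x v] by blast
qed

lemma canonical_module_endomorphisms:
  fixes W :: "('r, 'w) module"
  assumes max: "max_ideal R = \<mm>" and kdim: "krull_dim R = 1" and can: "canonical_module R W"
  shows "fin_gen_module R W"
    and "\<And>x v. nonzerodivisor R x ==> v \<in> W ==> x *\<^sub>W v = 0\<^sub>W ==> v = 0\<^sub>W"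
    and "\<And>h. lin R W W h ==> \<exists>a\<in>R. \<forall>v\<in>W. h v = a *\<^sub>W v"
    and "\<And>a. a \<in> R ==> (\<And>v. v \<in> W ==> a *\<^sub>W v = 0\<^sub>W) ==> a = \<zero>"
proof -
  have depth: "depth R W = 1" and fg: "fin_gen_module R W" and inj: "inj_dim R W < \<infinity>"
    and ext: "isomorphic_modules R (Ext_module R 1 (residue_module R) W) (residue_module R)"
    using can kdim by (auto simp: canonical_module_def maximal_cohen_macaulay_def one_enat_def)
  show "fin_gen_module R W" by (rule fg)
  have Wm: "module R W" by (rule moduleD_fin_gen[OF fg])
  interpret W: rmod R W by (rule rmodI, fact)
  interpret S: rmod R "self_module R" by (rule rmodI, rule self_module_module)
  have mS: "submodule \<mm> R (self_module R)" using self_submodule_iff m_ideal by simp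
  show reg: "\<And>x v. nonzerodivisor R x ==> v \<in> W ==> x *\<^sub>W v = 0\<^sub>W ==> v = 0\<^sub>W"
    by (rule depth_one_regular[OF max Wm depth])
  obtain x where x: "x \<in> \<mm>" "nonzerodivisor R x" using exists_nonzerodivisor by blast
  have xR: "x \<in> R" using x(1) m_closed' by auto
  note xreg = reg[OF x(2)]
  define \<kappa> where "\<kappa> = quotient_module (self_module R) \<mm>"
  have \<kappa>res: "residue_module R = \<kappa>" by (simp add: residue_module_def max \<kappa>_def)
  have \<kappa>m: "module R \<kappa>" unfolding \<kappa>_def by (rule S.quotient_module_module[OF mS])
  have "fin_gen_module R \<kappa>"
    by (rule S.fin_gen_image[OF \<kappa>m _ _ self_module_fin_gen]) (use S.quotient_lin[OF mS] in \<open>simp_all add: \<kappa>_def\<close>)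
  then obtain P0 d0 e0 where "projective_resolution R \<kappa> P0 d0 e0" by (rule exists_projective_resolution)
  hence ex: "\<exists>T. case T of (P, d, e) \<Rightarrow> projective_resolution R \<kappa> P d e" by auto
  obtain P d e where T: "(SOME T. case T of (P, d, e) \<Rightarrow> projective_resolution R \<kappa> P d e) = (P, d, e)"
    by (metis prod_cases3)
  have res: "projective_resolution R \<kappa> P d e" using someI_ex[OF ex] unfolding T by simp
  have "Ext_module R 1 \<kappa> W = quotient_module ((Hom_module R (P 1) W)\<lparr>carrier := cocycles R P d W 1\<rparr>)
      (coboundaries R P d W 1)" by (simp add: Ext_module_def T)
  with ext \<kappa>res have iso: "isomorphic_modules R
      (quotient_module ((Hom_module R (P 1) W)\<lparr>carrier := cocycles R P d W 1\<rparr>) (coboundaries R P d W 1)) \<kappa>"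
    by simp
  obtain s where s: "s \<in> W" "\<not> (\<exists>v\<in>W. s = x *\<^sub>W v)"
    "\<And>z. z \<in> \<mm> ==> \<exists>v\<in>W. z *\<^sub>W s = x *\<^sub>W v"
    "\<And>w. w \<in> W ==> (\<And>z. z \<in> \<mm> ==> \<exists>v\<in>W. z *\<^sub>W w = x *\<^sub>W v) ==>
      \<exists>r\<in>R. \<exists>v\<in>W. w = r *\<^sub>W s +\<^sub>W x *\<^sub>W v"
    by (rule Ext_socle[OF x(2,1) fg xreg res[unfolded \<kappa>_def] iso[unfolded \<kappa>_def]]) blast+
  obtain n E \<delta> \<epsilon> where E: "injective_resolution R W E \<delta> \<epsilon>" "\<forall>i>n. carrier (E i) = {\<zero>\<^bsub>E i\<^esub>}"
    using enat_Inf_less_infinity[OF inj[unfolded inj_dim_def]] by blast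
  define Y where "Y = (\<lambda>v. x *\<^sub>W v) ` carrier W"
  have Ymem: "w \<in> Y \<longleftrightarrow> (\<exists>v\<in>W. w = x *\<^sub>W v)" for w by (auto simp: Y_def)
  have Y: "submodule Y R W" unfolding Y_def by (rule W.multiples_submodule[OF xR])
  define Q where "Q = quotient_module W Y"
  have Qm: "module R Q" unfolding Q_def by (rule W.quotient_module_module[OF Y])
  interpret Q: rmod R Q by (rule rmodI, fact)
  define \<pi> where "\<pi> = (\<lambda>v. Y +>\<^bsub>W\<^esub> v)"
  have \<pi>l: "lin R W Q \<pi>" and \<pi>s: "\<pi> ` carrier W = carrier Q"
    using W.quotient_lin[OF Y] by (simp_all add: Q_def \<pi>_def)
  have \<pi>0: "\<pi> v = 0\<^sub>Q \<longleftrightarrow> v \<in> Y" if "v \<in> W" for v using W.coset_eq_zero_iff[OF Y that] by (simp add: Q_def \<pi>_def)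
  have \<pi>eq: "\<pi> v = \<pi> w \<longleftrightarrow> v -\<^sub>W w \<in> Y" if "v \<in> W" "w \<in> W" for v w
    using W.coset_eq_iff[OF Y that] by (simp add: \<pi>_def)
  have xY: "x *\<^sub>W v \<in> Y" if "v \<in> W" for v using that by (simp add: Y_def)
  have smul0: "z *\<^sub>Q \<pi> v = 0\<^sub>Q \<longleftrightarrow> z *\<^sub>W v \<in> Y" if "z \<in> R" "v \<in> W" for z v
    using \<pi>0[of "z *\<^sub>W v"] linD(3)[OF \<pi>l that] that by simp
  define J where "J = PIdl x"
  have J: "ideal J R" "x \<in> J" unfolding J_def using cgenideal_ideal[OF xR] cgenideal_self[OF xR] by auto
  have killJ: "a *\<^sub>Q u = 0\<^sub>Q" if au: "a \<in> J" "u \<in> Q" for a u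
  proof -
    obtain r where r: "r \<in> R" "a = r \<otimes> x" using au(1) by (auto simp: J_def cgenideal_def)
    obtain v where v: "v \<in> W" "u = \<pi> v" using au(2) \<pi>s by blast
    show ?thesis using smul0[OF xR v(1)] xY[OF v(1)] r v au(2) xR by (simp add: Q.smult_assoc1)
  qed
  have whole: "{e \<in> Q. \<forall>a\<in>J. a *\<^sub>Q e = 0\<^sub>Q} = carrier Q" using killJ by auto
  \<comment> \<open>With J = R x the elements killed by J are all of W / x W, so the result concerns
    all its endomorphisms. The class of s spans the socle, and \<open>socle_lifting\<close> supplies
    the elements that are multiplied by u into this class.\<close>
  have main: "(\<forall>h. lin R (Q\<lparr>carrier := {e \<in> carrier Q. \<forall>a\<in>J. a *\<^sub>Q e = 0\<^sub>Q}\<rparr>) Q h \<longrightarrow>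
      (\<exists>a\<in>R. \<forall>e\<in>Q. (\<forall>a\<in>J. a *\<^sub>Q e = 0\<^sub>Q) \<longrightarrow> h e = a *\<^sub>Q e)) \<and>
    (\<forall>a\<in>R. (\<forall>e\<in>Q. (\<forall>a\<in>J. a *\<^sub>Q e = 0\<^sub>Q) \<longrightarrow> a *\<^sub>Q e = 0\<^sub>Q) \<longrightarrow> a \<in> J)"
  proof (rule homotheties_of_annihilated[OF x(2) Qm _ _ _ _ _ J])
    show "\<pi> s \<in> Q" using linD(1)[OF \<pi>l s(1)] .
    show "\<pi> s \<noteq> 0\<^sub>Q" using \<pi>0[OF s(1)] s(2) Ymem by auto
    show "z *\<^sub>Q \<pi> s = 0\<^sub>Q" if "z \<in> \<mm>" for z using smul0[OF m_closed'[OF that] s(1)] s(3)[OF that] Ymem by auto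
    show "\<exists>r\<in>R. u = r *\<^sub>Q \<pi> s" if u: "u \<in> Q" "\<And>z. z \<in> \<mm> ==> z *\<^sub>Q u = 0\<^sub>Q" for u
    proof -
      obtain w where w: "w \<in> W" "u = \<pi> w" using u(1) \<pi>s by blast
      have "\<exists>v\<in>W. z *\<^sub>W w = x *\<^sub>W v" if "z \<in> \<mm>" for z
        using u(2)[OF that] smul0[OF m_closed'[OF that] w(1)] w(2) Ymem by simp
      then obtain r v where rv: "r \<in> R" "v \<in> W" "w = r *\<^sub>W s +\<^sub>W x *\<^sub>W v" using s(4)[OF w(1)] by blast
      have "\<pi> w = r *\<^sub>Q \<pi> s +\<^sub>Q \<pi> (x *\<^sub>W v)"
        unfolding rv(3) using linD(2)[OF \<pi>l, of "r *\<^sub>W s" "x *\<^sub>W v"] linD(3)[OF \<pi>l rv(1) s(1)] rv(1,2) s(1) xR by simp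
      also have "\<pi> (x *\<^sub>W v) = 0\<^sub>Q" using \<pi>0 xY[OF rv(2)] xR rv(2) by simp
      finally show ?thesis using rv(1) w(2) linD(1)[OF \<pi>l s(1)] by (intro bexI[of _ r]) simp_all
    qed
    show "\<exists>e\<in>Q. (\<forall>a\<in>J'. a *\<^sub>Q e = 0\<^sub>Q) \<and> u *\<^sub>Q e = \<pi> s"
      if J': "ideal J' R" "x \<in> J'" and u: "u \<in> R" "u \<notin> J'" "\<And>z. z \<in> \<mm> ==> z \<otimes> u \<in> J'" for J' u
    proof -
      obtain w where w: "w \<in> W" "\<And>a. a \<in> J' ==> \<exists>v\<in>W. a *\<^sub>W w = x *\<^sub>W v"
        "\<exists>v\<in>W. u *\<^sub>W w = s +\<^sub>W x *\<^sub>W v" by (rule socle_lifting[OF x(2,1) Wm xreg E J' u s(1,3)]) blast+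
      obtain v where v: "v \<in> W" "u *\<^sub>W w = s +\<^sub>W x *\<^sub>W v" using w(3) by blast
      show ?thesis
      proof (intro bexI conjI ballI)
        show "\<pi> w \<in> Q" using linD(1)[OF \<pi>l w(1)] .
        show "a *\<^sub>Q \<pi> w = 0\<^sub>Q" if "a \<in> J'" for a
          using smul0[OF idealD(1)[OF J'(1) that] w(1)] w(2)[OF that] Ymem by simp
        have "u *\<^sub>Q \<pi> w = \<pi> s +\<^sub>Q \<pi> (x *\<^sub>W v)"
          using linD(3)[OF \<pi>l u(1) w(1)] v linD(2)[OF \<pi>l s(1), of "x *\<^sub>W v"] xR by simp
        also have "\<pi> (x *\<^sub>W v) = 0\<^sub>Q" using \<pi>0 xY[OF v(1)] xR v(1) by simp
        finally show "u *\<^sub>Q \<pi> w = \<pi> s" using linD(1)[OF \<pi>l s(1)] by simp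
      qed
    qed
  qed
  have endoQ: "\<exists>a\<in>R. \<forall>v\<in>W. \<exists>w\<in>W. h v = a *\<^sub>W v +\<^sub>W x *\<^sub>W w"
    if h: "lin R W W h" for h
  proof -
    have hY: "\<pi> (h v) = 0\<^sub>Q" if "v \<in> W" "\<pi> v = 0\<^sub>Q" for v
    proof -
      obtain u where "u \<in> W" "v = x *\<^sub>W u" using \<pi>0[of v] \<open>v \<in> W\<close> \<open>\<pi> v = 0\<^sub>Q\<close> by (auto simp: Y_def)
      thus ?thesis using linD(3)[OF h xR, of u] linD(1)[OF h] \<pi>0 xY xR by simp
    qed
    obtain k where kl: "lin R Q Q k" and k: "\<And>v. v \<in> W ==> k (\<pi> v) = \<pi> (h v)"
      by (rule lin_factor_surj[OF Wm Qm Qm \<pi>l \<pi>s lin_comp[OF h \<pi>l] hY]) (assumption+, rule that)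
    have "lin R (Q\<lparr>carrier := {e \<in> carrier Q. \<forall>a\<in>J. a *\<^sub>Q e = 0\<^sub>Q}\<rparr>) Q k" unfolding whole using kl by simp
    from mp[OF spec[OF conjunct1[OF main]] this]
    obtain a where a: "a \<in> R" and
      a': "\<forall>u\<in>Q. (\<forall>b\<in>J. b *\<^sub>Q u = 0\<^sub>Q) \<longrightarrow> k u = a *\<^sub>Q u" by (elim bexE)
    have a': "k u = a *\<^sub>Q u" if "u \<in> Q" for u using mp[OF bspec[OF a' that]] killJ that by simp
    have "\<exists>w\<in>W. h v = a *\<^sub>W v +\<^sub>W x *\<^sub>W w" if v: "v \<in> W" for v
    proof -
      note hv = linD(1)[OF h v] and av = W.smult_closed[OF a v]
      have "\<pi> (h v) = \<pi> (a *\<^sub>W v)" using a'[OF linD(1)[OF \<pi>l v]] k[OF v] linD(3)[OF \<pi>l a v] by simp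
      hence "h v -\<^sub>W a *\<^sub>W v \<in> Y" using \<pi>eq[OF hv av] by simp
      then obtain w where w: "w \<in> W" "h v -\<^sub>W a *\<^sub>W v = x *\<^sub>W w" using Ymem by blast
      have "h v = a *\<^sub>W v +\<^sub>W (h v -\<^sub>W a *\<^sub>W v)" using hv av by (simp add: a_minus_def W.add_minus_cancel)
      thus ?thesis using w by auto
    qed
    thus ?thesis using a by blast
  qed
  have annQ: "\<exists>r\<in>R. a = x \<otimes> r"
    if a: "a \<in> R" "\<And>v. v \<in> W ==> \<exists>w\<in>W. a *\<^sub>W v = x *\<^sub>W w" for a
  proof -
    have "a *\<^sub>Q u = 0\<^sub>Q" if u: "u \<in> Q" for u
    proof -
      obtain v where v: "v \<in> W" "u = \<pi> v" using u \<pi>s by blast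
      show ?thesis using smul0[OF a(1) v(1)] a(2)[OF v(1)] Ymem v(2) by simp
    qed
    hence "a \<in> J" using bspec[OF conjunct2[OF main] a(1)] by simp
    thus ?thesis using xR by (auto simp: J_def cgenideal_def m_comm)
  qed
  note final = endomorphisms_from_quotient[OF fg x xreg endoQ annQ]
  show "\<exists>a\<in>R. \<forall>v\<in>W. h v = a *\<^sub>W v" if "lin R W W h" for h using final(1)[OF _ _ _ _ _ that] by blast
  show "a = \<zero>" if "a \<in> R" "\<And>v. v \<in> W ==> a *\<^sub>W v = 0\<^sub>W" for a using final(2)[OF _ _ _ _ _ that] by blast
qed

end

section \<open>Finite projective dimension in depth one\<close>

text \<open>The number n counts terms: \<open>pd_le R n L\<close> means a projective resolution by n
  modules, thus projective dimension at most n - 1, and L = 0 for n = 0. Recursion over kernels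
  avoids carrying whole complexes. \<open>minimal_res\<close> is the same count for minimal free
  resolutions.\<close>

primrec pd_le :: "('r, 'x) ring_scheme \<Rightarrow> nat \<Rightarrow> ('r, nat \<Rightarrow> 'r) module \<Rightarrow> bool" where
  "pd_le R 0 = (\<lambda>L. carrier L = {0\<^sub>L})"
| "pd_le R (Suc n) = (\<lambda>L. \<exists>P g. projective_module R P \<and> lin R P L g \<and> g ` carrier P = carrier L \<and>
    pd_le R n (P\<lparr>carrier := {v \<in> carrier P. g v = 0\<^sub>L}\<rparr>))"

primrec minimal_res :: "('r, 'x) ring_scheme \<Rightarrow> 'r set \<Rightarrow> nat \<Rightarrow> ('r, nat \<Rightarrow> 'r) module \<Rightarrow> bool" where
  "minimal_res R \<mm> 0 = (\<lambda>M. carrier M = {0\<^sub>M})"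
| "minimal_res R \<mm> (Suc n) = (\<lambda>M. \<exists>b g. lin R (free_mod R b) M g \<and> g ` carrier (free_mod R b) = carrier M \<and>
    (\<forall>f\<in>(free_mod R b). g f = 0\<^sub>M \<longrightarrow> (\<forall>i. f i \<in> \<mm>)) \<and>
    minimal_res R \<mm> n ((free_mod R b)\<lparr>carrier := {f \<in> free_mod R b. g f = 0\<^sub>M}\<rparr>))"

lemma (in rmod) comb_in_submodule:
  assumes N: "submodule N R M" and "\<And>i. i < b ==> f i *\<^sub>M y i \<in> N"
  shows "comb M y b f \<in> N" using assms(2) by (induction b) (auto intro: submoduleD[OF N])

lemma (in rmod) lin_free_as_comb:
  assumes "lin R (free_mod R b) M h" "f \<in> free_mod R b"
  shows "h f = comb M (\<lambda>i. h (unit_vec R i)) b f"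
proof -
  have c: "\<And>i. i < b ==> h (unit_vec R i) \<in> M" using linD(1)[OF assms(1) R.unit_vec_closed] .
  show ?thesis by (rule lin_free_eq[OF assms(1) comb_lin[of b "\<lambda>i. h (unit_vec R i)"] _ assms(2)])
      (use c comb_unit_vec[of b "\<lambda>i. h (unit_vec R i)"] in auto)
qed

lemma lin_sub:
  assumes "lin R M N h" "S \<subseteq> M" "\<And>v. v \<in> S ==> h v \<in> T"
  shows "lin R (M\<lparr>carrier := S\<rparr>) (N\<lparr>carrier := T\<rparr>) h" using assms by (auto simp: lin_def subset_iff)

context dim_one_ring
begin

text \<open>A chain map through the given projective resolution is homotopic to the identity of the minimal
  free resolution. The hypothesis on \<open>\<beta> \<circ> \<alpha>\<close> is the part of the homotopy that is seen on a syzygy;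
  once \<open>L = 0\<close>, minimality and Nakayama's lemma give \<open>M = 0\<close>.\<close>

lemma minimal_res_if_pd_le:
  fixes M L :: "('r, nat \<Rightarrow> 'r) module"
  assumes "pd_le R n L" "module R L" "fin_gen_module R M" "lin R M L \<alpha>" "lin R L M \<beta>"
    and "lin R M (free_mod R c) \<iota>" "\<And>v i. v \<in> M ==> \<iota> v i \<in> \<mm>" "lin R (free_mod R c) M h"
    and "\<And>v. v \<in> M ==> \<beta> (\<alpha> v) = v +\<^sub>M h (\<iota> v)"
  shows "minimal_res R \<mm> n M" using assms
proof (induction n arbitrary: L M \<alpha> \<beta> c \<iota> h)
  case 0
  note L = 0(2) and fg = 0(3) and \<alpha> = 0(4) and \<beta> = 0(5) and \<iota> = 0(6) and \<iota>m = 0(7) and h = 0(8) and near = 0(9)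
  have Mm: "module R M" by (rule moduleD_fin_gen[OF fg])
  interpret M: rmod R M by (rule rmodI, fact)
  obtain A where A: "finite A" "A \<subseteq> M" "module_span R M A = carrier M" using fg by (rule fin_gen_moduleD)
  have "{0\<^sub>M} = carrier M"
  proof (rule ccontr)
    assume "{0\<^sub>M} \<noteq> carrier M"
    then obtain Z where Z: "submodule Z R M" "Z \<noteq> carrier M"
      "\<And>z v. z \<in> \<mm> ==> v \<in> M ==> z *\<^sub>M v \<in> Z" using nakayama[OF Mm M.submodule_zero _ A] by metis
    note ZD = M.submoduleD[OF Z(1)]
    have "v \<in> Z" if v: "v \<in> M" for v
    proof -
      note iv = linD(1)[OF \<iota> v]
      have "h (\<iota> v) \<in> Z" unfolding M.lin_free_as_comb[OF h iv]
        by (rule M.comb_in_submodule[OF Z(1)]) (use Z(3) \<iota>m[OF v] linD(1)[OF h unit_vec_closed] in auto)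
      moreover have "\<alpha> v = 0\<^sub>L" using linD(1)[OF \<alpha> v] 0(1) by simp
      hence "v +\<^sub>M h (\<iota> v) = 0\<^sub>M" using near[OF v] lin_zero[OF L Mm \<beta>] by simp
      hence "v = -\<^sub>M h (\<iota> v)" using M.M.minus_equality v linD(1)[OF h iv] by metis
      ultimately show ?thesis using ZD(4) by metis
    qed
    thus False using Z(2) ZD(1) by blast
  qed
  thus ?case by simp
next
  case (Suc n)
  note L = Suc.prems(2) and fg = Suc.prems(3) and \<alpha> = Suc.prems(4) and \<beta> = Suc.prems(5)
    and \<iota> = Suc.prems(6) and h = Suc.prems(8) and near = Suc.prems(9)
  have Mm: "module R M" by (rule moduleD_fin_gen[OF fg])
  interpret M: rmod R M by (rule rmodI, fact)
  obtain P \<gamma> where P: "projective_module R P" and \<gamma>: "lin R P L \<gamma>" "\<gamma> ` carrier P = carrier L"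
    and pd: "pd_le R n (P\<lparr>carrier := {v \<in> carrier P. \<gamma> v = 0\<^sub>L}\<rparr>)" using Suc.prems(1) by auto
  have Pm: "module R P" using P by (simp add: projective_module_def)
  interpret P: rmod R P by (rule rmodI, fact)
  obtain b g where g: "lin R (free_mod R b) M g" "g ` carrier (free_mod R b) = carrier M"
    and min: "\<And>f i. f \<in> free_mod R b ==> g f = 0\<^sub>M ==> f i \<in> \<mm>" using minimal_cover[OF fg] by metis
  define F where "F = free_mod R b"
  have Fm: "module R F" unfolding F_def by (rule free_mod_module)
  interpret F: rmod R F by (rule rmodI, fact)
  note g = g[folded F_def] and min = min[folded F_def]
  obtain \<alpha>0 where \<alpha>0: "lin R F P \<alpha>0" "\<And>f. f \<in> F ==> \<gamma> (\<alpha>0 f) = \<alpha> (g f)"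
    using P.free_lift[OF L \<gamma> lin_comp[OF g(1) \<alpha>, unfolded F_def]] by (auto simp: F_def)
  obtain \<beta>0 where \<beta>0: "lin R P F \<beta>0" "\<And>v. v \<in> P ==> g (\<beta>0 v) = \<beta> (\<gamma> v)"
    by (rule projective_lift[OF P Fm Mm inj_on_id g lin_comp[OF \<gamma>(1) \<beta>]]) blast
  obtain h1 where h1: "lin R (free_mod R c) F h1" "\<And>f. f \<in> free_mod R c ==> g (h1 f) = h f"
    using F.free_lift[OF Mm g h] by auto
  define K where "K = {f \<in> F. g f = 0\<^sub>M}"
  have K: "submodule K R F" unfolding K_def by (rule F.kernel_submodule[OF Mm g(1)])
  define KL where "KL = {v \<in> P. \<gamma> v = 0\<^sub>L}"
  have KL: "submodule KL R P" unfolding KL_def by (rule P.kernel_submodule[OF L \<gamma>(1)])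
  have \<iota>g: "lin R F (free_mod R c) (\<lambda>f. \<iota> (g f))" by (rule lin_comp[OF g(1) \<iota>])
  have \<beta>\<alpha>: "lin R F F (\<lambda>f. \<beta>0 (\<alpha>0 f))" by (rule lin_comp[OF \<alpha>0(1) \<beta>0(1)])
  have hig: "lin R F F (\<lambda>f. h1 (\<iota> (g f)))" by (rule lin_comp[OF \<iota>g h1(1)])
  \<comment> \<open>The next piece of the homotopy: \<beta>0 \<alpha>0 minus the identity minus the
    lifted previous piece. By \<open>near\<close> it is mapped to 0 in M, so it has values in the
    syzygy K. On K the term with g f vanishes, so \<beta>0 \<alpha>0 f = f + \<psi> f. The new
    \<iota> is the inclusion of K in F, with entries in \<mm> by minimality.\<close>
  define \<psi> where "\<psi> f = \<beta>0 (\<alpha>0 f) +\<^sub>F (\<ominus> \<one>) *\<^sub>F (f +\<^sub>F h1 (\<iota> (g f)))" for f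
  have \<psi>l: "lin R F F \<psi>" unfolding \<psi>_def
    by (intro lin_add[OF Fm Fm] lin_smult[OF Fm Fm] \<beta>\<alpha> hig) (auto intro: linI)
  have \<psi>K: "\<psi> f \<in> K" if f: "f \<in> F" for f
  proof -
    note gf = linD(1)[OF g(1) f] and hf = linD(1)[OF hig f] and bf = linD(1)[OF \<beta>\<alpha> f]
    have "g (\<psi> f) = g (\<beta>0 (\<alpha>0 f)) +\<^sub>M (\<ominus> \<one>) *\<^sub>M (g f +\<^sub>M g (h1 (\<iota> (g f))))"
      unfolding \<psi>_def using f hf bf linD(2)[OF g(1)] linD(3)[OF g(1)] by simp
    also have "g (\<beta>0 (\<alpha>0 f)) = g f +\<^sub>M h (\<iota> (g f))"
      using \<beta>0(2)[OF linD(1)[OF \<alpha>0(1) f]] \<alpha>0(2)[OF f] near[OF gf] by simp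
    also have "g (h1 (\<iota> (g f))) = h (\<iota> (g f))" by (rule h1(2)[OF linD(1)[OF \<iota>g f]])
    finally have "g (\<psi> f) = 0\<^sub>M"
      using gf linD(1)[OF h linD(1)[OF \<iota>g f]] by (simp add: M.smult_l_minus M.M.r_neg)
    thus ?thesis using linD(1)[OF \<psi>l f] by (simp add: K_def)
  qed
  have "minimal_res R \<mm> n (F\<lparr>carrier := K\<rparr>)"
  proof (rule Suc.IH[of "P\<lparr>carrier := KL\<rparr>" _ \<alpha>0 \<beta>0 b "\<lambda>f. f" \<psi>])
    show "pd_le R n (P\<lparr>carrier := KL\<rparr>)" using pd by (simp add: KL_def)
    show "module R (P\<lparr>carrier := KL\<rparr>)" by (rule P.submodule_module[OF KL])
    show "fin_gen_module R (F\<lparr>carrier := K\<rparr>)"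
      by (rule F.fin_gen_submodule[OF noetherian_ring_axioms _ K]) (simp add: F_def free_mod_fin_gen)
    show "lin R (F\<lparr>carrier := K\<rparr>) (P\<lparr>carrier := KL\<rparr>) \<alpha>0" by (rule lin_sub[OF \<alpha>0(1)])
        (use \<alpha>0 lin_zero[OF Mm L \<alpha>] linD(1)[OF \<alpha>0(1)] in \<open>auto simp: K_def KL_def\<close>)
    show "lin R (P\<lparr>carrier := KL\<rparr>) (F\<lparr>carrier := K\<rparr>) \<beta>0" by (rule lin_sub[OF \<beta>0(1)])
        (use \<beta>0 lin_zero[OF L Mm \<beta>] linD(1)[OF \<beta>0(1)] in \<open>auto simp: K_def KL_def\<close>)
    show "lin R (F\<lparr>carrier := K\<rparr>) (free_mod R b) (\<lambda>f. f)" by (rule linI) (auto simp: K_def F_def)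
    show "v i \<in> \<mm>" if "v \<in> carrier (F\<lparr>carrier := K\<rparr>)" for v i using min that by (auto simp: K_def)
    show "lin R (free_mod R b) (F\<lparr>carrier := K\<rparr>) \<psi>" using \<psi>l \<psi>K by (auto simp: lin_def F_def)
    fix v assume "v \<in> carrier (F\<lparr>carrier := K\<rparr>)"
    hence v: "v \<in> F" "g v = 0\<^sub>M" by (auto simp: K_def)
    have "h1 (\<iota> (g v)) = 0\<^sub>F"
      using v(2) lin_zero[OF Mm free_mod_module \<iota>] lin_zero[OF free_mod_module Fm h1(1)] by simp
    hence "\<psi> v = \<beta>0 (\<alpha>0 v) -\<^sub>F v" using v(1) by (simp add: \<psi>_def F.smult_l_minus a_minus_def)
    hence "v +\<^sub>F \<psi> v = \<beta>0 (\<alpha>0 v)" using v(1) linD(1)[OF \<beta>\<alpha> v(1)] by (simp add: a_minus_def F.add_minus_cancel)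
    thus "\<beta>0 (\<alpha>0 v) = v \<oplus>\<^bsub>F\<lparr>carrier := K\<rparr>\<^esub> \<psi> v" by simp
  qed
  thus ?case using g min unfolding F_def K_def minimal_res.simps(2)
    by (intro exI[of _ b] exI[of _ g] conjI ballI impI allI) simp_all
qed

text \<open>The Auslander-Buchsbaum formula in depth one. By induction the kernel K of the minimal
  cover F -> M is free. A basis vector v of K has entries in \<mm>, so s v = x f for an s outside R
  x with \<mm> s inside R x. As x acts injectively on M, f lies in K, and comparing coordinates in
  the basis of K gives s in R x, a contradiction. So K = 0.\<close>

lemma free_if_minimal_res:
  assumes x: "nonzerodivisor R x" "x \<in> \<mm>"
  shows "minimal_res R \<mm> n M ==> module R M ==>
    (\<And>v. v \<in> M ==> x *\<^sub>M v = 0\<^sub>M ==> v = 0\<^sub>M) ==>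
    \<exists>b g. lin R (free_mod R b) M g \<and> bij_betw g (free_mod R b) M"
proof (induction n arbitrary: M)
  case 0
  have c0: "carrier (free_mod R 0) = {\<lambda>_. \<zero>}" by (auto simp: free_mod_carrier)
  show ?case using 0(1) lin_const_zero[OF 0(2), of "free_mod R 0"]
    by (intro exI[of _ 0] exI[of _ "\<lambda>_. 0\<^sub>M"]) (auto simp: bij_betw_def c0)
next
  case (Suc n)
  interpret M: rmod R M by (rule rmodI, fact)
  have xR: "x \<in> R" using x(1) by (simp add: nonzerodivisor_def)
  obtain b g where g: "lin R (free_mod R b) M g" "g ` carrier (free_mod R b) = carrier M"
    and min: "\<And>f i. f \<in> free_mod R b ==> g f = 0\<^sub>M ==> f i \<in> \<mm>"
    and res: "minimal_res R \<mm> n ((free_mod R b)\<lparr>carrier := {f \<in> free_mod R b. g f = 0\<^sub>M}\<rparr>)"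
    using Suc.prems(1) by auto
  define F where "F = free_mod R b"
  have Fm: "module R F" unfolding F_def by (rule free_mod_module)
  interpret F: rmod R F by (rule rmodI, fact)
  note g = g[folded F_def] and min = min[folded F_def]
  have Fx: "f = 0\<^sub>F" if "f \<in> F" "x *\<^sub>F f = 0\<^sub>F" for f
  proof -
    have "f i = \<zero>" for i
    proof -
      have "x \<otimes> f i = \<zero>" using that(2) by (simp add: F_def fun_eq_iff)
      thus ?thesis using x(1) free_mod_closed[of f b i] that(1) by (simp add: nonzerodivisor_def F_def)
    qed
    thus ?thesis by (simp add: F_def fun_eq_iff)
  qed
  define K where "K = {f \<in> F. g f = 0\<^sub>M}"
  have K: "submodule K R F" unfolding K_def by (rule F.kernel_submodule[OF Suc.prems(2) g(1)])
  obtain c k where k: "lin R (free_mod R c) (F\<lparr>carrier := K\<rparr>) k"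
      "bij_betw k (carrier (free_mod R c)) (carrier (F\<lparr>carrier := K\<rparr>))"
    using Suc.IH[of "F\<lparr>carrier := K\<rparr>"] res F.submodule_module[OF K] Fx F.submoduleD(1)[OF K]
    by (auto simp: F_def K_def)
  have kK: "k ` carrier (free_mod R c) = K" "inj_on k (free_mod R c)" using k(2) by (auto simp: bij_betw_def)
  have kl: "lin R (free_mod R c) F k" using k(1) F.submoduleD(1)[OF K] by (auto simp: lin_def)
  have "c = 0"
  proof (rule ccontr)
    assume "c \<noteq> 0"
    hence u0: "unit_vec R 0 \<in> free_mod R c" by (intro unit_vec_closed) simp
    define v where "v = k (unit_vec R 0)"
    have vK: "v \<in> K" using u0 kK(1) by (auto simp: v_def)
    have vF: "v \<in> F" using F.submoduleD(1)[OF K vK] .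
    have vm: "v i \<in> \<mm>" for i using min vK by (auto simp: K_def)
    define J where "J = PIdl x"
    have J: "ideal J R" "x \<in> J" unfolding J_def using cgenideal_ideal[OF xR] cgenideal_self[OF xR] by auto
    have "J \<subseteq> \<mm>" unfolding J_def by (rule cgenideal_minimal[OF m_ideal x(2)])
    hence "J \<noteq> carrier R" using one_notin_m by auto
    then obtain s where s: "s \<in> R" "s \<notin> J" "\<And>z. z \<in> \<mm> ==> z \<otimes> s \<in> J"
      using ideal_socle[OF J(1) _ x(1) J(2)] by blast
    have "\<exists>r. r \<in> R \<and> s \<otimes> v i = x \<otimes> r" for i
    proof -
      have "v i \<otimes> s \<in> J" by (rule s(3)[OF vm])
      thus ?thesis using xR s(1) m_closed'[OF vm] by (auto simp: J_def cgenideal_def m_comm)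
    qed
    then obtain f0 where f0: "\<And>i. f0 i \<in> R" "\<And>i. s \<otimes> v i = x \<otimes> f0 i" by metis
    define f where "f i = (if i < b then f0 i else \<zero>)" for i
    have fF: "f \<in> F" using f0(1) by (simp add: F_def free_mod_carrier f_def)
    have sv: "s *\<^sub>F v = x *\<^sub>F f"
    proof
      fix i
      show "(s *\<^sub>F v) i = (x *\<^sub>F f) i" using f0(2)[of i] vF s(1) xR by (auto simp: F_def f_def free_mod_carrier)
    qed
    have "x *\<^sub>M g f = g (s *\<^sub>F v)" using linD(3)[OF g(1) xR fF] sv by simp
    also have "\<dots> = 0\<^sub>M" using linD(3)[OF g(1) s(1) vF] vK s(1) by (simp add: K_def)
    finally have "f \<in> K" using Suc.prems(3)[OF linD(1)[OF g(1) fF]] fF by (simp add: K_def)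
    then obtain f' where f': "f' \<in> free_mod R c" "f = k f'" using kK(1) by blast
    interpret C: rmod R "free_mod R c" by (rule rmodI, rule free_mod_module)
    have "k (s \<odot>\<^bsub>free_mod R c\<^esub> unit_vec R 0) = k (x \<odot>\<^bsub>free_mod R c\<^esub> f')"
      using linD(3)[OF kl s(1) u0] linD(3)[OF kl xR f'(1)] sv f'(2) by (simp add: v_def)
    hence "s \<odot>\<^bsub>free_mod R c\<^esub> unit_vec R 0 = x \<odot>\<^bsub>free_mod R c\<^esub> f'"
      using inj_onD[OF kK(2)] C.smult_closed[OF s(1) u0] C.smult_closed[OF xR f'(1)] by blast
    hence "s \<otimes> unit_vec R 0 0 = x \<otimes> f' 0" by (simp add: fun_eq_iff)
    hence "s = f' 0 \<otimes> x" using s(1) xR free_mod_closed[OF f'(1)] by (simp add: unit_vec_def m_comm)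
    hence "s \<in> J" using free_mod_closed[OF f'(1)] by (auto simp: J_def cgenideal_def)
    thus False using s(2) by simp
  qed
  have K0: "f = 0\<^sub>F" if "f \<in> K" for f
  proof -
    obtain f' where "f' \<in> free_mod R c" "f = k f'" using kK(1) \<open>f \<in> K\<close> by blast
    moreover from this have "f' = \<zero>\<^bsub>free_mod R c\<^esub>" using \<open>c = 0\<close> by (auto simp: free_mod_carrier)
    ultimately show ?thesis using lin_zero[OF free_mod_module Fm kl] by simp
  qed
  have "inj_on g F"
  proof (rule inj_onI)
    fix u v assume uv: "u \<in> F" "v \<in> F" "g u = g v"
    have "g (u -\<^sub>F v) = 0\<^sub>M"
      using lin_minus[OF Fm Suc.prems(2) g(1) uv(1,2)] uv M.minus_eq_iff linD(1)[OF g(1)] by simp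
    hence "u -\<^sub>F v \<in> K" using uv by (simp add: K_def)
    from K0[OF this] show "u = v" using F.minus_eq_iff uv by simp
  qed
  thus ?case using g by (intro exI[of _ b] exI[of _ g]) (auto simp: bij_betw_def F_def)
qed

theorem free_if_finite_proj_dim:
  fixes M :: "('r, 'm) module"
  assumes x: "nonzerodivisor R x" "x \<in> \<mm>" and fg: "fin_gen_module R M"
    and tf: "\<And>v. v \<in> M ==> x *\<^sub>M v = 0\<^sub>M ==> v = 0\<^sub>M"
    and pd: "proj_dim R M < \<infinity>"
  shows "\<exists>b g. lin R (free_mod R b) M g \<and> bij_betw g (free_mod R b) M"
proof -
  have Mm: "module R M" by (rule moduleD_fin_gen[OF fg])
  interpret M: rmod R M by (rule rmodI, fact)
  have xR: "x \<in> R" using x(1) by (simp add: nonzerodivisor_def)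
  obtain n P d e where res: "projective_resolution R M P d e" and fin: "\<forall>i>n. carrier (P i) = {\<zero>\<^bsub>P i\<^esub>}"
    using enat_Inf_less_infinity[OF pd[unfolded proj_dim_def]] by blast
  have proj: "\<And>i. projective_module R (P i)" and dl: "\<And>i. lin R (P (Suc i)) (P i) (d i)"
    and el: "lin R (P 0) M e" and es: "e ` carrier (P 0) = carrier M"
    and ker0: "d 0 ` carrier (P (Suc 0)) = {v \<in> P 0. e v = 0\<^sub>M}"
    and kerS: "\<And>i. d (Suc i) ` carrier (P (Suc (Suc i))) = {v \<in> carrier (P (Suc i)). d i v = \<zero>\<^bsub>P i\<^esub>}"
    using res by (simp_all add: projective_resolution_def module_homs_imp_lin a_kernel_def')
  have Pm: "\<And>i. module R (P i)" using proj by (simp add: projective_module_def)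
  obtain j :: "'m \<Rightarrow> nat \<Rightarrow> 'r" where j: "inj_on j M" using M.fin_gen_injection[OF fg] .
  define N where "N = transport j M"
  have Nm: "module R N" unfolding N_def by (rule M.transport_module[OF j])
  interpret N: rmod R N by (rule rmodI, fact)
  note tl = M.transport_lin[OF j, folded N_def]
  define ji where "ji = inv_into M j"
  define K where "K i = (case i of 0 \<Rightarrow> {v \<in> P 0. e v = 0\<^sub>M}
    | Suc i' \<Rightarrow> {v \<in> P i. d i' v = \<zero>\<^bsub>P i'\<^esub>})" for i
  have dK: "d i ` carrier (P (Suc i)) = K i" for i by (cases i) (simp_all add: K_def ker0 kerS)
  \<comment> \<open>Downwards from n, where the syzygy K n vanishes because P (n + 1) is zero.
    Together with P 0 this makes n + 1 terms for the module itself.\<close>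
  have pdK: "pd_le R (n - i) ((P i)\<lparr>carrier := K i\<rparr>)" if "i \<le> n" for i using that
  proof (induction rule: inc_induct)
    case base
    have "carrier (P (Suc n)) = {\<zero>\<^bsub>P (Suc n)\<^esub>}" using fin by simp
    hence "K n = {\<zero>\<^bsub>P n\<^esub>}" using dK[of n] lin_zero[OF Pm Pm dl] by auto
    thus ?case by simp
  next
    case (step i)
    have "pd_le R (Suc (n - Suc i)) ((P i)\<lparr>carrier := K i\<rparr>)" unfolding pd_le.simps(2)
    proof (intro exI conjI)
      show "projective_module R (P (Suc i))" by (rule proj)
      show "lin R (P (Suc i)) (P i\<lparr>carrier := K i\<rparr>) (d i)" using dl[of i] dK[of i] by (auto simp: lin_def)
      show "d i ` carrier (P (Suc i)) = carrier (P i\<lparr>carrier := K i\<rparr>)" using dK by simp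
      show "pd_le R (n - Suc i)
        (P (Suc i)\<lparr>carrier := {v \<in> carrier (P (Suc i)). d i v = \<zero>\<^bsub>P i\<lparr>carrier := K i\<rparr>\<^esub>}\<rparr>)"
        using step.IH by (simp add: K_def)
    qed
    thus ?case using step.hyps by (simp add: Suc_diff_Suc)
  qed
  have kerj: "{v \<in> P 0. j (e v) = 0\<^sub>N} = K 0"
  proof -
    have "j (e v) = 0\<^sub>N \<longleftrightarrow> e v = 0\<^sub>M" if "v \<in> P 0" for v
      using inj_onD[OF j, of "e v" "0\<^sub>M"] linD(1)[OF el that] lin_zero[OF Mm Nm tl(1)] by auto
    thus ?thesis by (auto simp: K_def)
  qed
  have "pd_le R (Suc n) N" unfolding pd_le.simps(2)
  proof (intro exI conjI)
    show "projective_module R (P 0)" by (rule proj)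
    show "lin R (P 0) N (\<lambda>v. j (e v))" by (rule lin_comp[OF el tl(1)])
    show "(\<lambda>v. j (e v)) ` carrier (P 0) = carrier N" unfolding tl(4)[symmetric] es[symmetric] by (simp add: image_image)
    show "pd_le R n (P 0\<lparr>carrier := {v \<in> P 0. j (e v) = 0\<^sub>N}\<rparr>)" using pdK[of 0] by (simp add: kerj)
  qed
  moreover have idN: "lin R N N (\<lambda>v. v)" by (rule linI) auto
  moreover have "fin_gen_module R N" unfolding N_def by (rule M.fin_gen_transport[OF j fg])
  \<comment> \<open>The comparison starts with the identity of N on both sides, so the initial
    homotopy is zero and factors through the free module of rank 0.\<close>
  ultimately have "minimal_res R \<mm> (Suc n) N"
    using idealD(2)[OF m_ideal] lin_const_zero[OF free_mod_module, of N 0] lin_const_zero[OF Nm, of "free_mod R 0"]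
    by (intro minimal_res_if_pd_le[of "Suc n" N N "\<lambda>v. v" "\<lambda>v. v" 0 "\<lambda>_ _. \<zero>" "\<lambda>_. 0\<^sub>N"]) (auto simp: Nm)
  moreover have "v = 0\<^sub>N" if v: "v \<in> N" "x *\<^sub>N v = 0\<^sub>N" for v
  proof -
    obtain w where w: "w \<in> M" "v = j w" using v(1) tl(4) by blast
    have "j (x *\<^sub>M w) = j 0\<^sub>M" using v(2) w(2) linD(3)[OF tl(1) xR w(1)] lin_zero[OF Mm Nm tl(1)] by simp
    hence "x *\<^sub>M w = 0\<^sub>M" using inj_onD[OF j] w(1) xR by auto
    hence "w = 0\<^sub>M" by (rule tf[OF w(1)])
    thus ?thesis using w(2) lin_zero[OF Mm Nm tl(1)] by simp
  qed
  ultimately obtain b g where g: "lin R (free_mod R b) N g" "bij_betw g (free_mod R b) N"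
    using free_if_minimal_res[OF x _ Nm] by blast
  have "bij_betw ji N (carrier M)"
    unfolding ji_def using tl(4) bij_betw_inv_into[of j "carrier M" "carrier N"] j by (simp add: bij_betw_def)
  hence "bij_betw (\<lambda>f. ji (g f)) (carrier (free_mod R b)) (carrier M)"
    using bij_betw_trans[OF g(2)] by (simp add: comp_def)
  moreover have "lin R (free_mod R b) M (\<lambda>f. ji (g f))"
    by (rule lin_comp[OF g(1)]) (use tl(2) in \<open>simp add: ji_def\<close>)
  ultimately show ?thesis by blast
qed

end

section \<open>Duality into the canonical module\<close>

lemma lin_inv_into:
  assumes M: "module R M" and N: "module R N" and g: "lin R M N g" "bij_betw g M (carrier N)"
  shows "lin R N M (inv_into M g)"
    and "\<And>v. v \<in> M ==> inv_into M g (g v) = v"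
    and "\<And>w. w \<in> N ==> g (inv_into M g w) = w"
    and "\<And>w. w \<in> N ==> inv_into M g w \<in> M"
    and "bij_betw (inv_into M g) (carrier N) (carrier M)"
proof -
  interpret M: rmod R M by (rule rmodI, fact)
  interpret N: rmod R N by (rule rmodI, fact)
  have inj: "inj_on g M" and im: "g ` carrier M = carrier N" using g(2) by (auto simp: bij_betw_def)
  show i: "\<And>v. v \<in> M ==> inv_into M g (g v) = v" by (rule inv_into_f_f[OF inj])
  show f: "\<And>w. w \<in> N ==> g (inv_into M g w) = w" by (rule f_inv_into_f) (simp add: im)
  show c: "\<And>w. w \<in> N ==> inv_into M g w \<in> M" by (rule inv_into_into) (simp add: im)
  show "bij_betw (inv_into M g) (carrier N) (carrier M)" by (rule bij_betw_inv_into[OF g(2)])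
  show "lin R N M (inv_into M g)"
  proof (rule linI[OF c])
    fix v w assume v: "v \<in> N" and w: "w \<in> N"
    show "inv_into M g (v +\<^sub>N w) = inv_into M g v +\<^sub>M inv_into M g w"
      using i[OF M.M.a_closed[OF c[OF v] c[OF w]]] linD(2)[OF g(1) c[OF v] c[OF w]] f[OF v] f[OF w] by simp
  next
    fix a v assume a: "a \<in> R" and v: "v \<in> N"
    show "inv_into M g (a *\<^sub>N v) = a *\<^sub>M inv_into M g v"
      using i[OF M.smult_closed[OF a c[OF v]]] linD(3)[OF g(1) a c[OF v]] f[OF v] by simp
  qed
qed

text \<open>The image of Hom(M, R) \<otimes> M in End M. If the homothety of c belongs to it, then c
  v is a finite sum of terms D(v) y with D and y independent of v.\<close>

definition trace_maps :: "('r, 'x) ring_scheme \<Rightarrow> ('r, 'm) module \<Rightarrow> ('m \<Rightarrow> 'm) set" where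
  "trace_maps R M = module_span R (Hom_module R M M)
    {(\<lambda>v\<in>M. D v *\<^sub>M y) |D y. lin R M (self_module R) D \<and> y \<in> M}"

lemma (in rmod) lin_rank_one:
  assumes "lin R M (self_module R) D" "module R N" "y \<in> N"
  shows "lin R M N (\<lambda>v. D v *\<^sub>N y)"
proof -
  interpret N: rmod R N by (rule rmodI, fact)
  show ?thesis by (rule linI) (use linD[OF assms(1)] assms(3) in \<open>auto simp: N.smult_l_distr N.smult_assoc1\<close>)
qed

lemma (in rmod) trace_maps_submodule: "submodule (trace_maps R M) R (Hom_module R M M)"
proof -
  interpret H: rmod R "Hom_module R M M" by (rule rmodI, rule Hom_module_module[OF is_mod is_mod])
  show ?thesis unfolding trace_maps_def
    by (rule H.span_submodule) (use lin_restrict[OF is_mod lin_rank_one[OF _ is_mod]] in auto)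
qed

section \<open>Rank-one endomorphisms\<close>

context dim_one_ring
begin

text \<open>Each element of P is killed by something outside P, by
  \<open>minimal_prime_annihilator\<close>. P is finitely generated, and the product of the killers
  of its generators kills all of P.\<close>

lemma annihilator_outside:
  assumes P: "primeideal P R" "P \<noteq> \<mm>"
  obtains t where "t \<in> R" "t \<notin> P" "\<And>b. b \<in> P ==> t \<otimes> b = \<zero>"
proof -
  note PD = primeidealD[OF P(1)]
  obtain G where G: "G \<subseteq> R" "finite G" "P = genideal R G" using finetely_gen[OF PD(1)] by blast
  have "G \<subseteq> P" using genideal_self[OF G(1)] G(3) by simp
  from G(2) this have "\<exists>t\<in>R. t \<notin> P \<and> (\<forall>b\<in>G. t \<otimes> b = \<zero>)"
  proof (induction G rule: finite_induct)
    case empty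
    show ?case using PD(2) by blast
  next
    case (insert b G)
    then obtain t where t: "t \<in> R" "t \<notin> P" "\<forall>b\<in>G. t \<otimes> b = \<zero>" by blast
    have bP: "b \<in> P" using insert.prems by simp
    obtain a where a: "a \<in> R" "a \<notin> P" "a \<otimes> b = \<zero>" using minimal_prime_annihilator[OF P bP] by blast
    have c: "c \<in> R" if "c \<in> insert b G" for c using idealD(1)[OF PD(1)] insert.prems that by auto
    have "(t \<otimes> a) \<otimes> c = \<zero>" if "c \<in> insert b G" for c
    proof (cases "c = b")
      case True
      thus ?thesis using a t c[OF that] by (simp add: m_assoc)
    next
      case False
      hence "t \<otimes> c = \<zero>" using t that by auto
      moreover have "(t \<otimes> a) \<otimes> c = a \<otimes> (t \<otimes> c)" using a t c[OF that] by (simp add: m_ac)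
      ultimately show ?thesis using a by simp
    qed
    moreover have "t \<otimes> a \<notin> P" using PD(3) a t by blast
    ultimately show ?case using a t by blast
  qed
  then obtain t where t: "t \<in> R" "t \<notin> P" "\<forall>b\<in>G. t \<otimes> b = \<zero>" by blast
  have "ideal {b \<in> R. t \<otimes> b = \<zero>} R"
  proof (rule cring_idealI)
    show "r \<otimes> a \<in> {b \<in> R. t \<otimes> b = \<zero>}" if "r \<in> R" "a \<in> {b \<in> R. t \<otimes> b = \<zero>}" for r a
    proof -
      have "t \<otimes> (r \<otimes> a) = r \<otimes> (t \<otimes> a)" by (rule m_lcomm) (use that t(1) in auto)
      thus ?thesis using that by simp
    qed
  qed (use t(1) in \<open>auto simp: r_distr\<close>)
  hence "P \<subseteq> {b \<in> R. t \<otimes> b = \<zero>}" unfolding G(3) using t(3) G(1) by (intro genideal_minimal) auto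
  thus ?thesis using that t by blast
qed

text \<open>Localized at \<open>P\<close> the module becomes a vector space over the field \<open>R\<^sub>P\<close>; clearing denominators in a
  basis taken from the generators gives the required maps.\<close>

lemma trace_ideal_outside_prime:
  fixes M :: "('r, 'm) module"
  assumes P: "primeideal P R" "P \<noteq> \<mm>" and fg: "fin_gen_module R M"
  shows "\<exists>c\<in>R. c \<notin> P \<and> (\<lambda>v\<in>M. c *\<^sub>M v) \<in> trace_maps R M"
proof -
  have Mm: "module R M" by (rule moduleD_fin_gen[OF fg])
  interpret M: rmod R M by (rule rmodI, fact)
  note PD = primeidealD[OF P(1)] and PI = idealD[OF primeidealD(1)[OF P(1)]]
  obtain t where t: "t \<in> R" "t \<notin> P" "\<And>b. b \<in> P ==> t \<otimes> b = \<zero>" using annihilator_outside[OF P] by blast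
  obtain A where A: "finite A" "A \<subseteq> M" "module_span R M A = carrier M" using fg by (rule fin_gen_moduleD)
  \<comment> \<open>Independence over the localization at P: the coefficients of a relation become
    zero there, that is, lie in P. The members of such a family are distinct, which bounds k by
    \<open>card A\<close>.\<close>
  define indep where "indep y k \<longleftrightarrow> (\<forall>i<k. y i \<in> A) \<and>
    (\<forall>f\<in>(free_mod R k). comb M y k f = 0\<^sub>M \<longrightarrow> (\<forall>i. f i \<in> P))" for y and k :: nat
  have ycl: "y i \<in> M" if "indep y k" "i < k" for y k i using that A(2) by (auto simp: indep_def)
  have bound: "k \<le> card A" if ind: "indep y k" for y k
  proof -
    have "inj_on y {..<k}"
    proof (rule inj_onI, rule ccontr)
      fix i j assume ij: "i \<in> {..<k}" "j \<in> {..<k}" "y i = y j" "i \<noteq> j"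
      interpret F: rmod R "free_mod R k" by (rule rmodI, rule free_mod_module)
      have cl: "lin R (free_mod R k) M (comb M y k)" by (rule M.comb_lin[of k y]) (rule ycl[OF ind])
      have u: "unit_vec R i \<in> free_mod R k" "unit_vec R j \<in> free_mod R k" using ij unit_vec_closed by auto
      define f where "f = unit_vec R i \<oplus>\<^bsub>free_mod R k\<^esub> (\<ominus> \<one>) \<odot>\<^bsub>free_mod R k\<^esub> unit_vec R j"
      have fF: "f \<in> free_mod R k" unfolding f_def using u by (intro F.M.a_closed F.smult_closed) auto
      have nj: "(\<ominus> \<one>) \<odot>\<^bsub>free_mod R k\<^esub> unit_vec R j \<in> free_mod R k" using u by (intro F.smult_closed) auto
      have "comb M y k f = comb M y k (unit_vec R i) +\<^sub>M (\<ominus> \<one>) *\<^sub>M comb M y k (unit_vec R j)"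
        unfolding f_def linD(2)[OF cl u(1) nj] by (subst linD(3)[OF cl _ u(2)]) auto
      also have "\<dots> = y i +\<^sub>M (\<ominus> \<one>) *\<^sub>M y i"
        using M.comb_unit_vec[of k y i] M.comb_unit_vec[of k y j] ycl[OF ind] ij by simp
      also have "\<dots> = 0\<^sub>M" using ycl[OF ind, of i] ij(1) by (simp add: M.smult_l_minus M.M.r_neg)
      finally have "f i \<in> P" using ind fF by (simp add: indep_def)
      thus False using PD(2) ij(4) by (simp add: f_def unit_vec_def)
    qed
    moreover have "y ` {..<k} \<subseteq> A" using ind by (auto simp: indep_def)
    ultimately show ?thesis using card_inj_on_le[OF _ _ A(1), of y "{..<k}"] by simp
  qed
  have "indep (\<lambda>_. undefined) 0" using PI(2) by (auto simp: indep_def free_mod_carrier)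
  hence ex: "\<exists>y. indep y 0" by blast
  define k where "k = (GREATEST k. \<exists>y. indep y k)"
  have k: "\<exists>y. indep y k" and max: "\<And>k' y. indep y k' ==> k' \<le> k"
    unfolding k_def using GreatestI_nat[of "\<lambda>k. \<exists>y. indep y k", OF ex] bound
      Greatest_le_nat[of "\<lambda>k. \<exists>y. indep y k"] by blast+
  obtain y where y: "indep y k" using k by blast
  note yM = ycl[OF y]
  have cl: "lin R (free_mod R k) M (comb M y k)" by (rule M.comb_lin[of k y]) (rule yM)
  define S where "S = comb M y k ` carrier (free_mod R k)"
  interpret F: rmod R "free_mod R k" by (rule rmodI, rule free_mod_module)
  have S: "submodule S R M" unfolding S_def by (rule F.image_submodule[OF Mm cl F.carrier_is_submodule])
  note SD = M.submoduleD[OF S]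
  have "\<exists>c\<in>R. c \<notin> P \<and> c *\<^sub>M a \<in> S" if a: "a \<in> A" for a
  proof -
    have aM: "a \<in> M" using a A by auto
    define y' where "y' = y(k := a)"
    have y'A: "\<forall>i<Suc k. y' i \<in> A" using y a by (auto simp: y'_def indep_def less_Suc_eq)
    have "\<not> indep y' (Suc k)" using max[of y' "Suc k"] by auto
    then obtain f i where f: "f \<in> carrier (free_mod R (Suc k))" "comb M y' (Suc k) f = 0\<^sub>M" "f i \<notin> P"
      using y'A by (auto simp: indep_def)
    note fR = free_mod_closed[OF f(1)]
    have "comb M y' n f = comb M y n f" if "n \<le> k" for n using that by (induction n) (auto simp: y'_def)
    hence rel: "comb M y k f +\<^sub>M f k *\<^sub>M a = 0\<^sub>M" using f(2) by (simp add: y'_def)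
    define f' where "f' = (\<lambda>j. if j < k then f j else \<zero>)"
    have f'F: "f' \<in> free_mod R k" using fR by (simp add: free_mod_carrier f'_def)
    have "comb M y n f = comb M y n f'" if "n \<le> k" for n using that by (induction n) (auto simp: f'_def)
    hence rel': "comb M y k f' +\<^sub>M f k *\<^sub>M a = 0\<^sub>M" using rel by simp
    note cf' = linD(1)[OF cl f'F]
    \<comment> \<open>If f k were in P, then t f k = 0 and t f' would be a relation among the y i.
      Independence and t outside P would put all entries of f into P.\<close>
    have "f k \<notin> P"
    proof
      assume fk: "f k \<in> P"
      have "t *\<^sub>M (comb M y k f' +\<^sub>M f k *\<^sub>M a) = comb M y k (t \<odot>\<^bsub>free_mod R k\<^esub> f') +\<^sub>M (t \<otimes> f k) *\<^sub>M a"
        using t(1) cf' fR aM linD(3)[OF cl t(1) f'F] by (simp add: M.smult_r_distr M.smult_assoc1)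
      hence "comb M y k (t \<odot>\<^bsub>free_mod R k\<^esub> f') = 0\<^sub>M"
        using rel' t(1) t(3)[OF fk] aM linD(1)[OF cl F.smult_closed[OF t(1) f'F]] by simp
      hence "(t \<odot>\<^bsub>free_mod R k\<^esub> f') i \<in> P" using y F.smult_closed[OF t(1) f'F] unfolding indep_def by blast
      hence "f' i \<in> P" using PD(3)[OF t(1) free_mod_closed[OF f'F]] t(2) by auto
      hence "i < k ==> f i \<in> P" by (simp add: f'_def)
      moreover have "Suc k \<le> i ==> f i \<in> P" using f(1) PI(2) by (simp add: free_mod_carrier)
      ultimately show False using f(3) fk by (metis not_less_eq_eq not_le le_antisym)
    qed
    moreover have "f k *\<^sub>M a = -\<^sub>M comb M y k f'"
      using M.M.minus_equality[of "f k *\<^sub>M a" "comb M y k f'"] rel' cf' fR aM by (simp add: M.M.a_comm)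
    moreover have "comb M y k f' \<in> S" unfolding S_def using f'F by blast
    ultimately show ?thesis using SD(4) fR by (intro bexI[of _ "f k"]) auto
  qed
  hence each: "\<forall>a\<in>A. \<exists>c\<in>R. c \<notin> P \<and> c *\<^sub>M a \<in> S" by blast
  have "\<exists>c\<in>R. c \<notin> P \<and> (\<forall>a\<in>A. c *\<^sub>M a \<in> S)" using A(1,2) each
  proof (induction A rule: finite_induct)
    case empty
    show ?case using PD(2) by blast
  next
    case (insert a A)
    obtain c where c: "c \<in> R" "c \<notin> P" "\<forall>a\<in>A. c *\<^sub>M a \<in> S" using insert by auto
    obtain c' where c': "c' \<in> R" "c' \<notin> P" "c' *\<^sub>M a \<in> S" using insert.prems by auto
    have "(c \<otimes> c') *\<^sub>M b \<in> S" if b: "b \<in> insert a A" for b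
    proof -
      have bM: "b \<in> M" using b insert.prems by auto
      have e: "(c \<otimes> c') *\<^sub>M b = c *\<^sub>M (c' *\<^sub>M b)" "(c \<otimes> c') *\<^sub>M b = c' *\<^sub>M (c *\<^sub>M b)"
        using c(1) c'(1) bM by (simp_all add: M.smult_assoc1[symmetric] m_comm)
      show ?thesis
      proof (cases "b = a")
        case True
        thus ?thesis using e(1) SD(6)[OF c(1) c'(3)] by simp
      next
        case False
        thus ?thesis using e(2) SD(6)[OF c'(1)] c(3) b by simp
      qed
    qed
    moreover have "c \<otimes> c' \<notin> P" using PD(3) c c' by blast
    ultimately show ?case using c c' by blast
  qed
  then obtain c where c: "c \<in> R" "c \<notin> P" "\<forall>a\<in>A. c *\<^sub>M a \<in> S" by blast
  have cS: "c *\<^sub>M v \<in> S" if "v \<in> M" for v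
    using M.span_least[OF M.vimage_submodule[OF Mm M.lin_homothety[OF c(1)] S], of A] c(3) A(2,3) that by auto
  define \<phi> where "\<phi> v = (SOME f. f \<in> free_mod R k \<and> c *\<^sub>M v = comb M y k f)" for v
  have \<phi>: "\<phi> v \<in> free_mod R k \<and> c *\<^sub>M v = comb M y k (\<phi> v)" if "v \<in> M" for v
  proof -
    have "\<exists>f. f \<in> free_mod R k \<and> c *\<^sub>M v = comb M y k f" using cS[OF that] unfolding S_def by blast
    from someI_ex[OF this] show ?thesis unfolding \<phi>_def .
  qed
  \<comment> \<open>The coordinates of c v are determined only up to elements of P; the factor t,
    which kills P, turns them into linear functions of v.\<close>
  define D where "D i v = t \<otimes> \<phi> v i" for i v
  define I where "I = M\<lparr>carrier := S\<rparr>"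
  have Im: "module R I" unfolding I_def by (rule M.submodule_module[OF S])
  have cI: "lin R (free_mod R k) I (comb M y k)" "comb M y k ` carrier (free_mod R k) = carrier I"
    unfolding I_def S_def using cl by (auto simp: lin_def)
  have Dl: "lin R M (self_module R) (D i)" for i
  proof -
    have kl: "lin R (free_mod R k) (self_module R) (\<lambda>f. t \<otimes> f i)"
      by (rule linI) (simp_all add: t(1) free_mod_closed r_distr m_lcomm)
    obtain h where h: "lin R I (self_module R) h" "\<And>f. f \<in> free_mod R k ==> h (comb M y k f) = t \<otimes> f i"
      by (rule lin_factor_surj[OF free_mod_module Im self_module_module cI kl])
        (use y t(3) in \<open>auto simp: indep_def I_def\<close>)
    have "lin R M (self_module R) (\<lambda>v. h (c *\<^sub>M v))"
      by (rule lin_comp[OF _ h(1)]) (use cS M.lin_homothety[OF c(1)] in \<open>auto simp: lin_def I_def\<close>)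
    moreover have "h (c *\<^sub>M v) = D i v" if "v \<in> M" for v using \<phi>[OF that] h(2) by (simp add: D_def)
    ultimately show ?thesis using lin_cong[OF Mm, of "D i" "\<lambda>v. h (c *\<^sub>M v)"] by simp
  qed
  interpret H: rmod R "Hom_module R M M" by (rule rmodI, rule Hom_module_module[OF Mm Mm])
  note TD = H.submoduleD[OF M.trace_maps_submodule]
  have "(\<lambda>v\<in>M. comb M y n (\<lambda>i. D i v)) \<in> trace_maps R M" if "n \<le> k" for n using that
  proof (induction n)
    case 0
    show ?case using TD(2) by (simp only: comb.simps Hom_module_simps)
  next
    case (Suc n)
    define h where "h = (\<lambda>v\<in>M. D n v *\<^sub>M y n)"
    have hT: "h \<in> trace_maps R M" unfolding trace_maps_def h_def
      by (rule subsetD[OF H.span_incl]) (use Dl yM[of n] Suc.prems in auto)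
    have "(\<lambda>v\<in>M. comb M y n (\<lambda>i. D i v)) \<oplus>\<^bsub>Hom_module R M M\<^esub> h \<in> trace_maps R M"
      by (rule TD(3)[OF Suc.IH hT]) (use Suc.prems in linarith)
    moreover have "(\<lambda>v\<in>M. comb M y n (\<lambda>i. D i v)) \<oplus>\<^bsub>Hom_module R M M\<^esub> h =
        (\<lambda>v\<in>M. comb M y (Suc n) (\<lambda>i. D i v))"
      unfolding Hom_module_simps by (rule restrict_ext) (simp add: h_def)
    ultimately show ?case by (simp only:)
  qed
  from this[OF order.refl] have in_T: "(\<lambda>v\<in>M. comb M y k (\<lambda>i. D i v)) \<in> trace_maps R M" .
  have "comb M y k (\<lambda>i. D i v) = (t \<otimes> c) *\<^sub>M v" if v: "v \<in> M" for v
  proof -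
    note fv = \<phi>[OF v]
    have "comb M y k (\<lambda>i. D i v) = comb M y k (t \<odot>\<^bsub>free_mod R k\<^esub> \<phi> v)" by (simp add: D_def)
    also have "\<dots> = t *\<^sub>M comb M y k (\<phi> v)" using linD(3)[OF cl t(1)] fv by blast
    also have "\<dots> = t *\<^sub>M (c *\<^sub>M v)" using fv by simp
    finally show ?thesis using t(1) c(1) v by (simp add: M.smult_assoc1)
  qed
  hence "(\<lambda>v\<in>M. comb M y k (\<lambda>i. D i v)) = (\<lambda>v\<in>M. (t \<otimes> c) *\<^sub>M v)" by (rule restrict_ext)
  moreover have "t \<otimes> c \<notin> P" using PD(3) t c by blast
  ultimately show ?thesis using in_T t(1) c(1) by (intro bexI[of _ "t \<otimes> c"] conjI) (simp_all only: m_closed not_False_eq_True)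
qed

text \<open>By \<open>trace_ideal_outside_prime\<close>, the ideal of all c whose homothety is a
  trace map lies in no prime except possibly \<mm>, so it contains a power of x.\<close>

lemma power_in_trace_ideal:
  fixes M :: "('r, 'm) module"
  assumes fg: "fin_gen_module R M" and x: "x \<in> \<mm>"
  shows "\<exists>n::nat. (\<lambda>v\<in>M. x [^] n *\<^sub>M v) \<in> trace_maps R M"
proof -
  have Mm: "module R M" by (rule moduleD_fin_gen[OF fg])
  interpret M: rmod R M by (rule rmodI, fact)
  interpret H: rmod R "Hom_module R M M" by (rule rmodI, rule Hom_module_module[OF Mm Mm])
  note TD = H.submoduleD[OF M.trace_maps_submodule]
  define J where "J = {c \<in> R. (\<lambda>v\<in>M. c *\<^sub>M v) \<in> trace_maps R M}"
  have "ideal J R"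
  proof (rule cring_idealI)
    show "J \<subseteq> R" by (auto simp: J_def)
    have "(\<lambda>v\<in>M. \<zero> *\<^sub>M v) = (\<lambda>v\<in>M. 0\<^sub>M)" by (rule restrict_ext) simp
    thus "\<zero> \<in> J" using TD(2) by (simp add: J_def)
    show "a \<oplus> b \<in> J" if ab: "a \<in> J" "b \<in> J" for a b
    proof -
      have c: "a \<in> R" "b \<in> R" using ab by (auto simp: J_def)
      have "(\<lambda>v\<in>M. a *\<^sub>M v) \<oplus>\<^bsub>Hom_module R M M\<^esub> (\<lambda>v\<in>M. b *\<^sub>M v) \<in> trace_maps R M"
        by (rule TD(3)) (use ab in \<open>auto simp: J_def\<close>)
      moreover have "(\<lambda>v\<in>M. a *\<^sub>M v) \<oplus>\<^bsub>Hom_module R M M\<^esub> (\<lambda>v\<in>M. b *\<^sub>M v) =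
          (\<lambda>v\<in>M. (a \<oplus> b) *\<^sub>M v)"
        unfolding Hom_module_simps by (rule restrict_ext) (use c in \<open>simp add: M.smult_l_distr\<close>)
      ultimately show ?thesis using c by (simp add: J_def)
    qed
    show "r \<otimes> a \<in> J" if ra: "r \<in> R" "a \<in> J" for r a
    proof -
      have c: "a \<in> R" using ra by (auto simp: J_def)
      have "r \<odot>\<^bsub>Hom_module R M M\<^esub> (\<lambda>v\<in>M. a *\<^sub>M v) \<in> trace_maps R M"
        by (rule TD(6)) (use ra in \<open>auto simp: J_def\<close>)
      moreover have "r \<odot>\<^bsub>Hom_module R M M\<^esub> (\<lambda>v\<in>M. a *\<^sub>M v) = (\<lambda>v\<in>M. (r \<otimes> a) *\<^sub>M v)"
        unfolding Hom_module_simps by (rule restrict_ext) (use c ra in \<open>simp add: M.smult_assoc1\<close>)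
      ultimately show ?thesis using c ra by (simp add: J_def)
    qed
  qed
  moreover have "x \<in> P" if P: "primeideal P R" "J \<subseteq> P" for P
  proof (rule ccontr)
    assume "x \<notin> P"
    hence "P \<noteq> \<mm>" using x by blast
    then obtain c where "c \<in> R" "c \<notin> P" "(\<lambda>v\<in>M. c *\<^sub>M v) \<in> trace_maps R M"
      using trace_ideal_outside_prime[OF P(1) _ fg] by blast
    thus False using P(2) by (auto simp: J_def)
  qed
  ultimately obtain n :: nat where "x [^] n \<in> J" using pow_in_if_prime m_closed'[OF x] by metis
  thus ?thesis by (auto simp: J_def)
qed

end

section \<open>The map from M \<otimes> W to Hom(Hom(M, R), W)\<close>

context local_noetherian
begin

text \<open>Dual form of Nakayama's lemma for free modules. If the last entries of N all lie in
  \<mm>, the last coordinate serves. Otherwise N has a member n with last entry 1, and the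
  projection \<pi> along n maps N into the part of N with last entry 0; a form for that part,
  composed with \<pi>, serves for N.\<close>

lemma proper_submodule_hyperplane:
  assumes "submodule N R (free_mod R r)" "N \<noteq> carrier (free_mod R r)"
  shows "\<exists>\<rho>. lin R (free_mod R r) (self_module R) \<rho> \<and> (\<exists>v\<in>(free_mod R r). \<rho> v = \<one>) \<and> (\<forall>n\<in>N. \<rho> n \<in> \<mm>)"
  using assms
proof (induction r arbitrary: N)
  case 0
  interpret F: rmod R "free_mod R 0" by (rule rmodI, rule free_mod_module)
  have "carrier (free_mod R 0) = {\<zero>\<^bsub>free_mod R 0\<^esub>}" by (auto simp: free_mod_carrier)
  hence "carrier (free_mod R 0) \<subseteq> N" using F.submoduleD(2)[OF 0(1)] by simp
  moreover have "N \<subseteq> free_mod R 0" using F.submoduleD(1)[OF 0(1)] by blast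
  ultimately show ?case using 0(2) by simp
next
  case (Suc r)
  define F where "F = free_mod R (Suc r)"
  define G where "G = free_mod R r"
  have Fm: "module R F" and Gm: "module R G" unfolding F_def G_def by (rule free_mod_module)+
  interpret F: rmod R F by (rule rmodI, fact)
  interpret G: rmod R G by (rule rmodI, fact)
  note N = Suc.prems[folded F_def] and ND = F.submoduleD[OF Suc.prems(1)[folded F_def]]
  have Fc: "v i \<in> R" if "v \<in> F" for v i using that free_mod_closed by (auto simp: F_def)
  have GF: "v \<in> G \<longleftrightarrow> v \<in> F \<and> v r = \<zero>" for v
  proof -
    have "(\<forall>i\<ge>r. v i = \<zero>) \<longleftrightarrow> v r = \<zero> \<and> (\<forall>i\<ge>Suc r. v i = \<zero>)"
      by (metis Suc_leD le_antisym not_less_eq_eq order.refl)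
    thus ?thesis by (auto simp: F_def G_def free_mod_carrier less_Suc_eq)
  qed
  have add: "v +\<^sub>G w = v +\<^sub>F w" and smul: "a *\<^sub>G v = a *\<^sub>F v" and zero: "0\<^sub>G = 0\<^sub>F" for v w a
    by (simp_all add: F_def G_def)
  have Fadd: "(v +\<^sub>F w) i = v i \<oplus> w i" and Fsmul: "(a *\<^sub>F v) i = a \<otimes> v i" for v w a i by (simp_all add: F_def)
  show ?case unfolding F_def[symmetric]
  proof (cases "\<forall>n\<in>N. n r \<in> \<mm>")
    case True
    show "\<exists>\<rho>. lin R F (self_module R) \<rho> \<and> (\<exists>v\<in>F. \<rho> v = \<one>) \<and> (\<forall>n\<in>N. \<rho> n \<in> \<mm>)"
    proof -
      have "lin R F (self_module R) (\<lambda>v. v r)" by (rule linI) (use Fc in \<open>auto simp: Fadd Fsmul\<close>)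
      moreover have "unit_vec R r r = \<one>" by (simp add: unit_vec_def)
      moreover have "unit_vec R r \<in> F" unfolding F_def by (rule unit_vec_closed) simp
      ultimately show ?thesis using True by blast
    qed
  next
    case False
    then obtain n0 where n0: "n0 \<in> N" "n0 r \<notin> \<mm>" by blast
    have u: "n0 r \<in> Units R" using unit_if n0(2) Fc[OF ND(1)[OF n0(1)]] by blast
    define n where "n = inv (n0 r) *\<^sub>F n0"
    have n: "n \<in> N" "n r = \<one>" unfolding n_def using ND(6) n0(1) u by (auto simp: Fsmul)
    note nF = ND(1)[OF n(1)]
    define \<pi> where "\<pi> v = v +\<^sub>F (\<ominus> v r) *\<^sub>F n" for v
    have \<pi>G: "\<pi> v \<in> G" if "v \<in> F" for v
      using that nF n(2) Fc[OF that, of r] by (simp add: GF \<pi>_def Fadd Fsmul r_neg)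
    have \<pi>N: "\<pi> v \<in> N" if "v \<in> N" for v
      unfolding \<pi>_def using ND(1)[OF that] Fc[of v r] by (intro ND(3,6) that n(1)) auto
    have \<pi>l: "lin R F G \<pi>"
    proof (rule linI[OF \<pi>G])
      fix v assume v: "v \<in> F"
      show "\<pi> (v +\<^sub>F w) = \<pi> v +\<^sub>G \<pi> w" if w: "w \<in> F" for w using v w nF Fc[OF v, of r] Fc[OF w, of r]
        by (simp add: \<pi>_def add Fadd minus_add F.smult_l_distr F.M.a_ac)
      show "\<pi> (a *\<^sub>F v) = a *\<^sub>G \<pi> v" if a: "a \<in> R" for a using v a nF Fc[OF v, of r]
        by (simp add: \<pi>_def smul Fsmul F.smult_r_distr F.smult_assoc1[symmetric] r_minus)
    qed
    define N0 where "N0 = {v \<in> G. v \<in> N}"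
    have N0: "submodule N0 R G"
      by (rule G.submoduleI') (use ND G.M.zero_closed G.M.a_closed G.smult_closed in \<open>auto simp: N0_def add smul zero\<close>)
    have "N0 \<noteq> carrier G"
    proof
      assume eq: "N0 = carrier G"
      have "v \<in> N" if v: "v \<in> F" for v
      proof -
        have "\<pi> v \<in> N" using \<pi>G[OF v] eq by (auto simp: N0_def)
        hence "\<pi> v +\<^sub>F v r *\<^sub>F n \<in> N" using ND(3,6) n(1) Fc[OF v] by auto
        moreover have "\<pi> v +\<^sub>F v r *\<^sub>F n = v"
          using v nF Fc[OF v, of r] by (simp add: \<pi>_def F.M.a_assoc F.smult_l_distr[symmetric] l_neg)
        ultimately show ?thesis by simp
      qed
      thus False using N(2) ND(1) by blast
    qed
    then obtain \<rho> v0 where \<rho>: "lin R G (self_module R) \<rho>" "v0 \<in> G" "\<rho> v0 = \<one>" "\<forall>n\<in>N0. \<rho> n \<in> \<mm>"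
      using Suc.IH[of N0] N0 unfolding G_def by blast
    show "\<exists>\<rho>. lin R F (self_module R) \<rho> \<and> (\<exists>v\<in>F. \<rho> v = \<one>) \<and> (\<forall>n\<in>N. \<rho> n \<in> \<mm>)"
    proof -
      have "lin R F (self_module R) (\<lambda>v. \<rho> (\<pi> v))" by (rule lin_comp[OF \<pi>l \<rho>(1)])
      moreover have "v0 \<in> F" using \<rho>(2) GF by simp
      moreover have "\<pi> v0 = v0" using \<rho>(2) nF by (simp add: \<pi>_def GF)
      moreover have "\<rho> (\<pi> m) \<in> \<mm>" if "m \<in> N" for m
        using \<rho>(4) \<pi>N[OF that] \<pi>G[OF ND(1)[OF that]] by (simp add: N0_def)
      moreover have "\<rho> (\<pi> v0) = \<one>" using \<open>\<pi> v0 = v0\<close> \<rho>(3) by simp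
      ultimately show ?thesis by blast
    qed
  qed
qed

end

text \<open>\<open>\<Delta>\<close> stands for the dual of \<open>M\<close> and \<open>W\<close> for the canonical module.\<close>

locale dual_pair = dim_one_ring R \<mm>
  for R :: "('r, 'x) ring_scheme" (structure) and \<mm> :: "'r set" +
  fixes M :: "('r, 'm) module" and \<Delta> :: "('r, 'd) module" and pr :: "'d \<Rightarrow> 'm \<Rightarrow> 'r"
    and W :: "('r, 'w) module"
  assumes M_fg: "fin_gen_module R M"
    and \<Delta>_module: "module R \<Delta>"
    and pr_lin: "D \<in> \<Delta> ==> lin R M (self_module R) (pr D)"
    and pr_lin': "v \<in> M ==> lin R \<Delta> (self_module R) (\<lambda>D. pr D v)"
    and pr_surj: "lin R M (self_module R) \<rho> ==> \<exists>D\<in>\<Delta>. \<forall>v\<in>M. pr D v = \<rho> v"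
    and pr_inj: "\<lbrakk>D \<in> \<Delta>; D' \<in> \<Delta>; \<And>v. v \<in> M ==> pr D v = pr D' v\<rbrakk> \<Longrightarrow> D = D'"
    and W_fg: "fin_gen_module R W"
    and W_reg: "\<lbrakk>nonzerodivisor R x; w \<in> W; x *\<^sub>W w = 0\<^sub>W\<rbrakk> \<Longrightarrow> w = 0\<^sub>W"
    and W_endo: "lin R W W h ==> \<exists>a\<in>R. \<forall>v\<in>W. h v = a *\<^sub>W v"
    and W_faithful: "\<lbrakk>a \<in> R; \<And>v. v \<in> W ==> a *\<^sub>W v = 0\<^sub>W\<rbrakk> \<Longrightarrow> a = \<zero>"
begin

lemma M_module: "module R M" by (rule moduleD_fin_gen[OF M_fg])
lemma W_module: "module R W" by (rule moduleD_fin_gen[OF W_fg])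

sublocale M: rmod R M by (rule rmodI, rule M_module)
sublocale W: rmod R W by (rule rmodI, rule W_module)
sublocale \<Delta>: rmod R \<Delta> by (rule rmodI, rule \<Delta>_module)

definition "H = Hom_module R \<Delta> W"

lemma H_module: "module R H" unfolding H_def by (rule Hom_module_module[OF \<Delta>_module W_module])

sublocale H: rmod R H by (rule rmodI, rule H_module)

lemma W_cancel:
  assumes "nonzerodivisor R x" "v \<in> W" "w \<in> W" "x *\<^sub>W v = x *\<^sub>W w"
  shows "v = w"
proof -
  have xR: "x \<in> R" using assms(1) by (simp add: nonzerodivisor_def)
  have "x *\<^sub>W (v -\<^sub>W w) = 0\<^sub>W"
    unfolding W.smult_minus_r[OF xR assms(2,3)] using assms xR by (simp add: W.minus_eq_iff)
  thus ?thesis using W_reg[OF assms(1), of "v -\<^sub>W w"] assms W.minus_eq_iff by simp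
qed

lemma W_scalar_eq:
  assumes "a \<in> R" "b \<in> R" "\<And>v. v \<in> W ==> a *\<^sub>W v = b *\<^sub>W v"
  shows "a = b"
proof -
  have "a \<ominus> b = \<zero>" by (rule W_faithful) (use assms in \<open>simp_all add: W.smult_minus_l W.minus_eq_iff\<close>)
  thus ?thesis using assms by simp
qed

lemma H_mem: "f \<in> H \<longleftrightarrow> f \<in> module_homs R \<Delta> W" by (simp add: H_def)

lemma H_lin: "f \<in> H ==> lin R \<Delta> W f" by (simp add: H_mem module_homs_imp_lin)

lemma H_ext: "f \<in> H ==> g \<in> H ==> (\<And>D. D \<in> \<Delta> ==> f D = g D) ==> f = g"
proof -
  assume f: "f \<in> H" and g: "g \<in> H" and e: "\<And>D. D \<in> \<Delta> ==> f D = g D"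
  have "(\<lambda>D\<in>\<Delta>. f D) = (\<lambda>D\<in>\<Delta>. g D)" by (rule restrict_ext) (rule e)
  thus "f = g" using module_homsD(4)[of f R \<Delta> W] module_homsD(4)[of g R \<Delta> W] f g H_mem by simp
qed

lemma H_ops:
  "D \<in> \<Delta> ==> (f +\<^sub>H g) D = f D +\<^sub>W g D" "D \<in> \<Delta> ==> (a *\<^sub>H f) D = a *\<^sub>W f D"
  "D \<in> \<Delta> ==> 0\<^sub>H D = 0\<^sub>W" by (simp_all add: H_def)

definition ev :: "'m \<Rightarrow> 'w \<Rightarrow> 'd \<Rightarrow> 'w" where
  "ev y w = (\<lambda>D\<in>\<Delta>. pr D y *\<^sub>W w)"

lemma ev_closed: "y \<in> M ==> w \<in> W ==> ev y w \<in> H"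
  unfolding ev_def H_mem by (rule lin_restrict[OF \<Delta>_module \<Delta>.lin_rank_one[OF pr_lin' W_module]])

lemma ev_apply: "D \<in> \<Delta> ==> ev y w D = pr D y *\<^sub>W w" by (simp add: ev_def)

lemma pr_closed: "D \<in> \<Delta> ==> v \<in> M ==> pr D v \<in> R" using linD(1)[OF pr_lin] by simp

text \<open>The image of M \<otimes> W in Hom(\<Delta>, W).\<close>

definition "N = module_span R H {ev y w |y w. y \<in> M \<and> w \<in> W}"

lemma N_submodule: "submodule N R H" unfolding N_def by (rule H.span_submodule) (use ev_closed in auto)

lemma ev_in_N: "y \<in> M ==> w \<in> W ==> ev y w \<in> N" unfolding N_def by (rule subsetD[OF H.span_incl]) blast

lemma N_least:
  assumes "submodule S R H" "\<And>y w. y \<in> M ==> w \<in> W ==> ev y w \<in> S"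
  shows "N \<subseteq> S" unfolding N_def by (rule H.span_least[OF assms(1)]) (use assms(2) in auto)

lemma \<Delta>_fin_gen: "fin_gen_module R \<Delta>"
proof -
  obtain A where A: "finite A" "A \<subseteq> M" "module_span R M A = carrier M" using M_fg by (rule fin_gen_moduleD)
  obtain y and b :: nat where y: "A = y ` {i. i < b}" using A(1) by (auto simp: finite_conv_nat_seg_image)
  show ?thesis
  proof (rule \<Delta>.fin_gen_if_embedding_family[OF noetherian_ring_axioms self_module_fin_gen])
    show "lin R \<Delta> (self_module R) (\<lambda>D. pr D (y i))" if "i < b" for i by (rule pr_lin') (use A(2) y that in auto)
    fix D assume D: "D \<in> \<Delta>" "\<And>i. i < b ==> pr D (y i) = \<zero>\<^bsub>self_module R\<^esub>"
    have z: "pr 0\<^sub>\<Delta> v = \<zero>" if "v \<in> M" for v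
      using lin_zero[OF \<Delta>_module self_module_module pr_lin'[OF that]] by simp
    show "D = 0\<^sub>\<Delta>"
    proof (rule pr_inj[OF D(1) \<Delta>.M.zero_closed])
      fix v assume v: "v \<in> M"
      have "pr D v = (\<lambda>_. \<zero>\<^bsub>self_module R\<^esub>) v"
        by (rule M.lin_eq_on_span[OF self_module_module pr_lin[OF D(1)] lin_const_zero[OF self_module_module] A(2)])
          (use D(2) y A(3) v in auto)
      thus "pr D v = pr 0\<^sub>\<Delta> v" using z[OF v] by simp
    qed
  qed
qed

lemma H_fin_gen: "fin_gen_module R H" unfolding H_def by (rule fin_gen_Hom[OF \<Delta>_fin_gen W_fg])

lemma H_reg: "nonzerodivisor R x ==> f \<in> H ==> x *\<^sub>H f = 0\<^sub>H ==> f = 0\<^sub>H"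
proof (rule H_ext[OF _ H.M.zero_closed])
  fix D assume x: "nonzerodivisor R x" and f: "f \<in> H" "x *\<^sub>H f = 0\<^sub>H" and D: "D \<in> \<Delta>"
  have "x *\<^sub>W f D = 0\<^sub>W" using f(2) D by (metis H_ops(2,3))
  thus "f D = 0\<^sub>H D" using W_reg[OF x linD(1)[OF H_lin[OF f(1)] D]] D by (simp add: H_ops)
qed

text \<open>The two properties of a regular \<open>c\<close> with \<open>c y = \<Sum> D\<^sub>i(y) y\<^sub>i\<close>, transposed to \<open>\<Delta>\<close> in the second case.\<close>

lemma trace_kernel:
  assumes c: "c \<in> R" "(\<lambda>v\<in>M. c *\<^sub>M v) \<in> trace_maps R M"
    and v: "v \<in> M" "\<And>D. D \<in> \<Delta> ==> pr D v = \<zero>"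
  shows "c *\<^sub>M v = 0\<^sub>M"
proof -
  interpret E: rmod R "Hom_module R M M" by (rule rmodI, rule Hom_module_module[OF M_module M_module])
  have S: "submodule {h \<in> Hom_module R M M. h v = 0\<^sub>M} R (Hom_module R M M)"
    by (rule E.kernel_submodule[OF M_module Hom_eval_lin[OF v(1)]])
  have "trace_maps R M \<subseteq> {h \<in> Hom_module R M M. h v = 0\<^sub>M}" unfolding trace_maps_def
  proof (rule E.span_least[OF S], safe)
    fix D y assume D: "lin R M (self_module R) D" and y: "y \<in> M"
    show "(\<lambda>v\<in>M. D v *\<^sub>M y) \<in> Hom_module R M M"
      using lin_restrict[OF M_module M.lin_rank_one[OF D M_module y]] by simp
    obtain D' where "D' \<in> \<Delta>" "\<forall>v\<in>M. pr D' v = D v" using pr_surj[OF D] by blast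
    hence "D v = \<zero>" using v by auto
    thus "(\<lambda>v\<in>M. D v *\<^sub>M y) v = 0\<^sub>M" using v(1) y by simp
  qed
  hence "(\<lambda>v\<in>M. c *\<^sub>M v) v = 0\<^sub>M" using c(2) by blast
  thus ?thesis using v(1) by simp
qed

lemma trace_in_N:
  assumes c: "c \<in> R" "(\<lambda>v\<in>M. c *\<^sub>M v) \<in> trace_maps R M" and f: "f \<in> H"
  shows "c *\<^sub>H f \<in> N"
proof -
  interpret E: rmod R "Hom_module R M M" by (rule rmodI, rule Hom_module_module[OF M_module M_module])
  note ND = H.submoduleD[OF N_submodule]
  note fl = H_lin[OF f]
  \<comment> \<open>Membership of h in S says that f, composed with the transpose of h on \<Delta>,
    lies in N. The transpose is given as a relation between D and D', with existence by
    \<open>pr_surj\<close> and uniqueness by \<open>pr_inj\<close>.\<close>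
  define S where "S = {h \<in> Hom_module R M M. \<exists>n\<in>N. \<forall>D\<in>\<Delta>. \<forall>D'\<in>\<Delta>.
    (\<forall>v\<in>M. pr D' v = pr D (h v)) \<longrightarrow> n D = f D'}"
  have ex: "\<exists>D'\<in>\<Delta>. \<forall>v\<in>M. pr D' v = pr D (h v)"
    if "h \<in> Hom_module R M M" "D \<in> \<Delta>" for h D
    by (rule pr_surj[OF lin_comp[OF module_homs_imp_lin pr_lin]]) (use that in auto)
  have zpr: "pr 0\<^sub>\<Delta> v = \<zero>" if "v \<in> M" for v
    using lin_zero[OF \<Delta>_module self_module_module pr_lin'[OF that]] by simp
  have S: "submodule S R (Hom_module R M M)"
  proof (rule E.submoduleI')
    show "S \<subseteq> Hom_module R M M" by (auto simp: S_def)
    have "0\<^sub>H D = f D'" if "D \<in> \<Delta>" "D' \<in> \<Delta>"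
        "\<forall>v\<in>M. pr D' v = pr D (\<zero>\<^bsub>Hom_module R M M\<^esub> v)" for D D'
    proof -
      have "pr D' v = pr 0\<^sub>\<Delta> v" if "v \<in> M" for v
        using \<open>\<forall>v\<in>M. _\<close> that lin_zero[OF M_module self_module_module pr_lin[OF \<open>D \<in> \<Delta>\<close>]]
          zpr[OF that] by simp
      hence "D' = 0\<^sub>\<Delta>" by (rule pr_inj[OF that(2) \<Delta>.M.zero_closed])
      thus ?thesis using lin_zero[OF \<Delta>_module W_module fl] that(1) by (simp add: H_ops)
    qed
    thus "\<zero>\<^bsub>Hom_module R M M\<^esub> \<in> S" using ND(2) E.M.zero_closed unfolding S_def by blast
    show "h \<oplus>\<^bsub>Hom_module R M M\<^esub> k \<in> S" if hk: "h \<in> S" "k \<in> S" for h k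
    proof -
      have hkE: "h \<in> Hom_module R M M" "k \<in> Hom_module R M M" using hk by (auto simp: S_def)
      obtain n n' where n: "n \<in> N" "n' \<in> N"
        "\<And>D D'. D \<in> \<Delta> ==> D' \<in> \<Delta> ==> \<forall>v\<in>M. pr D' v = pr D (h v) ==> n D = f D'"
        "\<And>D D'. D \<in> \<Delta> ==> D' \<in> \<Delta> ==> \<forall>v\<in>M. pr D' v = pr D (k v) ==> n' D = f D'"
        using hk unfolding S_def by blast
      have "(n +\<^sub>H n') D = f D'" if D: "D \<in> \<Delta>" "D' \<in> \<Delta>"
        and e: "\<forall>v\<in>M. pr D' v = pr D ((h \<oplus>\<^bsub>Hom_module R M M\<^esub> k) v)" for D D'
      proof -
        obtain D1 D2 where D12: "D1 \<in> \<Delta>" "\<forall>v\<in>M. pr D1 v = pr D (h v)"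
          "D2 \<in> \<Delta>" "\<forall>v\<in>M. pr D2 v = pr D (k v)" using ex[OF hkE(1) D(1)] ex[OF hkE(2) D(1)] by blast
        have "pr D' v = pr (D1 +\<^sub>\<Delta> D2) v" if v: "v \<in> M" for v
        proof -
          have "h v \<in> M" "k v \<in> M" using hkE v module_homsD(1) by fastforce+
          thus ?thesis using e v D12 linD(2)[OF pr_lin[OF D(1)]] linD(2)[OF pr_lin'[OF v] D12(1,3)] by simp
        qed
        hence "D' = D1 +\<^sub>\<Delta> D2" by (rule pr_inj[OF D(2) \<Delta>.M.a_closed[OF D12(1,3)]])
        thus ?thesis using n(3)[OF D(1) D12(1,2)] n(4)[OF D(1) D12(3,4)] linD(2)[OF fl D12(1,3)] D(1)
          by (simp add: H_ops)
      qed
      moreover have "n +\<^sub>H n' \<in> N" by (rule ND(3)[OF n(1,2)])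
      moreover have "h \<oplus>\<^bsub>Hom_module R M M\<^esub> k \<in> Hom_module R M M" by (rule E.M.a_closed[OF hkE])
      ultimately show ?thesis unfolding S_def by blast
    qed
    show "a \<odot>\<^bsub>Hom_module R M M\<^esub> h \<in> S" if a: "a \<in> R" and h: "h \<in> S" for a h
    proof -
      have hE: "h \<in> Hom_module R M M" using h by (auto simp: S_def)
      obtain n where n: "n \<in> N"
        "\<And>D D'. D \<in> \<Delta> ==> D' \<in> \<Delta> ==> \<forall>v\<in>M. pr D' v = pr D (h v) ==> n D = f D'" using h unfolding S_def by blast
      have "(a *\<^sub>H n) D = f D'" if D: "D \<in> \<Delta>" "D' \<in> \<Delta>"
        and e: "\<forall>v\<in>M. pr D' v = pr D ((a \<odot>\<^bsub>Hom_module R M M\<^esub> h) v)" for D D'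
      proof -
        obtain D1 where D1: "D1 \<in> \<Delta>" "\<forall>v\<in>M. pr D1 v = pr D (h v)" using ex[OF hE D(1)] by blast
        have "pr D' v = pr (a *\<^sub>\<Delta> D1) v" if v: "v \<in> M" for v
        proof -
          have "h v \<in> M" using hE v module_homsD(1) by fastforce
          thus ?thesis using e v D1 linD(3)[OF pr_lin[OF D(1)] a] linD(3)[OF pr_lin'[OF v] a D1(1)] by simp
        qed
        hence "D' = a *\<^sub>\<Delta> D1" by (rule pr_inj[OF D(2) \<Delta>.smult_closed[OF a D1(1)]])
        thus ?thesis using n(2)[OF D(1) D1] linD(3)[OF fl a D1(1)] D(1) by (simp add: H_ops)
      qed
      moreover have "a *\<^sub>H n \<in> N" by (rule ND(6)[OF a n(1)])
      moreover have "a \<odot>\<^bsub>Hom_module R M M\<^esub> h \<in> Hom_module R M M" by (rule E.smult_closed[OF a hE])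
      ultimately show ?thesis unfolding S_def by blast
    qed
  qed
  have "trace_maps R M \<subseteq> S" unfolding trace_maps_def
  proof (rule E.span_least[OF S], safe)
    fix D0 y assume D0: "lin R M (self_module R) D0" and y: "y \<in> M"
    define h where "h = (\<lambda>v\<in>M. D0 v *\<^sub>M y)"
    have hE: "h \<in> Hom_module R M M"
      unfolding h_def using lin_restrict[OF M_module M.lin_rank_one[OF D0 M_module y]] by simp
    obtain D1 where D1: "D1 \<in> \<Delta>" "\<forall>v\<in>M. pr D1 v = D0 v" using pr_surj[OF D0] by blast
    have fD: "f D1 \<in> W" by (rule linD(1)[OF fl D1(1)])
    \<comment> \<open>The transpose of v -> D0(v) y takes D to the multiple of D1 by the scalar
      \<open>pr D y\<close>; applying f gives \<open>ev y (f D1)\<close> at D.\<close>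
    have "ev y (f D1) D = f D'" if D: "D \<in> \<Delta>" "D' \<in> \<Delta>"
      and e: "\<forall>v\<in>M. pr D' v = pr D (h v)" for D D'
    proof -
      have "pr D' v = pr (pr D y *\<^sub>\<Delta> D1) v" if v: "v \<in> M" for v
        using e v D1 y pr_closed[OF D(1) y] linD(1)[OF D0 v] linD(3)[OF pr_lin[OF D(1)] _ y, of "D0 v"]
          linD(3)[OF pr_lin'[OF v] pr_closed[OF D(1) y] D1(1)] by (simp add: h_def m_comm)
      hence "D' = pr D y *\<^sub>\<Delta> D1" by (rule pr_inj[OF D(2) \<Delta>.smult_closed[OF pr_closed[OF D(1) y] D1(1)]])
      thus ?thesis using linD(3)[OF fl pr_closed[OF D(1) y] D1(1)] ev_apply[OF D(1)] by simp
    qed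
    thus "(\<lambda>v\<in>M. D0 v *\<^sub>M y) \<in> S" using ev_in_N[OF y fD] hE unfolding S_def h_def[symmetric] by blast
  qed
  then obtain n where n: "n \<in> N" "\<And>D D'. D \<in> \<Delta> ==> D' \<in> \<Delta> ==>
      \<forall>v\<in>M. pr D' v = pr D ((\<lambda>v\<in>M. c *\<^sub>M v) v) ==> n D = f D'" using c(2) unfolding S_def by blast
  have "n = c *\<^sub>H f"
  proof (rule H_ext[OF ND(1)[OF n(1)] H.smult_closed[OF c(1) f]])
    fix D assume D: "D \<in> \<Delta>"
    have "n D = f (c *\<^sub>\<Delta> D)" by (rule n(2)[OF D \<Delta>.smult_closed[OF c(1) D]])
        (use linD(3)[OF pr_lin'[OF _] c(1) D] linD(3)[OF pr_lin[OF D] c(1)] in simp)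
    thus "n D = (c *\<^sub>H f) D" using linD(3)[OF fl c(1) D] D by (simp add: H_ops)
  qed
  thus ?thesis using n(1) by simp
qed

end

context dual_pair
begin

lemma N_eq_H:
  assumes g: "lin R (free_mod R r) H g" "bij_betw g (free_mod R r) H"
  shows "N = carrier H"
proof (rule ccontr)
  assume NH: "N \<noteq> carrier H"
  define F where "F = free_mod R r"
  have Fm: "module R F" unfolding F_def by (rule free_mod_module)
  interpret F: rmod R F by (rule rmodI, fact)
  note g = g[folded F_def]
  note ND = H.submoduleD[OF N_submodule]
  define gi where "gi = inv_into F g"
  note gi = lin_inv_into[OF Fm H_module g, folded gi_def]
  define N' where "N' = {f \<in> F. g f \<in> N}"
  have N': "submodule N' R F" unfolding N'_def by (rule F.vimage_submodule[OF H_module g(1) N_submodule])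
  have "N' \<noteq> carrier F"
  proof
    assume "N' = carrier F"
    hence "f \<in> N" if "f \<in> H" for f using gi(3,4)[OF that] by (force simp: N'_def)
    thus False using NH ND(1) by blast
  qed
  then obtain \<rho>0 v0 where \<rho>0: "lin R F (self_module R) \<rho>0" "v0 \<in> F" "\<rho>0 v0 = \<one>" "\<forall>n\<in>N'. \<rho>0 n \<in> \<mm>"
    using proper_submodule_hyperplane[of N' r] N' unfolding F_def by blast
  define \<rho> where "\<rho> f = \<rho>0 (gi f)" for f
  have \<rho>: "lin R H (self_module R) \<rho>" unfolding \<rho>_def by (rule lin_comp[OF gi(1) \<rho>0(1)])
  have \<rho>N: "\<rho> n \<in> \<mm>" if "n \<in> N" for n using \<rho>0(4) gi(3,4)[OF ND(1)[OF that]] that by (auto simp: \<rho>_def N'_def)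
  define V where "V = g v0"
  have V: "V \<in> H" "\<rho> V = \<one>" using linD(1)[OF g(1) \<rho>0(2)] gi(2)[OF \<rho>0(2)] \<rho>0(3) by (auto simp: V_def \<rho>_def)
  have \<rho>R: "\<rho> f \<in> R" if "f \<in> H" for f using linD(1)[OF \<rho> that] by simp
  obtain x where x: "x \<in> \<mm>" "nonzerodivisor R x" using exists_nonzerodivisor by blast
  have xR: "x \<in> R" using x(1) m_closed' by auto
  obtain n :: nat where n: "(\<lambda>v\<in>M. x [^] n *\<^sub>M v) \<in> trace_maps R M"
    using power_in_trace_ideal[OF M_fg x(1)] by blast
  define c where "c = x [^] n"
  have c: "c \<in> R" "nonzerodivisor R c" unfolding c_def using xR nonzerodivisor_pow[OF x(2)] by auto
  have cN: "c *\<^sub>H V \<in> N" using trace_in_N[OF c(1) n[folded c_def] V(1)] .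
  define Y where "Y = (\<lambda>v. x *\<^sub>W v) ` carrier W"
  have Y: "submodule Y R W" unfolding Y_def by (rule W.multiples_submodule[OF xR])
  have YW: "Y \<noteq> carrier W"
  proof
    assume eq: "Y = carrier W"
    obtain A where A: "finite A" "A \<subseteq> W" "module_span R W A = carrier W" using W_fg by (rule fin_gen_moduleD)
    have "{0\<^sub>W} \<noteq> carrier W"
    proof
      assume "{0\<^sub>W} = carrier W"
      hence "\<one> = \<zero>" by (intro W_faithful) auto
      thus False using one_notin_m idealD(2)[OF m_ideal] by simp
    qed
    then obtain Z where Z: "submodule Z R W" "Z \<noteq> carrier W"
      "\<And>z v. z \<in> \<mm> ==> v \<in> W ==> z *\<^sub>W v \<in> Z" using nakayama[OF W_module W.submodule_zero _ A] by metis
    hence "Y \<subseteq> Z" using x(1) by (auto simp: Y_def)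
    thus False using eq Z(2) W.submoduleD(1)[OF Z(1)] by blast
  qed
  obtain w where w: "w \<in> W" "w \<notin> Y" "\<And>z. z \<in> \<mm> ==> z *\<^sub>W w \<in> Y"
  proof (rule socle[OF W_module Y YW x(2)])
    show "x *\<^sub>W v \<in> Y" if "v \<in> W" for v using that by (auto simp: Y_def)
  qed blast
  have evl: "lin R W H (ev y)" if y: "y \<in> M" for y
  proof (rule linI)
    fix v assume v: "v \<in> W"
    show "ev y v \<in> H" by (rule ev_closed[OF y v])
    show "ev y (v +\<^sub>W v') = ev y v +\<^sub>H ev y v'" if "v' \<in> W" for v'
      by (rule H_ext[OF ev_closed H.M.a_closed[OF ev_closed ev_closed]])
        (use y v that in \<open>simp_all add: ev_apply H_ops pr_closed W.smult_r_distr\<close>)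
    show "ev y (a *\<^sub>W v) = a *\<^sub>H ev y v" if "a \<in> R" for a
      by (rule H_ext[OF ev_closed H.smult_closed[OF _ ev_closed]])
        (use y v that in \<open>simp_all add: ev_apply H_ops pr_closed W.smult_swap\<close>)
  qed
  \<comment> \<open>\<rho> (ev y v) lies in \<mm>, and \<mm> w lies in x W. Division by x gives an
    endomorphism of W in the variable v, hence a scalar \<sigma> y.\<close>
  have "\<exists>\<theta>. lin R W W \<theta> \<and> (\<forall>v\<in>W. \<rho> (ev y v) *\<^sub>W w = x *\<^sub>W \<theta> v)" if y: "y \<in> M" for y
  proof -
    have wx: "\<exists>u\<in>W. \<rho> (ev y v) *\<^sub>W w = x *\<^sub>W u" if v: "v \<in> W" for v
      using w(3)[OF \<rho>N[OF ev_in_N[OF y v]]] by (auto simp: Y_def)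
    obtain \<theta> where "lin R W W \<theta>" "\<And>v. v \<in> W ==> \<rho> (ev y v) *\<^sub>W w = x *\<^sub>W \<theta> v"
      by (rule W.lin_divide[OF xR W_reg[OF x(2)] W_module lin_comp[OF evl[OF y] H.lin_rank_one[OF \<rho> W_module w(1)]] wx])
        (assumption+, rule that)
    thus ?thesis by blast
  qed
  then obtain \<theta> where \<theta>lin: "\<And>y. y \<in> M ==> lin R W W (\<theta> y)"
    and \<theta>: "\<And>y v. y \<in> M ==> v \<in> W ==> \<rho> (ev y v) *\<^sub>W w = x *\<^sub>W \<theta> y v" by metis
  have ev_add_l: "ev (y +\<^sub>M y') v = ev y v +\<^sub>H ev y' v"
    if "y \<in> M" "y' \<in> M" "v \<in> W" for y y' v by (rule H_ext[OF ev_closed H.M.a_closed[OF ev_closed ev_closed]])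
      (use that linD(2)[OF pr_lin] in \<open>simp_all add: ev_apply H_ops pr_closed W.smult_l_distr\<close>)
  have ev_smult_l: "ev (a *\<^sub>M y) v = a *\<^sub>H ev y v"
    if "y \<in> M" "v \<in> W" "a \<in> R" for y v a by (rule H_ext[OF ev_closed H.smult_closed[OF _ ev_closed]])
      (use that linD(3)[OF pr_lin] in \<open>simp_all add: ev_apply H_ops pr_closed W.smult_assoc1\<close>)
  have \<rho>add: "\<rho> (f +\<^sub>H f') = \<rho> f \<oplus> \<rho> f'" if "f \<in> H" "f' \<in> H" for f f' using linD(2)[OF \<rho> that] by simp
  have \<rho>smult: "\<rho> (a *\<^sub>H f) = a \<otimes> \<rho> f" if "a \<in> R" "f \<in> H" for f a using linD(3)[OF \<rho> that] by simp
  note xswap = W.smult_swap[OF _ xR]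
  have "\<exists>a\<in>R. \<forall>v\<in>W. \<theta> y v = a *\<^sub>W v" if "y \<in> M" for y by (rule W_endo[OF \<theta>lin[OF that]])
  then obtain \<sigma> where \<sigma>: "\<And>y. y \<in> M ==> \<sigma> y \<in> R"
    "\<And>y v. y \<in> M ==> v \<in> W ==> \<theta> y v = \<sigma> y *\<^sub>W v" by metis
  have \<sigma>\<rho>: "x *\<^sub>W (\<sigma> y *\<^sub>W v) = \<rho> (ev y v) *\<^sub>W w" if "y \<in> M" "v \<in> W" for y v
    using \<theta>[OF that] \<sigma>(2)[OF that] by simp
  \<comment> \<open>Scalars are compared through their action on W, and there after multiplication
    by x, where \<sigma> is expressed by the linear \<rho> and \<open>ev\<close>.\<close>
  have "lin R M (self_module R) \<sigma>"
  proof (rule linI)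
    fix y assume y: "y \<in> M"
    show "\<sigma> y \<in> self_module R" using \<sigma>(1)[OF y] by simp
    show "\<sigma> (y +\<^sub>M y') = \<sigma> y \<oplus>\<^bsub>self_module R\<^esub> \<sigma> y'" if y': "y' \<in> M" for y' unfolding self_module_simps
    proof (rule W_scalar_eq)
      fix v assume v: "v \<in> W"
      show "\<sigma> (y +\<^sub>M y') *\<^sub>W v = (\<sigma> y \<oplus> \<sigma> y') *\<^sub>W v"
      proof (rule W_cancel[OF x(2)])
        have "x *\<^sub>W (\<sigma> (y +\<^sub>M y') *\<^sub>W v) = (\<rho> (ev y v) \<oplus> \<rho> (ev y' v)) *\<^sub>W w"
          using \<sigma>\<rho>[OF M.M.a_closed[OF y y'] v] ev_add_l[OF y y' v] \<rho>add[OF ev_closed[OF y v] ev_closed[OF y' v]] by simp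
        also have "\<dots> = x *\<^sub>W (\<sigma> y *\<^sub>W v) +\<^sub>W x *\<^sub>W (\<sigma> y' *\<^sub>W v)"
          using \<sigma>\<rho>[OF y v] \<sigma>\<rho>[OF y' v] \<rho>R[OF ev_closed[OF y v]] \<rho>R[OF ev_closed[OF y' v]] w(1) by (simp add: W.smult_l_distr)
        finally show "x *\<^sub>W (\<sigma> (y +\<^sub>M y') *\<^sub>W v) = x *\<^sub>W ((\<sigma> y \<oplus> \<sigma> y') *\<^sub>W v)"
          using \<sigma>(1)[OF y] \<sigma>(1)[OF y'] v xR by (simp add: W.smult_l_distr W.smult_r_distr)
      qed (use \<sigma>(1)[OF y] \<sigma>(1)[OF y'] \<sigma>(1)[OF M.M.a_closed[OF y y']] v in auto)
    qed (use \<sigma>(1)[OF y] \<sigma>(1)[OF y'] \<sigma>(1)[OF M.M.a_closed[OF y y']] in auto)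
    show "\<sigma> (a *\<^sub>M y) = a \<odot>\<^bsub>self_module R\<^esub> \<sigma> y" if a: "a \<in> R" for a unfolding self_module_simps
    proof (rule W_scalar_eq)
      fix v assume v: "v \<in> W"
      show "\<sigma> (a *\<^sub>M y) *\<^sub>W v = (a \<otimes> \<sigma> y) *\<^sub>W v"
      proof (rule W_cancel[OF x(2)])
        have "x *\<^sub>W (\<sigma> (a *\<^sub>M y) *\<^sub>W v) = (a \<otimes> \<rho> (ev y v)) *\<^sub>W w"
          using \<sigma>\<rho>[OF M.smult_closed[OF a y] v] ev_smult_l[OF y v a] \<rho>smult[OF a ev_closed[OF y v]] by simp
        also have "\<dots> = a *\<^sub>W (x *\<^sub>W (\<sigma> y *\<^sub>W v))"
          using \<sigma>\<rho>[OF y v] \<rho>R[OF ev_closed[OF y v]] w(1) a by (simp add: W.smult_assoc1)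
        finally show "x *\<^sub>W (\<sigma> (a *\<^sub>M y) *\<^sub>W v) = x *\<^sub>W ((a \<otimes> \<sigma> y) *\<^sub>W v)"
          using \<sigma>(1)[OF y] v a xswap[OF a W.smult_closed[OF \<sigma>(1)[OF y] v]] by (simp add: W.smult_assoc1)
      qed (use \<sigma>(1)[OF y] \<sigma>(1)[OF M.smult_closed[OF a y]] v a in auto)
    qed (use \<sigma>(1)[OF y] \<sigma>(1)[OF M.smult_closed[OF a y]] a in auto)
  qed
  then obtain D where D: "D \<in> \<Delta>" "\<forall>y\<in>M. pr D y = \<sigma> y" using pr_surj by blast
  have evD: "lin R H W (\<lambda>f. f D)" unfolding H_def by (rule Hom_eval_lin[OF D(1)])
  have l1: "lin R H W (\<lambda>f. x *\<^sub>W f D)" by (rule lin_smult[OF W_module H_module evD xR])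
  have l2: "lin R H W (\<lambda>f. \<rho> f *\<^sub>W w)" by (rule H.lin_rank_one[OF \<rho> W_module w(1)])
  have gen: "{ev y w |y w. y \<in> M \<and> w \<in> W} \<subseteq> H" using ev_closed by auto
  \<comment> \<open>On the generators of N this is the definition of \<sigma>. For V only c V is
    known to lie in N, but c can be cancelled, which gives x V(D) = w against the choice of w
    outside x W.\<close>
  have key: "x *\<^sub>W f D = \<rho> f *\<^sub>W w" if f: "f \<in> N" for f
    by (rule H.lin_eq_on_span[OF W_module l1 l2 gen _ f[unfolded N_def]])
      (use \<sigma>\<rho> D in \<open>auto simp: ev_apply\<close>)
  have VD: "V D \<in> W" by (rule linD(1)[OF H_lin[OF V(1)] D(1)])
  have "x *\<^sub>W (c *\<^sub>W V D) = (c \<otimes> \<one>) *\<^sub>W w"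
    using key[OF cN] \<rho>smult[OF c(1) V(1)] V(2) H_ops(2)[OF D(1), of c V] by simp
  hence "c *\<^sub>W (x *\<^sub>W V D) = c *\<^sub>W w" using xswap[OF c(1) VD] c(1) by simp
  hence "x *\<^sub>W V D = w" using W_cancel[OF c(2)] VD xR w(1) by simp
  thus False using w(2) VD by (auto simp: Y_def)
qed

theorem free_if_bidual_free:
  assumes g: "lin R (free_mod R r) H g" "bij_betw g (free_mod R r) H"
    and tf: "\<And>x v. nonzerodivisor R x ==> v \<in> M ==> x *\<^sub>M v = 0\<^sub>M ==> v = 0\<^sub>M"
  shows "\<exists>r g. lin R (free_mod R r) M g \<and> bij_betw g (free_mod R r) M"
proof -
  define F where "F = free_mod R r"
  have Fm: "module R F" unfolding F_def by (rule free_mod_module)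
  interpret F: rmod R F by (rule rmodI, fact)
  note NH = N_eq_H[OF g]
  note g = g[folded F_def]
  define gi where "gi = inv_into F g"
  note gi = lin_inv_into[OF Fm H_module g, folded gi_def]
  obtain x where x: "x \<in> \<mm>" "nonzerodivisor R x" using exists_nonzerodivisor by blast
  have xR: "x \<in> R" using x(1) m_closed' by auto
  obtain n :: nat where n: "(\<lambda>v\<in>M. x [^] n *\<^sub>M v) \<in> trace_maps R M"
    using power_in_trace_ideal[OF M_fg x(1)] by blast
  \<comment> \<open>M embeds in its double dual: what all linear forms kill is killed by a power of
    x, hence zero since M is torsionfree.\<close>
  have pr_zero: "v = 0\<^sub>M" if v: "v \<in> M" "\<And>D. D \<in> \<Delta> ==> pr D v = \<zero>" for v
    by (rule tf[OF nonzerodivisor_pow[OF x(2), of n] v(1) trace_kernel[OF _ n v]]) (use xR in simp)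
  show ?thesis
  proof (cases "r = 0")
    case True
    have "f = 0\<^sub>H" if f: "f \<in> H" for f
    proof -
      have "gi f = 0\<^sub>F" using gi(4)[OF f] True by (auto simp: F_def free_mod_carrier)
      thus ?thesis using gi(3)[OF f] lin_zero[OF Fm H_module g(1)] by simp
    qed
    hence H0: "ev y w D = 0\<^sub>W" if "y \<in> M" "w \<in> W" "D \<in> \<Delta>" for y w D
      using ev_closed[OF that(1,2)] H_ops(3)[OF that(3)] by simp
    have "y = 0\<^sub>M" if y: "y \<in> M" for y
    proof (rule pr_zero[OF y])
      fix D assume D: "D \<in> \<Delta>"
      show "pr D y = \<zero>" by (rule W_faithful[OF pr_closed[OF D y]]) (use H0[OF y _ D] ev_apply[OF D] in simp)
    qed
    hence "carrier M = {0\<^sub>M}" by auto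
    moreover have "carrier (free_mod R 0) = {\<lambda>_. \<zero>}" by (auto simp: free_mod_carrier)
    ultimately show ?thesis using lin_const_zero[OF M_module, of "free_mod R 0"]
      by (intro exI[of _ 0] exI[of _ "\<lambda>_. 0\<^sub>M"]) (auto simp: bij_betw_def)
  next
    case False
    define \<rho> where "\<rho> f = gi f 0" for f
    have "lin R F (self_module R) (\<lambda>f. f 0)" by (rule linI) (use free_mod_closed in \<open>auto simp: F_def\<close>)
    hence \<rho>: "lin R H (self_module R) \<rho>" unfolding \<rho>_def by (rule lin_comp[OF gi(1)])
    have \<rho>R: "\<rho> f \<in> R" if "f \<in> H" for f using linD(1)[OF \<rho> that] by simp
    have mS: "submodule \<mm> R (self_module R)" using self_submodule_iff m_ideal by simp
    have u0: "unit_vec R 0 \<in> F" unfolding F_def using False by (intro unit_vec_closed) simp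
    \<comment> \<open>Since N = H, the first coordinate function cannot map all generators
      \<open>ev y w\<close> into \<mm>, for it takes the value 1 on H.\<close>
    have "\<exists>y\<in>M. \<exists>w\<in>W. \<rho> (ev y w) \<notin> \<mm>"
    proof (rule ccontr)
      assume "\<not> ?thesis"
      hence "N \<subseteq> {f \<in> H. \<rho> f \<in> \<mm>}"
        using ev_closed by (intro N_least[OF H.vimage_submodule[OF self_module_module \<rho> mS]]) blast
      hence "\<rho> (g (unit_vec R 0)) \<in> \<mm>" using NH linD(1)[OF g(1) u0] by blast
      moreover have "\<rho> (g (unit_vec R 0)) = \<one>" using gi(2)[OF u0] by (simp add: \<rho>_def unit_vec_def)
      ultimately show False using one_notin_m by simp
    qed
    then obtain y0 w0 where y0: "y0 \<in> M" and w0: "w0 \<in> W" and n0: "\<rho> (ev y0 w0) \<notin> \<mm>" by blast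
    define \<sigma> where "\<sigma> w = \<rho> (ev y0 w)" for w
    have "lin R W H (ev y0)"
    proof (rule linI[OF ev_closed[OF y0]])
      show "ev y0 (v +\<^sub>W v') = ev y0 v +\<^sub>H ev y0 v'" if "v \<in> W" "v' \<in> W" for v v'
        by (rule H_ext[OF ev_closed H.M.a_closed[OF ev_closed ev_closed]])
          (use that y0 in \<open>simp_all add: ev_apply H_ops pr_closed W.smult_r_distr\<close>)
      show "ev y0 (a *\<^sub>W v) = a *\<^sub>H ev y0 v" if "a \<in> R" "v \<in> W" for v a
        by (rule H_ext[OF ev_closed H.smult_closed[OF _ ev_closed]])
          (use that y0 in \<open>simp_all add: ev_apply H_ops pr_closed W.smult_assoc1[symmetric] m_comm\<close>)
    qed
    hence \<sigma>: "lin R W (self_module R) \<sigma>" unfolding \<sigma>_def by (rule lin_comp[OF _ \<rho>])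
    have \<sigma>R: "\<sigma> w \<in> R" if "w \<in> W" for w using linD(1)[OF \<sigma> that] by simp
    have u: "\<sigma> w0 \<in> Units R" using unit_if \<sigma>R[OF w0] n0 by (simp add: \<sigma>_def)
    \<comment> \<open>The endomorphism v -> \<sigma>(v) w0 is a homothety, and its value at w0
      identifies the scalar as the unit \<sigma> w0. So w0 generates W, and by \<open>ba\<close> it
      does so freely.\<close>
    obtain a where a: "a \<in> R" "\<forall>v\<in>W. \<sigma> v *\<^sub>W w0 = a *\<^sub>W v"
      using W_endo[OF W.lin_rank_one[OF \<sigma> W_module w0]] by blast
    have ba: "b = \<zero>" if b: "b \<in> R" "b *\<^sub>W w0 = 0\<^sub>W" for b
    proof -
      have "b \<otimes> \<sigma> w0 = \<sigma> (b *\<^sub>W w0)" using linD(3)[OF \<sigma> b(1) w0] by simp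
      also have "\<dots> = \<zero>" using b(2) lin_zero[OF W_module self_module_module \<sigma>] by simp
      finally have "b \<otimes> \<sigma> w0 \<otimes> inv (\<sigma> w0) = \<zero>" using u by simp
      thus ?thesis using u b(1) \<sigma>R[OF w0] by (simp add: m_assoc)
    qed
    have "a \<ominus> \<sigma> w0 = \<zero>" by (rule ba) (use a \<sigma>R[OF w0] w0 in \<open>simp_all add: W.smult_minus_l W.minus_eq_iff\<close>)
    hence a_eq: "a = \<sigma> w0" using a(1) \<sigma>R[OF w0] by simp
    have span_w0: "\<exists>b\<in>R. v = b *\<^sub>W w0" if v: "v \<in> W" for v
    proof (intro bexI)
      have "(inv (\<sigma> w0) \<otimes> \<sigma> v) *\<^sub>W w0 = inv (\<sigma> w0) *\<^sub>W (\<sigma> w0 *\<^sub>W v)"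
        using a(2) v u \<sigma>R[OF v] w0 by (simp add: W.smult_assoc1 a_eq)
      also have "\<dots> = v" using u v \<sigma>R[OF w0] by (simp add: W.smult_assoc1[symmetric])
      finally show "v = (inv (\<sigma> w0) \<otimes> \<sigma> v) *\<^sub>W w0" by simp
      show "inv (\<sigma> w0) \<otimes> \<sigma> v \<in> R" using u \<sigma>R[OF v] by simp
    qed
    \<comment> \<open>As W = R w0, each generator of N is of the form \<tau> y, so \<tau> maps M
      onto N = H; \<open>pr_zero\<close> and \<open>ba\<close> make it injective.\<close>
    define \<tau> where "\<tau> y = ev y w0" for y
    have \<tau>: "lin R M H \<tau>" unfolding \<tau>_def
    proof (rule linI[OF ev_closed[OF _ w0]])
      show "ev (y +\<^sub>M y') w0 = ev y w0 +\<^sub>H ev y' w0" if "y \<in> M" "y' \<in> M" for y y'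
        by (rule H_ext[OF ev_closed H.M.a_closed[OF ev_closed ev_closed]])
          (use that w0 linD(2)[OF pr_lin] in \<open>simp_all add: ev_apply H_ops pr_closed W.smult_l_distr\<close>)
      show "ev (b *\<^sub>M y) w0 = b *\<^sub>H ev y w0" if "b \<in> R" "y \<in> M" for y b
        by (rule H_ext[OF ev_closed H.smult_closed[OF _ ev_closed]])
          (use that w0 linD(3)[OF pr_lin] in \<open>simp_all add: ev_apply H_ops pr_closed W.smult_assoc1\<close>)
    qed
    have "inj_on \<tau> M"
    proof (rule inj_onI)
      fix y y' assume y: "y \<in> M" "y' \<in> M" "\<tau> y = \<tau> y'"
      have "y -\<^sub>M y' = 0\<^sub>M"
      proof (rule pr_zero)
        show "y -\<^sub>M y' \<in> M" using y by simp
        fix D assume D: "D \<in> \<Delta>"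
        have "\<tau> (y -\<^sub>M y') = 0\<^sub>H"
          using lin_minus[OF M_module H_module \<tau> y(1,2)] y H.minus_eq_iff linD(1)[OF \<tau>] by simp
        hence "pr D (y -\<^sub>M y') *\<^sub>W w0 = 0\<^sub>W"
          using ev_apply[OF D, of "y -\<^sub>M y'" w0] H_ops(3)[OF D] by (simp add: \<tau>_def)
        thus "pr D (y -\<^sub>M y') = \<zero>" using ba pr_closed[OF D] y by simp
      qed
      thus "y = y'" using M.minus_eq_iff y by simp
    qed
    moreover have "\<tau> ` carrier M = carrier H"
    proof
      show "\<tau> ` carrier M \<subseteq> H" using linD(1)[OF \<tau>] by auto
      have "N \<subseteq> \<tau> ` carrier M"
      proof (rule N_least[OF M.image_submodule[OF H_module \<tau> M.carrier_is_submodule]])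
        fix y w assume y: "y \<in> M" and w: "w \<in> W"
        obtain b where b: "b \<in> R" "w = b *\<^sub>W w0" using span_w0[OF w] by blast
        have "ev y w = \<tau> (b *\<^sub>M y)" unfolding \<tau>_def by (rule H_ext[OF ev_closed ev_closed])
            (use y w w0 b linD(3)[OF pr_lin] in \<open>simp_all add: ev_apply pr_closed W.smult_assoc1[symmetric] m_comm\<close>)
        thus "ev y w \<in> \<tau> ` carrier M" using b(1) y by auto
      qed
      thus "carrier H \<subseteq> \<tau> ` carrier M" using NH by simp
    qed
    ultimately have \<tau>b: "bij_betw \<tau> M (carrier H)" by (simp add: bij_betw_def)
    note ti = lin_inv_into[OF M_module H_module \<tau> \<tau>b]
    have "lin R F M (\<lambda>f. inv_into M \<tau> (g f))" by (rule lin_comp[OF g(1) ti(1)])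
    moreover have "bij_betw (\<lambda>f. inv_into M \<tau> (g f)) (carrier F) (carrier M)"
      using bij_betw_trans[OF g(2) ti(5)] by (simp add: comp_def)
    ultimately show ?thesis unfolding F_def by blast
  qed
qed

end

section \<open>A coefficient field modulo the square of the maximal ideal\<close>

text \<open>\<open>hv u as\<close> is the value at \<open>u\<close> of the polynomial with coefficient list \<open>as\<close>, and \<open>dl 1 (tl as)\<close> is the
  coefficient list of its derivative.\<close>

primrec (in ring) hv :: "'a \<Rightarrow> 'a list \<Rightarrow> 'a" where
  "hv u [] = \<zero>"
| "hv u (a # as) = a \<oplus> u \<otimes> hv u as"

primrec (in ring) dl :: "nat \<Rightarrow> 'a list \<Rightarrow> 'a list" where
  "dl k [] = []"
| "dl k (a # as) = ([k] \<cdot>\<^bsub>R\<^esub> a) # dl (Suc k) as"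

context cring
begin

lemma hv_closed: "u \<in> R ==> set as \<subseteq> R ==> hv u as \<in> R" by (induction as) auto

lemma dl_closed: "set as \<subseteq> R ==> set (dl k as) \<subseteq> R" by (induction as arbitrary: k) auto

lemma dl_append: "dl k (as @ [c]) = dl k as @ [add_pow R (k + length as) c]" by (induction as arbitrary: k) auto

lemma length_dl: "length (dl k as) = length as" by (induction as arbitrary: k) auto

lemma hv_append: "u \<in> R ==> set as \<subseteq> R ==> c \<in> R ==>
  hv u (as @ [c]) = hv u as \<oplus> u [^] length as \<otimes> c"
proof (induction as)
  case (Cons a as)
  hence "hv u as \<in> R" using hv_closed by auto
  thus ?case using Cons by (simp add: r_distr a_assoc m_assoc[symmetric] m_comm)
qed simp

lemma hv_smult: "u \<in> R ==> set as \<subseteq> R ==> c \<in> R ==>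
  hv u (map (\<lambda>a. c \<otimes> a) as) = c \<otimes> hv u as"
proof (induction as)
  case (Cons a as)
  hence "hv u as \<in> R" using hv_closed by auto
  thus ?case using Cons by (simp add: r_distr m_lcomm)
qed simp

lemma hv_dl_Suc: "u \<in> R ==> set as \<subseteq> R ==>
  hv u (dl (Suc k) as) = hv u (dl k as) \<oplus> hv u as"
proof (induction as arbitrary: k)
  case (Cons a as)
  hence c: "hv u as \<in> R" "hv u (dl (Suc k) as) \<in> R" using hv_closed dl_closed by auto
  have "[Suc k] \<cdot>\<^bsub>R\<^esub> a = [k] \<cdot>\<^bsub>R\<^esub> a \<oplus> a" using Cons.prems by simp
  thus ?case using Cons c by (simp add: r_distr a_ac)
qed simp

text \<open>\<open>dl 1 as\<close> lists the coefficients of the derivative of X times the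
  polynomial, so this is the product rule.\<close>

lemma hv_dl_one: "u \<in> R ==> set as \<subseteq> R ==>
  hv u (dl 1 as) = hv u as \<oplus> u \<otimes> hv u (dl 1 (tl as))"
proof (induction as)
  case (Cons b bs)
  have c: "hv u bs \<in> R" "hv u (dl 1 bs) \<in> R"
    using Cons.prems hv_closed[of u bs] hv_closed[of u "dl 1 bs"] dl_closed[of bs 1] by simp_all
  have "hv u (dl 1 (b # bs)) = b \<oplus> u \<otimes> hv u (dl (Suc 1) bs)" using Cons.prems by simp
  also have "hv u (dl (Suc 1) bs) = hv u (dl 1 bs) \<oplus> hv u bs" using Cons.prems by (intro hv_dl_Suc) auto
  finally have "hv u (dl 1 (b # bs)) = b \<oplus> u \<otimes> (hv u (dl 1 bs) \<oplus> hv u bs)" .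
  thus ?case using Cons.prems c by (simp add: r_distr a_ac)
qed simp

text \<open>The length is recorded because the later division by a monic polynomial has to stay
  below its degree.\<close>

lemma hv_add:
  assumes F: "F \<subseteq> R" "\<zero> \<in> F" "\<And>a b. a \<in> F ==> b \<in> F ==> a \<oplus> b \<in> F" and u: "u \<in> R"
  shows "set as \<subseteq> F ==> set bs \<subseteq> F ==>
    \<exists>cs. set cs \<subseteq> F \<and> length cs = max (length as) (length bs) \<and> hv u cs = hv u as \<oplus> hv u bs"
proof (induction as arbitrary: bs)
  case Nil
  hence "hv u bs \<in> R" using hv_closed[OF u] F(1) by blast
  thus ?case using Nil by (intro exI[of _ bs]) auto
next
  case (Cons a as)
  have c: "hv u (a # as) \<in> R" "hv u as \<in> R" "a \<in> R"
    using hv_closed[OF u, of "a # as"] hv_closed[OF u, of as] Cons.prems F(1) by auto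
  show ?case
  proof (cases bs)
    case Nil
    thus ?thesis using Cons.prems c by (intro exI[of _ "a # as"]) auto
  next
    case (Cons b bs')
    have c': "hv u bs' \<in> R" "b \<in> R" using hv_closed[OF u, of bs'] Cons.prems F(1) Cons by auto
    obtain cs where cs: "set cs \<subseteq> F" "length cs = max (length as) (length bs')" "hv u cs = hv u as \<oplus> hv u bs'"
      using Cons.IH[of bs'] Cons.prems Cons by auto
    have "a \<oplus> b \<in> F" using F(3) Cons.prems Cons by auto
    thus ?thesis using cs c c' u Cons by (intro exI[of _ "(a \<oplus> b) # cs"]) (auto simp: r_distr a_ac)
  qed
qed

lemma hv_subring:
  assumes F: "subring F R" and u: "u \<in> R"
  defines "T \<equiv> {hv u as |as. set as \<subseteq> F}"
  shows "subring T R" "F \<subseteq> T" "u \<in> T"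
proof -
  note FE = subringE[OF F]
  have memT: "hv u as \<in> T" if "set as \<subseteq> F" for as using that by (auto simp: T_def)
  have Tc: "T \<subseteq> R" using hv_closed[OF u] FE(1) by (fastforce simp: T_def)
  have FR: "a \<in> F ==> a \<in> R" for a using FE(1) by auto
  show FT: "F \<subseteq> T" using memT[of "[_]"] FR u by fastforce
  show "u \<in> T" using memT[of "[\<zero>, \<one>]"] FE(2,3) u by simp
  have addT: "s \<oplus> t \<in> T" if st: "s \<in> T" "t \<in> T" for s t
  proof -
    obtain as where "set as \<subseteq> F" "s = hv u as" using st(1) by (auto simp: T_def)
    moreover obtain bs where "set bs \<subseteq> F" "t = hv u bs" using st(2) by (auto simp: T_def)
    ultimately show ?thesis using hv_add[OF FE(1,2,7) u, of as bs] memT by metis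
  qed
  have smulT: "a \<otimes> t \<in> T" if at: "a \<in> F" "t \<in> T" for a t
  proof -
    obtain as where as: "set as \<subseteq> F" "t = hv u as" using at by (auto simp: T_def)
    have "hv u (map (\<lambda>b. a \<otimes> b) as) = a \<otimes> t" using hv_smult[OF u, of as a] as FE(1) at(1) by auto
    moreover have "set (map (\<lambda>b. a \<otimes> b) as) \<subseteq> F" using as(1) FE(6) at(1) by auto
    ultimately show ?thesis using memT by metis
  qed
  have uT: "u \<otimes> t \<in> T" if t: "t \<in> T" for t
  proof -
    obtain as where as: "set as \<subseteq> F" "t = hv u as" using t by (auto simp: T_def)
    have "hv u (\<zero> # as) = u \<otimes> t" using as hv_closed[OF u, of as] FE(1) u by auto
    thus ?thesis using memT[of "\<zero> # as"] as(1) FE(2) by auto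
  qed
  have multT: "hv u as \<otimes> t \<in> T" if "set as \<subseteq> F" "t \<in> T" for as t using that(1)
  proof (induction as)
    case Nil
    thus ?case using memT[of "[]"] that(2) Tc by auto
  next
    case (Cons a as)
    have c: "a \<in> R" "hv u as \<in> R" "t \<in> R" using Cons.prems FR hv_closed[OF u, of as] FE(1) that(2) Tc by auto
    have "hv u (a # as) \<otimes> t = a \<otimes> t \<oplus> u \<otimes> (hv u as \<otimes> t)" using c u by (simp add: l_distr m_assoc)
    thus ?case using addT[OF smulT uT] Cons that(2) by auto
  qed
  show "subring T R"
  proof (rule subringI[OF Tc])
    show "\<one> \<in> T" using FT FE(3) by auto
    show "\<ominus> h \<in> T" if "h \<in> T" for h
    proof -
      have "(\<ominus> \<one>) \<otimes> h \<in> T" by (rule smulT[OF FE(5)[OF FE(3)] that])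
      thus ?thesis using that Tc by (auto simp: l_minus)
    qed
    show "s \<otimes> t \<in> T" if "s \<in> T" "t \<in> T" for s t using that multT by (auto simp: T_def)
  qed (use addT in auto)
qed

end

context local_noetherian
begin

definition "m2 = genideal R {a \<otimes> b |a b. a \<in> \<mm> \<and> b \<in> \<mm>}"

lemma m2_ideal: "ideal m2 R" unfolding m2_def by (rule genideal_ideal) (auto dest: m_closed')

lemma m2_prod: "a \<in> \<mm> ==> b \<in> \<mm> ==> a \<otimes> b \<in> m2"
  unfolding m2_def by (rule subsetD[OF genideal_self]) (auto dest: m_closed')

lemma m2_least: "ideal J R ==> (\<And>a b. a \<in> \<mm> ==> b \<in> \<mm> ==> a \<otimes> b \<in> J) ==> m2 \<subseteq> J"
  unfolding m2_def by (rule genideal_minimal) auto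

lemma m2_le_m: "m2 \<subseteq> \<mm>" by (rule m2_least[OF m_ideal]) (use idealD(6)[OF m_ideal] m_closed' in auto)

lemma hv_taylor:
  assumes u: "u \<in> R" and v: "v \<in> \<mm>"
  shows "set as \<subseteq> R ==>
    \<exists>t\<in>m2. hv (u \<oplus> v) as = hv u as \<oplus> v \<otimes> hv u (dl 1 (tl as)) \<oplus> t"
proof (induction as)
  case Nil
  show ?case using idealD(2)[OF m2_ideal] m_closed'[OF v] by (auto intro!: bexI[of _ \<zero>])
next
  case (Cons a as)
  note vR = m_closed'[OF v] and m2D = idealD[OF m2_ideal]
  obtain t where t: "t \<in> m2" "hv (u \<oplus> v) as = hv u as \<oplus> v \<otimes> hv u (dl 1 (tl as)) \<oplus> t" using Cons by auto
  have "set (tl as) \<subseteq> R" using Cons.prems by (cases as) auto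
  hence c: "a \<in> R" "hv u as \<in> R" "hv u (dl 1 (tl as)) \<in> R" "t \<in> R"
    using Cons.prems hv_closed[OF u] dl_closed m2D(1)[OF t(1)] by auto
  define t' where "t' = (v \<otimes> v) \<otimes> hv u (dl 1 (tl as)) \<oplus> (u \<oplus> v) \<otimes> t"
  have t': "t' \<in> m2" unfolding t'_def using m2_prod[OF v v] m2D(3,6,7) t(1) c u vR by auto
  have "hv (u \<oplus> v) (a # as) = (a \<oplus> u \<otimes> hv u as) \<oplus> v \<otimes> (hv u as \<oplus> u \<otimes> hv u (dl 1 (tl as))) \<oplus> t'"
    unfolding hv.simps t(2) t'_def using c u vR by (simp add: l_distr r_distr m_ac a_ac)
  also have "hv u as \<oplus> u \<otimes> hv u (dl 1 (tl as)) = hv u (dl 1 (tl (a # as)))"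
    using hv_dl_one[OF u, of as] Cons.prems by simp
  finally show ?case using t' by auto
qed

text \<open>A maximal subring F that meets \<mm> inside \<open>m2\<close> surjects onto the residue
  field. Let u be given. If its residue is transcendental over that of F, then F[u] still meets
  \<mm> inside \<open>m2\<close>, so u lies in F. Otherwise a monic polynomial p of least degree
  with p(u) in \<mm> has a unit p'(u), by minimality and characteristic 0. The Newton step u' = u -
  p(u) / p'(u) brings p(u') into \<open>m2\<close>; one step is enough modulo \<open>m2\<close>.
  Then F[u'] meets \<mm> inside \<open>m2\<close>, so u' lies in F and differs from u by an element
  of \<mm>.\<close>

theorem coefficient_ring:
  assumes C: "subring C R" "\<And>c. c \<in> C ==> c \<in> \<mm> ==> c = \<zero>"
    and char0: "\<And>n::nat. n > 0 ==> [n] \<cdot>\<^bsub>R\<^esub> \<one> \<notin> \<mm>"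
  obtains F where "subring F R" "C \<subseteq> F" "m2 \<subseteq> F" "\<And>f. f \<in> F ==> f \<in> \<mm> ==> f \<in> m2"
    "\<And>u. u \<in> R ==> \<exists>f\<in>F. \<exists>v\<in>\<mm>. u = f \<oplus> v"
proof -
  note mD = idealD[OF m_ideal] and m2D = idealD[OF m2_ideal] and CE = subringE[OF C(1)]
  define FF where "FF = {F. subring F R \<and> C \<subseteq> F \<and> m2 \<subseteq> F \<and> F \<inter> \<mm> \<subseteq> m2}"
  define F0 where "F0 = {c \<oplus> t |c t. c \<in> C \<and> t \<in> m2}"
  have F0: "F0 \<in> FF"
  proof -
    have cR: "c \<in> C ==> c \<in> R" for c using CE(1) by auto
    have "subring F0 R"
    proof (rule subringI)
      show "F0 \<subseteq> R" using cR m2D(1) by (auto simp: F0_def)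
      show "\<one> \<in> F0" unfolding F0_def using CE(3) m2D(2) by (intro CollectI exI[of _ \<one>] exI[of _ \<zero>]) auto
      show "\<ominus> h \<in> F0" if h: "h \<in> F0" for h
      proof -
        obtain c t where ct: "c \<in> C" "t \<in> m2" "h = c \<oplus> t" using h by (auto simp: F0_def)
        hence "\<ominus> h = \<ominus> c \<oplus> \<ominus> t" using cR m2D(1) by (simp add: minus_add)
        thus ?thesis using CE(5) m2D(4) ct unfolding F0_def by blast
      qed
      show "h \<oplus> k \<in> F0" "h \<otimes> k \<in> F0" if hk: "h \<in> F0" "k \<in> F0" for h k
      proof -
        obtain c t d s where ct: "c \<in> C" "t \<in> m2" "h = c \<oplus> t" "d \<in> C" "s \<in> m2" "k = d \<oplus> s"
          using hk by (auto simp: F0_def)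
        note cc = cR[OF ct(1)] m2D(1)[OF ct(2)] cR[OF ct(4)] m2D(1)[OF ct(5)]
        have "h \<oplus> k = (c \<oplus> d) \<oplus> (t \<oplus> s)" using ct cc by (simp add: a_ac)
        thus "h \<oplus> k \<in> F0" using CE(7) m2D(3) ct unfolding F0_def by blast
        have "h \<otimes> k = c \<otimes> d \<oplus> (c \<otimes> s \<oplus> t \<otimes> (d \<oplus> s))" using ct cc by (simp add: l_distr r_distr a_ac)
        moreover have "c \<otimes> s \<oplus> t \<otimes> (d \<oplus> s) \<in> m2" using m2D(3,6,7) ct cc by auto
        ultimately show "h \<otimes> k \<in> F0" using CE(6) ct unfolding F0_def by blast
      qed
    qed
    moreover have "C \<subseteq> F0"
    proof
      fix c assume "c \<in> C"
      thus "c \<in> F0" unfolding F0_def using cR m2D(2) by (intro CollectI exI[of _ c] exI[of _ \<zero>]) auto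
    qed
    moreover have "m2 \<subseteq> F0"
    proof
      fix t assume "t \<in> m2"
      thus "t \<in> F0" unfolding F0_def using m2D(1) CE(2) by (intro CollectI exI[of _ \<zero>] exI[of _ t]) auto
    qed
    moreover have "F0 \<inter> \<mm> \<subseteq> m2"
    proof
      fix h assume h: "h \<in> F0 \<inter> \<mm>"
      obtain c t where ct: "c \<in> C" "t \<in> m2" "h = c \<oplus> t" using h by (auto simp: F0_def)
      have "h \<ominus> t \<in> \<mm>" using h ct(2) m2_le_m mD(5) by auto
      moreover have "h \<ominus> t = c" using ct cR m2D(1) by (simp add: a_minus_def a_assoc r_neg)
      ultimately have "c = \<zero>" using C(2) ct(1) by simp
      thus "h \<in> m2" using ct m2D(1) by simp
    qed
    ultimately show ?thesis by (simp add: FF_def)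
  qed
  have "\<exists>F\<in>FF. \<forall>G\<in>FF. F \<subseteq> G \<longrightarrow> G = F"
  proof (rule subset_Zorn_nonempty)
    show "FF \<noteq> {}" using F0 by auto
    fix \<C> assume \<C>: "\<C> \<noteq> {}" "subset.chain FF \<C>"
    have sub: "F \<in> FF" if "F \<in> \<C>" for F using \<C>(2) that by (auto simp: pred_on.chain_def)
    have E: "subring F R" if "F \<in> \<C>" for F using sub[OF that] by (simp add: FF_def)
    have two: "\<exists>F\<in>\<C>. h \<in> F \<and> k \<in> F" if "h \<in> \<Union>\<C>" "k \<in> \<Union>\<C>" for h k
      using that \<C>(2) unfolding pred_on.chain_def by blast
    have "subring (\<Union>\<C>) R"
    proof (rule subringI)
      show "\<Union>\<C> \<subseteq> R" using subringE(1)[OF E] by blast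
      show "\<one> \<in> \<Union>\<C>" using subringE(3)[OF E] \<C>(1) by blast
      show "\<ominus> h \<in> \<Union>\<C>" if "h \<in> \<Union>\<C>" for h using that subringE(5)[OF E] by blast
      show "h \<oplus> k \<in> \<Union>\<C>" if "h \<in> \<Union>\<C>" "k \<in> \<Union>\<C>" for h k using two[OF that] subringE(7)[OF E] by blast
      show "h \<otimes> k \<in> \<Union>\<C>" if "h \<in> \<Union>\<C>" "k \<in> \<Union>\<C>" for h k using two[OF that] subringE(6)[OF E] by blast
    qed
    moreover have "C \<subseteq> \<Union>\<C>" "m2 \<subseteq> \<Union>\<C>" "\<Union>\<C> \<inter> \<mm> \<subseteq> m2" using sub \<C>(1) unfolding FF_def by blast+
    ultimately show "\<Union>\<C> \<in> FF" by (simp add: FF_def)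
  qed
  then obtain F where "F \<in> FF" and maxF: "\<forall>G\<in>FF. F \<subseteq> G \<longrightarrow> G = F" by (elim bexE)
  hence F: "subring F R" "C \<subseteq> F" "m2 \<subseteq> F" and Fm: "\<And>f. f \<in> F ==> f \<in> \<mm> ==> f \<in> m2" by (auto simp: FF_def)
  have max: "G = F" if "subring G R" "F \<subseteq> G" "\<And>f. f \<in> G ==> f \<in> \<mm> ==> f \<in> m2" for G
  proof -
    have "G \<in> FF" unfolding FF_def using that F(2,3) by blast
    thus ?thesis using maxF that(2) by blast
  qed
  note FE = subringE[OF F(1)]
  have FR: "a \<in> F ==> a \<in> R" for a using FE(1) by auto
  \<comment> \<open>Admitting denominators outside \<mm> keeps the intersection with \<mm> inside
    \<open>m2\<close>, so maximality puts the inverses into F. They are used to make the polynomial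
    monic.\<close>
  have Finv: "inv f \<in> F" if f: "f \<in> F" "f \<notin> \<mm>" for f
  proof -
    define G where "G = {a \<otimes> inv t |a t. a \<in> F \<and> t \<in> F \<and> t \<notin> \<mm>}"
    have tU: "t \<in> Units R" if "t \<in> F" "t \<notin> \<mm>" for t using unit_if FR that by auto
    have "subring G R"
    proof (rule subringI)
      show "G \<subseteq> R" using tU FR by (auto simp: G_def)
      show "\<one> \<in> G" unfolding G_def using FE(3) one_notin_m by (intro CollectI exI[of _ \<one>]) auto
      show "\<ominus> h \<in> G" if h: "h \<in> G" for h
      proof -
        obtain a t where at: "a \<in> F" "t \<in> F" "t \<notin> \<mm>" "h = a \<otimes> inv t" using h by (auto simp: G_def)
        hence "\<ominus> h = (\<ominus> a) \<otimes> inv t" using FR tU by (simp add: l_minus)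
        thus ?thesis using FE(5) at unfolding G_def by blast
      qed
      show "h \<otimes> k \<in> G" "h \<oplus> k \<in> G" if hk: "h \<in> G" "k \<in> G" for h k
      proof -
        obtain a t b s where at: "a \<in> F" "t \<in> F" "t \<notin> \<mm>" "h = a \<otimes> inv t" "b \<in> F" "s \<in> F" "s \<notin> \<mm>" "k = b \<otimes> inv s"
          using hk by (auto simp: G_def)
        note U = tU[OF at(2,3)] tU[OF at(6,7)]
        note cc = FR[OF at(1)] FR[OF at(2)] FR[OF at(5)] FR[OF at(6)] Units_inv_closed[OF U(1)] Units_inv_closed[OF U(2)]
        have inv: "inv (t \<otimes> s) = inv t \<otimes> inv s"
        proof (rule inv_unique'[symmetric])
          show "(t \<otimes> s) \<otimes> (inv t \<otimes> inv s) = \<one>"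
          proof -
            have "(t \<otimes> s) \<otimes> (inv t \<otimes> inv s) = (t \<otimes> inv t) \<otimes> (s \<otimes> inv s)" using cc by (simp only: m_ac m_closed)
            thus ?thesis using U by simp
          qed
          thus "(inv t \<otimes> inv s) \<otimes> (t \<otimes> s) = \<one>" using cc by (simp add: m_comm)
        qed (use cc in auto)
        have ts: "t \<otimes> s \<in> F" "t \<otimes> s \<notin> \<mm>" using FE(6) at unit_notin_m[OF Units_m_closed[OF U]] by auto
        have "h \<otimes> k = (a \<otimes> b) \<otimes> inv (t \<otimes> s)" unfolding inv at(4,8) using cc by (simp add: m_ac)
        moreover have "a \<otimes> b \<in> F" using FE(6) at by simp
        ultimately show "h \<otimes> k \<in> G" using ts unfolding G_def by blast
        have "(a \<otimes> s) \<otimes> (inv t \<otimes> inv s) = a \<otimes> inv t \<otimes> (s \<otimes> inv s)"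
          "(b \<otimes> t) \<otimes> (inv t \<otimes> inv s) = b \<otimes> inv s \<otimes> (t \<otimes> inv t)" using cc by (simp_all only: m_ac m_closed)
        hence "h \<oplus> k = (a \<otimes> s \<oplus> b \<otimes> t) \<otimes> inv (t \<otimes> s)" using U cc at by (simp add: inv l_distr)
        moreover have "a \<otimes> s \<oplus> b \<otimes> t \<in> F" using FE(6,7) at by simp
        ultimately show "h \<oplus> k \<in> G" using ts unfolding G_def by blast
      qed
    qed
    moreover have "F \<subseteq> G"
    proof
      fix a assume "a \<in> F"
      thus "a \<in> G" unfolding G_def using FE(3) one_notin_m FR by (intro CollectI exI[of _ a] exI[of _ \<one>]) auto
    qed
    moreover have "h \<in> m2" if h: "h \<in> G" "h \<in> \<mm>" for h
    proof -
      obtain a t where at: "a \<in> F" "t \<in> F" "t \<notin> \<mm>" "h = a \<otimes> inv t" using h by (auto simp: G_def)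
      note U = tU[OF at(2,3)]
      have "h \<otimes> t = a" using at FR U by (simp add: m_assoc)
      hence "a \<in> \<mm>" using mD(7)[OF _ h(2), of t] FR at by auto
      hence "a \<in> m2" using Fm at by auto
      thus ?thesis using m2D(7) at U by auto
    qed
    ultimately have "G = F" by (rule max)
    moreover have "\<one> \<otimes> inv f \<in> G" using f FE(3) by (auto simp: G_def)
    ultimately show ?thesis using tU[OF f] by simp
  qed
  have hv_m2: "hv u as \<in> m2" if "set as \<subseteq> m2" "u \<in> R" for u as
    using that(1) by (induction as) (use that(2) m2D in auto)
  have add_pow_F: "[k] \<cdot>\<^bsub>R\<^esub> a \<in> F" if "a \<in> F" for k :: nat and a using that FE(2,7) by (induction k) auto
  have dl_F: "set (dl k as) \<subseteq> F" if "set as \<subseteq> F" for k as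
    using that by (induction as arbitrary: k) (auto simp: add_pow_F)
  have "\<exists>f\<in>F. \<exists>v\<in>\<mm>. u = f \<oplus> v" if u: "u \<in> R" for u
  \<comment> \<open>The transcendental case: a value in \<mm> forces all coefficients into \<mm>,
    and thereby into \<open>m2\<close>.\<close>
  proof (cases "\<forall>as. set as \<subseteq> F \<longrightarrow> hv u as \<in> \<mm> \<longrightarrow> set as \<subseteq> \<mm>")
    case True
    note T = hv_subring[OF F(1) u]
    have "{hv u as |as. set as \<subseteq> F} = F"
    proof (rule max[OF T(1,2)])
      fix f assume f: "f \<in> {hv u as |as. set as \<subseteq> F}" "f \<in> \<mm>"
      then obtain as where as: "set as \<subseteq> F" "f = hv u as" by auto
      hence "set as \<subseteq> m2" using True f(2) Fm by blast
      thus "f \<in> m2" using hv_m2 u as by auto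
    qed
    hence "u \<in> F" using T(3) by simp
    thus ?thesis using u mD(2) by (intro bexI[of _ u] bexI[of _ \<zero>]) auto
  next
    case False
    define B where "B as \<longleftrightarrow> set as \<subseteq> F \<and> hv u as \<in> \<mm> \<and> \<not> set as \<subseteq> \<mm>" for as
    have "\<exists>as. B as" using False by (auto simp: B_def)
    then obtain as where as: "B as" and min: "\<And>bs. B bs ==> length as \<le> length bs"
      using ex_has_least_nat[of B _ length] by blast
    have asF: "set as \<subseteq> F" "hv u as \<in> \<mm>" "\<not> set as \<subseteq> \<mm>" using as by (auto simp: B_def)
    have "as \<noteq> []" using asF(3) by auto
    then obtain bs c where bc: "as = bs @ [c]" by (metis rev_exhaust)
    have bF: "set bs \<subseteq> F" "c \<in> F" using asF(1) bc by auto
    have bR: "set bs \<subseteq> R" "c \<in> R" using bF FE(1) by auto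
    note hb = hv_closed[OF u bR(1)]
    \<comment> \<open>A leading coefficient in \<mm> could be dropped, which would give a shorter
      equation.\<close>
    have c: "c \<notin> \<mm>"
    proof
      assume cm: "c \<in> \<mm>"
      have "hv u bs = hv u as \<ominus> u [^] length bs \<otimes> c"
        unfolding bc hv_append[OF u bR] using hb u bR(2) by (simp add: a_minus_def a_assoc r_neg)
      hence "hv u bs \<in> \<mm>" using mD(5)[OF asF(2) mD(6)[OF _ cm]] u by simp
      moreover have "\<not> set bs \<subseteq> \<mm>" using asF(3) cm bc by auto
      ultimately have "B bs" using bF by (simp add: B_def)
      from min[OF this] show False using bc by simp
    qed
    hence cU: "c \<in> Units R" using unit_if bR by auto
    have ci: "inv c \<in> F" using Finv bF c by auto
    define p0 where "p0 = map (\<lambda>b. inv c \<otimes> b) bs"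
    define n where "n = length bs"
    have p0F: "set p0 \<subseteq> F" unfolding p0_def using bF ci FE(6) by auto
    have p0R: "set p0 \<subseteq> R" using p0F FE(1) by auto
    have lp0: "length p0 = n" by (simp add: p0_def n_def)
    have las: "length as = Suc n" by (simp add: bc n_def)
    define p where "p = p0 @ [\<one>]"
    have pR: "set p \<subseteq> R" using p0R by (simp add: p_def)
    have "hv u p = hv u (map (\<lambda>b. inv c \<otimes> b) as)" using cU by (simp add: p_def p0_def bc)
    also have "\<dots> = inv c \<otimes> hv u as" using hv_smult[OF u, of as "inv c"] asF(1) FE(1) cU by auto
    finally have hp: "hv u p \<in> \<mm>" using mD(6)[OF _ asF(2)] cU by simp
    have "n \<noteq> 0"
    proof
      assume "n = 0"
      hence "p = [\<one>]" using lp0 by (simp add: p_def)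
      thus False using hp one_notin_m u by simp
    qed
    have small: "set q \<subseteq> \<mm>" if "set q \<subseteq> F" "length q \<le> n" "hv u q \<in> \<mm>" for q
      using min[of q] that las by (auto simp: B_def)
    obtain b0 p1 where p1: "p0 = b0 # p1" using lp0 \<open>n \<noteq> 0\<close> by (cases p0) auto
    define q where "q = dl 1 (tl p)"
    have q: "q = dl 1 p1 @ [add_pow R n \<one>]" using dl_append[of 1 p1 \<one>] lp0 by (auto simp: q_def p_def p1)
    have qF: "set q \<subseteq> F" unfolding q_def using p0F FE(3) by (intro dl_F) (auto simp: p_def p1)
    have "length q = n" using lp0 p1 by (simp add: q length_dl)
    moreover have "[n] \<cdot>\<^bsub>R\<^esub> \<one> \<notin> \<mm>" using char0 \<open>n \<noteq> 0\<close> by simp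
    ultimately have eU: "hv u q \<in> Units R"
      using small[OF qF] q hv_closed[OF u, of q] qF FE(1) by (intro unit_if) auto
    define v where "v = \<ominus> (hv u p \<otimes> inv (hv u q))"
    have v: "v \<in> \<mm>" unfolding v_def using mD(4) mD(7)[OF _ hp] eU by auto
    note vR = m_closed'[OF v]
    define u' where "u' = u \<oplus> v"
    have u': "u' \<in> R" using u vR by (simp add: u'_def)
    obtain t where t: "t \<in> m2" "hv u' p = hv u p \<oplus> v \<otimes> hv u q \<oplus> t"
      using hv_taylor[OF u v pR] by (auto simp: u'_def q_def)
    have "v \<otimes> hv u q = \<ominus> hv u p"
      unfolding v_def using eU hv_closed[OF u pR] by (simp add: l_minus m_assoc Units_closed)
    hence hp': "hv u' p \<in> m2" using t m2D(1) hv_closed[OF u pR] by (simp add: r_neg)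
    \<comment> \<open>u and u' agree modulo \<mm>, so the minimality of p at u can be applied to
      values at u'.\<close>
    have cong: "hv u bs \<in> \<mm>" if bs: "set bs \<subseteq> F" "hv u' bs \<in> \<mm>" for bs
    proof -
      have bsR: "set bs \<subseteq> R" using bs(1) FE(1) by auto
      hence dR: "hv u (dl 1 (tl bs)) \<in> R" using hv_closed[OF u dl_closed[of "tl bs" 1]] by (cases bs) auto
      obtain s where s: "s \<in> m2" "hv u' bs = hv u bs \<oplus> v \<otimes> hv u (dl 1 (tl bs)) \<oplus> s"
        using hv_taylor[OF u v bsR] by (auto simp: u'_def)
      have w: "v \<otimes> hv u (dl 1 (tl bs)) \<oplus> s \<in> \<mm>" using mD(3,7) v dR s(1) m2_le_m by auto
      have "hv u bs = hv u' bs \<ominus> (v \<otimes> hv u (dl 1 (tl bs)) \<oplus> s)"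
        using s hv_closed[OF u bsR] dR vR m2D(1) by (simp add: a_minus_def a_assoc r_neg)
      thus ?thesis using mD(5)[OF bs(2) w] by simp
    qed
    have telescope: "a \<ominus> c = (a \<ominus> b) \<oplus> (b \<ominus> c)"
      if "a \<in> R" "b \<in> R" "c \<in> R" for a b c using that by (simp add: a_minus_def a_ac r_neg1 r_neg2)
    \<comment> \<open>Horner's scheme with reduction: when the length would reach n + 1, the leading
      coefficient times p is subtracted, which changes the value at u' by an element of
      \<open>m2\<close> only.\<close>
    have red: "\<exists>bs. set bs \<subseteq> F \<and> length bs \<le> n \<and> hv u' as \<ominus> hv u' bs \<in> m2" if "set as \<subseteq> F" for as using that
    proof (induction as)
      case Nil
      show ?case using m2D(2) by (intro exI[of _ "[]"]) (auto simp: a_minus_def)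
    next
      case (Cons a as)
      then obtain bs where bs: "set bs \<subseteq> F" "length bs \<le> n" "hv u' as \<ominus> hv u' bs \<in> m2" by auto
      have cl: "a \<in> R" "hv u' as \<in> R" "hv u' bs \<in> R" "a \<in> F"
        using Cons.prems bs(1) FE(1) hv_closed[OF u', of as] hv_closed[OF u', of bs] by auto
      have "hv u' (a # as) \<ominus> hv u' (a # bs) = u' \<otimes> (hv u' as \<ominus> hv u' bs)"
        using cl u' by (simp add: a_minus_def minus_add r_distr r_minus a_ac r_neg1 r_neg2 r_neg)
      hence d1: "hv u' (a # as) \<ominus> hv u' (a # bs) \<in> m2" using m2D(6)[OF u' bs(3)] by simp
      show ?case
      proof (cases "length bs < n")
        case True
        thus ?thesis using d1 bs(1) cl(4) by (intro exI[of _ "a # bs"]) auto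
      next
        case False
        hence lb: "length (a # bs) = Suc n" using bs(2) by simp
        then obtain ds c where dc: "a # bs = ds @ [c]" "length ds = n" by (metis length_append_singleton nat.inject rev_exhaust list.distinct(1))
        have abF: "set (a # bs) \<subseteq> F" using bs(1) cl(4) by simp
        hence dF: "set ds \<subseteq> F" "c \<in> F" using dc(1) by auto
        have dR: "set ds \<subseteq> R" "c \<in> R" using dF FE(1) by auto
        have nF: "set (map (\<lambda>b. (\<ominus> c) \<otimes> b) p0) \<subseteq> F" using p0F FE(5,6) dF(2) by auto
        obtain es where es: "set es \<subseteq> F" "length es = n"
          "hv u' es = hv u' ds \<oplus> hv u' (map (\<lambda>b. (\<ominus> c) \<otimes> b) p0)"
          using hv_add[OF FE(1,2,7) u' dF(1) nF] dc(2) lp0 by auto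
        have hes: "hv u' es = hv u' ds \<oplus> (\<ominus> c) \<otimes> hv u' p0"
          using es(3) hv_smult[OF u' p0R, of "\<ominus> c"] dR(2) by simp
        have hd: "hv u' (a # bs) = hv u' ds \<oplus> u' [^] n \<otimes> c" unfolding dc(1) hv_append[OF u' dR] dc(2) ..
        have hpp: "hv u' p = hv u' p0 \<oplus> u' [^] n" using hv_append[OF u' p0R, of \<one>] lp0 u' by (simp add: p_def)
        have c1: "hv u' ds \<in> R" "hv u' p0 \<in> R" "u' [^] n \<in> R" "hv u' es \<in> R"
          using hv_closed[OF u'] dR(1) p0R u' es(1) FE(1) by auto
        have "hv u' (a # bs) \<ominus> hv u' es = c \<otimes> hv u' p" unfolding hd hes hpp using c1 dR(2)
          by (simp add: a_minus_def minus_add r_distr l_minus m_comm a_ac r_neg1 r_neg2 r_neg)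
        hence d2: "hv u' (a # bs) \<ominus> hv u' es \<in> m2" using m2D(6)[OF dR(2) hp'] by simp
        have c2: "hv u' (a # as) \<in> R" "hv u' (a # bs) \<in> R" using cl u' by auto
        have "hv u' (a # as) \<ominus> hv u' es = (hv u' (a # as) \<ominus> hv u' (a # bs)) \<oplus> (hv u' (a # bs) \<ominus> hv u' es)"
          by (rule telescope[OF c2 c1(4)])
        hence "hv u' (a # as) \<ominus> hv u' es \<in> m2" using m2D(3)[OF d1 d2] by simp
        thus ?thesis using es by (intro exI[of _ es]) auto
      qed
    qed
    note T = hv_subring[OF F(1) u']
    have "{hv u' as |as. set as \<subseteq> F} = F"
    proof (rule max[OF T(1,2)])
      fix f assume f: "f \<in> {hv u' as |as. set as \<subseteq> F}" "f \<in> \<mm>"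
      then obtain as where as: "set as \<subseteq> F" "f = hv u' as" by auto
      obtain bs where bs: "set bs \<subseteq> F" "length bs \<le> n" "hv u' as \<ominus> hv u' bs \<in> m2" using red[OF as(1)] by blast
      have cl: "hv u' as \<in> R" "hv u' bs \<in> R"
        using hv_closed[OF u', of as] hv_closed[OF u', of bs] as(1) bs(1) FE(1) by auto
      have "hv u' bs = f \<ominus> (hv u' as \<ominus> hv u' bs)"
        unfolding as(2) using cl by (simp add: a_minus_def minus_add a_assoc[symmetric] r_neg)
      hence "hv u' bs \<in> \<mm>" using mD(5)[OF f(2) subsetD[OF m2_le_m bs(3)]] by simp
      hence "set bs \<subseteq> \<mm>" using small[OF bs(1,2) cong[OF bs(1)]] by simp
      hence "set bs \<subseteq> m2" using bs(1) Fm by blast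
      hence "hv u' bs \<in> m2" using hv_m2 u' by blast
      hence "(hv u' as \<ominus> hv u' bs) \<oplus> hv u' bs \<in> m2" using m2D(3) bs(3) by blast
      thus "f \<in> m2" unfolding as(2) using cl by (simp add: a_minus_def a_assoc l_neg)
    qed
    hence "u' \<in> F" using T(3) by simp
    moreover have "u = u' \<oplus> \<ominus> v" using u vR by (simp add: u'_def a_assoc r_neg)
    moreover have "\<ominus> v \<in> \<mm>" by (rule mD(4)[OF v])
    ultimately show ?thesis by blast
  qed
  thus ?thesis using that[OF F] Fm by blast
qed

end

section \<open>Free differentials force a principal maximal ideal\<close>

lemma (in cring) leibniz_pow:
  assumes D: "\<And>a. a \<in> R ==> D a \<in> R"
    "\<And>a b. a \<in> R ==> b \<in> R ==> D (a \<otimes> b) = a \<otimes> D b \<oplus> b \<otimes> D a" and a: "a \<in> R"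
  shows "D (a [^] Suc n) = add_pow R (Suc n) (a [^] n) \<otimes> D a"
proof (induction n)
  case 0
  show ?case using D(1)[OF a] a by simp
next
  case (Suc n)
  have c: "a [^] n \<in> R" "D a \<in> R" using D(1) a by auto
  have "D (a [^] Suc (Suc n)) = a [^] Suc n \<otimes> D a \<oplus> a \<otimes> (add_pow R (Suc n) (a [^] n) \<otimes> D a)"
    using D(2)[of "a [^] Suc n" a] Suc a by simp
  also have "a \<otimes> (add_pow R (Suc n) (a [^] n) \<otimes> D a) = add_pow R (Suc n) (a [^] Suc n) \<otimes> D a"
    using a c add_pow_rdistr[of a "a [^] n" "Suc n"] by (simp add: m_assoc[symmetric] m_comm[of a])
  finally show ?case using a c by (simp add: l_distr a_comm)
qed

context local_noetherian
begin

definition "m_module = (self_module R)\<lparr>carrier := \<mm>\<rparr>"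

definition "cotangent = quotient_module m_module m2"

abbreviation "cl z \<equiv> m2 +>\<^bsub>m_module\<^esub> z"

lemma m_module_simps [simp]:
  "carrier m_module = \<mm>" "\<zero>\<^bsub>m_module\<^esub> = \<zero>" "add m_module = add R" "smult m_module = monoid.mult R"
  by (simp_all add: m_module_def)

lemma m_module:
  shows "module R m_module" "fin_gen_module R m_module" "submodule J R m_module \<longleftrightarrow> ideal J R \<and> J \<subseteq> \<mm>"
    and "x \<in> \<mm> ==> y \<in> \<mm> ==> x \<ominus>\<^bsub>m_module\<^esub> y = x \<ominus> y"
proof -
  interpret S: rmod R "self_module R" by (rule rmodI, rule self_module_module)
  have S: "submodule \<mm> R (self_module R)" using m_ideal by (simp add: self_submodule_iff)
  show "module R m_module" unfolding m_module_def by (rule S.submodule_module[OF S])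
  show "fin_gen_module R m_module" unfolding m_module_def
    by (rule S.fin_gen_submodule[OF noetherian_ring_axioms self_module_fin_gen S])
  show "submodule J R m_module \<longleftrightarrow> ideal J R \<and> J \<subseteq> \<mm>"
    unfolding m_module_def S.submodule_of_submodule_iff[OF S] self_submodule_iff ..
  show "x \<ominus>\<^bsub>m_module\<^esub> y = x \<ominus> y" if "x \<in> \<mm>" "y \<in> \<mm>"
    using S.sub_carrier_neg[OF S that(2)] that m_closed' self_module_neg unfolding m_module_def by (simp add: a_minus_def)
qed

lemma cotangent:
  shows "module R cotangent" "fin_gen_module R cotangent" "lin R m_module cotangent (\<lambda>z. cl z)"
    and "carrier cotangent = (\<lambda>z. cl z) ` \<mm>"
    and "z \<in> \<mm> ==> cl z = \<zero>\<^bsub>cotangent\<^esub> \<longleftrightarrow> z \<in> m2"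
    and "z \<in> \<mm> ==> v \<in> cotangent ==> z \<odot>\<^bsub>cotangent\<^esub> v = \<zero>\<^bsub>cotangent\<^esub>"
proof -
  interpret S: rmod R m_module by (rule rmodI, rule m_module)
  have N: "submodule m2 R m_module" using m_module(3) m2_ideal m2_le_m by auto
  show Q: "module R cotangent" unfolding cotangent_def by (rule S.quotient_module_module[OF N])
  show L: "lin R m_module cotangent (\<lambda>z. cl z)" unfolding cotangent_def by (rule S.quotient_lin[OF N])
  show C: "carrier cotangent = (\<lambda>z. cl z) ` \<mm>" using S.quotient_carrier[of m2] by (simp add: cotangent_def)
  show "fin_gen_module R cotangent" by (rule S.fin_gen_image[OF Q L _ m_module(2)]) (simp add: C)
  show Z: "cl z = \<zero>\<^bsub>cotangent\<^esub> \<longleftrightarrow> z \<in> m2" if "z \<in> \<mm>" for z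
    unfolding cotangent_def using S.coset_eq_zero_iff[OF N, of z] that by simp
  show "z \<odot>\<^bsub>cotangent\<^esub> v = \<zero>\<^bsub>cotangent\<^esub>" if z: "z \<in> \<mm>" and v: "v \<in> cotangent"
  proof -
    obtain y where y: "y \<in> \<mm>" "v = cl y" using v C by auto
    have "z \<odot>\<^bsub>cotangent\<^esub> v = cl (z \<otimes> y)" using linD(3)[OF L m_closed'[OF z], of y] y by simp
    thus ?thesis using Z[of "z \<otimes> y"] m2_prod[OF z y(1)] m2_le_m by auto
  qed
qed

text \<open>If every coordinate of w lay in \<mm>, then h w = 0, because \<mm> kills U. So some
  coordinate function takes a unit value at w, and a multiple of it is the wanted form.\<close>

lemma unimodular_if_nonzero_in_residue_space:
  fixes M :: "('r, 'm) module" and U :: "('r, 'u) module"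
  assumes M: "module R M" and g: "lin R (free_mod R r) M g" "bij_betw g (free_mod R r) M"
    and U: "module R U" "\<And>z v. z \<in> \<mm> ==> v \<in> U ==> z *\<^sub>U v = 0\<^sub>U"
    and h: "lin R M U h" and w: "w \<in> M" "h w \<noteq> 0\<^sub>U"
  shows "\<exists>\<pi>. lin R M (self_module R) \<pi> \<and> \<pi> w = \<one>"
proof -
  interpret U: rmod R U by (rule rmodI, rule U)
  note G = lin_inv_into[OF free_mod_module M g]
  let ?f = "inv_into (free_mod R r) g w"
  have fc: "?f \<in> free_mod R r" by (rule G(4)[OF w(1)])
  note hg = lin_comp[OF g(1) h]
  have "\<exists>i. ?f i \<notin> \<mm>"
  proof (rule ccontr)
    assume "\<nexists>i. ?f i \<notin> \<mm>"
    hence fm: "?f i \<in> \<mm>" for i by auto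
    have e: "h (g (unit_vec R i)) \<in> U" if "i < r" for i using linD(1)[OF hg unit_vec_closed[OF that]] .
    have "comb U (\<lambda>i. h (g (unit_vec R i))) r ?f \<in> {0\<^sub>U}"
      by (rule U.comb_in_submodule[OF U.submodule_zero]) (use U(2)[OF fm e] in simp)
    hence "h (g ?f) = 0\<^sub>U" using U.lin_free_as_comb[OF hg fc] by simp
    thus False using G(3)[OF w(1)] w(2) by simp
  qed
  then obtain i where i: "?f i \<notin> \<mm>" ..
  have u: "?f i \<in> Units R" using unit_if i free_mod_closed[OF fc] by simp
  have "lin R (free_mod R r) (self_module R) (\<lambda>f. inv (?f i) \<otimes> f i)"
    using u by (intro linI) (simp_all add: r_distr m_lcomm free_mod_closed)
  from lin_comp[OF G(1) this] show ?thesis using u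
    by (intro exI[of _ "\<lambda>v. inv (?f i) \<otimes> inv_into (free_mod R r) g v i"]) simp
qed

end

theorem (in dim_one_ring) principal_if_free_differentials:
  fixes M :: "('r, 'm) module"
  assumes M: "module R M" and g: "lin R (free_mod R r) M g" "bij_betw g (free_mod R r) M"
    and d: "\<And>a. a \<in> R ==> d a \<in> M"
      "\<And>a b. a \<in> R ==> b \<in> R ==> d (a \<otimes> b) = a *\<^sub>M d b +\<^sub>M b *\<^sub>M d a"
    and h: "lin R M cotangent h" "\<And>z. z \<in> \<mm> ==> h (d z) = cl z"
    and char0: "\<And>n::nat. n > 0 ==> add_pow R n \<one> \<notin> \<mm>"
  shows "\<exists>x\<in>\<mm>. \<mm> = PIdl x"
proof -
  interpret M: rmod R M by (rule rmodI, rule M)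
  have uni: "\<exists>\<pi>. lin R M (self_module R) \<pi> \<and> \<pi> w = \<one>" if "w \<in> M" "h w \<noteq> \<zero>\<^bsub>cotangent\<^esub>" for w
    by (rule unimodular_if_nonzero_in_residue_space[OF M g cotangent(1) _ h(1) that]) (rule cotangent(6))
  have leib: "\<pi> (d (a \<otimes> b)) = a \<otimes> \<pi> (d b) \<oplus> b \<otimes> \<pi> (d a)" "\<pi> (d a) \<in> R"
    if \<pi>: "lin R M (self_module R) \<pi>" and ab: "a \<in> R" "b \<in> R" for \<pi> a b
  proof -
    note da = d(1)[OF ab(1)] and db = d(1)[OF ab(2)]
    show "\<pi> (d (a \<otimes> b)) = a \<otimes> \<pi> (d b) \<oplus> b \<otimes> \<pi> (d a)"
      unfolding d(2)[OF ab] using linD(2)[OF \<pi> M.smult_closed[OF ab(1) db] M.smult_closed[OF ab(2) da]]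
        linD(3)[OF \<pi> ab(1) db] linD(3)[OF \<pi> ab(2) da] by simp
    show "\<pi> (d a) \<in> R" using linD(1)[OF \<pi> da] by simp
  qed
  obtain A where A: "finite A" "A \<subseteq> carrier m_module" "module_span R m_module A = carrier m_module"
    by (rule fin_gen_moduleD[OF m_module(2)])
  have "\<exists>Z. ideal Z R \<and> J \<subseteq> Z \<and> Z \<subset> \<mm> \<and> m2 \<subseteq> Z" if J: "ideal J R" "J \<subset> \<mm>" for J
  proof -
    have JS: "submodule J R m_module" "J \<noteq> carrier m_module" using J m_module(3) by auto
    obtain Z where Z: "submodule Z R m_module" "J \<subseteq> Z" "Z \<noteq> carrier m_module"
      and ZV: "\<And>z v. z \<in> \<mm> ==> v \<in> carrier m_module ==> z \<odot>\<^bsub>m_module\<^esub> v \<in> Z"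
      using nakayama[OF m_module(1) JS A] by blast
    have "ideal Z R" "Z \<subset> \<mm>" using Z m_module(3) by auto
    moreover have "m2 \<subseteq> Z" by (rule m2_least[OF calculation(1)]) (use ZV in simp)
    ultimately show ?thesis using Z(2) by blast
  qed
  note nak = this
  obtain Z0 where Z0: "Z0 \<subset> \<mm>" "m2 \<subseteq> Z0" using nak[OF zeroideal] m_nonzero idealD(2)[OF m_ideal] by auto
  then obtain x where x: "x \<in> \<mm>" "x \<notin> m2" by auto
  note xR = m_closed'[OF x(1)]
  have "h (d x) \<noteq> \<zero>\<^bsub>cotangent\<^esub>" using h(2)[OF x(1)] cotangent(5)[OF x(1)] x(2) by simp
  then obtain \<pi> where \<pi>: "lin R M (self_module R) \<pi>" "\<pi> (d x) = \<one>" using uni[OF d(1)[OF xR]] by auto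
  have d0: "d \<zero> = 0\<^sub>M" using d(2)[of \<zero> \<zero>] d(1)[of \<zero>] by simp
  \<comment> \<open>The derivation \<pi> o d has value 1 at x. Applied to x a = 0 it shows that a is
    a multiple of x; multiplication by a then gives a a = 0.\<close>
  have nzd: "nonzerodivisor R x" unfolding nonzerodivisor_def
  proof (intro conjI ballI impI)
    fix a assume a: "a \<in> R" "x \<otimes> a = \<zero>"
    note c = leib(2)[OF \<pi>(1) a(1) a(1)]
    have "\<zero> = \<pi> (d (x \<otimes> a))" unfolding a(2) d0 lin_zero[OF M self_module_module \<pi>(1)] by simp
    also have "\<dots> = x \<otimes> \<pi> (d a) \<oplus> a" unfolding leib(1)[OF \<pi>(1) xR a(1)] \<pi>(2) using a(1) by simp
    finally have "a \<otimes> \<zero> = a \<otimes> (x \<otimes> \<pi> (d a) \<oplus> a)" by simp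
    also have "\<dots> = (x \<otimes> a) \<otimes> \<pi> (d a) \<oplus> a \<otimes> a" using a(1) c xR by (simp add: r_distr m_ac)
    finally have "a \<otimes> \<zero> = \<zero> \<otimes> \<pi> (d a) \<oplus> a \<otimes> a" unfolding a(2) .
    hence "a \<otimes> a = \<zero>" using a(1) c by simp
    thus "a = \<zero>" by (rule reduced[OF a(1)])
  qed (rule xR)
  have xI: "ideal (PIdl x) R" by (rule cgenideal_ideal[OF xR])
  have xx: "x \<in> PIdl x" by (rule cgenideal_self[OF xR])
  have sub: "PIdl x \<subseteq> \<mm>" by (rule cgenideal_minimal[OF m_ideal x(1)])
  show ?thesis
  proof (cases "PIdl x = \<mm>")
    case False
    then obtain Z where Z: "ideal Z R" "PIdl x \<subseteq> Z" "Z \<subset> \<mm>" "m2 \<subseteq> Z" using nak[OF xI] sub by blast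
    then obtain y where y: "y \<in> \<mm>" "y \<notin> Z" by auto
    note yR = m_closed'[OF y(1)]
    note c = leib(2)[OF \<pi>(1) yR yR]
    \<comment> \<open>Projection along d x, so that the derivation D below vanishes at x. The image
      of d y stays nonzero in the cotangent space, because y avoids the ideal Z, which contains x
      and \<open>m2\<close>.\<close>
    define \<phi> where "\<phi> v = v -\<^sub>M \<pi> v *\<^sub>M d x" for v
    have \<phi>: "\<phi> (v +\<^sub>M w) = \<phi> v +\<^sub>M \<phi> w" "a \<in> R ==> \<phi> (a *\<^sub>M v) = a *\<^sub>M \<phi> v" "\<phi> v \<in> M"
      if "v \<in> M" "w \<in> M" for v w a using that linD[OF \<pi>(1)] d(1)[OF xR] unfolding \<phi>_def
      by (simp_all add: a_minus_def M.smult_l_distr M.smult_r_distr M.smult_r_minus M.smult_assoc1 M.a_ac M.minus_add)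
    note \<phi>l = linI[of M \<phi> M R, OF \<phi>(3,1,2)]
    have \<phi>x: "\<phi> (d x) = 0\<^sub>M" using \<pi>(2) d(1)[OF xR] M.r_neg by (simp add: \<phi>_def a_minus_def)
    have "h (\<phi> (d y)) = h (d y) \<ominus>\<^bsub>cotangent\<^esub> \<pi> (d y) \<odot>\<^bsub>cotangent\<^esub> h (d x)"
      using lin_minus[OF M cotangent(1) h(1)] d(1) xR yR c linD(3)[OF h(1)] by (simp add: \<phi>_def)
    also have "\<dots> = cl (y \<ominus> \<pi> (d y) \<otimes> x)"
      using lin_minus[OF m_module(1) cotangent(1,3), of y "\<pi> (d y) \<otimes> x"] linD(3)[OF cotangent(3) c, of x]
        x y c h(2) m_module(4) idealD(6)[OF m_ideal c x(1)] by simp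
    finally have hy: "h (\<phi> (d y)) = cl (y \<ominus> \<pi> (d y) \<otimes> x)" .
    have ym: "y \<ominus> \<pi> (d y) \<otimes> x \<in> \<mm>" using idealD(5,6)[OF m_ideal] y x c by auto
    have "y \<ominus> \<pi> (d y) \<otimes> x \<notin> m2"
    proof
      assume "y \<ominus> \<pi> (d y) \<otimes> x \<in> m2"
      hence "(y \<ominus> \<pi> (d y) \<otimes> x) \<oplus> \<pi> (d y) \<otimes> x \<in> Z" using Z(2,4) xx c idealD(3,6)[OF Z(1)] by blast
      moreover have "(y \<ominus> \<pi> (d y) \<otimes> x) \<oplus> \<pi> (d y) \<otimes> x = y" using c xR yR by (simp add: a_minus_def a_assoc l_neg)
      ultimately show False using y(2) by simp
    qed
    hence "h (\<phi> (d y)) \<noteq> \<zero>\<^bsub>cotangent\<^esub>" using hy cotangent(5)[OF ym] by simp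
    then obtain \<rho> where \<rho>: "lin R M (self_module R) \<rho>" "\<rho> (\<phi> (d y)) = \<one>" using uni[OF \<phi>(3)] d(1)[OF yR] by blast
    define D where "D a = \<rho> (\<phi> (d a))" for a
    have D: "D a \<in> R" "D (a \<otimes> b) = a \<otimes> D b \<oplus> b \<otimes> D a"
      if "a \<in> R" "b \<in> R" for a b unfolding D_def using leib[OF lin_comp[OF \<phi>l \<rho>(1)] that] by auto
    have Dx: "D x = \<zero>" unfolding D_def \<phi>x by (rule lin_zero[OF M self_module_module \<rho>(1), simplified])
    \<comment> \<open>From y^(n+1) = b x the derivation D gives (n + 1) y^n = x D(b), and n + 1 is a
      unit; so no power can be the least one in R x. Yet x is regular, so some power of y does lie
      in R x.\<close>
    have "y [^] n \<notin> PIdl x" for n :: nat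
    proof (induction n)
      case 0
      show ?case using sub one_notin_m by auto
    next
      case (Suc n)
      show ?case
      proof
        assume "y [^] Suc n \<in> PIdl x"
        then obtain b where b: "b \<in> R" "y [^] Suc n = b \<otimes> x" by (auto simp: cgenideal_def)
        have "D (b \<otimes> x) \<in> PIdl x"
          using D[OF b(1) xR] D(1)[OF b(1) b(1)] Dx b(1) xR idealD(7)[OF xI _ xx] by simp
        moreover have "D (y [^] Suc n) = add_pow R (Suc n) (y [^] n) \<otimes> D y"
          by (rule leibniz_pow[OF _ D(2) yR]) (use D(1) yR in auto)
        hence "D (b \<otimes> x) = add_pow R (Suc n) (y [^] n)"
          using \<rho>(2) b(2) yR by (simp add: D_def del: nat_pow_Suc add.nat_pow_Suc)
        moreover have "add_pow R (Suc n) (y [^] n) = add_pow R (Suc n) \<one> \<otimes> y [^] n"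
          using add_pow_ldistr[of \<one> "y [^] n" "Suc n"] yR by simp
        ultimately have "add_pow R (Suc n) \<one> \<otimes> y [^] n \<in> PIdl x" by simp
        moreover have U: "add_pow R (Suc n) \<one> \<in> Units R" using char0[of "Suc n"] by (intro unit_if) auto
        ultimately have "inv (add_pow R (Suc n) \<one>) \<otimes> (add_pow R (Suc n) \<one> \<otimes> y [^] n) \<in> PIdl x"
          using idealD(6)[OF xI] by blast
        thus False using Suc U yR by (simp add: m_assoc[symmetric] del: add_pow_rdistr_int)
      qed
    qed
    thus ?thesis using pow_in_if_nonzerodivisor[OF xI nzd xx y(1)] by blast
  qed (use x in auto)
qed

section \<open>Derivations and the universal property\<close>

lemma derivationsD:
  assumes "D \<in> derivations K R M"
  shows "a \<in> R ==> D a \<in> M"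
    "a \<in> R ==> b \<in> R ==> D (a +\<^sub>R b) = D a +\<^sub>M D b"
    "c \<in> K ==> a \<in> R ==> D (c \<odot>\<^bsub>R\<^esub> a) = (c \<odot>\<^bsub>R\<^esub> \<one>\<^sub>R) *\<^sub>M D a"
    "a \<in> R ==> b \<in> R ==> D (a \<otimes>\<^sub>R b) = a *\<^sub>M D b +\<^sub>M b *\<^sub>M D a"
    "restrict D (carrier R) = D" using assms by (auto simp: derivations_def)

locale algebra_setup =
  fixes K :: "'k ring" and R :: "('k, 'r) module" (structure)
  assumes alg: "algebra K R"
begin

sublocale cring R using alg by (simp add: algebra_def)

lemma smult_one: "c \<in> K ==> c \<odot> \<one> \<in> R" "c \<in> K ==> a \<in> R ==> c \<odot> a \<in> R"
  "c \<in> K ==> a \<in> R ==> (c \<odot> \<one>) \<otimes> a = c \<odot> a"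
proof -
  interpret A: algebra K R by (rule alg)
  show "c \<in> K ==> c \<odot> \<one> \<in> R" "c \<in> K ==> a \<in> R ==> c \<odot> a \<in> R" by (simp_all add: A.smult_closed)
  show "c \<in> K ==> a \<in> R ==> (c \<odot> \<one>) \<otimes> a = c \<odot> a" by (simp add: A.smult_assoc2)
qed

lemma derivationsI:
  assumes "\<And>a. a \<in> carrier R ==> D a \<in> carrier M"
    "\<And>a b. a \<in> carrier R ==> b \<in> carrier R ==> D (a \<oplus> b) = D a +\<^sub>M D b"
    "\<And>c a. c \<in> carrier K ==> a \<in> carrier R ==> D (c \<odot> a) = (c \<odot> \<one>) *\<^sub>M D a"
    "\<And>a b. a \<in> carrier R ==> b \<in> carrier R ==> D (a \<otimes> b) = a *\<^sub>M D b +\<^sub>M b *\<^sub>M D a"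
  shows "restrict D (carrier R) \<in> derivations K R M" unfolding derivations_def using assms smult_one by auto

lemma lin_derivation:
  assumes M: "module R M" and D: "D \<in> derivations K R M" and f: "lin R M N f"
  shows "(\<lambda>a\<in>R. f (D a)) \<in> derivations K R N"
proof -
  interpret M: rmod R M by (rule rmodI, rule M)
  note D = derivationsD[OF D] and f = linD[OF f]
  show ?thesis
  proof (rule derivationsI)
    fix a b assume ab: "a \<in> R" "b \<in> R"
    note da = D(1)[OF ab(1)] and db = D(1)[OF ab(2)]
    show "f (D a) \<in> N" by (rule f(1)[OF da])
    show "f (D (a \<oplus> b)) = f (D a) +\<^sub>N f (D b)" unfolding D(2)[OF ab] by (rule f(2)[OF da db])
    show "f (D (a \<otimes> b)) = a *\<^sub>N f (D b) +\<^sub>N b *\<^sub>N f (D a)"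
      unfolding D(4)[OF ab] f(2)[OF M.smult_closed[OF ab(1) db] M.smult_closed[OF ab(2) da]]
        f(3)[OF ab(1) db] f(3)[OF ab(2) da] ..
  next
    fix c a assume ca: "c \<in> K" "a \<in> R"
    show "f (D (c \<odot> a)) = (c \<odot> \<one>) *\<^sub>N f (D a)"
      unfolding D(3)[OF ca] by (rule f(3)[OF smult_one(1)[OF ca(1)] D(1)[OF ca(2)]])
  qed
qed

text \<open>Carries the universal property from the test type to finitely generated modules of any
  type. The second part is uniqueness in the form used later: linear maps that agree on all d a are
  equal.\<close>

lemma universal_derivation:
  fixes U :: "('r, 'u) module" and \<Omega> :: "('r, 'w) module"
  assumes univ: "universally_finite_differentials K R \<Omega> d" and U: "fin_gen_module R U"
  shows "D \<in> derivations K R U ==> \<exists>h. lin R \<Omega> U h \<and> (\<forall>a\<in>R. h (d a) = D a)"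
    and "\<lbrakk>lin R \<Omega> U f; lin R \<Omega> U g; \<And>a. a \<in> R ==> f (d a) = g (d a); v \<in> \<Omega>\<rbrakk> \<Longrightarrow> f v = g v"
proof -
  interpret U: rmod R U by (rule rmodI, rule moduleD_fin_gen[OF U])
  obtain j :: "'u \<Rightarrow> nat \<Rightarrow> 'r" where j: "inj_on j U" by (rule U.fin_gen_injection[OF U])
  note T = U.transport_lin[OF j] and Tfg = U.fin_gen_transport[OF j U]
  have \<Omega>: "module R \<Omega>" "d \<in> derivations K R \<Omega>"
    using univ moduleD_fin_gen unfolding universally_finite_differentials_def by auto
  have ex: "\<exists>!h. h \<in> module_homs R \<Omega> (transport j U) \<and> (\<forall>a\<in>carrier R. h (d a) = D a)"
    if "D \<in> derivations K R (transport j U)" for D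
    using univ Tfg that unfolding universally_finite_differentials_def by blast
  show "\<exists>h. lin R \<Omega> U h \<and> (\<forall>a\<in>R. h (d a) = D a)" if D: "D \<in> derivations K R U"
  proof -
    obtain h where h: "h \<in> module_homs R \<Omega> (transport j U)" "\<forall>a\<in>carrier R. h (d a) = (\<lambda>a\<in>carrier R. j (D a)) a"
      using ex[OF lin_derivation[OF U.is_mod D T(1)]] by blast
    have "inv_into U j (h (d a)) = D a" if "a \<in> R" for a
      using h(2) that inv_into_f_f[OF j] derivationsD(1)[OF D that] by simp
    thus ?thesis using lin_comp[OF module_homs_imp_lin[OF h(1)] T(2)] by blast
  qed
  show "f v = g v" if f: "lin R \<Omega> U f" and g: "lin R \<Omega> U g"
    and fg: "\<And>a. a \<in> R ==> f (d a) = g (d a)" and v: "v \<in> \<Omega>"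
  proof -
    note jf = lin_comp[OF f T(1)] and jg = lin_comp[OF g T(1)]
    let ?D = "\<lambda>a\<in>R. j (f (d a))"
    have dc: "d a \<in> \<Omega>" if "a \<in> R" for a by (rule derivationsD(1)[OF \<Omega>(2) that])
    obtain k where "\<forall>y. y \<in> module_homs R \<Omega> (transport j U) \<and> (\<forall>a\<in>carrier R. y (d a) = ?D a) \<longrightarrow> y = k"
      using ex[OF lin_derivation[OF \<Omega> jf]] by (elim ex1E) (rule that)
    hence k: "y = k" if "y \<in> module_homs R \<Omega> (transport j U)" "\<forall>a\<in>carrier R. y (d a) = ?D a" for y
      using that by simp
    have "restrict (\<lambda>x. j (f x)) (carrier \<Omega>) = k" "restrict (\<lambda>x. j (g x)) (carrier \<Omega>) = k"
      by (rule k[OF lin_restrict[OF \<Omega>(1) jf]], use dc in simp) (rule k[OF lin_restrict[OF \<Omega>(1) jg]], use dc fg in simp)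
    hence "restrict (\<lambda>x. j (f x)) (carrier \<Omega>) v = restrict (\<lambda>x. j (g x)) (carrier \<Omega>) v" by simp
    hence "j (f v) = j (g v)" using v by simp
    thus ?thesis using inj_onD[OF j] linD(1)[OF f v] linD(1)[OF g v] by blast
  qed
qed

lemma Der_module_simps [simp]:
  "carrier (Der_module K R) = derivations K R (self_module R)"
  "f \<oplus>\<^bsub>Der_module K R\<^esub> g = (\<lambda>x\<in>R. f x \<oplus> g x)"
  "a \<odot>\<^bsub>Der_module K R\<^esub> f = (\<lambda>x\<in>R. a \<otimes> f x)" by (simp_all add: Der_module_def)

lemma Der_module_module: "module R (Der_module K R)" unfolding Der_module_def
proof (rule rmod.pointwise_module_module)
  show "rmod R (self_module R)" by (rule rmodI, rule self_module_module)
  show "derivations K R (self_module R) \<subseteq> R \<rightarrow>\<^sub>E carrier (self_module R)" by (auto simp: derivations_def)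
  show "(\<lambda>x\<in>R. \<zero>\<^bsub>self_module R\<^esub>) \<in> derivations K R (self_module R)"
    by (rule derivationsI) (use smult_one in auto)
next
  fix f g assume "f \<in> derivations K R (self_module R)" "g \<in> derivations K R (self_module R)"
  note f = derivationsD[OF this(1), simplified] and g = derivationsD[OF this(2), simplified]
  show "(\<lambda>x\<in>R. f x \<oplus>\<^bsub>self_module R\<^esub> g x) \<in> derivations K R (self_module R)"
    by (rule derivationsI) (simp_all add: f(1-4) g(1-4) smult_one(1) r_distr a_ac)
next
  fix a f assume a: "a \<in> R" and "f \<in> derivations K R (self_module R)"
  note f = derivationsD[OF this(2), simplified]
  show "(\<lambda>x\<in>R. a \<odot>\<^bsub>self_module R\<^esub> f x) \<in> derivations K R (self_module R)"
    by (rule derivationsI) (simp_all add: f(1-4) a smult_one(1) r_distr m_lcomm)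
qed

end

locale local_algebra = algebra_setup K R + local_noetherian R \<mm>
  for K :: "'k ring" and R :: "('k, 'r) module" (structure) and \<mm> :: "'r set" +
  assumes K_field: "field K" and K_char0: "\<And>n::nat. n > 0 ==> add_pow K n \<one>\<^sub>K \<noteq> 0\<^sub>K"
begin

lemma smult_one_unit:
  assumes c: "c \<in> K" "c \<odot> \<one> \<in> \<mm>"
  shows "c = 0\<^sub>K"
proof (rule ccontr)
  interpret K: field K by (rule K_field)
  interpret A: algebra K R by (rule alg)
  assume "c \<noteq> 0\<^sub>K"
  hence "inv\<^bsub>K\<^esub> c \<in> K" "inv\<^bsub>K\<^esub> c \<otimes>\<^sub>K c = \<one>\<^sub>K" using c(1) by (auto simp: K.field_Units)
  hence "(inv\<^bsub>K\<^esub> c \<odot> \<one>) \<otimes> (c \<odot> \<one>) = \<one>" "inv\<^bsub>K\<^esub> c \<odot> \<one> \<in> R"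
    using c(1) A.smult_assoc1[of "inv\<^bsub>K\<^esub> c" c \<one>] by (simp_all add: smult_one A.smult_one)
  thus False using idealD(6)[OF m_ideal _ c(2)] one_notin_m by metis
qed

lemma char0: "n > 0 ==> add_pow R (n::nat) \<one> \<notin> \<mm>"
proof
  interpret K: field K by (rule K_field)
  interpret A: algebra K R by (rule alg)
  have "add_pow K n \<one>\<^sub>K \<odot> \<one> = add_pow R n \<one>" for n :: nat
    by (induction n) (simp_all add: A.smult_l_distr A.smult_one A.smult_l_null)
  moreover assume "n > 0" "add_pow R n \<one> \<in> \<mm>"
  ultimately show False using smult_one_unit[of "add_pow K n \<one>\<^sub>K"] K_char0 by simp
qed

lemma constants:
  shows "subring {c \<odot> \<one> |c. c \<in> K} R" "a \<in> {c \<odot> \<one> |c. c \<in> K} ==> a \<in> \<mm> ==> a = \<zero>"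
proof -
  interpret K: field K by (rule K_field)
  interpret A: algebra K R by (rule alg)
  let ?C = "{c \<odot> \<one> |c. c \<in> K}"
  show "subring ?C R"
  proof (rule subringI)
    show "?C \<subseteq> R" using smult_one by auto
    show "\<one> \<in> ?C" using A.smult_one[of \<one>] by force
    show "\<ominus> h \<in> ?C" if h: "h \<in> ?C" for h
    proof -
      obtain c where "c \<in> K" "h = c \<odot> \<one>" using h by auto
      thus ?thesis using A.smult_l_minus[of c \<one>] by (intro CollectI exI[of _ "-\<^sub>K c"]) simp
    qed
    show "h \<otimes> k \<in> ?C" "h \<oplus> k \<in> ?C" if hk: "h \<in> ?C" "k \<in> ?C" for h k
    proof -
      obtain c c' where c: "c \<in> K" "h = c \<odot> \<one>" "c' \<in> K" "k = c' \<odot> \<one>" using hk by auto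
      have "h \<otimes> k = (c \<otimes>\<^sub>K c') \<odot> \<one>" using c by (simp add: smult_one A.smult_assoc1)
      thus "h \<otimes> k \<in> ?C" using c by blast
      have "h \<oplus> k = (c +\<^sub>K c') \<odot> \<one>" using c by (simp add: A.smult_l_distr)
      thus "h \<oplus> k \<in> ?C" using c by blast
    qed
  qed
  show "a = \<zero>" if "a \<in> ?C" "a \<in> \<mm>" 
  proof -
    obtain c where "c \<in> K" "a = c \<odot> \<one>" using \<open>a \<in> ?C\<close> by auto
    thus ?thesis using smult_one_unit[of c] \<open>a \<in> \<mm>\<close> A.smult_l_null[of \<one>] by simp
  qed
qed

text \<open>By \<open>coefficient_ring\<close>, R = F + \<mm> with F \<inter> \<mm> inside
  \<open>m2\<close>. Hence f + v -> \<open>cl v\<close> is well defined, and it is K-linear since F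
  contains the constants.\<close>

lemma cotangent_derivation:
  obtains \<delta> where "\<delta> \<in> derivations K R cotangent" "\<And>z. z \<in> \<mm> ==> \<delta> z = cl z"
proof -
  obtain F where F: "subring F R" "{c \<odot> \<one> |c. c \<in> K} \<subseteq> F" "m2 \<subseteq> F" "\<And>f. f \<in> F ==> f \<in> \<mm> ==> f \<in> m2"
    and dec: "\<And>u. u \<in> R ==> \<exists>f\<in>F. \<exists>v\<in>\<mm>. u = f \<oplus> v"
    by (rule coefficient_ring[OF constants char0]) (assumption+, rule that)
  note FE = subringE[OF F(1)] and mD = idealD[OF m_ideal] and cD = linD[OF cotangent(3)]
  have FR: "f \<in> F ==> f \<in> R" for f using FE(1) by auto
  interpret V: rmod R m_module by (rule rmodI, rule m_module)
  have m2: "submodule m2 R m_module" using m_module(3) m2_ideal m2_le_m by auto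
  define \<delta> where "\<delta> a = cl (SOME v. v \<in> \<mm> \<and> (\<exists>f\<in>F. a = f \<oplus> v))" for a
  have \<delta>: "\<delta> (f \<oplus> v) = cl v" if fv: "f \<in> F" "v \<in> \<mm>" for f v
  proof -
    define w where "w = (SOME w. w \<in> \<mm> \<and> (\<exists>g\<in>F. f \<oplus> v = g \<oplus> w))"
    have "w \<in> \<mm> \<and> (\<exists>g\<in>F. f \<oplus> v = g \<oplus> w)" unfolding w_def by (rule someI[of _ v]) (use fv in auto)
    then obtain g where g: "w \<in> \<mm>" "g \<in> F" "f \<oplus> v = g \<oplus> w" by auto
    note cc = FR[OF fv(1)] m_closed'[OF fv(2)] FR[OF g(2)] m_closed'[OF g(1)]
    have "w \<ominus> v = (\<ominus> g \<oplus> (g \<oplus> w)) \<ominus> v" using cc by (simp add: r_neg1)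
    also have "\<dots> = \<ominus> g \<oplus> f" unfolding g(3)[symmetric] using cc by (simp add: a_minus_def a_assoc r_neg)
    finally have "w \<ominus> v \<in> F" using FE(5,7) g fv by simp
    hence "w \<ominus> v \<in> m2" by (rule F(4)[OF _ mD(5)[OF g(1) fv(2)]])
    hence "cl w = cl v" using V.coset_eq_iff[OF m2, of w v] g fv m_module(4) by simp
    thus ?thesis by (simp add: \<delta>_def w_def)
  qed
  have "restrict \<delta> R \<in> derivations K R cotangent"
  proof (rule derivationsI)
    fix a b assume ab: "a \<in> R" "b \<in> R"
    obtain f v g w where fv: "f \<in> F" "v \<in> \<mm>" "a = f \<oplus> v" "g \<in> F" "w \<in> \<mm>" "b = g \<oplus> w"
      using dec[OF ab(1)] dec[OF ab(2)] by blast
    note cc = FR[OF fv(1)] m_closed'[OF fv(2)] FR[OF fv(4)] m_closed'[OF fv(5)]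
    note da = \<delta>[OF fv(1,2), folded fv(3)] and db = \<delta>[OF fv(4,5), folded fv(6)]
    show "\<delta> a \<in> cotangent" unfolding da using cD(1) fv(2) by simp
    have "a \<oplus> b = (f \<oplus> g) \<oplus> (v \<oplus> w)" unfolding fv(3,6) using cc by (simp add: a_ac)
    hence "\<delta> (a \<oplus> b) = cl (v \<oplus> w)" using \<delta> FE(7) mD(3) fv by simp
    thus "\<delta> (a \<oplus> b) = \<delta> a \<oplus>\<^bsub>cotangent\<^esub> \<delta> b" unfolding da db using cD(2)[of v w] fv by simp
    have vw: "\<ominus> (v \<otimes> w) \<in> F" using m2_prod[OF fv(2,5)] idealD(4)[OF m2_ideal] F(3) by blast
    \<comment> \<open>v w occurs twice in a w + b v. The surplus lies in \<open>m2\<close>, hence in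
      F, so the first summand is a member of F.\<close>
    have "a \<otimes> b = (f \<otimes> g \<oplus> \<ominus> (v \<otimes> w)) \<oplus> (a \<otimes> w \<oplus> b \<otimes> v)"
      unfolding fv(3,6) using cc by (simp add: l_distr r_distr m_ac a_ac r_neg r_neg1 r_neg2)
    hence "\<delta> (a \<otimes> b) = cl (a \<otimes> w \<oplus> b \<otimes> v)" using \<delta> FE(6,7) vw mD(3,6) fv ab by simp
    also have "\<dots> = a \<odot>\<^bsub>cotangent\<^esub> \<delta> b \<oplus>\<^bsub>cotangent\<^esub> b \<odot>\<^bsub>cotangent\<^esub> \<delta> a"
      unfolding da db using cD(2)[of "a \<otimes> w" "b \<otimes> v"] cD(3)[OF ab(1), of w] cD(3)[OF ab(2), of v] mD(6) fv ab by simp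
    finally show "\<delta> (a \<otimes> b) = a \<odot>\<^bsub>cotangent\<^esub> \<delta> b \<oplus>\<^bsub>cotangent\<^esub> b \<odot>\<^bsub>cotangent\<^esub> \<delta> a" .
  next
    fix c a assume ca: "c \<in> K" "a \<in> R"
    obtain f v where fv: "f \<in> F" "v \<in> \<mm>" "a = f \<oplus> v" using dec[OF ca(2)] by blast
    note cc = FR[OF fv(1)] m_closed'[OF fv(2)] smult_one(1)[OF ca(1)]
    have "c \<odot> a = (c \<odot> \<one>) \<otimes> f \<oplus> (c \<odot> \<one>) \<otimes> v" using smult_one(3)[OF ca] cc fv(3) by (simp add: r_distr)
    moreover have "c \<odot> \<one> \<in> F" using F(2) ca by blast
    ultimately have "\<delta> (c \<odot> a) = cl ((c \<odot> \<one>) \<otimes> v)" using \<delta> FE(6) mD(6) fv cc by simp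
    also have "\<dots> = (c \<odot> \<one>) \<odot>\<^bsub>cotangent\<^esub> \<delta> a" using cD(3)[OF cc(3), of v] fv \<delta> by simp
    finally show "\<delta> (c \<odot> a) = (c \<odot> \<one>) \<odot>\<^bsub>cotangent\<^esub> \<delta> a" .
  qed
  moreover have "\<delta> z = cl z" if "z \<in> \<mm>" for z using \<delta>[OF FE(2) that] m_closed'[OF that] by simp
  hence "restrict \<delta> R z = cl z" if "z \<in> \<mm>" for z using that m_closed'[OF that] by simp
  ultimately show ?thesis by (rule that)
qed

end

section \<open>Dimension one, regularity, and the conclusion for R\<close>

context local_noetherian
begin

lemma maximalideal_iff: "maximalideal J R \<longleftrightarrow> J = \<mm>"
proof
  have "maximalideal \<mm> R"
  proof (rule maximalidealI[OF m_ideal])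
    show "carrier R \<noteq> \<mm>" using one_notin_m by auto
    show "J = \<mm> \<or> J = carrier R" if "ideal J R" "\<mm> \<subseteq> J" "J \<subseteq> R" for J
      using proper_ideal_le_m[OF that(1)] that ideal_notin_one by blast
  qed
  thus "J = \<mm> ==> maximalideal J R" by simp
  assume J: "maximalideal J R"
  have i: "ideal J R" "J \<noteq> carrier R" using J maximalideal.axioms(1) maximalideal.I_notcarr by auto
  hence "J \<subseteq> \<mm>" using proper_ideal_le_m ideal_notin_one by blast
  thus "J = \<mm>" using maximalideal.I_maximal[OF J m_ideal] m_closed' one_notin_m by blast
qed

lemma local: "local_ring R" "max_ideal R = \<mm>"
  by (auto simp: local_ring_def max_ideal_def maximalideal_iff is_cring)

lemma dim_one_ringI:
  assumes red: "\<And>a. a \<in> R ==> a \<otimes> a = \<zero> ==> a = \<zero>" and dim: "krull_dim R = 1"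
  shows "dim_one_ring R \<mm>"
proof
  show "a = \<zero>" if "a \<in> R" "a \<otimes> a = \<zero>" for a by (rule red[OF that])
  show False if pq: "primeideal p R" "primeideal q R" "p \<subset> q" "q \<subset> \<mm>" for p q
  proof -
    let ?p = "\<lambda>i::nat. if i = 0 then p else if i = 1 then q else \<mm>"
    have "(\<forall>i\<le>2. primeideal (?p i) R) \<and> (\<forall>i<2. ?p i \<subset> ?p (Suc i))"
      using pq m_prime by (simp add: less_2_cases_iff)
    hence "enat 2 \<le> krull_dim R" unfolding krull_dim_def 
      by - (rule Sup_upper, rule CollectI, rule exI[of _ 2], rule conjI[OF refl], rule exI[of _ ?p])
    thus False using dim by (simp add: one_enat_def)
  qed
  show "\<mm> \<noteq> {\<zero>}"
  proof
    assume m: "\<mm> = {\<zero>}"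
    have "P = {\<zero>}" if "primeideal P R" for P
      using primeidealD(4)[OF that] idealD(2)[OF primeidealD(1)[OF that]] m by auto
    hence "krull_dim R \<le> 0" unfolding krull_dim_def
    proof (intro Sup_least, elim CollectE exE conjE)
      fix e n p assume e: "e = enat n" and p: "\<forall>i\<le>n. primeideal (p i) R" "\<forall>i<n. p i \<subset> p (Suc i)"
        and z: "\<And>P. primeideal P R ==> P = {\<zero>}"
      show "e \<le> 0"
      proof (cases n)
        case (Suc k)
        hence "p 0 = {\<zero>}" "p 1 = {\<zero>}" "p 0 \<subset> p 1" using p z by auto
        thus ?thesis by simp
      qed (simp add: e zero_enat_def)
    qed
    thus False using dim by simp
  qed
qed

lemma regular_if_principal:
  assumes x: "x \<in> \<mm>" "\<mm> = PIdl x" and "\<mm> \<noteq> {\<zero>}" and dim: "krull_dim R = 1"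
  shows "regular_local_ring R"
proof -
  have "embedding_dim R = 1"
  proof (rule antisym)
    show "embedding_dim R \<le> 1" unfolding embedding_dim_def
      using x m_closed' cgenideal_eq_genideal[of x] local(2)
      by (intro Inf_lower CollectI exI[of _ "{x}"]) (auto simp: one_enat_def)
    show "1 \<le> embedding_dim R" unfolding embedding_dim_def
    proof (intro Inf_greatest, elim CollectE exE conjE)
      fix e A assume A: "e = enat (card A)" "finite A" "Idl A = max_ideal R"
      have "A \<noteq> {}"
      proof
        assume "A = {}"
        hence "\<mm> \<subseteq> {\<zero>}" using A(3) local(2) genideal_minimal[OF zeroideal, of "{}"] by simp
        thus False using assms(3) idealD(2)[OF m_ideal] by auto
      qed
      thus "1 \<le> e" using A(1,2) by (simp add: one_enat_def Suc_leI card_gt_0_iff)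
    qed
  qed
  thus ?thesis using noetherian_ring_axioms local(1) dim by (simp add: regular_local_ring_def)
qed

end

theorem (in local_algebra) regular_if_finite_proj_dim:
  fixes \<Omega> :: "('r, 'w) module" and d :: "'r \<Rightarrow> 'w" and \<omega> :: "('r, 'c) module"
  assumes red: "\<And>a. a \<in> R ==> a \<otimes> a = \<zero> ==> a = \<zero>" and dim: "krull_dim R = 1"
    and univ: "universally_finite_differentials K R \<Omega> d" and tf: "torsionfree_module R \<Omega>"
    and can: "canonical_module R \<omega>" and pd: "proj_dim R (Hom_module R (Der_module K R) \<omega>) < \<infinity>"
  shows "regular_local_ring R"
proof -
  interpret dim_one_ring R \<mm> by (rule dim_one_ringI[OF red dim])
  have \<Omega>: "fin_gen_module R \<Omega>" and d: "d \<in> derivations K R \<Omega>"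
    using univ unfolding universally_finite_differentials_def by auto
  note \<Omega>m = moduleD_fin_gen[OF \<Omega>]
  note u1 = universal_derivation(1)[OF univ self_module_fin_gen] and u2 = universal_derivation(2)[OF univ self_module_fin_gen]
  note Dm = Der_module_module
  \<comment> \<open>The identification of Der R with the dual of \<Omega>: D corresponds to the
    linear map whose composite with d is D. Uniqueness makes it linear in D.\<close>
  define pr where "pr D = (SOME h. lin R \<Omega> (self_module R) h \<and> (\<forall>a\<in>R. h (d a) = D a))" for D
  have pr: "lin R \<Omega> (self_module R) (pr D)" "a \<in> R ==> pr D (d a) = D a"
    if "D \<in> Der_module K R" for D a using someI_ex[OF u1[of D]] that unfolding pr_def by auto
  have tf': "v = 0\<^sub>\<Omega>" if "nonzerodivisor R x" "v \<in> \<Omega>" "x *\<^sub>\<Omega> v = 0\<^sub>\<Omega>" for x v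
    using tf that unfolding torsionfree_module_def nonzerodivisor_def by blast
  note W = canonical_module_endomorphisms[OF local(2) dim can]
  interpret dual_pair R \<mm> \<Omega> "Der_module K R" pr \<omega>
  proof (intro dual_pair.intro dual_pair_axioms.intro dim_one_ring_axioms)
    interpret S: rmod R "self_module R" by (rule rmodI, rule self_module_module)
    show "fin_gen_module R \<Omega>" by (rule \<Omega>)
    show "module R (Der_module K R)" by (rule Dm)
    show "lin R \<Omega> (self_module R) (pr D)" if "D \<in> Der_module K R" for D by (rule pr(1)[OF that])
    show "lin R (Der_module K R) (self_module R) (\<lambda>D. pr D v)" if v: "v \<in> \<Omega>" for v
    proof (rule linI)
      interpret D: module R "Der_module K R" by (rule Dm)
      fix D assume D: "D \<in> Der_module K R"
      show "pr D v \<in> self_module R" by (rule linD(1)[OF pr(1)[OF D] v])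
      show "pr (D \<oplus>\<^bsub>Der_module K R\<^esub> D') v = pr D v \<oplus>\<^bsub>self_module R\<^esub> pr D' v"
        if D': "D' \<in> Der_module K R" for D'
        by (rule u2[OF pr(1)[OF D.a_closed[OF D D']] lin_add[OF S.is_mod \<Omega>m pr(1)[OF D] pr(1)[OF D']] _ v])
          (use pr(2)[OF D.a_closed[OF D D']] pr(2)[OF D] pr(2)[OF D'] in simp)
      show "pr (a \<odot>\<^bsub>Der_module K R\<^esub> D) v = a \<odot>\<^bsub>self_module R\<^esub> pr D v" if a: "a \<in> R" for a
        by (rule u2[OF pr(1)[OF D.smult_closed[OF a D]] lin_smult[OF S.is_mod \<Omega>m pr(1)[OF D] a] _ v])
          (use pr(2)[OF D.smult_closed[OF a D]] pr(2)[OF D] in simp)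
    qed
    show "\<exists>D\<in>(Der_module K R). \<forall>v\<in>\<Omega>. pr D v = \<rho> v" if \<rho>: "lin R \<Omega> (self_module R) \<rho>" for \<rho>
    proof -
      let ?D = "\<lambda>a\<in>R. \<rho> (d a)"
      have D: "?D \<in> Der_module K R" using lin_derivation[OF \<Omega>m d \<rho>] by simp
      have "pr ?D v = \<rho> v" if "v \<in> \<Omega>" for v by (rule u2[OF pr(1)[OF D] \<rho> _ that]) (simp add: pr(2)[OF D])
      thus ?thesis using D by blast
    qed
    show "D = D'" if D: "D \<in> Der_module K R" "D' \<in> Der_module K R"
      and e: "\<And>v. v \<in> \<Omega> ==> pr D v = pr D' v" for D D'
    proof -
      have "D a = D' a" if "a \<in> R" for a
        using pr(2)[OF D(1) that] pr(2)[OF D(2) that] e[OF derivationsD(1)[OF d that]] by simp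
      hence "restrict D (carrier R) = restrict D' (carrier R)" by (rule restrict_ext)
      thus ?thesis using derivationsD(5) D by (metis Der_module_simps(1))
    qed
  qed (fact W)+
  obtain x where x: "x \<in> \<mm>" "nonzerodivisor R x" using exists_nonzerodivisor by blast
  obtain b g where bg: "lin R (free_mod R b) H g" "bij_betw g (free_mod R b) H"
    using free_if_finite_proj_dim[OF x(2,1) H_fin_gen H_reg[OF x(2)]] pd unfolding H_def by blast
  have "\<exists>r k. lin R (free_mod R r) \<Omega> k \<and> bij_betw k (free_mod R r) \<Omega>"
    by (rule free_if_bidual_free[OF bg]) (rule tf')
  then obtain r k where
    k: "lin R (free_mod R r) \<Omega> k" "bij_betw k (free_mod R r) \<Omega>" by blast
  obtain \<delta> where \<delta>: "\<delta> \<in> derivations K R cotangent" "\<And>z. z \<in> \<mm> ==> \<delta> z = cl z"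
    using cotangent_derivation by blast
  obtain h where h: "lin R \<Omega> cotangent h" "\<forall>a\<in>R. h (d a) = \<delta> a"
    using universal_derivation(1)[OF univ cotangent(2) \<delta>(1)] by blast
  have "\<exists>y\<in>\<mm>. \<mm> = PIdl y"
  proof (rule principal_if_free_differentials[OF \<Omega>m k _ _ h(1)])
    show "h (d z) = cl z" if "z \<in> \<mm>" for z using h(2) \<delta>(2) that m_closed' by simp
  qed (use derivationsD[OF d] char0 in auto)
  thus ?thesis using regular_if_principal m_nonzero dim by blast
qed

section \<open>Power series and polynomial rings are Noetherian\<close>

text \<open>Fix a in T. A member of T that is not above a has, for some k in V, one of the finitely
  many multiplicities below \<open>count a k\<close>; the members with a fixed multiplicity of k
  vary in fewer variables. The second hypothesis says that V contains all variables that
  vary.\<close>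

lemma dickson:
  fixes T :: "nat multiset set"
  assumes "finite V" "\<And>s t k. s \<in> T ==> t \<in> T ==> k \<notin> V ==> count s k = count t k"
  shows "\<exists>B\<subseteq>T. finite B \<and> (\<forall>t\<in>T. \<exists>b\<in>B. b \<subseteq># t)" using assms
proof (induction V arbitrary: T rule: finite_psubset_induct)
  case (psubset V)
  show ?case
  proof (cases "T = {}")
    case False
    then obtain a where a: "a \<in> T" by blast
    define slice where "slice k c = {t \<in> T. count t k = c}" for k c
    define I where "I = (SIGMA k:V. {..<count a k})"
    have "\<exists>B\<subseteq>slice k c. finite B \<and> (\<forall>t\<in>slice k c. \<exists>b\<in>B. b \<subseteq># t)" if "(k, c) \<in> I" for k c
    proof (rule psubset.IH)
      show "V - {k} \<subset> V" using that by (auto simp: I_def)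
      show "count s l = count t l" if "s \<in> slice k c" "t \<in> slice k c" "l \<notin> V - {k}" for s t l
        using that psubset.prems[of s t l] by (cases "l = k") (auto simp: slice_def)
    qed
    then obtain B where B: "\<And>k c. (k, c) \<in> I ==> B k c \<subseteq> slice k c \<and> finite (B k c) \<and> (\<forall>t\<in>slice k c. \<exists>b\<in>B k c. b \<subseteq># t)"
      by metis
    define B' where "B' = insert a (\<Union>(k, c)\<in>I. B k c)"
    have "finite I" using psubset.hyps by (auto simp: I_def)
    hence "finite B'" using B by (auto simp: B'_def)
    moreover have "B' \<subseteq> T" using a B by (fastforce simp: B'_def slice_def)
    moreover have "\<exists>b\<in>B'. b \<subseteq># t" if t: "t \<in> T" for t
    proof (cases "a \<subseteq># t")
      case False
      then obtain k where k: "count t k < count a k" by (auto simp: subseteq_mset_def not_le)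
      hence kI: "(k, count t k) \<in> I" using psubset.prems[OF t a, of k] by (auto simp: I_def)
      have "t \<in> slice k (count t k)" using t by (simp add: slice_def)
      then obtain b where "b \<in> B k (count t k)" "b \<subseteq># t" using B[OF kI] by auto
      thus ?thesis using kI unfolding B'_def by (intro bexI[of _ b]) auto
    qed (auto simp: B'_def)
    ultimately show ?thesis by blast
  qed auto
qed

lemma dickson_family:
  fixes ini :: "'a \<Rightarrow> nat multiset"
  assumes "\<And>f. f \<in> J ==> set_mset (ini f) \<subseteq> {..<m}"
  obtains B f where "finite B" "\<forall>b\<in>B. f b \<in> J \<and> ini (f b) = b" "\<forall>g\<in>J. \<exists>b\<in>B. b \<subseteq># ini g"
proof -
  have "count s k = count t k" if st: "s \<in> ini ` J" "t \<in> ini ` J" and k: "k \<notin> {..<m}" for s t k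
  proof -
    have "k \<notin># u" if "u \<in> ini ` J" for u using assms that k by blast
    thus ?thesis using st by (simp add: not_in_iff)
  qed
  hence "\<exists>B\<subseteq>ini ` J. finite B \<and> (\<forall>t\<in>ini ` J. \<exists>b\<in>B. b \<subseteq># t)" by (rule dickson[OF finite_lessThan])
  then obtain B where B: "B \<subseteq> ini ` J" "finite B" "\<forall>t\<in>ini ` J. \<exists>b\<in>B. b \<subseteq># t" by (elim exE conjE)
  have "\<forall>b\<in>B. \<exists>f. f \<in> J \<and> ini f = b" using B(1) by auto
  then obtain f where "\<forall>b\<in>B. f b \<in> J \<and> ini (f b) = b" by metis
  thus ?thesis using that B(2,3) by blast
qed

lemma finite_submultisets: "finite {\<nu>. \<nu> \<subseteq># (\<mu> :: 'a multiset)}"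
proof (induction \<mu>)
  case (add x \<mu>)
  have "{\<nu>. \<nu> \<subseteq># add_mset x \<mu>} \<subseteq> {\<nu>. \<nu> \<subseteq># \<mu>} \<union> add_mset x ` {\<nu>. \<nu> \<subseteq># \<mu>}"
  proof
    fix \<nu> assume "\<nu> \<in> {\<nu>. \<nu> \<subseteq># add_mset x \<mu>}"
    hence \<nu>: "count \<nu> y \<le> (if y = x then Suc (count \<mu> y) else count \<mu> y)" for y
      by (auto simp: subseteq_mset_def split: if_splits)
    show "\<nu> \<in> {\<nu>. \<nu> \<subseteq># \<mu>} \<union> add_mset x ` {\<nu>. \<nu> \<subseteq># \<mu>}"
    proof (cases "x \<in># \<nu>")
      case True
      then obtain \<nu>' where "\<nu> = add_mset x \<nu>'" by (blast dest: multi_member_split)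
      moreover have "count \<nu>' y \<le> count \<mu> y" for y using \<nu>[of y] calculation by (cases "y = x") auto
      ultimately show ?thesis by (auto simp: subseteq_mset_def)
    next
      case False
      hence "count \<nu> y \<le> count \<mu> y" for y using \<nu>[of y] by (cases "y = x") (auto simp: not_in_iff)
      thus ?thesis by (simp add: subseteq_mset_def)
    qed
  qed
  thus ?case using add finite_subset by blast
qed simp

lemma power_series_ring_simps [simp]:
  "f \<in> carrier (power_series_ring K m) \<longleftrightarrow> (\<forall>\<mu>. f \<mu> \<in> K) \<and> (\<forall>\<mu>. \<not> set_mset \<mu> \<subseteq> {..<m} \<longrightarrow> f \<mu> = 0\<^sub>K)"
  "(f \<otimes>\<^bsub>power_series_ring K m\<^esub> g) \<mu> = (\<Oplus>\<^bsub>K\<^esub>\<nu>\<in>{\<nu>. \<nu> \<subseteq># \<mu>}. f \<nu> \<otimes>\<^sub>K g (\<mu> - \<nu>))"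
  by (simp_all add: power_series_ring_def)

lemma (in ring) power_series_ring_simps' [simp]:
  "\<one>\<^bsub>power_series_ring R m\<^esub> \<mu> = (if \<mu> = {#} then \<one> else \<zero>)" "\<zero>\<^bsub>power_series_ring R m\<^esub> \<mu> = \<zero>"
  "(f \<oplus>\<^bsub>power_series_ring R m\<^esub> g) \<mu> = f \<mu> \<oplus> g \<mu>"
  by (simp_all add: power_series_ring_def indexed_const_def indexed_padd_def)

lemma (in ring) coefficient_minus:
  fixes S :: "('c \<Rightarrow> 'a) ring"
  assumes S: "ring S" and "\<And>f \<mu>. f \<in> S ==> f \<mu> \<in> R" "\<And>\<mu>. 0\<^sub>S \<mu> = \<zero>"
    and add: "\<And>f g \<mu>. (f +\<^sub>S g) \<mu> = f \<mu> \<oplus> g \<mu>" and fg: "f \<in> S" "g \<in> S"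
  shows "(f -\<^sub>S g) \<mu> = f \<mu> \<ominus> g \<mu>"
proof -
  interpret S: ring S by (rule S)
  have "(-\<^sub>S g) \<mu> \<oplus> g \<mu> = \<zero>" using S.l_neg[OF fg(2)] add assms(3) by metis
  hence "\<ominus> g \<mu> = (-\<^sub>S g) \<mu>" using fg assms(2) by (intro minus_equality) auto
  thus ?thesis by (simp add: a_minus_def add)
qed

text \<open>The ring laws of S are assumed here; where the locale is interpreted they come with the
  ideal I.\<close>

locale series_ring = field K for K :: "'k ring" (structure) +
  fixes m :: nat and S :: "(nat multiset \<Rightarrow> 'k) ring"
  defines "S \<equiv> power_series_ring K m"
  assumes ring_S: "ring S"
begin

sublocale S: ring S by (rule ring_S)

lemma S_minus: "f \<in> S ==> g \<in> S ==> (f -\<^sub>S g) \<mu> = f \<mu> \<ominus> g \<mu>"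
  by (rule coefficient_minus[OF ring_S]) (auto simp: S_def)

lemma S_finsum: "finite A ==> F \<in> A \<rightarrow> carrier S ==> (\<Oplus>\<^bsub>S\<^esub>t\<in>A. F t) \<mu> = (\<Oplus>t\<in>A. F t \<mu>)"
proof (induction A rule: finite_induct)
  case (insert t A)
  have "(\<lambda>t. F t \<mu>) \<in> insert t A \<rightarrow> carrier K" using insert.prems unfolding S_def Pi_iff power_series_ring_simps by blast
  thus ?case using insert by (simp add: Pi_iff) (simp add: S_def)
next
  case empty
  show ?case unfolding S.finsum_empty by (simp add: S_def)
qed

text \<open>Weierstrass division by finitely many series \<open>f t\<close> with initial monomials \<open>t\<close>: the coefficients of the
  quotients are determined by well-founded recursion, each initial monomial being the least one.\<close>

lemma series_division:
  assumes T: "finite T" and f: "\<And>t. t \<in> T ==> f t \<in> S" "\<And>t. t \<in> T ==> f t t \<noteq> \<zero>"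
      "\<And>t \<mu>. t \<in> T ==> f t \<mu> \<noteq> \<zero> ==> t \<le> \<mu>"
    and g: "g \<in> S"
  shows "\<exists>h. (\<forall>t\<in>T. h t \<in> S) \<and>
    (\<forall>\<mu>. (\<exists>t\<in>T. t \<subseteq># \<mu>) \<longrightarrow> set_mset \<mu> \<subseteq> {..<m} \<longrightarrow> (\<Oplus>\<^bsub>S\<^esub>t\<in>T. h t \<otimes>\<^sub>S f t) \<mu> = g \<mu>)"
proof -
  have fK: "f t \<mu> \<in> K" "g \<mu> \<in> K" if "t \<in> T" for t \<mu> using f(1)[OF that] g by (auto simp: S_def)
  define \<tau> where "\<tau> \<mu> = (SOME t. t \<in> T \<and> t \<subseteq># \<mu>)" for \<mu>
  define D where "D = {\<mu>. set_mset \<mu> \<subseteq> {..<m} \<and> (\<exists>t\<in>T. t \<subseteq># \<mu>)}"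
  have \<tau>: "\<tau> \<mu> \<in> T" "\<tau> \<mu> \<subseteq># \<mu>" if "\<mu> \<in> D" for \<mu>
    using someI_ex[of "\<lambda>t. t \<in> T \<and> t \<subseteq># \<mu>"] that unfolding \<tau>_def D_def by auto
  \<comment> \<open>The contribution to the coefficient at \<mu> of the quotient coefficient
    attached to \<nu> + t < \<mu>. \<open>P\<close> adds up these known terms, and \<open>F\<close>
    solves the equation at \<mu> for the one new coefficient.\<close>
  define q where "q c \<mu> t \<nu> = (if \<nu> + t < \<mu> \<and> \<nu> + t \<in> D \<and> \<tau> (\<nu> + t) = t then c (\<nu> + t) \<otimes> f t (\<mu> - \<nu>) else \<zero>)"
    for c \<mu> t \<nu>
  define P where "P c \<mu> = (\<Oplus>t\<in>T. \<Oplus>\<nu>\<in>{\<nu>. \<nu> \<subseteq># \<mu>}. q c \<mu> t \<nu>)" for c \<mu>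
  define F where "F c \<mu> = (if \<mu> \<in> D then inv (f (\<tau> \<mu>) (\<tau> \<mu>)) \<otimes> (g \<mu> \<ominus> P c \<mu>) else \<zero>)" for c \<mu>
  define c where "c = wfrec {(x, y). x < y} F"
  have adm: "adm_wf {(x, y). x < y} F" unfolding adm_wf_def
  proof (intro allI impI)
    fix c c' :: "nat multiset \<Rightarrow> 'k" and \<mu> assume "\<forall>z. (z, \<mu>) \<in> {(x, y). x < y} \<longrightarrow> c z = c' z"
    hence "q c \<mu> = q c' \<mu>" by (auto simp: q_def fun_eq_iff)
    thus "F c \<mu> = F c' \<mu>" by (simp add: F_def P_def)
  qed
  have c: "c \<mu> = F c \<mu>" for \<mu> unfolding c_def by (rule fun_cong[OF wfrec_fixpoint[OF wf adm]])
  have inv: "inv (f t t) \<in> K" "f t t \<otimes> inv (f t t) = \<one>" if "t \<in> T" for t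
    using fK(1)[OF that] f(2)[OF that] by (auto simp: field_Units)
  have qK: "q c \<mu> t \<nu> \<in> K" if "\<And>z. z < \<mu> ==> c z \<in> K" "t \<in> T" for \<mu> t \<nu>
    using that(1) fK(1)[OF that(2)] by (auto simp: q_def)
  have PK: "P c \<mu> \<in> K" if "\<And>z. z < \<mu> ==> c z \<in> K" for \<mu>
    unfolding P_def using qK[OF that] by (intro finsum_closed Pi_I)
  have cK: "c \<mu> \<in> K" for \<mu>
  proof (induction \<mu> rule: less_induct)
    case (less \<mu>)
    thus ?case using PK[OF less] inv(1) \<tau>(1)[of \<mu>] fK(2) by (subst c) (auto simp: F_def)
  qed
  define h where "h t \<nu> = (if \<nu> + t \<in> D \<and> \<tau> (\<nu> + t) = t then c (\<nu> + t) else \<zero>)" for t \<nu>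
  have hS: "h t \<in> S" for t using cK by (auto simp: S_def h_def D_def)
  have "(\<Oplus>\<^bsub>S\<^esub>t\<in>T. h t \<otimes>\<^sub>S f t) \<mu> = g \<mu>" if \<mu>: "\<mu> \<in> D" for \<mu>
  proof -
    define e where "e t \<nu> = (if \<mu> - t = \<nu> then (if \<tau> \<mu> = t then c \<mu> \<otimes> f t t else \<zero>) else \<zero>)" for t \<nu>
    note \<tau>\<mu> = \<tau>[OF \<mu>]
    note qK' = qK[OF cK, of _ \<mu>]
    have eK: "e t \<nu> \<in> K" if "t \<in> T" for t \<nu> using cK fK(1)[OF that] by (simp add: e_def)
    \<comment> \<open>As f t begins at t, a nonzero f t (\<mu> - \<nu>) forces \<nu> + t \<le>
      \<mu>. So each product is either an earlier term q or the new term e, where \<nu> + t =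
      \<mu>.\<close>
    have split: "h t \<nu> \<otimes> f t (\<mu> - \<nu>) = q c \<mu> t \<nu> \<oplus> e t \<nu>" if t: "t \<in> T" and \<nu>: "\<nu> \<subseteq># \<mu>" for t \<nu>
    proof (cases "f t (\<mu> - \<nu>) = \<zero>")
      case True
      have "e t \<nu> = \<zero>"
      proof (cases "\<mu> - t = \<nu> \<and> \<tau> \<mu> = t")
        case eq: True
        hence "\<nu> + t = \<mu>" using \<tau>\<mu>(2) by auto
        hence "\<mu> - \<nu> = t" by auto
        thus ?thesis using True f(2)[OF t] by simp
      qed (auto simp: e_def)
      thus ?thesis using True cK by (simp add: q_def h_def)
    next
      case False
      hence "\<nu> + t \<le> \<nu> + (\<mu> - \<nu>)" using f(3)[OF t] by (intro add_left_mono)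
      hence le: "\<nu> + t \<le> \<mu>" using \<nu> by simp
      show ?thesis
      proof (cases "\<nu> + t = \<mu>")
        case True
        hence "\<mu> - t = \<nu>" "\<mu> - \<nu> = t" by auto
        thus ?thesis using True \<mu> cK fK(1)[OF t] by (simp add: q_def h_def e_def)
      next
        case neq: False
        have "e t \<nu> = \<zero>" using neq \<tau>\<mu>(2) by (auto simp: e_def)
        thus ?thesis using neq le cK fK(1)[OF t] by (simp add: q_def h_def)
      qed
    qed
    have conv: "(h t \<otimes>\<^sub>S f t) \<mu> = (\<Oplus>\<nu>\<in>{\<nu>. \<nu> \<subseteq># \<mu>}. q c \<mu> t \<nu>) \<oplus> (if \<tau> \<mu> = t then c \<mu> \<otimes> f t t else \<zero>)"
      (is "_ = ?Q t \<oplus> ?E t") if t: "t \<in> T" for t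
    proof -
      have "(h t \<otimes>\<^sub>S f t) \<mu> = (\<Oplus>\<nu>\<in>{\<nu>. \<nu> \<subseteq># \<mu>}. h t \<nu> \<otimes> f t (\<mu> - \<nu>))" by (simp add: S_def)
      also have "\<dots> = (\<Oplus>\<nu>\<in>{\<nu>. \<nu> \<subseteq># \<mu>}. q c \<mu> t \<nu> \<oplus> e t \<nu>)"
        using split[OF t] qK'[OF t] eK[OF t] by (intro finsum_cong') auto
      also have "\<dots> = ?Q t \<oplus> (\<Oplus>\<nu>\<in>{\<nu>. \<nu> \<subseteq># \<mu>}. e t \<nu>)" using qK'[OF t] eK[OF t] by (intro finsum_addf) auto
      also have "(\<Oplus>\<nu>\<in>{\<nu>. \<nu> \<subseteq># \<mu>}. e t \<nu>) = ?E t" unfolding e_def using cK fK(1)[OF t]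
        by (intro finsum_singleton[of "\<mu> - t" _ "\<lambda>_. ?E t"] finite_submultisets) auto
      finally show ?thesis .
    qed
    have QK: "?Q t \<in> K" if "t \<in> T" for t using qK'[OF that] by (intro finsum_closed) auto
    have EK: "?E t \<in> K" if "t \<in> T" for t using cK fK(1)[OF that] by simp
    have "(\<Oplus>\<^bsub>S\<^esub>t\<in>T. h t \<otimes>\<^sub>S f t) \<mu> = (\<Oplus>t\<in>T. (h t \<otimes>\<^sub>S f t) \<mu>)" using hS f(1) by (intro S_finsum T) auto
    also have "\<dots> = (\<Oplus>t\<in>T. ?Q t \<oplus> ?E t)" using conv QK EK by (intro finsum_cong') auto
    also have "\<dots> = (\<Oplus>t\<in>T. ?Q t) \<oplus> (\<Oplus>t\<in>T. ?E t)" using QK EK by (intro finsum_addf) auto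
    also have "(\<Oplus>t\<in>T. ?E t) = c \<mu> \<otimes> f (\<tau> \<mu>) (\<tau> \<mu>)"
      using cK fK(1) by (intro finsum_singleton[of "\<tau> \<mu>" _ "\<lambda>t. c \<mu> \<otimes> f t t"] T \<tau>\<mu>(1)) auto
    also have "c \<mu> = inv (f (\<tau> \<mu>) (\<tau> \<mu>)) \<otimes> (g \<mu> \<ominus> P c \<mu>)" using \<mu> by (subst c) (simp add: F_def)
    also have "inv (f (\<tau> \<mu>) (\<tau> \<mu>)) \<otimes> (g \<mu> \<ominus> P c \<mu>) \<otimes> f (\<tau> \<mu>) (\<tau> \<mu>) = g \<mu> \<ominus> P c \<mu>"
      using inv[OF \<tau>\<mu>(1)] fK[OF \<tau>\<mu>(1)] PK[OF cK] by (simp add: m_comm[of "inv _ \<otimes> _"] m_assoc[symmetric])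
    also have "(\<Oplus>t\<in>T. ?Q t) = P c \<mu>" by (simp add: P_def)
    also have "P c \<mu> \<oplus> (g \<mu> \<ominus> P c \<mu>) = g \<mu>"
      using fK[OF \<tau>\<mu>(1)] PK[OF cK] by (simp add: a_minus_def a_lcomm r_neg)
    finally show ?thesis .
  qed
  thus ?thesis using hS unfolding D_def by blast
qed

text \<open>The multiset order is well-founded and compatible with addition, so initial monomials
  exist. By Dickson's lemma those of J are divisible by finitely many among them. After division by
  the corresponding series the remainder lies in J and has coefficient 0 at every multiple of these
  monomials, so it has no initial monomial.\<close>

theorem series_noetherian: "noetherian_ring S"
proof (rule S.noetherian_ringI)
  fix J assume J: "ideal J S"
  note JD = idealD[OF J]
  define ini where "ini f = (LEAST \<mu>. f \<mu> \<noteq> \<zero>)" for f :: "nat multiset \<Rightarrow> 'k"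
  have ini: "f (ini f) \<noteq> \<zero>" "f \<mu> \<noteq> \<zero> ==> ini f \<le> \<mu>" "set_mset (ini f) \<subseteq> {..<m}"
    if "f \<in> S" "f \<noteq> 0\<^sub>S" for f \<mu>
  proof -
    have "\<exists>\<mu>. f \<mu> \<noteq> \<zero>"
    proof (rule ccontr)
      assume "\<not> ?thesis"
      hence "f = 0\<^sub>S" by (auto simp: S_def fun_eq_iff)
      thus False using that(2) by simp
    qed
    thus "f (ini f) \<noteq> \<zero>" unfolding ini_def by (rule LeastI_ex)
    thus "set_mset (ini f) \<subseteq> {..<m}" using that(1) by (auto simp: S_def)
    show "f \<mu> \<noteq> \<zero> ==> ini f \<le> \<mu>" unfolding ini_def by (rule Least_le)
  qed
  have "set_mset (ini f) \<subseteq> {..<m}" if "f \<in> J - {0\<^sub>S}" for f using ini(3)[of f] JD(1) that by blast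
  then obtain B f where B: "finite B" "\<forall>g\<in>J - {0\<^sub>S}. \<exists>b\<in>B. b \<subseteq># ini g"
    and f: "\<forall>b\<in>B. f b \<in> J - {0\<^sub>S} \<and> ini (f b) = b" by (rule dickson_family)
  have fS: "f b \<in> S" "f b b \<noteq> \<zero>" "f b \<mu> \<noteq> \<zero> ==> b \<le> \<mu>" if "b \<in> B" for b \<mu>
    using bspec[OF f that] ini[of "f b"] JD(1) by auto
  have fB: "f ` B \<subseteq> S" using fS by auto
  have "J = genideal S (f ` B)"
  proof
    show "genideal S (f ` B) \<subseteq> J" by (rule S.genideal_minimal[OF J]) (use f in auto)
    have I: "ideal (genideal S (f ` B)) S" by (rule S.genideal_ideal[OF fB])
    show "J \<subseteq> genideal S (f ` B)"
    proof
      fix g assume g: "g \<in> J"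
      obtain h where h: "\<forall>t\<in>B. h t \<in> S"
        "\<forall>\<mu>. (\<exists>t\<in>B. t \<subseteq># \<mu>) \<longrightarrow> set_mset \<mu> \<subseteq> {..<m} \<longrightarrow> (\<Oplus>\<^bsub>S\<^esub>t\<in>B. h t \<otimes>\<^sub>S f t) \<mu> = g \<mu>"
        using series_division[OF B(1) fS JD(1)[OF g]] by blast
      define s where "s = (\<Oplus>\<^bsub>S\<^esub>t\<in>B. h t \<otimes>\<^sub>S f t)"
      have sum: "(\<Oplus>\<^bsub>S\<^esub>t\<in>C. h t \<otimes>\<^sub>S f t) \<in> L"
        if "C \<subseteq> B" "ideal L S" "f ` B \<subseteq> L" for C L using finite_subset[OF that(1) B(1)] that(1)
      proof (induction C rule: finite_induct)
        case (insert t C)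
        have "h t \<otimes>\<^sub>S f t \<in> L" using idealD(6)[OF that(2)] h(1) that(3) insert.prems by auto
        thus ?case using insert h(1) fS(1) idealD(3)[OF that(2)] by (subst S.finsum_insert) auto
      qed (use idealD(2)[OF that(2)] in simp)
      have sJ: "s \<in> J" and sI: "s \<in> genideal S (f ` B)"
        unfolding s_def using sum[OF subset_refl J] sum[OF subset_refl I S.genideal_self[OF fB]] f by auto
      have "g -\<^sub>S s = 0\<^sub>S"
      proof (rule ccontr)
        assume r: "g -\<^sub>S s \<noteq> 0\<^sub>S"
        let ?\<mu> = "ini (g -\<^sub>S s)"
        have rJ: "g -\<^sub>S s \<in> J" by (rule JD(5)[OF g sJ])
        note i = ini[OF JD(1)[OF rJ] r]
        have "s ?\<mu> = g ?\<mu>" using h(2) B(2) i(3) rJ r unfolding s_def by blast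
        hence "(g -\<^sub>S s) ?\<mu> = \<zero>"
          using S_minus[OF JD(1)[OF g] JD(1)[OF sJ]] JD(1)[OF g] by (simp add: S_def a_minus_def r_neg)
        thus False using i(1) by simp
      qed
      hence "g = s" using JD(1)[OF g] JD(1)[OF sJ] by simp
      thus "g \<in> genideal S (f ` B)" using sI by simp
    qed
  qed
  thus "\<exists>A\<subseteq>S. finite A \<and> J = genideal S A" using fB B(1) by blast
qed

text \<open>Division of 1 by f alone. The initial monomial of f is the empty multiset, which divides
  every monomial, so the division is exact.\<close>

lemma series_right_inverse:
  assumes f: "f \<in> S" "f {#} \<noteq> \<zero>"
  shows "\<exists>h\<in>S. h \<otimes>\<^sub>S f = \<one>\<^sub>S"
proof -
  obtain h where h: "\<forall>t\<in>{{#}}. h t \<in> S"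
    "\<forall>\<mu>. (\<exists>t\<in>{{#}}. t \<subseteq># \<mu>) \<longrightarrow> set_mset \<mu> \<subseteq> {..<m} \<longrightarrow> (\<Oplus>\<^bsub>S\<^esub>t\<in>{{#}}. h t \<otimes>\<^sub>S f) \<mu> = \<one>\<^sub>S \<mu>"
    using series_division[of "{{#}}" "\<lambda>_. f" "\<one>\<^sub>S"] f by auto
  have hf: "h {#} \<otimes>\<^sub>S f \<in> S" using h(1) f(1) by simp
  hence "(\<Oplus>\<^bsub>S\<^esub>t\<in>{{#}}. h t \<otimes>\<^sub>S f) = h {#} \<otimes>\<^sub>S f" by simp
  hence eq: "(h {#} \<otimes>\<^sub>S f) \<mu> = \<one>\<^sub>S \<mu>" if "set_mset \<mu> \<subseteq> {..<m}" for \<mu> using h(2) that by simp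
  have "(h {#} \<otimes>\<^sub>S f) \<mu> = \<one>\<^sub>S \<mu>" for \<mu>
  proof (cases "set_mset \<mu> \<subseteq> {..<m}")
    case False
    thus ?thesis using hf S.one_closed unfolding S_def power_series_ring_simps(1) by simp
  qed (rule eq)
  thus ?thesis using h(1) by (auto simp: fun_eq_iff)
qed

end

section \<open>Polynomial rings\<close>

locale poly_ring = field K for K :: "'k ring" (structure) +
  fixes m :: nat and A :: "(nat multiset \<Rightarrow> 'k) ring"
  defines "A \<equiv> polynomial_ring K m"
  assumes ring_A: "ring A"
begin

sublocale A: ring A by (rule ring_A)

lemma A_simps [simp]:
  "(f \<otimes>\<^sub>A g) \<mu> = (\<Oplus>\<nu>\<in>{\<nu>. \<nu> \<subseteq># \<mu>}. f \<nu> \<otimes> g (\<mu> - \<nu>))" "0\<^sub>A \<mu> = \<zero>"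
  "(f +\<^sub>A g) \<mu> = f \<mu> \<oplus> g \<mu>"
  by (simp_all add: A_def polynomial_ring_def power_series_ring_def indexed_const_def indexed_padd_def)

lemma A_carrier: "carrier A = indexed_pset {..<m} (carrier K)" by (simp add: A_def polynomial_ring_def)

lemma A_closed:
  assumes "f \<in> A"
  shows "f \<mu> \<in> K" "\<not> set_mset \<mu> \<subseteq> {..<m} ==> f \<mu> = \<zero>" "finite {\<mu>. f \<mu> \<noteq> \<zero>}"
proof -
  have "(\<forall>\<mu>. f \<mu> \<in> K \<and> (\<not> set_mset \<mu> \<subseteq> {..<m} \<longrightarrow> f \<mu> = \<zero>)) \<and> finite {\<mu>. f \<mu> \<noteq> \<zero>}" using assms unfolding A_carrier
  proof (induction rule: indexed_pset.induct)
    case (indexed_const k)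
    have "{\<mu>. (indexed_const k :: nat multiset \<Rightarrow> 'k) \<mu> \<noteq> \<zero>} \<subseteq> {{#}}" by (auto simp: indexed_const_def)
    thus ?case using indexed_const by (auto simp: indexed_const_def dest: finite_subset)
  next
    case (indexed_padd P Q)
    have "{\<mu>. indexed_padd P Q \<mu> \<noteq> \<zero>} \<subseteq> {\<mu>. P \<mu> \<noteq> \<zero>} \<union> {\<mu>. Q \<mu> \<noteq> \<zero>}"
      using indexed_padd by (auto simp: indexed_padd_def)
    thus ?case using indexed_padd by (auto simp: indexed_padd_def dest: finite_subset)
  next
    case (indexed_pmult P i)
    have "{\<mu>. indexed_pmult P i \<mu> \<noteq> \<zero>} \<subseteq> add_mset i ` {\<mu>. P \<mu> \<noteq> \<zero>}"
      by (auto simp: indexed_pmult_def image_iff split: if_splits intro!: exI[of _ "_ - {#i#}"])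
    hence "finite {\<mu>. indexed_pmult P i \<mu> \<noteq> \<zero>}" using indexed_pmult.IH finite_surj by blast
    moreover have "indexed_pmult P i \<mu> = \<zero>" if n: "\<not> set_mset \<mu> \<subseteq> {..<m}" for \<mu>
    proof (cases "i \<in># \<mu>")
      case True
      then obtain \<nu> where "\<mu> = add_mset i \<nu>" by (blast dest: multi_member_split)
      thus ?thesis using n indexed_pmult by (simp add: indexed_pmult_def)
    qed (simp add: indexed_pmult_def)
    moreover have "indexed_pmult P i \<mu> \<in> K" for \<mu> using indexed_pmult.IH by (simp add: indexed_pmult_def)
    ultimately show ?case by blast
  qed
  thus "f \<mu> \<in> K" "\<not> set_mset \<mu> \<subseteq> {..<m} ==> f \<mu> = \<zero>" "finite {\<mu>. f \<mu> \<noteq> \<zero>}" by auto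
qed

lemma monomial_closed: "a \<in> K ==> set_mset \<nu> \<subseteq> {..<m} ==> (\<lambda>\<mu>. if \<mu> = \<nu> then a else \<zero>) \<in> A"
proof (induction \<nu>)
  case empty
  thus ?case using indexed_pset.indexed_const[of a "carrier K" "{..<m}"] by (simp add: A_carrier indexed_const_def)
next
  case (add i \<nu>)
  have "indexed_pmult (\<lambda>\<mu>. if \<mu> = \<nu> then a else \<zero>) i \<in> A"
    using add indexed_pset.indexed_pmult[of _ "{..<m}" "carrier K" i] by (simp add: A_carrier)
  moreover have "indexed_pmult (\<lambda>\<mu>. if \<mu> = \<nu> then a else \<zero>) i = (\<lambda>\<mu>. if \<mu> = add_mset i \<nu> then a else \<zero>)"
    by (auto simp: indexed_pmult_def fun_eq_iff dest!: multi_member_split)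
  ultimately show ?case by simp
qed

lemma monomial_mult:
  assumes a: "a \<in> K" and f: "f \<in> A"
  shows "((\<lambda>\<mu>. if \<mu> = \<nu> then a else \<zero>) \<otimes>\<^sub>A f) \<mu> = (if \<nu> \<subseteq># \<mu> then a \<otimes> f (\<mu> - \<nu>) else \<zero>)"
proof -
  have "((\<lambda>\<mu>. if \<mu> = \<nu> then a else \<zero>) \<otimes>\<^sub>A f) \<mu> = (\<Oplus>\<kappa>\<in>{\<kappa>. \<kappa> \<subseteq># \<mu>}. if \<nu> = \<kappa> then a \<otimes> f (\<mu> - \<kappa>) else \<zero>)"
    using a A_closed(1)[OF f] by (auto intro!: finsum_cong')
  also have "\<dots> = (if \<nu> \<subseteq># \<mu> then a \<otimes> f (\<mu> - \<nu>) else \<zero>)"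
  proof (cases "\<nu> \<subseteq># \<mu>")
    case True
    thus ?thesis using a A_closed(1)[OF f] finsum_singleton[of \<nu> "{\<kappa>. \<kappa> \<subseteq># \<mu>}" "\<lambda>\<kappa>. a \<otimes> f (\<mu> - \<kappa>)"]
      by (simp add: finite_submultisets)
  next
    case False
    hence "(\<Oplus>\<kappa>\<in>{\<kappa>. \<kappa> \<subseteq># \<mu>}. if \<nu> = \<kappa> then a \<otimes> f (\<mu> - \<kappa>) else \<zero>) = (\<Oplus>\<kappa>\<in>{\<kappa>. \<kappa> \<subseteq># \<mu>}. \<zero>)"
      by (intro finsum_cong') auto
    thus ?thesis using False by simp
  qed
  finally show ?thesis .
qed

text \<open>Leading monomials replace initial ones: the support is finite, and cancelling the
  leading term by a multiple of some f b lowers the leading monomial, which the well-founded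
  multiset order allows only finitely often.\<close>

theorem poly_noetherian: "noetherian_ring A"
proof (rule A.noetherian_ringI)
  fix J assume J: "ideal J A"
  note JD = idealD[OF J]
  define lead where "lead f = Max {\<mu>. f \<mu> \<noteq> \<zero>}" for f :: "nat multiset \<Rightarrow> 'k"
  have lead: "f (lead f) \<noteq> \<zero>" "f \<mu> \<noteq> \<zero> ==> \<mu> \<le> lead f" "set_mset (lead f) \<subseteq> {..<m}"
    if f: "f \<in> A" "f \<noteq> 0\<^sub>A" for f \<mu>
  proof -
    note fin = A_closed(3)[OF f(1)]
    have "{\<mu>. f \<mu> \<noteq> \<zero>} \<noteq> {}"
    proof
      assume "{\<mu>. f \<mu> \<noteq> \<zero>} = {}"
      hence "f = 0\<^sub>A" by (auto simp: fun_eq_iff)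
      thus False using f(2) by simp
    qed
    from Max_in[OF fin this] show "f (lead f) \<noteq> \<zero>" by (simp add: lead_def)
    thus "set_mset (lead f) \<subseteq> {..<m}" using A_closed(2)[OF f(1)] by auto
    show "f \<mu> \<noteq> \<zero> ==> \<mu> \<le> lead f" unfolding lead_def using fin by simp
  qed
  have "set_mset (lead f) \<subseteq> {..<m}" if "f \<in> J - {0\<^sub>A}" for f using lead(3)[of f] JD(1) that by blast
  then obtain B f where B: "finite B" "\<forall>g\<in>J - {0\<^sub>A}. \<exists>b\<in>B. b \<subseteq># lead g"
    and f: "\<forall>b\<in>B. f b \<in> J - {0\<^sub>A} \<and> lead (f b) = b" by (rule dickson_family)
  have fA: "f b \<in> A" "f b b \<noteq> \<zero>" "f b \<mu> \<noteq> \<zero> ==> \<mu> \<le> b" if "b \<in> B" for b \<mu>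
    using bspec[OF f that] lead[of "f b"] JD(1) by auto
  have fB: "f ` B \<subseteq> A" using fA by auto
  note I = idealD[OF A.genideal_ideal[OF fB]]
  have "g \<in> genideal A (f ` B)" if "g \<in> J" for g using that
  proof (induction "lead g" arbitrary: g rule: less_induct)
    case less
    note gA = JD(1)[OF less.prems]
    show ?case
    proof (cases "g = 0\<^sub>A")
      case False
      note l = lead[OF gA False]
      obtain b where b: "b \<in> B" "b \<subseteq># lead g" using B(2) less.prems False by blast
      define \<nu> where "\<nu> = lead g - b"
      have \<nu>: "lead g = \<nu> + b" using b(2) by (simp add: \<nu>_def)
      define a where "a = g (lead g) \<otimes> inv (f b b)"
      have bK: "f b b \<in> Units K" using fA(2)[OF b(1)] A_closed(1)[OF fA(1)[OF b(1)]] by (simp add: field_Units)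
      have aK: "a \<in> K" using bK A_closed(1)[OF gA] by (simp add: a_def)
      define p where "p = (\<lambda>\<mu>. if \<mu> = \<nu> then a else \<zero>)"
      have pA: "p \<in> A" unfolding p_def using l(3) \<nu> by (intro monomial_closed[OF aK]) auto
      define r where "r = g -\<^sub>A p \<otimes>\<^sub>A f b"
      have pJ: "p \<otimes>\<^sub>A f b \<in> J" using JD(6)[OF pA] f b(1) by blast
      have rJ: "r \<in> J" unfolding r_def by (rule JD(5)[OF less.prems pJ])
      have r: "r \<mu> = g \<mu> \<ominus> (if \<nu> \<subseteq># \<mu> then a \<otimes> f b (\<mu> - \<nu>) else \<zero>)" for \<mu>
      proof -
        have "r \<mu> = g \<mu> \<ominus> (p \<otimes>\<^sub>A f b) \<mu>" unfolding r_def
          by (rule coefficient_minus[OF ring_A]) (fact A_closed A_simps gA JD(1)[OF pJ])+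
        thus ?thesis unfolding p_def monomial_mult[OF aK fA(1)[OF b(1)]] .
      qed
      have "r \<in> genideal A (f ` B)"
      proof (cases "r = 0\<^sub>A")
        case rn: False
        have "lead r \<noteq> lead g"
        proof
          assume "lead r = lead g"
          moreover have "r (lead g) = \<zero>"
            using r[of "lead g"] bK A_closed(1)[OF gA] by (simp add: \<nu> a_def m_assoc a_minus_def r_neg Units_closed)
          ultimately show False using lead(1)[OF JD(1)[OF rJ] rn] by simp
        qed
        moreover have "lead r \<le> lead g"
        proof (cases "g (lead r) = \<zero>")
          case True
          hence "\<nu> \<subseteq># lead r" "f b (lead r - \<nu>) \<noteq> \<zero>"
            using lead(1)[OF JD(1)[OF rJ] rn] r[of "lead r"] aK by (auto simp: a_minus_def split: if_splits)
          hence "\<nu> + (lead r - \<nu>) \<le> \<nu> + b" using fA(3)[OF b(1)] by (intro add_left_mono)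
          thus ?thesis using \<open>\<nu> \<subseteq># lead r\<close> \<nu> by simp
        qed (rule l(2))
        ultimately show ?thesis using less.hyps[OF _ rJ] by simp
      qed (use I(2) in simp)
      moreover have "p \<otimes>\<^sub>A f b \<in> genideal A (f ` B)" using I(6)[OF pA] A.genideal_self[OF fB] b(1) by blast
      ultimately have "r +\<^sub>A p \<otimes>\<^sub>A f b \<in> genideal A (f ` B)" by (rule I(3))
      moreover have "r +\<^sub>A p \<otimes>\<^sub>A f b = g"
        using gA JD(1)[OF pJ] by (simp add: r_def a_minus_def A.a_assoc A.l_neg)
      ultimately show ?thesis by simp
    qed (use I(2) in simp)
  qed
  moreover have "genideal A (f ` B) \<subseteq> J" by (rule A.genideal_minimal[OF J]) (use f in auto)
  ultimately show "\<exists>C\<subseteq>A. finite C \<and> J = genideal A C" using fB B(1) by (intro exI[of _ "f ` B"]) auto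
qed

end

section \<open>Localizations and quotients\<close>

text \<open>The operations of \<open>localization\<close> are unions over all representatives; if
  the members of such a union coincide, they are its value.\<close>

lemma UN_const_pairs:
  assumes "p \<in> U" "q \<in> V" "\<And>a s b t. (a, s) \<in> U ==> (b, t) \<in> V ==> F a s b t = Z"
  shows "(\<Union>(a, s)\<in>U. \<Union>(b, t)\<in>V. F a s b t) = Z"
proof -
  have F: "(case y of (a, s) \<Rightarrow> case z of (b, t) \<Rightarrow> F a s b t) = Z" if "y \<in> U" "z \<in> V" for y z
    using assms(3) that by (cases y; cases z) simp
  have "(\<Union>(a, s)\<in>U. \<Union>(b, t)\<in>V. F a s b t) = (\<Union>y\<in>U. \<Union>z\<in>V. case y of (a, s) \<Rightarrow> case z of (b, t) \<Rightarrow> F a s b t)"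
    by (simp add: case_prod_beta)
  also have "\<dots> = (\<Union>y\<in>U. \<Union>z\<in>V. Z)" by (simp add: F)
  also have "\<dots> = Z" using assms(1,2) by auto
  finally show ?thesis .
qed

locale prime_localization = cring A + primeideal Q A
  for A :: "('a, 'x) ring_scheme" (structure) and Q :: "'a set"
begin

abbreviation "M \<equiv> carrier A - Q"
abbreviation "L \<equiv> localization A Q"
abbreviation "frc \<equiv> fraction A Q"

lemma M: "s \<in> M ==> s \<in> A" "s \<in> M ==> t \<in> M ==> s \<otimes> t \<in> M" "\<one> \<in> M"
  using I_prime I_notcarr one_imp_carrier by auto

lemma mem_frc:
  assumes "a \<in> A" "s \<in> M"
  shows "(b, t) \<in> frc a s \<longleftrightarrow> b \<in> A \<and> t \<in> M \<and> (\<exists>u\<in>M. u \<otimes> (a \<otimes> t) = u \<otimes> (b \<otimes> s))"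
proof -
  have "u \<otimes> (a \<otimes> t \<ominus> b \<otimes> s) = \<zero> \<longleftrightarrow> u \<otimes> (a \<otimes> t) = u \<otimes> (b \<otimes> s)"
    if "b \<in> A" "t \<in> M" "u \<in> M" for u
  proof -
    have c: "u \<in> A" "a \<otimes> t \<in> A" "b \<otimes> s \<in> A" using that assms M(1) by auto
    have "u \<otimes> (a \<otimes> t \<ominus> b \<otimes> s) = u \<otimes> (a \<otimes> t) \<ominus> u \<otimes> (b \<otimes> s)" using c by (simp add: a_minus_def r_distr r_minus)
    thus ?thesis using c by simp
  qed
  thus ?thesis unfolding fraction_def by auto
qed

lemma frc_self: "a \<in> A ==> s \<in> M ==> (a, s) \<in> frc a s" using M(3) by (subst mem_frc) auto

lemma frc_eqI:
  assumes a: "a \<in> A" "s \<in> M" and b: "(b, t) \<in> frc a s"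
  shows "frc b t = frc a s"
proof -
  obtain u where u: "b \<in> A" "t \<in> M" "u \<in> M" "u \<otimes> (a \<otimes> t) = u \<otimes> (b \<otimes> s)" using b mem_frc[OF a] by auto
  have trans: "\<exists>w\<in>M. w \<otimes> (a \<otimes> r) = w \<otimes> (c \<otimes> s)"
    if "a \<in> A" "b \<in> A" "c \<in> A" "s \<in> M" "t \<in> M" "r \<in> M" "u \<in> M" "v \<in> M"
      and e: "u \<otimes> (a \<otimes> t) = u \<otimes> (b \<otimes> s)" "v \<otimes> (b \<otimes> r) = v \<otimes> (c \<otimes> t)" for a b c s t r u v
  \<comment> \<open>Besides the two given factors u and v, the middle denominator t has to be
    cleared.\<close>
  proof (rule bexI[of _ "u \<otimes> v \<otimes> t"])
    note cc = that(1-3) that(4-8)[THEN M(1)]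
    have "(u \<otimes> v \<otimes> t) \<otimes> (a \<otimes> r) = (v \<otimes> r) \<otimes> (u \<otimes> (a \<otimes> t))" using cc by (simp add: m_ac)
    also have "\<dots> = (u \<otimes> s) \<otimes> (v \<otimes> (b \<otimes> r))" unfolding e(1) using cc by (simp add: m_ac)
    also have "\<dots> = (u \<otimes> v \<otimes> t) \<otimes> (c \<otimes> s)" unfolding e(2) using cc by (simp add: m_ac)
    finally show "(u \<otimes> v \<otimes> t) \<otimes> (a \<otimes> r) = (u \<otimes> v \<otimes> t) \<otimes> (c \<otimes> s)" .
    show "u \<otimes> v \<otimes> t \<in> M" using M(2) that by blast
  qed
  have "(c, r) \<in> frc b t \<longleftrightarrow> (c, r) \<in> frc a s" for c r
  proof
    assume "(c, r) \<in> frc b t"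
    then obtain v where "c \<in> A" "r \<in> M" "v \<in> M" "v \<otimes> (b \<otimes> r) = v \<otimes> (c \<otimes> t)" using mem_frc[OF u(1,2)] by auto
    thus "(c, r) \<in> frc a s" unfolding mem_frc[OF a] using trans[OF a(1) u(1) _ a(2) u(2) _ u(3) _ u(4)] by blast
  next
    assume "(c, r) \<in> frc a s"
    then obtain v where "c \<in> A" "r \<in> M" "v \<in> M" "v \<otimes> (a \<otimes> r) = v \<otimes> (c \<otimes> s)" using mem_frc[OF a] by auto
    thus "(c, r) \<in> frc b t" unfolding mem_frc[OF u(1,2)] using trans[OF u(1) a(1) _ u(2) a(2) _ u(3) _ u(4)[symmetric]] by blast
  qed
  thus ?thesis by auto
qed

lemma frc_eq:
  assumes "a \<in> A" "s \<in> M" "b \<in> A" "t \<in> M" "u \<in> M" "u \<otimes> (a \<otimes> t) = u \<otimes> (b \<otimes> s)"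
  shows "frc b t = frc a s" using assms by (intro frc_eqI) (auto simp: mem_frc)

lemma frc_ops:
  assumes a: "a \<in> A" "s \<in> M" and b: "b \<in> A" "t \<in> M"
  shows "frc a s \<otimes>\<^sub>L frc b t = frc (a \<otimes> b) (s \<otimes> t)"
    and "frc a s +\<^sub>L frc b t = frc (a \<otimes> t \<oplus> b \<otimes> s) (s \<otimes> t)"
proof -
  have "frc (a' \<otimes> b') (s' \<otimes> t') = frc (a \<otimes> b) (s \<otimes> t) \<and>
      frc (a' \<otimes> t' \<oplus> b' \<otimes> s') (s' \<otimes> t') = frc (a \<otimes> t \<oplus> b \<otimes> s) (s \<otimes> t)"
    if p: "(a', s') \<in> frc a s" "(b', t') \<in> frc b t" for a' s' b' t'
  proof -
    obtain u v where u: "a' \<in> A" "s' \<in> M" "u \<in> M" "u \<otimes> (a \<otimes> s') = u \<otimes> (a' \<otimes> s)"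
      and v: "b' \<in> A" "t' \<in> M" "v \<in> M" "v \<otimes> (b \<otimes> t') = v \<otimes> (b' \<otimes> t)" using p mem_frc[OF a] mem_frc[OF b] by auto
    note cc = a(1) M(1)[OF a(2)] b(1) M(1)[OF b(2)] u(1) M(1)[OF u(2)] M(1)[OF u(3)] v(1) M(1)[OF v(2)] M(1)[OF v(3)]
    have "(u \<otimes> v) \<otimes> ((a \<otimes> b) \<otimes> (s' \<otimes> t')) = (u \<otimes> (a \<otimes> s')) \<otimes> (v \<otimes> (b \<otimes> t'))" using cc by (simp add: m_ac)
    also have "\<dots> = (u \<otimes> v) \<otimes> ((a' \<otimes> b') \<otimes> (s \<otimes> t))" unfolding u(4) v(4) using cc by (simp add: m_ac)
    finally have 1: "(u \<otimes> v) \<otimes> ((a \<otimes> b) \<otimes> (s' \<otimes> t')) = (u \<otimes> v) \<otimes> ((a' \<otimes> b') \<otimes> (s \<otimes> t))" .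
    have "(u \<otimes> v) \<otimes> ((a \<otimes> t \<oplus> b \<otimes> s) \<otimes> (s' \<otimes> t'))
        = (v \<otimes> (t \<otimes> t')) \<otimes> (u \<otimes> (a \<otimes> s')) \<oplus> (u \<otimes> (s \<otimes> s')) \<otimes> (v \<otimes> (b \<otimes> t'))"
      using cc by (simp add: l_distr r_distr m_ac)
    also have "\<dots> = (u \<otimes> v) \<otimes> ((a' \<otimes> t' \<oplus> b' \<otimes> s') \<otimes> (s \<otimes> t))"
      unfolding u(4) v(4) using cc by (simp add: l_distr r_distr m_ac)
    finally have 2: "(u \<otimes> v) \<otimes> ((a \<otimes> t \<oplus> b \<otimes> s) \<otimes> (s' \<otimes> t')) = (u \<otimes> v) \<otimes> ((a' \<otimes> t' \<oplus> b' \<otimes> s') \<otimes> (s \<otimes> t))" .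
    show ?thesis using frc_eq[OF _ _ _ _ _ 1] frc_eq[OF _ _ _ _ _ 2] M(2) a(2) b(2) u(2,3) v(2,3) cc by simp
  qed
  note same = this
  show "frc a s \<otimes>\<^sub>L frc b t = frc (a \<otimes> b) (s \<otimes> t)"
    unfolding localization_def by simp (rule UN_const_pairs[OF frc_self[OF a] frc_self[OF b] same[THEN conjunct1]])
  show "frc a s +\<^sub>L frc b t = frc (a \<otimes> t \<oplus> b \<otimes> s) (s \<otimes> t)"
    unfolding localization_def by simp (rule UN_const_pairs[OF frc_self[OF a] frc_self[OF b] same[THEN conjunct2]])
qed

lemma frc_closed: "a \<in> A ==> s \<in> M ==> frc a s \<in> L" by (auto simp: localization_def)

lemma frc_ring_hom: "(\<lambda>a. frc a \<one>) \<in> ring_hom A L"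
proof (rule ring_hom_memI)
  show "frc \<one> \<one> = \<one>\<^sub>L" by (simp add: localization_def)
  show "frc (a \<otimes> b) \<one> = frc a \<one> \<otimes>\<^sub>L frc b \<one>" if "a \<in> A" "b \<in> A" for a b
    using frc_ops(1)[OF that(1) M(3) that(2) M(3)] by simp
  show "frc (a \<oplus> b) \<one> = frc a \<one> +\<^sub>L frc b \<one>" if "a \<in> A" "b \<in> A" for a b
    using frc_ops(2)[OF that(1) M(3) that(2) M(3)] that by simp
qed (rule frc_closed[OF _ M(3)])

lemma frc_cancel:
  assumes "a \<in> A" "s \<in> M"
  shows "frc a s \<otimes>\<^sub>L frc s \<one> = frc a \<one>" "frc \<one> s \<otimes>\<^sub>L frc s \<one> = \<one>\<^sub>L"
proof -
  have "frc a s \<otimes>\<^sub>L frc s \<one> = frc a \<one>" if "a \<in> A" for a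
  proof -
    have "frc a s \<otimes>\<^sub>L frc s \<one> = frc (a \<otimes> s) (s \<otimes> \<one>)" by (rule frc_ops(1)) (use that assms M in auto)
    also have "\<dots> = frc a \<one>"
      using that M(1)[OF assms(2)] assms(2) M(3) by (intro frc_eq[of _ _ _ _ \<one>]) (auto simp: m_ac)
    finally show ?thesis .
  qed
  thus "frc a s \<otimes>\<^sub>L frc s \<one> = frc a \<one>" "frc \<one> s \<otimes>\<^sub>L frc s \<one> = \<one>\<^sub>L"
    using assms(1) by (auto simp: localization_def)
qed

end

text \<open>Serves both cases: A with Q is the polynomial ring with the given prime, or the power
  series ring with the series of constant term 0, where all denominators may be taken to be 1. Both
  properties pass from A to R in one stage, along the composite of localization and projection
  modulo I.\<close>

lemma (in cring) local_noetherian_of_fractions: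
  fixes A :: "('c, 'y) ring_scheme"
  assumes A: "noetherian_ring A" and \<chi>: "\<chi> \<in> ring_hom A R" and one: "\<one> \<noteq> \<zero>"
    and Q: "ideal Q A" "\<one>\<^sub>A \<notin> Q" "\<And>s t. s \<in> carrier A - Q ==> t \<in> carrier A - Q ==> s \<otimes>\<^sub>A t \<notin> Q"
    and unit: "\<And>s. s \<in> carrier A - Q ==> \<exists>r\<in>carrier R. r \<otimes> \<chi> s = \<one>"
    and frc: "\<And>r. r \<in> carrier R ==> \<exists>a\<in>carrier A. \<exists>s\<in>carrier A - Q. r \<otimes> \<chi> s = \<chi> a"
  shows "\<exists>\<mm>. local_noetherian R \<mm>"
proof -
  interpret A: noetherian_ring A by (rule A)
  note \<chi>D = ring_hom_memE[OF \<chi>] and QD = idealD[OF Q(1)]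
  have \<chi>0: "\<chi> 0\<^sub>A = \<zero>" by (rule ring_hom_zero[OF \<chi> A.ring_axioms ring_axioms])
  have U: "\<chi> s \<in> Units R" if s: "s \<in> carrier A - Q" for s
  proof -
    obtain r where "r \<in> carrier R" "r \<otimes> \<chi> s = \<one>" using unit[OF s] by blast
    thus ?thesis using s \<chi>D(1) m_comm[of r "\<chi> s"] by (auto simp: Units_def)
  qed
  have \<chi>m: "\<chi> (a -\<^sub>A b) = \<chi> a \<ominus> \<chi> b" if "a \<in> carrier A" "b \<in> carrier A" for a b
  proof -
    have "\<chi> (a -\<^sub>A b) \<oplus> \<chi> b = \<chi> a" using \<chi>D(3)[of "a -\<^sub>A b" b] that by (simp add: a_minus_def A.a_assoc A.l_neg)
    thus ?thesis using \<chi>D(1) that A.minus_closed by (metis a_minus_def a_assoc r_neg r_zero a_inv_closed)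
  qed
  define \<mm> where "\<mm> = {r \<in> carrier R. \<exists>a\<in>Q. \<exists>s\<in>carrier A - Q. r \<otimes> \<chi> s = \<chi> a}"
  have "local_noetherian R \<mm>"
  proof (intro local_noetherian.intro local_noetherian_axioms.intro)
    show "cring R" by (rule is_cring)
    show "noetherian_ring R"
    proof (rule noetherian_ringI)
      fix J assume J: "ideal J R"
      note JD = idealD[OF J]
      have vimage: "ideal {a \<in> carrier A. \<chi> a \<in> L} A" if "ideal L R" for L
        using idealD[OF that] \<chi>D \<chi>0 \<chi>m[of "0\<^sub>A"]
        by (intro A.abelian_group_axioms idealI A.ring_axioms A.add.subgroupI) (auto simp: a_minus_def)
      \<comment> \<open>Generators of the preimage of J in A also generate J, because denominators
        become units in R.\<close>
      obtain B where B: "B \<subseteq> carrier A" "finite B" "{a \<in> carrier A. \<chi> a \<in> J} = genideal A B"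
        using A.finetely_gen[OF vimage[OF J]] by blast
      have \<chi>B: "\<chi> ` B \<subseteq> carrier R" using B(1) \<chi>D(1) by auto
      note I = genideal_ideal[OF \<chi>B]
      have "J \<subseteq> Idl (\<chi> ` B)"
      proof
        fix r assume r: "r \<in> J"
        note rR = JD(1)[OF r]
        obtain a s where as: "a \<in> carrier A" "s \<in> carrier A - Q" "r \<otimes> \<chi> s = \<chi> a" using frc[OF rR] by blast
        note s = U[OF as(2)]
        have "\<chi> a \<in> J" using JD(7)[OF Units_closed[OF s] r] as(3) by simp
        hence "a \<in> genideal A B" using B(3) as(1) by blast
        also have "genideal A B \<subseteq> {a \<in> carrier A. \<chi> a \<in> Idl (\<chi> ` B)}"
          by (rule A.genideal_minimal[OF vimage[OF I]]) (use B(1) genideal_self[OF \<chi>B] in auto)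
        finally have "\<chi> a \<otimes> inv (\<chi> s) \<in> Idl (\<chi> ` B)" using idealD(7)[OF I] s by auto
        moreover have "\<chi> a \<otimes> inv (\<chi> s) = r" unfolding as(3)[symmetric] using rR s by (simp add: m_assoc Units_closed)
        ultimately show "r \<in> Idl (\<chi> ` B)" by simp
      qed
      moreover have "Idl (\<chi> ` B) \<subseteq> J"
        by (rule genideal_minimal[OF J]) (use A.genideal_self[OF B(1)] B(3) in auto)
      ultimately show "\<exists>C\<subseteq>carrier R. finite C \<and> J = Idl C" using \<chi>B B(2) by (intro exI[of _ "\<chi> ` B"]) auto
    qed
    show "ideal \<mm> R"
    proof (rule cring_idealI)
      show "\<zero> \<in> \<mm>" unfolding \<mm>_def using QD(2) Q(2) \<chi>0 \<chi>D(1,4)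
        by (intro CollectI conjI bexI[of _ "0\<^sub>A"] bexI[of _ "\<one>\<^sub>A"]) auto
    next
      fix r r' assume "r \<in> \<mm>" "r' \<in> \<mm>"
      then obtain a s b t where as: "r \<in> carrier R" "a \<in> Q" "s \<in> carrier A - Q" "r \<otimes> \<chi> s = \<chi> a"
        and bt: "r' \<in> carrier R" "b \<in> Q" "t \<in> carrier A - Q" "r' \<otimes> \<chi> t = \<chi> b" unfolding \<mm>_def by blast
      have c: "a \<in> carrier A" "s \<in> carrier A" "b \<in> carrier A" "t \<in> carrier A" using as bt QD(1) by auto
      note \<chi>c = c[THEN \<chi>D(1)]
      have "(r \<oplus> r') \<otimes> (\<chi> s \<otimes> \<chi> t) = (r \<otimes> \<chi> s) \<otimes> \<chi> t \<oplus> (r' \<otimes> \<chi> t) \<otimes> \<chi> s"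
        using as(1) bt(1) \<chi>c l_distr[of r r' "\<chi> s \<otimes> \<chi> t"] by (simp add: m_ac)
      also have "\<dots> = \<chi> (a \<otimes>\<^sub>A t +\<^sub>A b \<otimes>\<^sub>A s)" unfolding as(4) bt(4) using c by (simp add: \<chi>D(2,3))
      finally have "(r \<oplus> r') \<otimes> \<chi> (s \<otimes>\<^sub>A t) = \<chi> (a \<otimes>\<^sub>A t +\<^sub>A b \<otimes>\<^sub>A s)" using c by (simp add: \<chi>D(2))
      moreover have "a \<otimes>\<^sub>A t +\<^sub>A b \<otimes>\<^sub>A s \<in> Q" using QD(3,7) as(2) bt(2) c by blast
      moreover have "s \<otimes>\<^sub>A t \<in> carrier A - Q" using Q(3)[OF as(3) bt(3)] c by simp
      ultimately show "r \<oplus> r' \<in> \<mm>" unfolding \<mm>_def using as(1) bt(1) by blast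
    next
      fix r r' assume r: "r \<in> carrier R" "r' \<in> \<mm>"
      then obtain b t where bt: "r' \<in> carrier R" "b \<in> Q" "t \<in> carrier A - Q" "r' \<otimes> \<chi> t = \<chi> b" unfolding \<mm>_def by blast
      obtain a s where as: "a \<in> carrier A" "s \<in> carrier A - Q" "r \<otimes> \<chi> s = \<chi> a" using frc[OF r(1)] by blast
      have c: "s \<in> carrier A" "b \<in> carrier A" "t \<in> carrier A" using as bt QD(1) by auto
      note \<chi>c = c[THEN \<chi>D(1)]
      have "(r \<otimes> r') \<otimes> (\<chi> s \<otimes> \<chi> t) = (r \<otimes> \<chi> s) \<otimes> (r' \<otimes> \<chi> t)" using r(1) bt(1) \<chi>c by (simp add: m_ac)
      hence "(r \<otimes> r') \<otimes> \<chi> (s \<otimes>\<^sub>A t) = \<chi> (a \<otimes>\<^sub>A b)" unfolding as(3) bt(4) using c as(1) by (simp add: \<chi>D(2))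
      moreover have "a \<otimes>\<^sub>A b \<in> Q" by (rule QD(6)[OF as(1) bt(2)])
      moreover have "s \<otimes>\<^sub>A t \<in> carrier A - Q" using Q(3)[OF as(2) bt(3)] c by simp
      ultimately show "r \<otimes> r' \<in> \<mm>" unfolding \<mm>_def using r(1) bt(1) by blast
    qed (auto simp: \<mm>_def)
    show "\<one> \<notin> \<mm>"
    proof
      assume "\<one> \<in> \<mm>"
      then obtain a s where as: "a \<in> Q" "s \<in> carrier A - Q" "\<one> \<otimes> \<chi> s = \<chi> a" unfolding \<mm>_def by blast
      have c: "s \<in> carrier A" "a \<in> carrier A" using as QD(1) by auto
      \<comment> \<open>If 1 were a fraction a / s with a in Q, then s - a would be outside Q and
        yet be mapped to 0, making 0 a unit.\<close>
      have "s -\<^sub>A a \<notin> Q"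
      proof
        assume "s -\<^sub>A a \<in> Q"
        hence "(s -\<^sub>A a) +\<^sub>A a \<in> Q" using QD(3) as(1) by blast
        moreover have "(s -\<^sub>A a) +\<^sub>A a = s" using c by (simp add: a_minus_def A.a_assoc A.l_neg)
        ultimately show False using as(2) by simp
      qed
      hence "\<chi> (s -\<^sub>A a) \<in> Units R" using U c A.minus_closed by blast
      moreover have "\<chi> (s -\<^sub>A a) = \<zero>" using \<chi>m[OF c] as(3) c \<chi>D(1) by (simp add: a_minus_def r_neg)
      ultimately have z: "\<zero> \<in> Units R" by simp
      have "inv \<zero> \<otimes> \<zero> = \<zero>" by (rule r_null[OF Units_inv_closed[OF z]])
      thus False using one Units_l_inv[OF z] by metis
    qed
    show "r \<in> Units R" if r: "r \<in> carrier R" "r \<notin> \<mm>" for r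
    proof -
      obtain a s where as: "a \<in> carrier A" "s \<in> carrier A - Q" "r \<otimes> \<chi> s = \<chi> a" using frc[OF r(1)] by blast
      have "a \<notin> Q" using as r unfolding \<mm>_def by blast
      hence "r \<otimes> \<chi> s \<in> Units R" using U as by simp
      hence "r \<otimes> (\<chi> s \<otimes> inv (r \<otimes> \<chi> s)) = \<one>" "\<chi> s \<otimes> inv (r \<otimes> \<chi> s) \<in> carrier R"
        using r(1) U[OF as(2)] by (simp_all add: m_assoc[symmetric] Units_closed)
      thus ?thesis using r(1) m_comm[OF r(1)] by (auto simp: Units_def)
    qed
  qed
  thus ?thesis ..
qed

lemma quotient_projection:
  assumes I: "proper_radical_ideal I S" and R: "cring R" and iso: "\<psi> \<in> ring_iso (S Quot I) R"
  defines "\<chi> \<equiv> \<lambda>s. \<psi> (I +>\<^bsub>S\<^esub> s)"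
  shows "\<chi> \<in> ring_hom S R" "r \<in> carrier R ==> \<exists>s\<in>carrier S. r = \<chi> s" "\<one>\<^sub>R \<noteq> 0\<^sub>R"
    and "r \<in> carrier R ==> r \<otimes>\<^sub>R r = 0\<^sub>R ==> r = 0\<^sub>R"
proof -
  interpret R: cring R by (rule R)
  have i: "ideal I S" and proper: "I \<noteq> carrier S" and rad: "\<And>a n. a \<in> carrier S ==> a [^]\<^bsub>S\<^esub> (n::nat) \<in> I ==> a \<in> I"
    using I by (auto simp: proper_radical_ideal_def)
  interpret I: ideal I S by (rule i)
  have hom: "\<psi> \<in> ring_hom (S Quot I) R" and bij: "bij_betw \<psi> (carrier (S Quot I)) (carrier R)"
    using iso by (auto simp: ring_iso_def)
  show \<chi>: "\<chi> \<in> ring_hom S R" using ring_hom_trans[OF I.rcos_ring_hom hom] by (simp add: \<chi>_def o_def)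
  note \<chi>D = ring_hom_memE[OF \<chi>]
  have carr: "carrier (S Quot I) = (\<lambda>s. I +>\<^bsub>S\<^esub> s) ` carrier S" by (auto simp: FactRing_def A_RCOSETS_def')
  show surj: "\<exists>s\<in>carrier S. r = \<chi> s" if "r \<in> carrier R" for r
    using that bij unfolding bij_betw_def carr \<chi>_def by auto
  have \<chi>0: "\<chi> 0\<^sub>S = 0\<^sub>R" by (rule ring_hom_zero[OF \<chi> I.ring_axioms R.ring_axioms])
  have ker: "s \<in> I" if s: "s \<in> carrier S" "\<chi> s = 0\<^sub>R" for s
  proof -
    have "\<psi> (I +>\<^bsub>S\<^esub> s) = \<psi> (I +>\<^bsub>S\<^esub> 0\<^sub>S)" using s(2) \<chi>0 by (simp add: \<chi>_def)
    hence "I +>\<^bsub>S\<^esub> s = I +>\<^bsub>S\<^esub> 0\<^sub>S" using bij s(1) by (auto simp: bij_betw_def carr dest: inj_onD)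
    hence "s -\<^sub>S 0\<^sub>S \<in> I" using I.quotient_eq_iff_same_a_r_cos[OF i s(1) I.zero_closed] by simp
    thus ?thesis using s(1) by (simp add: a_minus_def)
  qed
  show "\<one>\<^sub>R \<noteq> 0\<^sub>R"
  proof
    assume "\<one>\<^sub>R = 0\<^sub>R"
    hence "\<one>\<^sub>S \<in> I" using ker[of "\<one>\<^sub>S"] \<chi>D(4) by simp
    thus False using proper I.one_imp_carrier by blast
  qed
  show "r = 0\<^sub>R" if r: "r \<in> carrier R" "r \<otimes>\<^sub>R r = 0\<^sub>R"
  proof -
    obtain s where s: "s \<in> carrier S" "r = \<chi> s" using surj[OF r(1)] by blast
    have "s [^]\<^bsub>S\<^esub> (2::nat) = s \<otimes>\<^sub>S s" using s(1) by (simp add: numeral_2_eq_2)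
    moreover have "s \<otimes>\<^sub>S s \<in> I" using ker[of "s \<otimes>\<^sub>S s"] \<chi>D(2)[OF s(1) s(1)] r(2) s by simp
    ultimately have "s \<in> I" using rad[OF s(1), of 2] by simp
    hence "I +>\<^bsub>S\<^esub> s = I +>\<^bsub>S\<^esub> 0\<^sub>S"
      using I.quotient_eq_iff_same_a_r_cos[OF i s(1) I.zero_closed] s(1) by (simp add: a_minus_def)
    thus ?thesis using s(2) \<chi>0 by (simp add: \<chi>_def)
  qed
qed

lemma power_series_quotient:
  fixes K :: "'k ring" and R :: "('r, 'x) ring_scheme"
  assumes K: "field K" and R: "cring R" and I: "proper_radical_ideal I (power_series_ring K m)"
    and iso: "\<psi> \<in> ring_iso (power_series_ring K m Quot I) R"
  shows "\<exists>\<mm>. local_noetherian R \<mm>"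
proof -
  define S where "S = power_series_ring K m"
  have i: "ideal I S" using I by (simp add: proper_radical_ideal_def S_def)
  interpret series_ring K m S
    unfolding S_def by (intro series_ring.intro series_ring_axioms.intro K) (use i in \<open>simp add: ideal_def S_def\<close>)
  interpret R: cring R by (rule R)
  note P = quotient_projection[OF I[folded S_def] R iso[folded S_def]]
  note \<chi>D = ring_hom_memE[OF P(1)]
  define Q where "Q = {f \<in> carrier S. f {#} = 0\<^sub>K}"
  have const: "(f \<otimes>\<^sub>S g) {#} = f {#} \<otimes>\<^sub>K g {#}" if "f \<in> carrier S" "g \<in> carrier S" for f g
    using that by (simp add: S_def)
  show ?thesis
  proof (rule R.local_noetherian_of_fractions[OF series_noetherian P(1,3)])
    have "f {#} \<in> carrier K" if "f \<in> carrier S" for f using that by (simp add: S_def)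
    note c0 = this
    show "ideal Q S"
    proof (rule idealI[OF S.ring_axioms S.add.subgroupI])
      show "-\<^sub>S f \<in> Q" if "f \<in> Q" for f
        using S_minus[of "0\<^sub>S" f "{#}"] that by (simp add: Q_def a_minus_def) (simp add: S_def)
      show "f +\<^sub>S g \<in> Q" if "f \<in> Q" "g \<in> Q" for f g using that S.a_closed by (simp add: Q_def) (simp add: S_def)
    qed (use const c0 in \<open>auto simp: Q_def\<close>, auto simp: S_def)
    show "\<one>\<^sub>S \<notin> Q" using one_not_zero by (simp add: Q_def S_def)
    show "s \<otimes>\<^sub>S t \<notin> Q" if "s \<in> carrier S - Q" "t \<in> carrier S - Q" for s t
      using that const c0[of s] c0[of t] integral[of "s {#}" "t {#}"] by (auto simp: Q_def)
    show "\<exists>r\<in>carrier R. r \<otimes>\<^sub>R \<psi> (I +>\<^bsub>S\<^esub> s) = \<one>\<^sub>R" if s: "s \<in> carrier S - Q" for s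
    proof -
      obtain h where h: "h \<in> carrier S" "h \<otimes>\<^sub>S s = \<one>\<^sub>S" using series_right_inverse[of s] s by (auto simp: Q_def)
      thus ?thesis using \<chi>D(2)[of h s] \<chi>D(1)[OF h(1)] \<chi>D(4) s by auto
    qed
    show "\<exists>a\<in>carrier S. \<exists>s\<in>carrier S - Q. r \<otimes>\<^sub>R \<psi> (I +>\<^bsub>S\<^esub> s) = \<psi> (I +>\<^bsub>S\<^esub> a)" if r: "r \<in> carrier R" for r
    proof -
      obtain a where a: "a \<in> carrier S" "r = \<psi> (I +>\<^bsub>S\<^esub> a)" using P(2)[OF r] by blast
      have "\<one>\<^sub>S \<in> carrier S - Q" using one_not_zero S.one_closed by (simp add: Q_def) (simp add: S_def)
      thus ?thesis using a r \<chi>D(4) by (intro bexI[of _ a] bexI[of _ "\<one>\<^sub>S"]) auto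
    qed
  qed
qed

lemma localized_polynomial_quotient:
  fixes K :: "'k ring" and R :: "('r, 'x) ring_scheme"
  assumes K: "field K" and R: "cring R" and Q: "primeideal Q (polynomial_ring K m)"
    and I: "proper_radical_ideal I (localization (polynomial_ring K m) Q)"
    and iso: "\<psi> \<in> ring_iso (localization (polynomial_ring K m) Q Quot I) R"
  shows "\<exists>\<mm>. local_noetherian R \<mm>"
proof -
  define A where "A = polynomial_ring K m"
  interpret Q: primeideal Q A using Q by (simp add: A_def)
  interpret poly_ring K m A
    unfolding A_def by (intro poly_ring.intro poly_ring_axioms.intro K) (use Q.ring_axioms in \<open>simp add: A_def\<close>)
  interpret PL: prime_localization A Q by unfold_locales
  interpret R: cring R by (rule R)
  note P = quotient_projection[OF I[folded A_def] R iso[folded A_def]]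
  note \<chi>D = ring_hom_memE[OF P(1)]
  let ?\<chi> = "\<lambda>a. \<psi> (I +>\<^bsub>PL.L\<^esub> PL.frc a \<one>\<^sub>A)"
  show ?thesis
  proof (rule R.local_noetherian_of_fractions[OF poly_noetherian _ P(3) Q.is_ideal])
    show "?\<chi> \<in> ring_hom A R" using ring_hom_trans[OF PL.frc_ring_hom P(1)] by (simp add: o_def)
    show "\<one>\<^sub>A \<notin> Q" "\<And>s t. s \<in> carrier A - Q ==> t \<in> carrier A - Q ==> s \<otimes>\<^sub>A t \<notin> Q" using PL.M by auto
    show "\<exists>r\<in>carrier R. r \<otimes>\<^sub>R ?\<chi> s = \<one>\<^sub>R" if s: "s \<in> carrier A - Q" for s
      using \<chi>D(2)[OF PL.frc_closed[OF Q.one_closed s] PL.frc_closed[OF PL.M(1)[OF s] PL.M(3)]]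
        \<chi>D(1)[OF PL.frc_closed[OF Q.one_closed s]] \<chi>D(4) PL.frc_cancel(2)[OF Q.one_closed s] by metis
    show "\<exists>a\<in>carrier A. \<exists>s\<in>carrier A - Q. r \<otimes>\<^sub>R ?\<chi> s = ?\<chi> a" if r: "r \<in> carrier R" for r
    proof -
      obtain z where z: "z \<in> carrier PL.L" "r = \<psi> (I +>\<^bsub>PL.L\<^esub> z)" using P(2)[OF r] by blast
      obtain a s where as: "a \<in> carrier A" "s \<in> carrier A - Q" "z = PL.frc a s"
        using z(1) by (auto simp: localization_def)
      have "r \<otimes>\<^sub>R ?\<chi> s = \<psi> (I +>\<^bsub>PL.L\<^esub> (z \<otimes>\<^bsub>PL.L\<^esub> PL.frc s \<one>\<^sub>A))"
        unfolding z(2) by (rule \<chi>D(2)[OF z(1) PL.frc_closed[OF PL.M(1)[OF as(2)] PL.M(3)], symmetric])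
      hence "r \<otimes>\<^sub>R ?\<chi> s = ?\<chi> a" by (simp only: as(3) PL.frc_cancel(1)[OF as(1,2)])
      thus ?thesis using as by blast
    qed
  qed
qed

theorem corollary54:
  fixes K :: "'k ring"
    and m :: nat
    and R :: "('k, 'r) module"
    and \<Omega> :: "('r, 'w) module"
    and d :: "'r \<Rightarrow> 'w"
    and \<omega> :: "('r, 'c) module"
  assumes "field K"
    and "\<forall>n::nat. n > 0 \<longrightarrow> [n] \<cdot>\<^bsub>K\<^esub> \<one>\<^bsub>K\<^esub> \<noteq> \<zero>\<^bsub>K\<^esub>"
    and "algebra K R"
    and "(\<exists>Q I. primeideal Q (polynomial_ring K m) \<and>
            proper_radical_ideal I (localization (polynomial_ring K m) Q) \<and>
            iso_quotient_algebra K R (localization (polynomial_ring K m) Q)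
              (\<lambda>c. fraction (polynomial_ring K m) Q
                 (ring.indexed_const K c) \<one>\<^bsub>polynomial_ring K m\<^esub>) I) \<or>
         (\<exists>I. proper_radical_ideal I (power_series_ring K m) \<and>
            iso_quotient_algebra K R (power_series_ring K m) (ring.indexed_const K) I)"
    and "krull_dim R = 1"
    and "universally_finite_differentials K R \<Omega> d"
    and "torsionfree_module R \<Omega>"
    and "canonical_module R \<omega>"
    and "proj_dim R (Hom_module R (Der_module K R) \<omega>) < \<infinity>"
  shows "regular_local_ring R"
proof -
  have R: "cring R" using assms(3) by (simp add: algebra_def)
  have "(\<exists>\<mm>. local_noetherian R \<mm>) \<and> (\<forall>r\<in>carrier R. r \<otimes>\<^sub>R r = 0\<^sub>R \<longrightarrow> r = 0\<^sub>R)" using assms(4)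
  proof (elim disjE exE conjE)
    fix Q I assume Q: "primeideal Q (polynomial_ring K m)"
      and I: "proper_radical_ideal I (localization (polynomial_ring K m) Q)"
      and "iso_quotient_algebra K R (localization (polynomial_ring K m) Q)
              (\<lambda>c. fraction (polynomial_ring K m) Q
                 (ring.indexed_const K c) \<one>\<^bsub>polynomial_ring K m\<^esub>) I"
    then obtain \<psi> where \<psi>: "\<psi> \<in> ring_iso (localization (polynomial_ring K m) Q Quot I) R"
      by (auto simp: iso_quotient_algebra_def)
    show ?thesis using localized_polynomial_quotient[OF assms(1) R Q I \<psi>] quotient_projection(4)[OF I R \<psi>] by blast
  next
    fix I assume I: "proper_radical_ideal I (power_series_ring K m)"
      and "iso_quotient_algebra K R (power_series_ring K m) (ring.indexed_const K) I"
    then obtain \<psi> where \<psi>: "\<psi> \<in> ring_iso (power_series_ring K m Quot I) R"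
      by (auto simp: iso_quotient_algebra_def)
    show ?thesis using power_series_quotient[OF assms(1) R I \<psi>] quotient_projection(4)[OF I R \<psi>] by blast
  qed
  then obtain \<mm> where "local_noetherian R \<mm>"
    and red: "\<And>r. r \<in> R ==> r \<otimes>\<^sub>R r = 0\<^sub>R ==> r = 0\<^sub>R" by blast
  then interpret local_noetherian R \<mm> by simp
  interpret local_algebra K R \<mm>
    by (intro local_algebra.intro algebra_setup.intro local_algebra_axioms.intro local_noetherian_axioms)
      (use assms in auto)
  show ?thesis by (rule regular_if_finite_proj_dim[OF red assms(5-9)])
qed

end
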